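(* Let $n$ be odd. Let $\beta\in O_L$ satisfy $\beta^{\iota}+\beta=0$ and $O_L=O[\beta]$, and identify $\beta$ with the element $x\mapsto x\beta$ of $\mathfrak g(O)\subset\mathrm{End}_O(O_L)$. Put $U_{L/F}=\{\gamma\in O_L^\times:\gamma\gamma^{\iota}=1\}$. Then $\theta\mapsto\mathrm{Ind}_{G(O_r,\beta)}^{G(O_r)}\sigma_{\beta,\theta}$ is a bijection of the set of group homomorphisms $\theta:U_{L/F}\to\mathbb C^\times$ which factor through the image of $U_{L/F}$ in $(O_L/\mathfrak p_L^r)^\times$ and satisfy $$\theta(\gamma)=\tau(\varpi^{-l'}T_{L/F}(\beta x))\quad\text{for all }\gamma=1+\varpi^lx\in U_{L/F}\ (x\in O_L)$$ onto $\mathrm{Irr}(G(O_r)\mid\psi_\beta)$, where $G=U(S_\varepsilon)$.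
   Context: Let $F$ be a non-archimedean local field with integer ring $O$, maximal ideal $\mathfrak p=\varpi O$ and finite residue field $\mathbb F=O/\mathfrak p$ of odd characteristic; $O_m=O/\mathfrak p^m$. Fix a continuous unitary character $\tau$ of the additive group $F$ with $\{x\in F:\tau(xO)=1\}=O$. For a finite abelian group $A$, $A^\wedge$ is its group of complex characters. A bar denotes reduction modulo $\mathfrak p$. $K/F$ is the unramified quadratic extension, $n\geq 3$ is odd, and $L/F$ is the unramified extension of degree $2n$, containing $K$, with integer ring $O_L$ and maximal ideal $\mathfrak p_L=\varpi O_L$. $\iota\in\mathrm{Gal}(L/F)$ is the element of order 2 (so $\iota|_K$ generates $\mathrm{Gal}(K/F)$); $T_{L/K},T_{L/F}$ are traces. Fix $\varepsilon\in O_L^\times$ with $\varepsilon^\iota=\varepsilon$ and let $S_\varepsilon(x,y)=T_{L/K}(\varepsilon xy^\iota)$, a non-degenerate Hermitian form over $K$ on $L$. $G=U(S_\varepsilon)$ is the $O$-group scheme with $G(A)=\{g\in GL_A(O_L\otimes_OA): S_\varepsilon(gx,gy)=S_\varepsilon(x,y)\ \forall x,y\in O_L\otimes_OA\}$ and its Lie algebra $\mathfrak g=\mathfrak u(S_\varepsilon)$ is $\mathfrak g(A)=\{X\in\mathrm{End}_A(O_L\otimes_OA): S_\varepsilon(Xx,y)+S_\varepsilon(x,Xy)=0\ \forall x,y\in O_L\otimes_OA\}$ for commutative $O$-algebras $A$. $B(X,Y)=\mathrm{tr}(XY)$ is the trace form on $\mathrm{End}_O(O_L)=\mathfrak{gl}_{2n}(O)$,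 $K_m(O_r)=\ker(G(O_r)\to G(O_m))$ for $0<m<r$. Fix $r\ge2$ and write $r=l+l'$ with $l'=l$ if $r=2l$, $l'=l-1$ if $r=2l-1$. $\psi_\beta$ is the character of the abelian group $K_l(O_r)$ with $\psi_\beta(1+\varpi^lX\bmod\mathfrak p^r)=\tau(\varpi^{-l'}B(X,\beta))$, $X\in\mathfrak g(O)$; its stabilizer in $G(O_r)$ is $G(O_r,\beta)=\{g\bmod\mathfrak p^r:\mathrm{Ad}(g)\beta\equiv\beta\pmod{\mathfrak p^{l'}}\}$. $\mathrm{Irr}(G(O_r)\mid\psi_\beta)$ is the set of isomorphism classes of irreducible complex representations of $G(O_r)$ whose restriction to $K_l(O_r)$ contains $\psi_\beta$. $G_\beta$, $\mathfrak g_\beta$ are the centralizers of $\beta$ in $G$, $\mathfrak g$. Here $G_\beta(O_r)=\{\gamma\bmod\mathfrak p_L^r:\gamma\in U_{L/F}\}\subset(O_L/\mathfrak p_L^r)^\times$, so $\theta$ is regarded as a character of $G_\beta(O_r)$. Definition of $\sigma_{\beta,\theta}$, an irreducible representation of $G(O_r,\beta)=G_\beta(O_r)\cdot K_{l'}(O_r)$. If $r=2l$: $\sigma_{\beta,\theta}(gh)=\theta(g)\psi_\beta(h)$ for $g\in G_\beta(O_r)$, $h\in K_l(O_r)$. If $r=2l-1\ge3$: let $Z(O_r,\beta)\subset K_{l-1}(O_r)$ be the subgroup of the elements $1+\varpi^{l-1}X\bmod\mathfrak p^r$ with $\overline X\in\mathfrak g_\beta(\mathbb F)$. For $\rho\in\mathfrak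 g_\beta(\mathbb F)^\wedge$ let $\psi_{\beta,\rho}$ be the character $1+\varpi^{l-1}X\mapsto\tau(\varpi^{-l}B(X,\beta)-(2\varpi)^{-1}B(X^2,\beta))\rho(\overline X)$ of $Z(O_r,\beta)$, and $\pi_{\beta,\rho}$ (on $V_{\beta,\rho}$) the unique irreducible representation of $K_{l-1}(O_r)$ whose restriction to $Z(O_r,\beta)$ contains $\psi_{\beta,\rho}$. Fix for each $\rho$ a group homomorphism $U_{\beta,\rho}:G_\beta(O_r)\to GL_{\mathbb C}(V_{\beta,\rho})$ (which exists here) such that $\pi_{\beta,\rho}(g^{-1}xg)=U_{\beta,\rho}(g)^{-1}\pi_{\beta,\rho}(x)U_{\beta,\rho}(g)$ for $g\in G_\beta(O_r)$, $x\in K_{l-1}(O_r)$, and $U_{\beta,\rho}=1$ on $G_\beta(O_r)\cap K_{l-1}(O_r)$. For $\theta\in G_\beta(O_r)^\wedge$ with $\theta=\psi_\beta$ on $G_\beta(O_r)\cap K_l(O_r)$ there is a unique $\rho$ with $\theta=\psi_{\beta,\rho}$ on $G_\beta(O_r)\cap K_{l-1}(O_r)$, and $\sigma_{\beta,\theta}(gh)=\theta(g)U_{\beta,\rho}(g)\pi_{\beta,\rho}(h)$ for $g\in G_\beta(O_r)$, $h\in K_{l-1}(O_r)$. *)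

theory Defs
  imports
    "HOL-Analysis.Analysis"
    "HOL-Algebra.Algebra"
    "HOL-Algebra.Algebraic_Closure_Type"
    "Jordan_Normal_Form.VS_Connect"
begin

definition Cx :: "complex monoid" where
  "Cx = \<lparr>carrier = UNIV - {0}, monoid.mult = (*), one = 1\<rparr>"

text \<open>Characters are extensional, so that equal characters are equal functions.\<close>

definition chars :: "('g, 'm) monoid_scheme \<Rightarrow> ('g \<Rightarrow> complex) set" where
  "chars A = hom A Cx \<inter> extensional (carrier A)"

definition GLC :: "nat \<Rightarrow> complex mat monoid" where
  "GLC d = units_of (ring_mat TYPE(complex) d ())"

text \<open>
  A finite-dimensional complex representation is a matrix representation. Its degree is the
  size of the matrices; as JNF matrices carry their dimensions, it is determined by the
  value at the identity.
\<close>

definition rep_degree :: "('g, 'm) monoid_scheme \<Rightarrow> ('g \<Rightarrow> complex mat) \<Rightarrow> nat" where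
  "rep_degree G \<rho> = dim_row (\<rho> \<one>\<^bsub>G\<^esub>)"

definition is_rep :: "('g, 'm) monoid_scheme \<Rightarrow> ('g \<Rightarrow> complex mat) \<Rightarrow> bool" where
  "is_rep G \<rho> \<longleftrightarrow> \<rho> \<in> hom G (GLC (rep_degree G \<rho>))"

definition irreducible_rep :: "('g, 'm) monoid_scheme \<Rightarrow> ('g \<Rightarrow> complex mat) \<Rightarrow> bool" where
  "irreducible_rep G \<rho> \<longleftrightarrow>
     is_rep G \<rho> \<and> rep_degree G \<rho> > 0 \<and>
     (\<forall>W. VectorSpace.subspace class_ring W (module_vec TYPE(complex) (rep_degree G \<rho>)) \<and>
          (\<forall>g\<in>carrier G. \<forall>w\<in>W. \<rho> g *\<^sub>v w \<in> W) \<longrightarrow>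
          W = {0\<^sub>v (rep_degree G \<rho>)} \<or> W = carrier_vec (rep_degree G \<rho>))"

definition rep_iso ::
    "('g, 'm) monoid_scheme \<Rightarrow> (('g \<Rightarrow> complex mat) \<times> ('g \<Rightarrow> complex mat)) set" where
  "rep_iso G = {(\<rho>, \<rho>'). is_rep G \<rho> \<and> is_rep G \<rho>' \<and> rep_degree G \<rho>' = rep_degree G \<rho> \<and>
     (\<exists>T\<in>carrier (GLC (rep_degree G \<rho>)). \<forall>g\<in>carrier G. T * \<rho> g = \<rho>' g * T)}"

definition rep_contains ::
    "('g, 'm) monoid_scheme \<Rightarrow> ('g \<Rightarrow> complex mat) \<Rightarrow> 'g set \<Rightarrow> ('g \<Rightarrow> complex) \<Rightarrow> bool" where
  "rep_contains G \<rho> H \<psi> \<longleftrightarrow>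
     (\<exists>v\<in>carrier_vec (rep_degree G \<rho>). v \<noteq> 0\<^sub>v (rep_degree G \<rho>) \<and>
        (\<forall>h\<in>H. \<rho> h *\<^sub>v v = \<psi> h \<cdot>\<^sub>v v))"

definition Irr_over ::
    "('g, 'm) monoid_scheme \<Rightarrow> 'g set \<Rightarrow> ('g \<Rightarrow> complex) \<Rightarrow> ('g \<Rightarrow> complex mat) set set" where
  "Irr_over G H \<psi> = {\<rho>. irreducible_rep G \<rho> \<and> rep_contains G \<rho> H \<psi>} // rep_iso G"

text \<open>
  The representation induced from a subgroup \<open>H\<close> of finite index, written in block form with
  respect to representatives \<open>t 0, t 1, \<dots>\<close> of the left cosets of \<open>H\<close>: the block in position
  \<open>(a, b)\<close> is \<open>\<sigma> (inv t a \<otimes> x \<otimes> t b)\<close>, where \<open>\<sigma>\<close> is extended by \<open>0\<close> outside \<open>H\<close>.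
  Another choice of representatives gives an isomorphic representation.
\<close>

definition left_index :: "('g, 'm) monoid_scheme \<Rightarrow> 'g set \<Rightarrow> nat" where
  "left_index G H = card ((\<lambda>a. a <#\<^bsub>G\<^esub> H) ` carrier G)"

definition transversal :: "('g, 'm) monoid_scheme \<Rightarrow> 'g set \<Rightarrow> nat \<Rightarrow> 'g" where
  "transversal G H = (SOME t. (\<forall>i<left_index G H. t i \<in> carrier G) \<and>
     bij_betw (\<lambda>i. t i <#\<^bsub>G\<^esub> H) {..<left_index G H} ((\<lambda>a. a <#\<^bsub>G\<^esub> H) ` carrier G))"

definition induced_rep ::
    "('g, 'm) monoid_scheme \<Rightarrow> 'g set \<Rightarrow> ('g \<Rightarrow> complex mat) \<Rightarrow> 'g \<Rightarrow> complex mat" where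
  "induced_rep G H \<sigma> x =
     (let d = rep_degree G \<sigma>; m = left_index G H; t = transversal G H in
      mat (m * d) (m * d) (\<lambda>(i, j).
        let y = inv\<^bsub>G\<^esub> (t (i div d)) \<otimes>\<^bsub>G\<^esub> x \<otimes>\<^bsub>G\<^esub> t (j div d)
        in if y \<in> H then \<sigma> y $$ (i mod d, j mod d) else 0))"

text \<open>
  The field \<open>L\<close> is the type \<^typ>\<open>'a\<close>; the fields \<open>F\<close> and \<open>K\<close> are subfields of it. The
  absolute value of \<open>F\<close> is given together with its extension to \<open>L\<close>, \<open>unif\<close> is the uniformizer
  of \<open>F\<close>, \<open>invol\<close> is \<open>\<iota>\<close>, \<open>eps\<close> is \<open>\<epsilon>\<close> and \<open>tau\<close> is the additive character (on \<open>F\<close>).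
\<close>

record 'a unitary_datum =
  subF :: "'a set"
  subK :: "'a set"
  absv :: "'a \<Rightarrow> real"
  unif :: 'a
  invol :: "'a \<Rightarrow> 'a"
  eps :: 'a
  tau :: "'a \<Rightarrow> complex"

abbreviation ringL :: "'a::Fields.field ring" where
  "ringL \<equiv> ring_of_type_algebra"

definition ints :: "'a::Fields.field unitary_datum \<Rightarrow> 'a set \<Rightarrow> 'a set" where
  "ints D E = {x\<in>E. absv D x \<le> 1}"

definition max_ideal :: "'a::Fields.field unitary_datum \<Rightarrow> 'a set \<Rightarrow> 'a set" where
  "max_ideal D E = {x\<in>E. absv D x < 1}"

abbreviation OF :: "'a::Fields.field unitary_datum \<Rightarrow> 'a set" where
  "OF D \<equiv> ints D (subF D)"

abbreviation OL :: "'a::Fields.field unitary_datum \<Rightarrow> 'a set" where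
  "OL D \<equiv> ints D UNIV"

definition ring_ints :: "'a::Fields.field unitary_datum \<Rightarrow> 'a set \<Rightarrow> 'a ring" where
  "ring_ints D E = ringL\<lparr>carrier := ints D E\<rparr>"

abbreviation ROL :: "'a::Fields.field unitary_datum \<Rightarrow> 'a ring" where
  "ROL D \<equiv> ring_ints D UNIV"

definition residue_ring_F :: "'a::Fields.field unitary_datum \<Rightarrow> 'a set ring" where
  "residue_ring_F D = ring_ints D (subF D) Quot max_ideal D (subF D)"

text \<open>
  The condition on the maximal ideals says that the ramification index is 1. The extension of
  (finite) residue fields is separable without further assumption. The characteristic of the
  residue field is the additive order of its identity.
\<close>

locale unramified_unitary_datum =
  fixes D :: "'a::Fields.field unitary_datum" and n :: nat
  assumes subfields: "subfield (subF D) ringL" "subfield (subK D) ringL" "subF D \<subseteq> subK D"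
    and absv_nonneg: "absv D x \<ge> 0"
    and absv_zero_iff: "absv D x = 0 \<longleftrightarrow> x = 0"
    and absv_mult: "absv D (x * y) = absv D x * absv D y"
    and absv_ultra: "absv D (x + y) \<le> max (absv D x) (absv D y)"
    and complete: "Metric_space.mcomplete (subF D) (\<lambda>x y. absv D (x - y))"
    and unif_F: "unif D \<in> subF D" "unif D \<noteq> 0"
      "max_ideal D (subF D) = (\<lambda>x. unif D * x) ` ints D (subF D)"
    and residue_finite: "finite (carrier (residue_ring_F D))"
    and residue_odd: "odd (group.ord (add_monoid (residue_ring_F D)) \<one>\<^bsub>residue_ring_F D\<^esub>)"
    and degrees: "ring.dimension ringL 2 (subF D) (subK D)"
      "ring.dimension ringL (2 * n) (subF D) UNIV"
    and unramified: "max_ideal D (subK D) = (\<lambda>x. unif D * x) ` ints D (subK D)"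
      "max_ideal D UNIV = (\<lambda>x. unif D * x) ` ints D UNIV"
    and invol_aut: "invol D \<in> ring_iso ringL ringL" "\<And>x. x \<in> subF D \<Longrightarrow> invol D x = x"
    and invol_order_2: "invol D \<circ> invol D = id" "invol D \<noteq> id"
    and eps_unit: "eps D \<in> Units (ROL D)"
    and eps_fixed: "invol D (eps D) = eps D"
    and tau_unitary: "x \<in> subF D \<Longrightarrow> cmod (tau D x) = 1"
    and tau_add: "x \<in> subF D \<Longrightarrow> y \<in> subF D \<Longrightarrow> tau D (x + y) = tau D x * tau D y"
    and tau_continuous:
      "continuous_map (Metric_space.mtopology (subF D) (\<lambda>x y. absv D (x - y))) euclidean (tau D)"
    and tau_conductor: "{x \<in> subF D. \<forall>y\<in>OF D. tau D (x * y) = 1} = OF D"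

text \<open>
  The trace of an \<open>R\<close>-linear endomorphism \<open>f\<close> of a finite free \<open>R\<close>-module \<open>M\<close> inside \<open>L\<close>,
  where \<open>R\<close> is a subring: \<open>b 0, \<dots>, b (N - 1)\<close> is a basis and \<open>c\<close> is the matrix of \<open>f\<close>.
\<close>

definition trace_on :: "'a::Fields.field set \<Rightarrow> 'a set \<Rightarrow> ('a \<Rightarrow> 'a) \<Rightarrow> 'a" where
  "trace_on R M f = (THE t. \<exists>(N::nat) b c.
     b ` {..<N} \<subseteq> M \<and>
     (\<forall>x\<in>M. \<exists>!a. a \<in> {..<N} \<rightarrow>\<^sub>E R \<and> x = (\<Sum>i<N. a i * b i)) \<and>
     (\<forall>i<N. \<forall>j<N. c i j \<in> R) \<and>
     (\<forall>j<N. f (b j) = (\<Sum>i<N. c i j * b i)) \<and>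
     t = (\<Sum>i<N. c i i))"

definition field_trace :: "'a::Fields.field set \<Rightarrow> 'a \<Rightarrow> 'a" where
  "field_trace E x = trace_on E UNIV (\<lambda>y. x * y)"

definition herm :: "'a::Fields.field unitary_datum \<Rightarrow> 'a \<Rightarrow> 'a \<Rightarrow> 'a" where
  "herm D x y = field_trace (subK D) (eps D * x * invol D y)"

definition End_OL :: "'a::Fields.field unitary_datum \<Rightarrow> ('a \<Rightarrow> 'a) set" where
  "End_OL D = {Y \<in> OL D \<rightarrow> OL D.
     (\<forall>x\<in>OL D. \<forall>y\<in>OL D. Y (x + y) = Y x + Y y) \<and>
     (\<forall>a\<in>OF D. \<forall>x\<in>OL D. Y (a * x) = a * Y x)}"

definition trace_form ::
    "'a::Fields.field unitary_datum \<Rightarrow> ('a \<Rightarrow> 'a) \<Rightarrow> ('a \<Rightarrow> 'a) \<Rightarrow> 'a" where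
  "trace_form D Y Z = trace_on (OF D) (OL D) (Y \<circ> Z)"

definition lie_O :: "'a::Fields.field unitary_datum \<Rightarrow> ('a \<Rightarrow> 'a) set" where
  "lie_O D = {Y \<in> End_OL D. \<forall>x\<in>OL D. \<forall>y\<in>OL D. herm D (Y x) y + herm D x (Y y) = 0}"

text \<open>
  For \<open>A = O/\<pp>\<^sup>m\<close> the \<open>A\<close>-module \<open>O\<^sub>L \<otimes> A\<close> is \<open>O\<^sub>L/\<pp>\<^sub>L\<^sup>m\<close>, and the values of the Hermitian form
  are taken in \<open>O\<^sub>L/\<pp>\<^sub>L\<^sup>m\<close>, which contains \<open>O\<^sub>K \<otimes> A = O\<^sub>K/\<pp>\<^sub>K\<^sup>m\<close>. The endomorphisms of
  \<open>O\<^sub>L/\<pp>\<^sub>L\<^sup>m\<close> are extensional functions on the set of cosets.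
\<close>

definition idl :: "'a::Fields.field unitary_datum \<Rightarrow> nat \<Rightarrow> 'a set" where
  "idl D m = (\<lambda>x. unif D ^ m * x) ` OL D"

definition Q :: "'a::Fields.field unitary_datum \<Rightarrow> nat \<Rightarrow> 'a set ring" where
  "Q D m = ROL D Quot idl D m"

definition cls :: "'a::Fields.field unitary_datum \<Rightarrow> nat \<Rightarrow> 'a \<Rightarrow> 'a set" where
  "cls D m x = idl D m +>\<^bsub>ROL D\<^esub> x"

definition End_Q :: "'a::Fields.field unitary_datum \<Rightarrow> nat \<Rightarrow> ('a set \<Rightarrow> 'a set) set" where
  "End_Q D m = {Y \<in> hom (add_monoid (Q D m)) (add_monoid (Q D m)) \<inter> extensional (carrier (Q D m)).
     \<forall>a\<in>OF D. \<forall>C\<in>carrier (Q D m).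
       Y (cls D m a \<otimes>\<^bsub>Q D m\<^esub> C) = cls D m a \<otimes>\<^bsub>Q D m\<^esub> Y C}"

text \<open>The unions below are over representatives and do not depend on them.\<close>

definition herm_Q :: "'a::Fields.field unitary_datum \<Rightarrow> nat \<Rightarrow> 'a set \<Rightarrow> 'a set \<Rightarrow> 'a set" where
  "herm_Q D m C E = (\<Union>x\<in>C. \<Union>y\<in>E. cls D m (herm D x y))"

definition red_End ::
    "'a::Fields.field unitary_datum \<Rightarrow> nat \<Rightarrow> ('a \<Rightarrow> 'a) \<Rightarrow> 'a set \<Rightarrow> 'a set" where
  "red_End D m Y = (\<lambda>C\<in>carrier (Q D m). \<Union>x\<in>C. cls D m (Y x))"

text \<open>\<open>unitary_group D m\<close> is \<open>G(O\<^sub>m)\<close> and \<open>lie_Q D m\<close> is \<open>\<gg>(O\<^sub>m)\<close>; the case \<open>m = 1\<close>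
  gives the points over the residue field.\<close>

definition unitary_group ::
    "'a::Fields.field unitary_datum \<Rightarrow> nat \<Rightarrow> ('a set \<Rightarrow> 'a set) monoid" where
  "unitary_group D m = (BijGroup (carrier (Q D m)))\<lparr>carrier :=
     {g \<in> Bij (carrier (Q D m)) \<inter> End_Q D m.
       \<forall>C\<in>carrier (Q D m). \<forall>E\<in>carrier (Q D m). herm_Q D m (g C) (g E) = herm_Q D m C E}\<rparr>"

definition lie_Q :: "'a::Fields.field unitary_datum \<Rightarrow> nat \<Rightarrow> ('a set \<Rightarrow> 'a set) set" where
  "lie_Q D m = {Y \<in> End_Q D m. \<forall>C\<in>carrier (Q D m). \<forall>E\<in>carrier (Q D m).
     herm_Q D m (Y C) E \<oplus>\<^bsub>Q D m\<^esub> herm_Q D m C (Y E) = \<zero>\<^bsub>Q D m\<^esub>}"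

text \<open>The reduction \<open>G(O\<^sub>r) \<rightarrow> G(O\<^sub>m)\<close> and its kernel \<open>K\<^sub>m(O\<^sub>r)\<close>, for \<open>m \<le> r\<close>.\<close>

definition red_group :: "'a::Fields.field unitary_datum \<Rightarrow> nat \<Rightarrow> nat \<Rightarrow>
    ('a set \<Rightarrow> 'a set) \<Rightarrow> 'a set \<Rightarrow> 'a set" where
  "red_group D r m g = (\<lambda>C\<in>carrier (Q D m). \<Union>x\<in>C. \<Union>y\<in>g (cls D r x). cls D m y)"

definition cong_subgroup ::
    "'a::Fields.field unitary_datum \<Rightarrow> nat \<Rightarrow> nat \<Rightarrow> ('a set \<Rightarrow> 'a set) set" where
  "cong_subgroup D m r = kernel (unitary_group D r) (unitary_group D m) (red_group D r m)"

definition mult_by :: "'a::Fields.field \<Rightarrow> 'a \<Rightarrow> 'a" where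
  "mult_by b = (\<lambda>x. x * b)"

text \<open>The stabilizer \<open>G(O\<^sub>r, \<beta>)\<close>, the group of those \<open>g\<close> with
  \<open>Ad(g) \<beta> \<equiv> \<beta>\<close> modulo \<open>\<pp>\<^sup>l\<^sup>'\<close>.\<close>

definition Ad_Q :: "'a::Fields.field unitary_datum \<Rightarrow> nat \<Rightarrow>
    ('a set \<Rightarrow> 'a set) \<Rightarrow> ('a set \<Rightarrow> 'a set) \<Rightarrow> ('a set \<Rightarrow> 'a set)" where
  "Ad_Q D m g Y =
     compose (carrier (Q D m)) (compose (carrier (Q D m)) g Y) (inv\<^bsub>unitary_group D m\<^esub> g)"

definition stab :: "'a::Fields.field unitary_datum \<Rightarrow> nat \<Rightarrow> nat \<Rightarrow> 'a \<Rightarrow>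
    ('a set \<Rightarrow> 'a set) set" where
  "stab D r l' \<beta> = {g \<in> carrier (unitary_group D r).
     Ad_Q D l' (red_group D r l' g) (red_End D l' (mult_by \<beta>)) = red_End D l' (mult_by \<beta>)}"

definition centralizer :: "'a::Fields.field unitary_datum \<Rightarrow> nat \<Rightarrow> 'a \<Rightarrow>
    ('a set \<Rightarrow> 'a set) set" where
  "centralizer D r \<beta> = {g \<in> carrier (unitary_group D r).
     compose (carrier (Q D r)) g (red_End D r (mult_by \<beta>)) =
     compose (carrier (Q D r)) (red_End D r (mult_by \<beta>)) g}"

definition lie_centralizer :: "'a::Fields.field unitary_datum \<Rightarrow> nat \<Rightarrow> 'a \<Rightarrow>
    ('a set \<Rightarrow> 'a set) monoid" where
  "lie_centralizer D m \<beta> =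
     \<lparr>carrier = {Y \<in> lie_Q D m.
        compose (carrier (Q D m)) Y (red_End D m (mult_by \<beta>)) =
        compose (carrier (Q D m)) (red_End D m (mult_by \<beta>)) Y},
      monoid.mult = (\<lambda>Y Z. \<lambda>C\<in>carrier (Q D m). Y C \<oplus>\<^bsub>Q D m\<^esub> Z C),
      one = (\<lambda>C\<in>carrier (Q D m). \<zero>\<^bsub>Q D m\<^esub>)\<rparr>"

text \<open>
  Throughout, \<open>r = l + l'\<close> with \<open>l' = l\<close> or \<open>l' = l - 1\<close>. The definite descriptions express
  values that are given on representatives.
\<close>

definition one_plus :: "'a::Fields.field unitary_datum \<Rightarrow> nat \<Rightarrow> ('a \<Rightarrow> 'a) \<Rightarrow> 'a \<Rightarrow> 'a" where
  "one_plus D m Y = (\<lambda>x. x + unif D ^ m * Y x)"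

definition psi :: "'a::Fields.field unitary_datum \<Rightarrow> nat \<Rightarrow> nat \<Rightarrow> 'a \<Rightarrow>
    ('a set \<Rightarrow> 'a set) \<Rightarrow> complex" where
  "psi D l l' \<beta> k = (THE z. \<exists>Y\<in>lie_O D.
     k = red_End D (l + l') (one_plus D l Y) \<and>
     z = tau D (inverse (unif D ^ l') * trace_form D Y (mult_by \<beta>)))"

text \<open>The subgroup \<open>Z(O\<^sub>r, \<beta>)\<close> and its characters \<open>\<psi>\<^sub>\<beta>\<^sub>,\<^sub>\<rho>\<close>, used for \<open>r = 2 l - 1\<close>,
  that is \<open>l' = l - 1\<close>.\<close>

definition Zgrp :: "'a::Fields.field unitary_datum \<Rightarrow> nat \<Rightarrow> nat \<Rightarrow> 'a \<Rightarrow>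
    ('a set \<Rightarrow> 'a set) set" where
  "Zgrp D l l' \<beta> = {k \<in> cong_subgroup D l' (l + l'). \<exists>Y\<in>End_OL D.
     k = red_End D (l + l') (one_plus D l' Y) \<and>
     red_End D 1 Y \<in> carrier (lie_centralizer D 1 \<beta>)}"

definition psi_rho :: "'a::Fields.field unitary_datum \<Rightarrow> nat \<Rightarrow> nat \<Rightarrow> 'a \<Rightarrow>
    (('a set \<Rightarrow> 'a set) \<Rightarrow> complex) \<Rightarrow> ('a set \<Rightarrow> 'a set) \<Rightarrow> complex" where
  "psi_rho D l l' \<beta> \<rho> k = (THE z. \<exists>Y\<in>End_OL D.
     k = red_End D (l + l') (one_plus D l' Y) \<and>
     red_End D 1 Y \<in> carrier (lie_centralizer D 1 \<beta>) \<and>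
     z = tau D (inverse (unif D ^ l) * trace_form D Y (mult_by \<beta>)
              - inverse (2 * unif D) * trace_form D (Y \<circ> Y) (mult_by \<beta>)) * \<rho> (red_End D 1 Y))"

text \<open>\<open>\<pi> \<rho>\<close> is the irreducible representation \<open>\<pi>\<^sub>\<beta>\<^sub>,\<^sub>\<rho>\<close> and \<open>U \<rho>\<close> is the chosen
  homomorphism \<open>U\<^sub>\<beta>\<^sub>,\<^sub>\<rho>\<close> on the same space.\<close>

definition intertwining_data :: "'a::Fields.field unitary_datum \<Rightarrow> nat \<Rightarrow> nat \<Rightarrow> 'a \<Rightarrow>
    (('a set \<Rightarrow> 'a set) \<Rightarrow> complex) \<Rightarrow>
    (('a set \<Rightarrow> 'a set) \<Rightarrow> complex mat) \<Rightarrow> (('a set \<Rightarrow> 'a set) \<Rightarrow> complex mat) \<Rightarrow> bool" where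
  "intertwining_data D l l' \<beta> \<rho> \<pi> U \<longleftrightarrow>
     (let G = unitary_group D (l + l'); K = cong_subgroup D l' (l + l');
          Gb = centralizer D (l + l') \<beta>;
          GL = GLC (rep_degree (G\<lparr>carrier := K\<rparr>) \<pi>) in
      irreducible_rep (G\<lparr>carrier := K\<rparr>) \<pi> \<and>
      rep_contains (G\<lparr>carrier := K\<rparr>) \<pi> (Zgrp D l l' \<beta>) (psi_rho D l l' \<beta> \<rho>) \<and>
      U \<in> hom (G\<lparr>carrier := Gb\<rparr>) GL \<and>
      (\<forall>g\<in>Gb. \<forall>x\<in>K.
         \<pi> (inv\<^bsub>G\<^esub> g \<otimes>\<^bsub>G\<^esub> x \<otimes>\<^bsub>G\<^esub> g) = inv\<^bsub>GL\<^esub> (U g) \<otimes>\<^bsub>GL\<^esub> \<pi> x \<otimes>\<^bsub>GL\<^esub> U g) \<and>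
      (\<forall>g\<in>Gb \<inter> K. U g = \<one>\<^bsub>GL\<^esub>))"

definition norm_one_group :: "'a::Fields.field unitary_datum \<Rightarrow> 'a monoid" where
  "norm_one_group D =
     (units_of (ROL D))\<lparr>carrier := {\<gamma> \<in> Units (ROL D). \<gamma> * invol D \<gamma> = 1}\<rparr>"

definition theta_set :: "'a::Fields.field unitary_datum \<Rightarrow> nat \<Rightarrow> nat \<Rightarrow> 'a \<Rightarrow>
    ('a \<Rightarrow> complex) set" where
  "theta_set D l l' \<beta> = {\<theta> \<in> chars (norm_one_group D).
     (\<forall>\<gamma>\<in>carrier (norm_one_group D). \<forall>\<delta>\<in>carrier (norm_one_group D).
        \<gamma> - \<delta> \<in> idl D (l + l') \<longrightarrow> \<theta> \<gamma> = \<theta> \<delta>) \<and>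
     (\<forall>x\<in>OL D. 1 + unif D ^ l * x \<in> carrier (norm_one_group D) \<longrightarrow>
        \<theta> (1 + unif D ^ l * x) =
          tau D (inverse (unif D ^ l') * field_trace (subF D) (\<beta> * x)))}"

text \<open>\<open>\<theta>\<close> regarded as a character of \<open>G\<^sub>\<beta>(O\<^sub>r)\<close>, whose elements are the multiplications by
  the elements of \<open>U\<^sub>L\<^sub>/\<^sub>F\<close> modulo \<open>\<pp>\<^sub>L\<^sup>r\<close>.\<close>

definition theta_Q :: "'a::Fields.field unitary_datum \<Rightarrow> nat \<Rightarrow> ('a \<Rightarrow> complex) \<Rightarrow>
    ('a set \<Rightarrow> 'a set) \<Rightarrow> complex" where
  "theta_Q D r \<theta> g = (THE z. \<exists>\<gamma>\<in>carrier (norm_one_group D).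
     g = red_End D r (mult_by \<gamma>) \<and> z = \<theta> \<gamma>)"

definition rho_of :: "'a::Fields.field unitary_datum \<Rightarrow> nat \<Rightarrow> nat \<Rightarrow> 'a \<Rightarrow>
    ('a \<Rightarrow> complex) \<Rightarrow> ('a set \<Rightarrow> 'a set) \<Rightarrow> complex" where
  "rho_of D l l' \<beta> \<theta> = (THE \<rho>. \<rho> \<in> chars (lie_centralizer D 1 \<beta>) \<and>
     (\<forall>g\<in>centralizer D (l + l') \<beta> \<inter> cong_subgroup D l' (l + l').
        theta_Q D (l + l') \<theta> g = psi_rho D l l' \<beta> \<rho> g))"

text \<open>
  The representation \<open>\<sigma>\<^sub>\<beta>\<^sub>,\<^sub>\<theta>\<close> of \<open>G(O\<^sub>r, \<beta>) = G\<^sub>\<beta>(O\<^sub>r) \<cdot> K\<^sub>l\<^sub>'(O\<^sub>r)\<close>; it is one-dimensional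
  for \<open>l' = l\<close>. The families \<open>\<pi>\<close> and \<open>U\<close> are not used in that case.
\<close>

definition sigma_rep :: "'a::Fields.field unitary_datum \<Rightarrow> nat \<Rightarrow> nat \<Rightarrow> 'a \<Rightarrow>
    ((('a set \<Rightarrow> 'a set) \<Rightarrow> complex) \<Rightarrow> ('a set \<Rightarrow> 'a set) \<Rightarrow> complex mat) \<Rightarrow>
    ((('a set \<Rightarrow> 'a set) \<Rightarrow> complex) \<Rightarrow> ('a set \<Rightarrow> 'a set) \<Rightarrow> complex mat) \<Rightarrow>
    ('a \<Rightarrow> complex) \<Rightarrow> ('a set \<Rightarrow> 'a set) \<Rightarrow> complex mat" where
  "sigma_rep D l l' \<beta> \<pi> U \<theta> x = (THE M.
     \<exists>g\<in>centralizer D (l + l') \<beta>. \<exists>h\<in>cong_subgroup D l' (l + l').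
       x = g \<otimes>\<^bsub>unitary_group D (l + l')\<^esub> h \<and>
       M = (if l' = l
            then mat 1 1 (\<lambda>_. theta_Q D (l + l') \<theta> g * psi D l l' \<beta> h)
            else theta_Q D (l + l') \<theta> g \<cdot>\<^sub>m
                   (U (rho_of D l l' \<beta> \<theta>) g * \<pi> (rho_of D l l' \<beta> \<theta>) h)))"

end

theory Submission
  imports Defs "Jordan_Normal_Form.Spectral_Radius" "HOL-Computational_Algebra.Primes"
begin

text \<open>
  An isometry that commutes with \<open>\<beta>\<close> modulo \<open>\<pp>\<^sup>l\<^sup>'\<close> is there the multiplication by an element of norm one, and the
  trace form is a perfect pairing of the Lie algebra with the skew endomorphisms modulo \<open>\<pp>\<^sup>l\<^sup>'\<close>. Hence the
  stabilizer of \<open>\<psi>\<^sub>\<beta>\<close> in \<open>G(O\<^sub>r)\<close> is \<open>G\<^sub>\<beta>(O\<^sub>r) K\<^sub>l\<^sub>'(O\<^sub>r)\<close>, and by Clifford theory induction is a bijection from its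
  irreducible representations over \<open>\<psi>\<^sub>\<beta>\<close> onto those of \<open>G(O\<^sub>r)\<close>.

  On a representation \<open>V\<close> of the stabilizer over \<open>\<psi>\<^sub>\<beta>\<close> the abelian group \<open>G\<^sub>\<beta>(O\<^sub>r) \<inter> K\<^sub>l\<^sub>'(O\<^sub>r)\<close> has an eigenvector,
  whose eigenvalues determine \<open>\<rho>\<close>. For odd \<open>r\<close> the commutator pairing of \<open>K\<^sub>l\<^sub>-\<^sub>1(O\<^sub>r)\<close> modulo \<open>Z(O\<^sub>r, \<beta>)\<close> is
  non-degenerate, so that the space of \<open>K\<^sub>l\<^sub>-\<^sub>1(O\<^sub>r)\<close>-homomorphisms from \<open>\<pi>\<^sub>\<beta>\<^sub>,\<^sub>\<rho>\<close> to \<open>V\<close> is not zero. The group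
  \<open>G\<^sub>\<beta>(O\<^sub>r)\<close> acts on it by \<open>A \<mapsto> g A U(g)\<^sup>-\<^sup>1\<close>, and an eigenvector of this action gives \<open>\<theta>\<close>. The case of even
  \<open>r\<close> is the degenerate one in which \<open>K\<^sub>l\<^sub>'(O\<^sub>r)\<close> and \<open>Z(O\<^sub>r, \<beta>)\<close> are both replaced by \<open>K\<^sub>l(O\<^sub>r)\<close>.
\<close>

section \<open>Matrix representations\<close>

text \<open>Two consequences of the hypotheses on \<open>\<beta>\<close> carry the arithmetic. Since
  \<open>\<iota>\<close> negates \<open>\<beta>\<close>, the powers of \<open>\<beta> ^ 2\<close>
  span the fixed field of \<open>\<iota>\<close>, of degree \<open>n\<close> over \<open>F\<close>.
  As \<open>n\<close> is odd this field does not contain \<open>K\<close>, so \<open>\<iota>\<close>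
  moves \<open>K\<close>, and the same powers form a basis of \<open>L\<close> over
  \<open>K\<close>. In this basis the Hermitian form is the top coordinate of
  \<open>u * x * \<iota> y\<close>, where \<open>u\<close> is \<open>eps D\<close> times the
  derivative of a minimal polynomial. The form is perfect over the integers because \<open>u\<close>
  is a unit, and this is derived from the finiteness of the residue field.

  Elements of the finite groups are functions on cosets. They are represented by
  \<open>O\<close>-linear endomorphisms of \<open>O_L\<close> that preserve the form only modulo a
  power of the maximal ideal; exact lifts are made for skew endomorphisms and for elements of norm
  one. Representations are compared through nonzero intertwiners, obtained by averaging or as common
  eigenvectors of a finite abelian group.\<close>

definition msum :: "nat \<Rightarrow> nat \<Rightarrow> ('i \<Rightarrow> complex mat) \<Rightarrow> 'i set \<Rightarrow> complex mat" where
  "msum nr nc f S = mat nr nc (\<lambda>ij. \<Sum>s\<in>S. f s $$ ij)"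

lemma msum_carrier [simp, intro]: "msum nr nc f S \<in> carrier_mat nr nc"
  by (simp add: msum_def)

lemma msum_dim [simp]: "dim_row (msum nr nc f S) = nr" "dim_col (msum nr nc f S) = nc"
  by (simp_all add: msum_def)

lemma msum_index: "i < nr \<Longrightarrow> j < nc \<Longrightarrow> msum nr nc f S $$ (i, j) = (\<Sum>s\<in>S. f s $$ (i, j))"
  by (simp add: msum_def)

lemma msum_cong: "S = S' \<Longrightarrow> (\<And>s. s \<in> S' \<Longrightarrow> f s = g s) \<Longrightarrow> msum nr nc f S = msum nr nc g S'"
  by (auto simp: msum_def intro!: cong_mat sum.cong)

lemma mult_index_sum:
  assumes "A \<in> carrier_mat a b" "B \<in> carrier_mat b c" "i < a" "j < c"
  shows "(A * B) $$ (i, j) = (\<Sum>k<b. A $$ (i, k) * B $$ (k, j))"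
  using assms by (auto simp: scalar_prod_def lessThan_atLeast0 intro!: sum.cong)

lemma mult_msum:
  assumes "A \<in> carrier_mat a nr" "\<And>s. s \<in> S \<Longrightarrow> f s \<in> carrier_mat nr nc"
  shows "A * msum nr nc f S = msum a nc (\<lambda>s. A * f s) S"
proof (rule eq_matI)
  fix i j assume ij: "i < dim_row (msum a nc (\<lambda>s. A * f s) S)" "j < dim_col (msum a nc (\<lambda>s. A * f s) S)"
  then have ij': "i < a" "j < nc" by auto
  have "(A * msum nr nc f S) $$ (i, j) = (\<Sum>k<nr. \<Sum>s\<in>S. A $$ (i, k) * f s $$ (k, j))"
    using ij' by (simp add: mult_index_sum[OF assms(1) msum_carrier] msum_index sum_distrib_left)
  also have "\<dots> = (\<Sum>s\<in>S. \<Sum>k<nr. A $$ (i, k) * f s $$ (k, j))" by (rule sum.swap)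
  also have "\<dots> = (\<Sum>s\<in>S. (A * f s) $$ (i, j))"
    using ij' by (intro sum.cong refl mult_index_sum[OF assms(1) assms(2), symmetric])
  finally show "(A * msum nr nc f S) $$ (i, j) = msum a nc (\<lambda>s. A * f s) S $$ (i, j)"
    using ij' by (simp add: msum_index)
qed (use assms in auto)

lemma msum_mult:
  assumes "B \<in> carrier_mat nc b" "\<And>s. s \<in> S \<Longrightarrow> f s \<in> carrier_mat nr nc"
  shows "msum nr nc f S * B = msum nr b (\<lambda>s. f s * B) S"
proof (rule eq_matI)
  fix i j assume ij: "i < dim_row (msum nr b (\<lambda>s. f s * B) S)" "j < dim_col (msum nr b (\<lambda>s. f s * B) S)"
  then have ij': "i < nr" "j < b" by auto
  have "(msum nr nc f S * B) $$ (i, j) = (\<Sum>k<nc. \<Sum>s\<in>S. f s $$ (i, k) * B $$ (k, j))"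
    using ij' by (simp add: mult_index_sum[OF msum_carrier assms(1)] msum_index sum_distrib_right)
  also have "\<dots> = (\<Sum>s\<in>S. \<Sum>k<nc. f s $$ (i, k) * B $$ (k, j))" by (rule sum.swap)
  also have "\<dots> = (\<Sum>s\<in>S. (f s * B) $$ (i, j))"
    using ij' by (intro sum.cong refl mult_index_sum[OF assms(2) assms(1), symmetric])
  finally show "(msum nr nc f S * B) $$ (i, j) = msum nr b (\<lambda>s. f s * B) S $$ (i, j)"
    using ij' by (simp add: msum_index)
qed (use assms in auto)

lemma msum_smult:
  assumes "\<And>s. s \<in> S \<Longrightarrow> f s \<in> carrier_mat nr nc"
  shows "c \<cdot>\<^sub>m msum nr nc f S = msum nr nc (\<lambda>s. c \<cdot>\<^sub>m f s) S"
proof (rule eq_matI)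
  fix i j assume "i < dim_row (msum nr nc (\<lambda>s. c \<cdot>\<^sub>m f s) S)" "j < dim_col (msum nr nc (\<lambda>s. c \<cdot>\<^sub>m f s) S)"
  then have ij: "i < nr" "j < nc" by auto
  have "(\<Sum>s\<in>S. (c \<cdot>\<^sub>m f s) $$ (i, j)) = (\<Sum>s\<in>S. c * f s $$ (i, j))"
    using ij assms by (intro sum.cong refl) (metis carrier_matD index_smult_mat(1))
  then show "(c \<cdot>\<^sub>m msum nr nc f S) $$ (i, j) = msum nr nc (\<lambda>s. c \<cdot>\<^sub>m f s) S $$ (i, j)"
    using ij by (simp add: msum_index sum_distrib_left)
qed auto

lemma msum_smult_const:
  assumes "A \<in> carrier_mat nr nc"
  shows "msum nr nc (\<lambda>s. c s \<cdot>\<^sub>m A) S = (\<Sum>s\<in>S. c s) \<cdot>\<^sub>m A"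
  by (rule eq_matI) (use assms in \<open>auto simp: msum_index sum_distrib_right\<close>)

lemma msum_zero: "(\<And>s. s \<in> S \<Longrightarrow> f s = 0\<^sub>m nr nc) \<Longrightarrow> msum nr nc f S = 0\<^sub>m nr nc"
  by (rule eq_matI) (auto simp: msum_index)

lemma msum_reindex: "bij_betw h S S' \<Longrightarrow> msum nr nc f S' = msum nr nc (\<lambda>s. f (h s)) S"
  unfolding msum_def by (intro cong_mat refl sum.reindex_bij_betw[symmetric])

lemma msum_swap:
  "msum nr nc (\<lambda>s. msum nr nc (\<lambda>t. f s t) T) S = msum nr nc (\<lambda>t. msum nr nc (\<lambda>s. f s t) S) T"
  by (rule eq_matI) (auto simp: msum_index intro: sum.swap)

lemma msum_delta:
  assumes "finite S" "a \<in> S" "f a \<in> carrier_mat nr nc" "\<And>s. s \<in> S \<Longrightarrow> s \<noteq> a \<Longrightarrow> f s = 0\<^sub>m nr nc"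
  shows "msum nr nc f S = f a"
proof (rule eq_matI)
  fix i j assume "i < dim_row (f a)" "j < dim_col (f a)"
  then have ij: "i < nr" "j < nc" using assms by auto
  have "(\<Sum>s\<in>S. f s $$ (i, j)) = (\<Sum>s\<in>S. if s = a then f a $$ (i, j) else 0)"
    using assms(4) ij by (intro sum.cong) auto
  then show "msum nr nc f S $$ (i, j) = f a $$ (i, j)"
    using ij assms by (simp add: msum_index)
qed (use assms in auto)

lemma msum_mono_neutral:
  assumes "finite S" "T \<subseteq> S" "\<And>s. s \<in> S - T \<Longrightarrow> f s = 0\<^sub>m nr nc"
  shows "msum nr nc f S = msum nr nc f T"
  by (rule eq_matI) (use assms in \<open>auto simp: msum_index intro!: sum.mono_neutral_right\<close>)

text \<open>One notion of linear subspace serves columns (\<open>nc = 1\<close>), where it describes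
  subrepresentations, and spaces of intertwiners, where a group acts from both sides.\<close>

definition mlin :: "nat \<Rightarrow> nat \<Rightarrow> complex mat set \<Rightarrow> bool" where
  "mlin nr nc M \<longleftrightarrow> M \<subseteq> carrier_mat nr nc \<and> 0\<^sub>m nr nc \<in> M \<and>
     (\<forall>A\<in>M. \<forall>B\<in>M. A + B \<in> M) \<and> (\<forall>c. \<forall>A\<in>M. c \<cdot>\<^sub>m A \<in> M)"

lemma mlin_msum:
  assumes "mlin nr nc M" "finite S" "\<And>s. s \<in> S \<Longrightarrow> f s \<in> M"
  shows "msum nr nc f S \<in> M"
  using assms(2,3)
proof (induction S rule: finite_induct)
  case empty
  have "msum nr nc f {} = 0\<^sub>m nr nc" by (rule msum_zero) simp
  then show ?case using assms(1) by (simp add: mlin_def)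
next
  case (insert x F)
  have "msum nr nc f (insert x F) = f x + msum nr nc f F"
    using insert assms(1) by (intro eq_matI) (auto simp: msum_index mlin_def)
  then show ?case using insert assms(1) by (auto simp: mlin_def)
qed

section \<open>Representations with an explicit degree, acting on one-column matrices\<close>

definition mrep :: "('g, 'm) monoid_scheme \<Rightarrow> nat \<Rightarrow> ('g \<Rightarrow> complex mat) \<Rightarrow> bool" where
  "mrep G d \<rho> \<longleftrightarrow> (\<forall>g\<in>carrier G. \<rho> g \<in> carrier_mat d d) \<and>
     (\<forall>g\<in>carrier G. \<forall>h\<in>carrier G. \<rho> (g \<otimes>\<^bsub>G\<^esub> h) = \<rho> g * \<rho> h) \<and> \<rho> \<one>\<^bsub>G\<^esub> = 1\<^sub>m d"

lemma mrepD:
  assumes "mrep G d \<rho>"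
  shows "g \<in> carrier G \<Longrightarrow> \<rho> g \<in> carrier_mat d d"
    and "g \<in> carrier G \<Longrightarrow> h \<in> carrier G \<Longrightarrow> \<rho> (g \<otimes>\<^bsub>G\<^esub> h) = \<rho> g * \<rho> h"
    and "\<rho> \<one>\<^bsub>G\<^esub> = 1\<^sub>m d"
  using assms by (auto simp: mrep_def)

lemma mrep_degree: "mrep G d \<rho> \<Longrightarrow> rep_degree G \<rho> = d"
  by (auto simp: mrep_def rep_degree_def)

lemma GLC_carrier:
  "carrier (GLC d) = {A \<in> carrier_mat d d. \<exists>B\<in>carrier_mat d d. A * B = 1\<^sub>m d \<and> B * A = 1\<^sub>m d}"
  by (auto simp: GLC_def units_of_def Units_def ring_mat_def)

lemma GLC_simps [simp]: "mult (GLC d) = (*)" "one (GLC d) = 1\<^sub>m d"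
  by (auto simp: GLC_def units_of_def ring_mat_def)

lemma GLC_group: "group (GLC d)"
proof -
  interpret R: ring "ring_mat TYPE(complex) d ()" by (rule ring_mat)
  show ?thesis unfolding GLC_def by (rule R.units_group)
qed

context group
begin

lemma mrep_inv:
  assumes "mrep G d \<rho>" "g \<in> carrier G"
  shows "\<rho> g * \<rho> (inv g) = 1\<^sub>m d" "\<rho> (inv g) * \<rho> g = 1\<^sub>m d"
  using mrepD[OF assms(1)] assms(2) by (metis inv_closed r_inv, metis inv_closed l_inv)

lemma is_rep_iff_mrep: "is_rep G \<rho> \<longleftrightarrow> mrep G (rep_degree G \<rho>) \<rho>"
proof
  let ?d = "rep_degree G \<rho>"
  assume "is_rep G \<rho>"
  then have h: "\<rho> \<in> hom G (GLC ?d)" by (simp add: is_rep_def)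
  interpret L: group "GLC ?d" by (rule GLC_group)
  have "\<rho> \<one> = \<one>\<^bsub>GLC ?d\<^esub>" using h by (simp add: hom_one L.group_axioms is_group)
  then show "mrep G ?d \<rho>" using h by (auto simp: mrep_def hom_def GLC_carrier Pi_iff)
next
  let ?d = "rep_degree G \<rho>"
  assume m: "mrep G ?d \<rho>"
  have "\<rho> g \<in> carrier (GLC ?d)" if "g \<in> carrier G" for g
    using mrepD(1)[OF m that] mrepD(1)[OF m inv_closed[OF that]] mrep_inv[OF m that]
    unfolding GLC_carrier by blast
  then show "is_rep G \<rho>" using m by (auto simp: is_rep_def hom_def mrep_def)
qed

end

lemma col_mat_of_cols_single: "v \<in> carrier_vec d \<Longrightarrow> col (mat_of_cols d [v]) 0 = v"
  by (auto simp: mat_of_cols_def)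

lemma mat_of_cols_col_single: "A \<in> carrier_mat d 1 \<Longrightarrow> mat_of_cols d [col A 0] = A"
  by (rule eq_matI) (auto simp: mat_of_cols_def)

lemma mat_of_cols_single_carrier [simp]: "mat_of_cols d [v] \<in> carrier_mat d 1"
  by (auto simp: mat_of_cols_def)

lemma mult_mat_of_cols_single:
  "A \<in> carrier_mat d d \<Longrightarrow> v \<in> carrier_vec d \<Longrightarrow> A * mat_of_cols d [v] = mat_of_cols d [A *\<^sub>v v]"
  by (rule eq_matI) (auto simp: mat_of_cols_def scalar_prod_def)

text \<open>Vectors are traded for one-column matrices, so that group actions, intertwiners and
  eigenvectors are all governed by the matrix product.\<close>

lemma subspace_iff_mlin:
  "VectorSpace.subspace class_ring W (module_vec TYPE(complex) d) \<longleftrightarrow>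
     W \<subseteq> carrier_vec d \<and> mlin d 1 ((\<lambda>v. mat_of_cols d [v]) ` W)" (is "?l \<longleftrightarrow> ?r")
proof -
  let ?f = "\<lambda>v :: complex vec. mat_of_cols d [v]"
  have l: "?l \<longleftrightarrow> W \<subseteq> carrier_vec d \<and> 0\<^sub>v d \<in> W \<and> (\<forall>v\<in>W. \<forall>w\<in>W. v + w \<in> W) \<and> (\<forall>c. \<forall>v\<in>W. c \<cdot>\<^sub>v v \<in> W)"
    using vec_vs[of d] vec_module[of d]
    by (auto simp: VectorSpace.subspace_def submodule_def module_vec_simps class_ring_simps)
  have inj: "?f v = ?f w \<longleftrightarrow> v = w" if "v \<in> carrier_vec d" "w \<in> carrier_vec d" for v w
    using that col_mat_of_cols_single by metis
  have add: "?f v + ?f w = ?f (v + w)" if "v \<in> carrier_vec d" "w \<in> carrier_vec d" for v w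
    using that by (intro eq_matI) (auto simp: mat_of_cols_def)
  have sm: "c \<cdot>\<^sub>m ?f v = ?f (c \<cdot>\<^sub>v v)" if "v \<in> carrier_vec d" for v c
    using that by (intro eq_matI) (auto simp: mat_of_cols_def)
  have z: "0\<^sub>m d 1 = ?f (0\<^sub>v d)" by (intro eq_matI) (auto simp: mat_of_cols_def)
  have mem: "?f v \<in> ?f ` W \<longleftrightarrow> v \<in> W" if "v \<in> carrier_vec d" "W \<subseteq> carrier_vec d" for v
  proof
    assume "?f v \<in> ?f ` W"
    then obtain w where "w \<in> W" "?f v = ?f w" by blast
    then show "v \<in> W" using inj[of v w] that by blast
  qed blast
  show ?thesis
  proof (cases "W \<subseteq> carrier_vec d")
    case True
    have c: "v \<in> carrier_vec d" if "v \<in> W" for v using that True by auto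
    have "?f v + ?f w \<in> ?f ` W \<longleftrightarrow> v + w \<in> W" if "v \<in> W" "w \<in> W" for v w
      using add[OF c c, OF that] mem[OF add_carrier_vec[OF c c, OF that] True] by simp
    then have "(\<forall>v\<in>W. \<forall>w\<in>W. ?f v + ?f w \<in> ?f ` W) \<longleftrightarrow> (\<forall>v\<in>W. \<forall>w\<in>W. v + w \<in> W)"
      by blast
    moreover have "a \<cdot>\<^sub>m ?f v \<in> ?f ` W \<longleftrightarrow> a \<cdot>\<^sub>v v \<in> W" if "v \<in> W" for v a
      using sm[OF c, OF that] mem[OF _ True, of "a \<cdot>\<^sub>v v"] c[OF that] by simp
    then have "(\<forall>a. \<forall>v\<in>W. a \<cdot>\<^sub>m ?f v \<in> ?f ` W) \<longleftrightarrow> (\<forall>a. \<forall>v\<in>W. a \<cdot>\<^sub>v v \<in> W)"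
      by blast
    moreover have "0\<^sub>m d 1 \<in> ?f ` W \<longleftrightarrow> 0\<^sub>v d \<in> W" using True z mem by auto
    ultimately show ?thesis unfolding l mlin_def using True by auto
  qed (auto simp: l)
qed

text \<open>The map from vectors to columns is a bijection that respects stability and the two
  trivial subspaces. The degree is quantified, since it is otherwise hidden in the value at the
  identity.\<close>

lemma irreducible_rep_iff:
  fixes G :: "('g, 'm) monoid_scheme"
  assumes "group G"
  shows "irreducible_rep G \<rho> \<longleftrightarrow> (\<exists>d>0. mrep G d \<rho> \<and>
     (\<forall>M. mlin d 1 M \<and> (\<forall>g\<in>carrier G. \<forall>A\<in>M. \<rho> g * A \<in> M) \<longrightarrow> M = {0\<^sub>m d 1} \<or> M = carrier_mat d 1))"
    (is "?l \<longleftrightarrow> ?r")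
proof -
  interpret group G by fact
  let ?d = "rep_degree G \<rho>"
  let ?f = "\<lambda>v :: complex vec. mat_of_cols ?d [v]"
  have stab: "(\<forall>g\<in>carrier G. \<forall>w\<in>W. \<rho> g *\<^sub>v w \<in> W) \<longleftrightarrow> (\<forall>g\<in>carrier G. \<forall>A\<in>?f ` W. \<rho> g * A \<in> ?f ` W)"
    if "mrep G ?d \<rho>" "W \<subseteq> carrier_vec ?d" for W
  proof -
    have "\<rho> g *\<^sub>v w \<in> W \<longleftrightarrow> \<rho> g * ?f w \<in> ?f ` W" if "g \<in> carrier G" "w \<in> W" for g w
    proof -
      have g: "\<rho> g \<in> carrier_mat ?d ?d" and w: "w \<in> carrier_vec ?d"
        using that \<open>W \<subseteq> _\<close> mrepD[OF \<open>mrep G ?d \<rho>\<close>] by auto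
      then have c: "\<rho> g *\<^sub>v w \<in> carrier_vec ?d" by auto
      show ?thesis unfolding mult_mat_of_cols_single[OF g w]
      proof
        assume "?f (\<rho> g *\<^sub>v w) \<in> ?f ` W"
        then obtain u where "u \<in> W" "?f (\<rho> g *\<^sub>v w) = ?f u" by blast
        then show "\<rho> g *\<^sub>v w \<in> W" using col_mat_of_cols_single[OF c] col_mat_of_cols_single[of u ?d] \<open>W \<subseteq> _\<close> by auto
      qed blast
    qed
    then show ?thesis by auto
  qed
  have im: "?f ` W = {0\<^sub>m ?d 1} \<longleftrightarrow> W = {0\<^sub>v ?d}" "?f ` W = carrier_mat ?d 1 \<longleftrightarrow> W = carrier_vec ?d"
    if W: "W \<subseteq> carrier_vec ?d" for W
  proof -
    have z: "0\<^sub>m ?d 1 = ?f (0\<^sub>v ?d)" by (intro eq_matI) (auto simp: mat_of_cols_def)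
    have inj: "inj_on ?f (carrier_vec ?d)" by (rule inj_on_inverseI[of _ "\<lambda>A. col A 0"]) (simp add: col_mat_of_cols_single)
    have c: "?f ` carrier_vec ?d = carrier_mat ?d 1"
    proof
      show "carrier_mat ?d 1 \<subseteq> ?f ` carrier_vec ?d"
      proof
        fix A :: "complex mat" assume A: "A \<in> carrier_mat ?d 1"
        then have "col A 0 \<in> carrier_vec ?d" by (simp add: carrier_vecI)
        then show "A \<in> ?f ` carrier_vec ?d" using mat_of_cols_col_single[OF A] by (metis imageI)
      qed
    qed auto
    have "?f ` W = ?f ` {0\<^sub>v ?d} \<longleftrightarrow> W = {0\<^sub>v ?d}"
      by (rule inj_on_image_eq_iff[OF inj W]) auto
    then show "?f ` W = {0\<^sub>m ?d 1} \<longleftrightarrow> W = {0\<^sub>v ?d}" unfolding z by simp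
    show "?f ` W = carrier_mat ?d 1 \<longleftrightarrow> W = carrier_vec ?d"
      unfolding c[symmetric] by (rule inj_on_image_eq_iff[OF inj W]) auto
  qed
  have ex: "\<exists>W. W \<subseteq> carrier_vec ?d \<and> M = ?f ` W" if "mlin ?d 1 M" for M
  proof (intro exI conjI)
    show "(\<lambda>A. col A 0) ` M \<subseteq> carrier_vec ?d"
      using that by (auto simp: mlin_def intro!: carrier_vecI)
    have "?f ` ((\<lambda>A. col A 0) ` M) = id ` M" unfolding image_image
      by (rule image_cong[OF refl]) (use that in \<open>auto simp: mlin_def mat_of_cols_col_single\<close>)
    then show "M = ?f ` ((\<lambda>A. col A 0) ` M)" by simp
  qed
  have "?l \<longleftrightarrow> mrep G ?d \<rho> \<and> ?d > 0 \<and>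
     (\<forall>M. mlin ?d 1 M \<and> (\<forall>g\<in>carrier G. \<forall>A\<in>M. \<rho> g * A \<in> M) \<longrightarrow> M = {0\<^sub>m ?d 1} \<or> M = carrier_mat ?d 1)"
  proof (cases "mrep G ?d \<rho>")
    case True
    let ?P = "\<lambda>M. mlin ?d 1 M \<and> (\<forall>g\<in>carrier G. \<forall>A\<in>M. \<rho> g * A \<in> M) \<longrightarrow> M = {0\<^sub>m ?d 1} \<or> M = carrier_mat ?d 1"
    let ?Q = "\<lambda>W. (W \<subseteq> carrier_vec ?d \<and> mlin ?d 1 (?f ` W)) \<and> (\<forall>g\<in>carrier G. \<forall>w\<in>W. \<rho> g *\<^sub>v w \<in> W) \<longrightarrow>
       W = {0\<^sub>v ?d} \<or> W = carrier_vec ?d"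
    have PQ: "?P (?f ` W) \<longleftrightarrow> ?Q W" if "W \<subseteq> carrier_vec ?d" for W
      using that unfolding stab[OF True that] im[OF that] by simp
    have "(\<forall>W. ?Q W) \<longleftrightarrow> (\<forall>M. ?P M)"
    proof
      assume Q: "\<forall>W. ?Q W"
      show "\<forall>M. ?P M"
      proof
        fix M show "?P M"
        proof (cases "mlin ?d 1 M")
          case True
          then obtain W where "W \<subseteq> carrier_vec ?d" "M = ?f ` W" using ex by blast
          then show ?thesis using PQ Q by simp
        qed simp
      qed
    next
      assume P: "\<forall>M. ?P M"
      show "\<forall>W. ?Q W"
      proof
        fix W show "?Q W" using PQ[of W] P by (cases "W \<subseteq> carrier_vec ?d") auto
      qed
    qed
    then show ?thesis unfolding irreducible_rep_def is_rep_iff_mrep subspace_iff_mlin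
      using True by simp
  qed (simp add: irreducible_rep_def is_rep_iff_mrep)
  also have "\<dots> \<longleftrightarrow> ?r"
  proof
    assume ?r
    then obtain d where "d > 0" "mrep G d \<rho>"
      "\<forall>M. mlin d 1 M \<and> (\<forall>g\<in>carrier G. \<forall>A\<in>M. \<rho> g * A \<in> M) \<longrightarrow> M = {0\<^sub>m d 1} \<or> M = carrier_mat d 1"
      by blast
    then show "mrep G ?d \<rho> \<and> ?d > 0 \<and>
     (\<forall>M. mlin ?d 1 M \<and> (\<forall>g\<in>carrier G. \<forall>A\<in>M. \<rho> g * A \<in> M) \<longrightarrow> M = {0\<^sub>m ?d 1} \<or> M = carrier_mat ?d 1)"
      using mrep_degree[of G d \<rho>] by simp
  qed blast
  finally show ?thesis .
qed

lemma rep_contains_iff: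
  assumes "mrep G d \<rho>" "H \<subseteq> carrier G"
  shows "rep_contains G \<rho> H \<psi> \<longleftrightarrow>
    (\<exists>A\<in>carrier_mat d 1. A \<noteq> 0\<^sub>m d 1 \<and> (\<forall>h\<in>H. \<rho> h * A = \<psi> h \<cdot>\<^sub>m A))"
proof -
  have d: "rep_degree G \<rho> = d" using assms(1) by (rule mrep_degree)
  let ?f = "\<lambda>v :: complex vec. mat_of_cols d [v]"
  have inj: "?f v = ?f w \<longleftrightarrow> v = w" if "v \<in> carrier_vec d" "w \<in> carrier_vec d" for v w
    using that col_mat_of_cols_single by metis
  have z: "0\<^sub>m d 1 = ?f (0\<^sub>v d)" by (intro eq_matI) (auto simp: mat_of_cols_def)
  have sm: "c \<cdot>\<^sub>m ?f v = ?f (c \<cdot>\<^sub>v v)" if "v \<in> carrier_vec d" for v c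
    using that by (intro eq_matI) (auto simp: mat_of_cols_def)
  have eq: "\<rho> h * ?f v = \<psi> h \<cdot>\<^sub>m ?f v \<longleftrightarrow> \<rho> h *\<^sub>v v = \<psi> h \<cdot>\<^sub>v v" if "h \<in> H" "v \<in> carrier_vec d" for h v
  proof -
    have h: "\<rho> h \<in> carrier_mat d d" using assms that by (auto simp: mrep_def)
    show ?thesis unfolding mult_mat_of_cols_single[OF h that(2)] sm[OF that(2)]
      by (rule inj) (use h that in auto)
  qed
  have *: "(\<exists>A\<in>carrier_mat d 1. P A) \<longleftrightarrow> (\<exists>v\<in>carrier_vec d. P (?f v))" for P :: "complex mat \<Rightarrow> bool"
  proof
    assume "\<exists>A\<in>carrier_mat d 1. P A"
    then obtain A where A: "A \<in> carrier_mat d 1" "P A" by blast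
    then have "P (?f (col A 0))" "col A 0 \<in> carrier_vec d" by (simp_all add: mat_of_cols_col_single carrier_vecI)
    then show "\<exists>v\<in>carrier_vec d. P (?f v)" by blast
  qed (use mat_of_cols_single_carrier in blast)
  have "(v \<noteq> 0\<^sub>v d \<and> (\<forall>h\<in>H. \<rho> h *\<^sub>v v = \<psi> h \<cdot>\<^sub>v v)) \<longleftrightarrow>
      (?f v \<noteq> ?f (0\<^sub>v d) \<and> (\<forall>h\<in>H. \<rho> h * ?f v = \<psi> h \<cdot>\<^sub>m ?f v))" if "v \<in> carrier_vec d" for v
    using inj[OF that zero_carrier_vec] eq[OF _ that] by auto
  then show ?thesis unfolding rep_contains_def d * z by (intro bex_cong refl)
qed

lemma irreducible_repD:
  assumes "irreducible_rep G \<rho>" "group G"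
  shows "mrep G (rep_degree G \<rho>) \<rho>" "rep_degree G \<rho> > 0"
    and "mlin (rep_degree G \<rho>) 1 M \<Longrightarrow> (\<And>g A. g \<in> carrier G \<Longrightarrow> A \<in> M \<Longrightarrow> \<rho> g * A \<in> M) \<Longrightarrow>
      A \<in> M \<Longrightarrow> A \<noteq> 0\<^sub>m (rep_degree G \<rho>) 1 \<Longrightarrow> M = carrier_mat (rep_degree G \<rho>) 1"
proof -
  obtain d where d: "d > 0" "mrep G d \<rho>"
    "\<forall>M. mlin d 1 M \<and> (\<forall>g\<in>carrier G. \<forall>A\<in>M. \<rho> g * A \<in> M) \<longrightarrow> M = {0\<^sub>m d 1} \<or> M = carrier_mat d 1"
    using assms(1)[unfolded irreducible_rep_iff[OF assms(2)]] by (elim exE conjE)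
  have dd: "rep_degree G \<rho> = d" using d(2) by (rule mrep_degree)
  show "mrep G (rep_degree G \<rho>) \<rho>" "rep_degree G \<rho> > 0" using d dd by auto
  show "M = carrier_mat (rep_degree G \<rho>) 1" if "mlin (rep_degree G \<rho>) 1 M"
    "\<And>g A. g \<in> carrier G \<Longrightarrow> A \<in> M \<Longrightarrow> \<rho> g * A \<in> M" "A \<in> M" "A \<noteq> 0\<^sub>m (rep_degree G \<rho>) 1"
    using that d(3)[rule_format, of M] unfolding dd by blast
qed

lemma mat_eq_smult_oneI:
  assumes "A \<in> carrier_mat d d" "\<And>B. B \<in> carrier_mat d 1 \<Longrightarrow> A * B = c \<cdot>\<^sub>m B"
  shows "A = c \<cdot>\<^sub>m (1\<^sub>m d :: complex mat)"
proof (rule eq_matI)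
  fix i j assume ij: "i < dim_row (c \<cdot>\<^sub>m 1\<^sub>m d)" "j < dim_col (c \<cdot>\<^sub>m 1\<^sub>m d)"
  let ?B = "mat d 1 (\<lambda>(k, _). if k = j then 1 else 0) :: complex mat"
  have "(A * ?B) $$ (i, 0) = (c \<cdot>\<^sub>m ?B) $$ (i, 0)" using assms(2)[of ?B] by simp
  moreover have "(A * ?B) $$ (i, 0) = (\<Sum>k<d. A $$ (i, k) * ?B $$ (k, 0))"
    by (rule mult_index_sum[OF assms(1)]) (use ij in auto)
  ultimately show "A $$ (i, j) = (c \<cdot>\<^sub>m 1\<^sub>m d) $$ (i, j)" using ij
    by (cases "i = j") (simp_all add: if_distrib cong: if_cong del: index_mult_mat(1))
qed (use assms in auto)

lemma mat_assoc: "dim_col A = dim_row B \<Longrightarrow> dim_col B = dim_row C \<Longrightarrow> A * B * C = A * (B * C :: complex mat)"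
  by (rule assoc_mult_mat[of _ "dim_row A" "dim_col A" _ "dim_col B" _ "dim_col C"]) auto

lemma mat_smult_left: "dim_col A = dim_row B \<Longrightarrow> (c \<cdot>\<^sub>m A) * B = c \<cdot>\<^sub>m (A * B :: complex mat)"
  by (rule mult_smult_assoc_mat[of _ "dim_row A" "dim_col A" _ "dim_col B"]) auto

lemma mat_smult_right: "dim_col A = dim_row B \<Longrightarrow> A * (c \<cdot>\<^sub>m B) = c \<cdot>\<^sub>m (A * B :: complex mat)"
  by (rule mult_smult_distrib[of _ "dim_row A" "dim_col A" _ "dim_col B"]) auto

lemma smult_smult_mat: "a \<cdot>\<^sub>m (b \<cdot>\<^sub>m A) = (a * b :: complex) \<cdot>\<^sub>m A"
  by (rule eq_matI) auto

lemma one_smult_mat: "(1 :: complex) \<cdot>\<^sub>m A = A"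
  by (rule eq_matI) auto

lemma zero_smult_mat: "A \<in> carrier_mat a b \<Longrightarrow> (0 :: complex) \<cdot>\<^sub>m A = 0\<^sub>m a b"
  by (rule eq_matI) auto

text \<open>An eigenvalue of \<open>A\<close> exists over the complex numbers, its eigenspace is
  stable because \<open>A\<close> commutes with the action, and irreducibility makes it the whole
  space.\<close>

theorem schur_scalar:
  assumes "group G" "irreducible_rep G \<rho>" "A \<in> carrier_mat (rep_degree G \<rho>) (rep_degree G \<rho>)"
    and comm: "\<And>g. g \<in> carrier G \<Longrightarrow> A * \<rho> g = \<rho> g * A"
  obtains c where "A = c \<cdot>\<^sub>m 1\<^sub>m (rep_degree G \<rho>)"
proof -
  let ?d = "rep_degree G \<rho>"
  note irr = irreducible_repD[OF assms(2,1)]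
  obtain c where "eigenvalue A c" using spectrum_non_empty[OF assms(3) irr(2)] by (auto simp: spectrum_def)
  then obtain v where v: "v \<in> carrier_vec ?d" "v \<noteq> 0\<^sub>v ?d" "A *\<^sub>v v = c \<cdot>\<^sub>v v"
    using assms(3) by (auto simp: eigenvalue_def eigenvector_def)
  define M where "M = {B \<in> carrier_mat ?d 1. A * B = c \<cdot>\<^sub>m B}"
  have "mlin ?d 1 M" using assms(3) unfolding mlin_def M_def
    by (auto simp: mult_add_distrib_mat[OF assms(3)] mult_smult_distrib[OF assms(3)] add_smult_distrib_left_mat[of _ ?d 1]
        mult.commute smult_smult_mat)
  moreover have "\<rho> g * B \<in> M" if "g \<in> carrier G" "B \<in> M" for g B
  proof -
    have g: "\<rho> g \<in> carrier_mat ?d ?d" using mrepD(1)[OF irr(1) that(1)] .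
    have B: "B \<in> carrier_mat ?d 1" "A * B = c \<cdot>\<^sub>m B" using that by (auto simp: M_def)
    have "A * (\<rho> g * B) = A * \<rho> g * B" by (rule assoc_mult_mat[symmetric, OF assms(3) g B(1)])
    also have "\<dots> = \<rho> g * (A * B)" unfolding comm[OF that(1)] by (rule assoc_mult_mat[OF g assms(3) B(1)])
    also have "\<dots> = c \<cdot>\<^sub>m (\<rho> g * B)" unfolding B(2) by (rule mult_smult_distrib[OF g B(1)])
    finally show ?thesis using g B by (auto simp: M_def)
  qed
  moreover have "mat_of_cols ?d [v] \<in> M"
    using mult_mat_of_cols_single[OF assms(3) v(1)] v(1,3)
    by (auto simp: M_def mat_of_cols_def intro!: eq_matI)
  moreover have "mat_of_cols ?d [v] \<noteq> 0\<^sub>m ?d 1"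
  proof
    assume "mat_of_cols ?d [v] = 0\<^sub>m ?d 1"
    then have "col (mat_of_cols ?d [v]) 0 = 0\<^sub>v ?d" by simp
    then show False using v col_mat_of_cols_single[OF v(1)] by simp
  qed
  ultimately have "M = carrier_mat ?d 1" by (rule irr(3))
  then have "A = c \<cdot>\<^sub>m 1\<^sub>m ?d" by (intro mat_eq_smult_oneI assms(3)) (auto simp: M_def)
  then show ?thesis by (rule that)
qed

lemma smult_mat_cancel:
  assumes "A \<in> carrier_mat a b" "A \<noteq> 0\<^sub>m a b" "x \<cdot>\<^sub>m A = y \<cdot>\<^sub>m A"
  shows "x = (y :: complex)"
proof -
  obtain i j where ij: "i < a" "j < b" "A $$ (i, j) \<noteq> 0"
    using assms(1,2) by (metis carrier_matD eq_matI index_zero_mat(1) index_zero_mat(2) index_zero_mat(3))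
  have "(x \<cdot>\<^sub>m A) $$ (i, j) = (y \<cdot>\<^sub>m A) $$ (i, j)" using assms(3) by simp
  then show ?thesis using ij assms(1) by auto
qed

definition mtrace :: "complex mat \<Rightarrow> complex" where
  "mtrace A = (\<Sum>i<dim_row A. A $$ (i, i))"

lemma trace_smult_one: "mtrace (c \<cdot>\<^sub>m 1\<^sub>m d) = c * of_nat d"
  by (simp add: mtrace_def)

lemma trace_msum: "mtrace (msum d d f S) = (\<Sum>s\<in>S. \<Sum>i<d. f s $$ (i, i))"
  by (simp add: mtrace_def msum_index lessThan_atLeast0 sum.swap[of _ S])

lemma trace_mult_comm:
  assumes "A \<in> carrier_mat a b" "B \<in> carrier_mat b a"
  shows "mtrace (A * B) = mtrace (B * A :: complex mat)"
proof -
  have "mtrace (A * B) = (\<Sum>i<a. \<Sum>k<b. A $$ (i, k) * B $$ (k, i))"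
    using assms by (simp add: mtrace_def lessThan_atLeast0 mult_index_sum[OF assms] del: index_mult_mat(1))
  also have "\<dots> = (\<Sum>k<b. \<Sum>i<a. B $$ (k, i) * A $$ (i, k))" by (subst sum.swap) (simp add: mult.commute)
  also have "\<dots> = mtrace (B * A)"
    using assms by (simp add: mtrace_def lessThan_atLeast0 mult_index_sum[OF assms(2,1)] del: index_mult_mat(1))
  finally show ?thesis .
qed

text \<open>The sum is not divided by the order of the group: only its vanishing and its trace
  matter.\<close>

definition avg :: "('g, 'm) monoid_scheme \<Rightarrow> nat \<Rightarrow> nat \<Rightarrow> ('g \<Rightarrow> complex mat) \<Rightarrow> ('g \<Rightarrow> complex mat) \<Rightarrow> complex mat \<Rightarrow> complex mat" where
  "avg G d' d \<rho>' \<rho> L = msum d' d (\<lambda>g. \<rho>' g * L * \<rho> (inv\<^bsub>G\<^esub> g)) (carrier G)"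

lemma (in group) avg_intertwines:
  assumes "mrep G d \<rho>" "mrep G d' \<rho>'" "L \<in> carrier_mat d' d" "h \<in> carrier G"
  shows "avg G d' d \<rho>' \<rho> L * \<rho> h = \<rho>' h * avg G d' d \<rho>' \<rho> L"
proof -
  let ?f = "\<lambda>g. \<rho>' g * L * \<rho> (inv g)"
  note r = mrepD[OF assms(1)] and r' = mrepD[OF assms(2)]
  have f: "?f g \<in> carrier_mat d' d" if "g \<in> carrier G" for g
    using r(1)[OF inv_closed[OF that]] r'(1)[OF that] assms(3) by auto
  have "bij_betw (\<lambda>g. h \<otimes> g) (carrier G) (carrier G)"
    by (rule bij_betw_byWitness[where f' = "\<lambda>g. inv h \<otimes> g"]) (use assms(4) in \<open>auto simp: m_assoc[symmetric]\<close>)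
  then have "avg G d' d \<rho>' \<rho> L = msum d' d (\<lambda>g. ?f (h \<otimes> g)) (carrier G)"
    unfolding avg_def by (rule msum_reindex)
  also have "\<dots> * \<rho> h = msum d' d (\<lambda>g. ?f (h \<otimes> g) * \<rho> h) (carrier G)"
    using assms(4) r(1) by (intro msum_mult f) auto
  also have "\<dots> = msum d' d (\<lambda>g. \<rho>' h * ?f g) (carrier G)"
  proof (rule msum_cong[OF refl])
    fix g assume g: "g \<in> carrier G"
    have c: "\<rho> (inv g) \<in> carrier_mat d d" "\<rho> (inv h) \<in> carrier_mat d d" "\<rho> h \<in> carrier_mat d d"
      "\<rho>' g \<in> carrier_mat d' d'" "\<rho>' h \<in> carrier_mat d' d'" using r(1) r'(1) g assms(4) by auto
    have "?f (h \<otimes> g) * \<rho> h = \<rho>' h * \<rho>' g * L * (\<rho> (inv g) * \<rho> (inv h)) * \<rho> h"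
      using g assms(4) by (simp add: r'(2) inv_mult_group r(2))
    also have "\<dots> = \<rho>' h * (\<rho>' g * L * \<rho> (inv g) * (\<rho> (inv h) * \<rho> h))"
      using c assms(3) by (simp add: assoc_mult_mat[of _ _ d' _ d' _ d'] assoc_mult_mat[of _ _ d' _ d' _ d] assoc_mult_mat[of _ _ d' _ d _ d]
         assoc_mult_mat[of _ _ d _ d _ d] assoc_mult_mat[of _ d' d' L d _ d] mult_carrier_mat[of _ _ d' _ d])
    also have "\<rho> (inv h) * \<rho> h = 1\<^sub>m d" using mrep_inv[OF assms(1,4)] by simp
    also have "\<rho>' g * L * \<rho> (inv g) * 1\<^sub>m d = \<rho>' g * L * \<rho> (inv g)" by (rule right_mult_one_mat[OF f[OF g]])
    finally show "?f (h \<otimes> g) * \<rho> h = \<rho>' h * ?f g" .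
  qed
  also have "\<dots> = \<rho>' h * avg G d' d \<rho>' \<rho> L" unfolding avg_def
    using assms(4) r'(1) by (intro mult_msum[symmetric] f) auto
  finally show ?thesis .
qed

lemma intertwiner_comp:
  assumes "A \<in> carrier_mat d d" "B \<in> carrier_mat e e" "C \<in> carrier_mat k k" "F \<in> carrier_mat e d" "F' \<in> carrier_mat k e"
    and "F * A = B * F" "F' * B = C * F'"
  shows "F' * F * A = C * (F' * F :: complex mat)"
proof -
  have "F' * F * A = F' * B * F"
    using assms(6) by (simp add: mat_assoc assms(1-5)[THEN carrier_matD(1)] assms(1-5)[THEN carrier_matD(2)])
  also have "\<dots> = C * (F' * F)" unfolding assms(7) by (rule assoc_mult_mat[OF assms(3,5,4)])
  finally show ?thesis .
qed

text \<open>Instead of kernel and image of \<open>F\<close>, an intertwiner \<open>F'\<close> in the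
  opposite direction is built by averaging. By Schur both products are scalars, they are the same
  scalar because \<open>F * F' * F\<close> can be read in two ways, and the trace of
  \<open>F' * F\<close> shows that it is not zero. Comparing the traces of the two products gives
  equal degrees, so a multiple of \<open>F'\<close> inverts \<open>F\<close>.\<close>

theorem irreducible_rep_iso:
  assumes "group G" "finite (carrier G)" "irreducible_rep G \<rho>" "irreducible_rep G \<rho>'"
    and F: "F \<in> carrier_mat (rep_degree G \<rho>') (rep_degree G \<rho>)"
      "F \<noteq> 0\<^sub>m (rep_degree G \<rho>') (rep_degree G \<rho>)"
      "\<And>g. g \<in> carrier G \<Longrightarrow> F * \<rho> g = \<rho>' g * F"
  shows "(\<rho>, \<rho>') \<in> rep_iso G"
proof -
  interpret group G by fact
  let ?d = "rep_degree G \<rho>" and ?e = "rep_degree G \<rho>'"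
  note m = irreducible_repD(1)[OF assms(3,1)] and m' = irreducible_repD(1)[OF assms(4,1)]
  obtain i j where ij: "i < ?e" "j < ?d" "F $$ (i, j) \<noteq> 0"
    using F(1,2) by (metis carrier_matD eq_matI index_zero_mat(1) index_zero_mat(2) index_zero_mat(3))
  \<comment> \<open>The matrix unit for which the trace of \<open>L * F\<close> is the nonzero entry
    of \<open>F\<close> at \<open>(i, j)\<close>; averaging multiplies this trace by the order of
    the group.\<close>
  define L where "L = mat ?d ?e (\<lambda>(a, b). if a = j \<and> b = i then 1 else 0 :: complex)"
  have L: "L \<in> carrier_mat ?d ?e" by (simp add: L_def)
  note dims = carrier_matD[OF mrepD(1)[OF m]] carrier_matD[OF mrepD(1)[OF m']] carrier_matD[OF L] carrier_matD[OF F(1)]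
  define F' where "F' = avg G ?d ?e \<rho> \<rho>' L"
  have F': "F' \<in> carrier_mat ?d ?e" by (simp add: F'_def avg_def)
  have int': "F' * \<rho>' g = \<rho> g * F'" if "g \<in> carrier G" for g
    unfolding F'_def by (rule avg_intertwines[OF m' m L that])
  have "F' * F * \<rho> g = \<rho> g * (F' * F)" if "g \<in> carrier G" for g
    using intertwiner_comp[OF mrepD(1)[OF m that] mrepD(1)[OF m' that] mrepD(1)[OF m that] F(1) F' F(3)[OF that] int'[OF that]] .
  then obtain c where c: "F' * F = c \<cdot>\<^sub>m 1\<^sub>m ?d" using schur_scalar[OF assms(1,3), of "F' * F"] F' F(1) by (metis mult_carrier_mat)
  have "F * F' * \<rho>' g = \<rho>' g * (F * F')" if "g \<in> carrier G" for g
    using intertwiner_comp[OF mrepD(1)[OF m' that] mrepD(1)[OF m that] mrepD(1)[OF m' that] F' F(1) int'[OF that] F(3)[OF that]] .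
  then obtain c' where c': "F * F' = c' \<cdot>\<^sub>m 1\<^sub>m ?e" using schur_scalar[OF assms(1,4), of "F * F'"] F' F(1) by (metis mult_carrier_mat)
  have "mtrace (F' * F) = of_nat (card (carrier G)) * F $$ (i, j)"
  proof -
    have "F' * F = msum ?d ?d (\<lambda>g. \<rho> g * L * \<rho>' (inv\<^bsub>G\<^esub> g) * F) (carrier G)"
      unfolding F'_def avg_def by (rule msum_mult[OF F(1)]) (auto intro!: carrier_matI simp: dims)
    also have "mtrace \<dots> = (\<Sum>g\<in>carrier G. mtrace (\<rho> g * L * \<rho>' (inv\<^bsub>G\<^esub> g) * F))"
      unfolding trace_msum by (rule sum.cong[OF refl]) (simp add: mtrace_def lessThan_atLeast0 carrier_matD[OF mrepD(1)[OF m]])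
    also have "\<dots> = (\<Sum>g\<in>carrier G. mtrace (L * F))"
    proof (rule sum.cong[OF refl])
      fix g assume g: "g \<in> carrier G"
      have c: "\<rho> g \<in> carrier_mat ?d ?d" "\<rho> (inv\<^bsub>G\<^esub> g) \<in> carrier_mat ?d ?d" "\<rho>' (inv\<^bsub>G\<^esub> g) \<in> carrier_mat ?e ?e"
        using mrepD(1)[OF m] mrepD(1)[OF m'] g by auto
      have "\<rho> g * L * \<rho>' (inv\<^bsub>G\<^esub> g) * F = \<rho> g * L * (F * \<rho> (inv\<^bsub>G\<^esub> g))"
        using F(3)[of "inv\<^bsub>G\<^esub> g"] g by (simp add: mat_assoc dims)
      also have "\<dots> = \<rho> g * (L * F * \<rho> (inv\<^bsub>G\<^esub> g))"
        using g by (simp add: mat_assoc dims)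
      also have "mtrace \<dots> = mtrace (L * F * \<rho> (inv\<^bsub>G\<^esub> g) * \<rho> g)"
        by (rule trace_mult_comm[of _ ?d ?d]) (use c L F(1) in auto)
      also have "L * F * \<rho> (inv\<^bsub>G\<^esub> g) * \<rho> g = L * F * (\<rho> (inv\<^bsub>G\<^esub> g) * \<rho> g)"
        by (rule assoc_mult_mat[of _ ?d ?d _ ?d _ ?d]) (use c L F(1) in auto)
      also have "\<dots> = L * F" using mrep_inv[OF m g] L F(1) by simp
      finally show "mtrace (\<rho> g * L * \<rho>' (inv\<^bsub>G\<^esub> g) * F) = mtrace (L * F)" .
    qed
    also have "mtrace (L * F) = F $$ (i, j)"
    proof -
      have "mtrace (L * F) = (\<Sum>a<?d. \<Sum>b<?e. L $$ (a, b) * F $$ (b, a))"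
        using L F(1) by (simp add: mtrace_def lessThan_atLeast0 mult_index_sum[OF L F(1)] del: index_mult_mat(1))
      also have "\<dots> = (\<Sum>a<?d. if a = j then F $$ (i, j) else 0)"
        using ij by (intro sum.cong refl) (auto simp: L_def if_distrib[of "\<lambda>x. x * _"] cong: if_cong)
      finally show ?thesis using ij by simp
    qed
    finally show ?thesis by simp
  qed
  then have cd: "c * of_nat ?d = of_nat (card (carrier G)) * F $$ (i, j)" unfolding c trace_smult_one .
  then have c0: "c \<noteq> 0" using ij assms(2) order_gt_0_iff_finite by (auto simp: order_def)
  have "c \<cdot>\<^sub>m F = F * (F' * F)" unfolding c by (simp add: mat_smult_right carrier_matD[OF F(1)] right_mult_one_mat[OF F(1)])
  also have "\<dots> = F * F' * F" by (rule assoc_mult_mat[symmetric, OF F(1) F' F(1)])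
  also have "\<dots> = c' \<cdot>\<^sub>m F" unfolding c' using F(1) by (simp add: mult_smult_assoc_mat[of _ ?e ?e])
  finally have cc: "c = c'" by (rule smult_mat_cancel[OF F(1,2)])
  have "c * of_nat ?d = c' * of_nat ?e"
    using trace_mult_comm[OF F' F(1)] unfolding c c' trace_smult_one .
  then have de: "?e = ?d" using c0 cc by simp
  have "F \<in> carrier (GLC ?d)" unfolding GLC_carrier
  proof (safe intro!: bexI[of _ "(1 / c) \<cdot>\<^sub>m F'"])
    show "F \<in> carrier_mat ?d ?d" using F(1) de by simp
    show "F * ((1 / c) \<cdot>\<^sub>m F') = 1\<^sub>m ?d"
      using c0 cc c' de by (simp add: mat_smult_right carrier_matD[OF F(1)] carrier_matD[OF F'] smult_smult_mat one_smult_mat)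
    show "(1 / c) \<cdot>\<^sub>m F' * F = 1\<^sub>m ?d"
      using c0 c de by (simp add: mat_smult_left carrier_matD[OF F(1)] carrier_matD[OF F'] smult_smult_mat one_smult_mat)
    show "(1 / c) \<cdot>\<^sub>m F' \<in> carrier_mat ?d ?d" using F' de by simp
  qed
  then show ?thesis unfolding rep_iso_def using m m' de F(3) is_rep_iff_mrep by auto
qed

section \<open>Common eigenvectors of finite abelian groups\<close>

lemma msum_shift:
  assumes "f m = f (0::nat)"
  shows "msum nr nc (\<lambda>k. f (Suc k)) {..<m} = msum nr nc f {..<m}"
proof (rule eq_matI)
  fix i j assume "i < dim_row (msum nr nc f {..<m})" "j < dim_col (msum nr nc f {..<m})"
  moreover have "(\<Sum>k<m. f (Suc k) $$ (i, j)) = (\<Sum>k<m. f k $$ (i, j))"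
    using sum.lessThan_Suc[of "\<lambda>k. f k $$ (i, j)" m] sum.lessThan_Suc_shift[of "\<lambda>k. f k $$ (i, j)" m] assms
    by (simp add: add.commute)
  ultimately show "msum nr nc (\<lambda>k. f (Suc k)) {..<m} $$ (i, j) = msum nr nc f {..<m} $$ (i, j)"
    by (simp add: msum_index)
qed auto

lemma sum_root_unity:
  assumes "0 < k" "k < m"
  shows "(\<Sum>j<m. exp (2 * of_real pi * \<i> / of_nat m) ^ (j * k)) = (0 :: complex)"
proof -
  let ?z = "exp (2 * of_real pi * \<i> / of_nat m) ^ k :: complex"
  have z: "?z = exp (2 * of_real pi * \<i> * of_nat k / of_nat m)"
    by (simp add: exp_of_nat_mult[symmetric] field_simps)
  have "?z \<noteq> 1" unfolding z using complex_root_unity_eq_1[of m k] assms by (auto dest: dvd_imp_le)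
  moreover have "?z ^ m = 1" unfolding z using complex_root_unity[of m k] assms by simp
  ultimately have "(\<Sum>j<m. ?z ^ j) = 0" by (simp add: geometric_sum)
  then show ?thesis by (simp add: power_mult[symmetric] mult.commute)
qed

text \<open>The operators \<open>A \<mapsto> R g * A * U (inv g)\<close> on \<open>M\<close> commute
  and have finite order. Induction over a finite set of group elements: the eigenprojections of the
  new element sum to a multiple of \<open>A\<close>, so one of them does not kill \<open>A\<close>,
  and it preserves the earlier eigenvalues. A trivial \<open>U\<close> gives ordinary eigenvectors,
  the twist by \<open>U\<close> those in spaces of intertwiners.\<close>

theorem (in comm_group) common_eigenvector:
  assumes fin: "finite (carrier G)" and R: "mrep G D R" and U: "mrep G d U"
    and M: "mlin D d M" "\<And>g A. g \<in> carrier G \<Longrightarrow> A \<in> M \<Longrightarrow> R g * A * U (inv g) \<in> M"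
    and A0: "A0 \<in> M" "A0 \<noteq> 0\<^sub>m D d"
  obtains A ev where "A \<in> M" "A \<noteq> 0\<^sub>m D d" "\<And>g. g \<in> carrier G \<Longrightarrow> R g * A = ev g \<cdot>\<^sub>m (A * U g)"
proof -
  define P where "P g A = R g * A * U (inv g)" for g A
  have Mc: "A \<in> carrier_mat D d" if "A \<in> M" for A using M(1) that by (auto simp: mlin_def)
  note dims = carrier_matD[OF Mc] carrier_matD[OF mrepD(1)[OF R]] carrier_matD[OF mrepD(1)[OF U]]
  have Pm: "P g A \<in> M" if "g \<in> carrier G" "A \<in> M" for g A using M(2)[OF that] by (simp add: P_def)
  have PP: "P g (P h A) = P (g \<otimes> h) A" if "g \<in> carrier G" "h \<in> carrier G" "A \<in> M" for g h A
    unfolding P_def using that by (simp add: mrepD(2)[OF R] inv_mult_group mrepD(2)[OF U] mat_assoc dims)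
  have Psum: "P g (msum D d f S) = msum D d (\<lambda>s. P g (f s)) S" if "g \<in> carrier G" "\<And>s. s \<in> S \<Longrightarrow> f s \<in> M" for g f and S :: "nat set"
  proof -
    have "R g * msum D d f S = msum D d (\<lambda>s. R g * f s) S"
      by (rule mult_msum[OF mrepD(1)[OF R that(1)]]) (use that Mc in auto)
    then show ?thesis unfolding P_def using that mrepD(1)[OF R that(1)] Mc
      by (simp add: msum_mult[OF mrepD(1)[OF U inv_closed[OF that(1)]], of S] mult_carrier_mat[of _ D D _ d])
  qed
  have Psm: "P g (c \<cdot>\<^sub>m A) = c \<cdot>\<^sub>m P g A" if "g \<in> carrier G" "A \<in> M" for g A c
    unfolding P_def using that by (simp add: mat_smult_left mat_smult_right dims)
  have "\<exists>A\<in>M. A \<noteq> 0\<^sub>m D d \<and> (\<forall>g\<in>S. \<exists>c. P g A = c \<cdot>\<^sub>m A)" if "finite S" "S \<subseteq> carrier G" for S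
    using that
  proof (induction S rule: finite_induct)
    case empty
    then show ?case using A0 by blast
  next
    case (insert g S)
    then obtain A where A: "A \<in> M" "A \<noteq> 0\<^sub>m D d" "\<And>h. h \<in> S \<Longrightarrow> \<exists>c. P h A = c \<cdot>\<^sub>m A" by auto
    have g: "g \<in> carrier G" using insert by auto
    define m where "m = order G"
    have m0: "m > 0" using fin order_gt_0_iff_finite by (simp add: m_def)
    have gm: "g [^] m = \<one>" using pow_order_eq_1[OF g] by (simp add: m_def)
    define z :: complex where "z = exp (2 * of_real pi * \<i> / of_nat m)"
    have zm: "z ^ m = 1" unfolding z_def using complex_root_unity[of m 1] m0 by simp
    \<comment> \<open>Up to the factor \<open>m\<close>, the projection of \<open>A\<close> to the
      eigenspace of \<open>P g\<close> for the value \<open>1 / z ^ j\<close>. The exponent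
      \<open>m\<close> is the order of the group, a multiple of the order of
      \<open>g\<close>.\<close>
    define B where "B j = msum D d (\<lambda>k. z ^ (j * k) \<cdot>\<^sub>m P (g [^] k) A) {..<m}" for j
    have pow: "g [^] (k::nat) \<in> carrier G" for k using g by simp
    have fM: "z ^ (j * k) \<cdot>\<^sub>m P (g [^] k) A \<in> M" for j k
      using Pm[OF pow A(1)] M(1) by (auto simp: mlin_def)
    have BM: "B j \<in> M" for j unfolding B_def by (rule mlin_msum[OF M(1)]) (use fM in auto)
    have Bg: "P g (B j) = (1 / z ^ j) \<cdot>\<^sub>m B j" for j
    proof -
      have zj: "z ^ j \<noteq> 0" by (simp add: z_def)
      have "P g (B j) = msum D d (\<lambda>k. (1 / z ^ j) \<cdot>\<^sub>m (z ^ (j * Suc k) \<cdot>\<^sub>m P (g [^] Suc k) A)) {..<m}"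
        unfolding B_def
      proof (subst Psum[OF g fM], rule msum_cong[OF refl])
        fix k assume "k \<in> {..<m}"
        have "g \<otimes> g [^] k = g [^] Suc k" using g by (simp add: m_comm)
        then show "P g (z ^ (j * k) \<cdot>\<^sub>m P (g [^] k) A) = (1 / z ^ j) \<cdot>\<^sub>m (z ^ (j * Suc k) \<cdot>\<^sub>m P (g [^] Suc k) A)"
          using zj by (simp only: Psm[OF g Pm[OF pow A(1)]] PP[OF g pow A(1)] smult_smult_mat) (simp add: power_add)
      qed
      also have "\<dots> = (1 / z ^ j) \<cdot>\<^sub>m msum D d (\<lambda>k. z ^ (j * Suc k) \<cdot>\<^sub>m P (g [^] Suc k) A) {..<m}"
        by (rule msum_smult[symmetric]) (rule Mc[OF fM])
      also have "msum D d (\<lambda>k. z ^ (j * Suc k) \<cdot>\<^sub>m P (g [^] Suc k) A) {..<m} = B j"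
        unfolding B_def by (rule msum_shift) (simp add: gm power_mult[symmetric] mult.commute[of j] power_mult zm)
      finally show ?thesis .
    qed
    have BS: "P h (B j) = c \<cdot>\<^sub>m B j" if "P h A = c \<cdot>\<^sub>m A" "h \<in> carrier G" for h c j
    proof -
      have "P h (B j) = msum D d (\<lambda>k. c \<cdot>\<^sub>m (z ^ (j * k) \<cdot>\<^sub>m P (g [^] k) A)) {..<m}"
        unfolding B_def
      proof (subst Psum[OF that(2) fM], rule msum_cong[OF refl])
        fix k :: nat
        have "P h (P (g [^] k) A) = P (g [^] k) (P h A)"
          using that(2) pow[of k] by (simp add: PP[OF _ _ A(1)] m_comm)
        then show "P h (z ^ (j * k) \<cdot>\<^sub>m P (g [^] k) A) = c \<cdot>\<^sub>m (z ^ (j * k) \<cdot>\<^sub>m P (g [^] k) A)"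
          using that(1) by (simp add: Psm[OF that(2) Pm[OF pow A(1)]] Psm[OF pow A(1)] smult_smult_mat mult.commute)
      qed
      also have "\<dots> = c \<cdot>\<^sub>m B j" unfolding B_def by (rule msum_smult[symmetric]) (rule Mc[OF fM])
      finally show ?thesis .
    qed
    have "msum D d B {..<m} = of_nat m \<cdot>\<^sub>m A"
    proof -
      have "msum D d B {..<m} = msum D d (\<lambda>k. (\<Sum>j<m. z ^ (j * k)) \<cdot>\<^sub>m P (g [^] k) A) {..<m}"
        unfolding B_def by (subst msum_swap) (intro msum_cong refl msum_smult_const Mc Pm pow A(1))
      also have "\<dots> = msum D d (\<lambda>k. (\<Sum>j<m. z ^ (j * k)) \<cdot>\<^sub>m P (g [^] k) A) {0}"
      proof (rule msum_mono_neutral)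
        fix k assume "k \<in> {..<m} - {0}"
        then have "(\<Sum>j<m. z ^ (j * k)) = 0" unfolding z_def by (intro sum_root_unity) auto
        then show "(\<Sum>j<m. z ^ (j * k)) \<cdot>\<^sub>m P (g [^] k) A = 0\<^sub>m D d"
          by (simp add: zero_smult_mat[OF Mc[OF Pm[OF pow A(1)]]])
      qed (use m0 in auto)
      also have "\<dots> = of_nat m \<cdot>\<^sub>m A"
      proof (subst msum_delta[of _ 0])
        have "P \<one> A = A" unfolding P_def using Mc[OF A(1)]
          by (simp add: mrepD(3)[OF R] mrepD(3)[OF U])
        then show "(\<Sum>j<m. z ^ (j * 0)) \<cdot>\<^sub>m P (g [^] (0::nat)) A = of_nat m \<cdot>\<^sub>m A"
          and "(\<Sum>j<m. z ^ (j * 0)) \<cdot>\<^sub>m P (g [^] (0::nat)) A \<in> carrier_mat D d" using Mc[OF A(1)] by simp_all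
      qed auto
      finally show ?thesis .
    qed
    moreover have "of_nat m \<cdot>\<^sub>m A \<noteq> 0 \<cdot>\<^sub>m A"
      using smult_mat_cancel[OF Mc[OF A(1)] A(2), of "of_nat m" 0] m0 by auto
    moreover have "0 \<cdot>\<^sub>m A = 0\<^sub>m D d" by (rule zero_smult_mat[OF Mc[OF A(1)]])
    ultimately obtain j where "B j \<noteq> 0\<^sub>m D d" using msum_zero[of "{..<m}" B D d] by auto
    moreover have "\<exists>c. P h (B j) = c \<cdot>\<^sub>m B j" if h: "h \<in> insert g S" for h
    proof (cases "h = g")
      case False
      then obtain c where "P h A = c \<cdot>\<^sub>m A" using A(3) h by blast
      then show ?thesis using BS h insert.prems by blast
    qed (use Bg in blast)
    ultimately show ?case using BM by blast
  qed
  from this[OF fin subset_refl] obtain A where A: "A \<in> M" "A \<noteq> 0\<^sub>m D d" "\<And>g. g \<in> carrier G \<Longrightarrow> \<exists>c. P g A = c \<cdot>\<^sub>m A"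
    by blast
  then obtain ev where ev: "\<And>g. g \<in> carrier G \<Longrightarrow> P g A = ev g \<cdot>\<^sub>m A" by metis
  have "R g * A = ev g \<cdot>\<^sub>m (A * U g)" if "g \<in> carrier G" for g
  proof -
    have "R g * A = R g * A * (U (inv g) * U g)"
      using mrep_inv[OF U that] mrepD(1)[OF R that] Mc[OF A(1)] by (simp add: right_mult_one_mat[of _ D d])
    also have "\<dots> = P g A * U g" unfolding P_def using that A(1) by (simp add: mat_assoc dims)
    also have "\<dots> = ev g \<cdot>\<^sub>m (A * U g)" unfolding ev[OF that] using that A(1) by (simp add: mat_smult_left dims)
    finally show ?thesis .
  qed
  then show ?thesis using that A by blast
qed

text \<open>Averaging over the conjugates of \<open>\<Sum>\<^sub>x R x A \<pi> x\<^sup>-\<^sup>1\<close> isolates the terms with \<open>x \<in> Z\<close>,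
  because \<open>h \<mapsto> \<psi> [x, h]\<close> is a nontrivial character for \<open>x \<notin> Z\<close>.\<close>

theorem (in group) heisenberg_hom:
  assumes fin: "finite (carrier G)" and R: "mrep G D R" and \<pi>: "mrep G d \<pi>"
    and Z: "Z \<subseteq> carrier G" "\<one> \<in> Z"
    and A: "A \<in> carrier_mat D d" "A \<noteq> 0\<^sub>m D d" "\<And>z. z \<in> Z \<Longrightarrow> R z * A = \<psi> z \<cdot>\<^sub>m A"
    and \<pi>Z: "\<And>z. z \<in> Z \<Longrightarrow> \<pi> z = \<psi> z \<cdot>\<^sub>m 1\<^sub>m d"
    and comm: "\<And>x h. x \<in> carrier G \<Longrightarrow> h \<in> carrier G \<Longrightarrow> inv x \<otimes> inv h \<otimes> x \<otimes> h \<in> Z"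
      "\<And>x h. x \<in> carrier G \<Longrightarrow> h \<in> carrier G \<Longrightarrow> \<psi> (inv x \<otimes> inv h \<otimes> x \<otimes> h) = \<kappa> x h"
    and mul: "\<And>x h k. x \<in> carrier G \<Longrightarrow> h \<in> carrier G \<Longrightarrow> k \<in> carrier G \<Longrightarrow>
        \<kappa> x (h \<otimes> k) = \<kappa> x h * \<kappa> x k"
    and cent: "\<And>x h. x \<in> Z \<Longrightarrow> h \<in> carrier G \<Longrightarrow> \<kappa> x h = 1"
    and nondeg: "\<And>x. x \<in> carrier G \<Longrightarrow> x \<notin> Z \<Longrightarrow> \<exists>h\<in>carrier G. \<kappa> x h \<noteq> 1"
  obtains B where "B \<in> carrier_mat D d" "B \<noteq> 0\<^sub>m D d" "\<And>x. x \<in> carrier G \<Longrightarrow> R x * B = B * \<pi> x"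
proof -
  define E where "E x = R x * A * \<pi> (inv x)" for x
  note dims = carrier_matD[OF A(1)] carrier_matD[OF mrepD(1)[OF R]] carrier_matD[OF mrepD(1)[OF \<pi>]]
  have Ec: "E x \<in> carrier_mat D d" if "x \<in> carrier G" for x
    unfolding E_def by (rule carrier_matI) (use that in \<open>simp_all add: dims\<close>)
  \<comment> \<open>Starting the average from \<open>R h * A\<close> instead of \<open>A\<close> and
    translating back by \<open>R (inv h)\<close> multiplies the term of \<open>x\<close> by
    \<open>\<kappa> x h\<close>.\<close>
  have conj: "R (inv h) * (R x * (R h * A) * \<pi> (inv x)) = \<kappa> x h \<cdot>\<^sub>m E x" if x: "x \<in> carrier G" and h: "h \<in> carrier G" for x h
  proof -
    let ?z = "inv x \<otimes> inv h \<otimes> x \<otimes> h"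
    have z: "?z \<in> carrier G" using x h by simp
    have "x \<otimes> ?z = inv h \<otimes> x \<otimes> h" using x h by (simp add: m_assoc[symmetric])
    then have "R (inv h) * (R x * R h) = R x * R ?z"
      using x h z by (metis mrepD(2)[OF R] inv_closed m_assoc m_closed)
    then have "R (inv h) * (R x * (R h * A) * \<pi> (inv x)) = R x * (R ?z * A) * \<pi> (inv x)"
      using x h z by (simp add: mat_assoc[symmetric] dims)
    also have "\<dots> = \<kappa> x h \<cdot>\<^sub>m E x"
      unfolding E_def A(3)[OF comm(1)[OF x h]] comm(2)[OF x h] using x h by (simp add: mat_smult_left mat_smult_right dims)
    finally show ?thesis .
  qed
  have "\<exists>h\<in>carrier G. avg G D d R \<pi> (R h * A) \<noteq> 0\<^sub>m D d"
  proof (rule ccontr)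
    assume "\<not> ?thesis"
    then have z: "avg G D d R \<pi> (R h * A) = 0\<^sub>m D d" if "h \<in> carrier G" for h using that by blast
    have z2: "msum D d (\<lambda>x. \<kappa> x h \<cdot>\<^sub>m E x) (carrier G) = 0\<^sub>m D d" if h: "h \<in> carrier G" for h
    proof -
      have "msum D d (\<lambda>x. \<kappa> x h \<cdot>\<^sub>m E x) (carrier G) = msum D d (\<lambda>x. R (inv h) * (R x * (R h * A) * \<pi> (inv x))) (carrier G)"
        by (rule msum_cong) (use conj h in auto)
      also have "\<dots> = R (inv h) * avg G D d R \<pi> (R h * A)" unfolding avg_def
        by (rule mult_msum[symmetric]) (use h in \<open>auto intro!: mrepD(1)[OF R] carrier_matI simp: dims\<close>)
      finally show ?thesis unfolding z[OF h] using mrepD(1)[OF R inv_closed[OF h]] by simp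
    qed
    have sum: "(\<Sum>h\<in>carrier G. \<kappa> x h) = (if x \<in> Z then of_nat (card (carrier G)) else 0)" if x: "x \<in> carrier G" for x
    proof (cases "x \<in> Z")
      case True
      then show ?thesis using cent by simp
    next
      case False
      obtain h where h: "h \<in> carrier G" "\<kappa> x h \<noteq> 1" using nondeg[OF x False] by blast
      have "bij_betw (\<lambda>g. h \<otimes> g) (carrier G) (carrier G)"
        by (rule bij_betw_byWitness[where f' = "\<lambda>g. inv h \<otimes> g"]) (use h in \<open>auto simp: m_assoc[symmetric]\<close>)
      then have "(\<Sum>k\<in>carrier G. \<kappa> x k) = (\<Sum>k\<in>carrier G. \<kappa> x (h \<otimes> k))"
        by (rule sum.reindex_bij_betw[symmetric])
      also have "\<dots> = \<kappa> x h * (\<Sum>k\<in>carrier G. \<kappa> x k)"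
        unfolding sum_distrib_left by (rule sum.cong[OF refl]) (use mul x h in simp)
      finally have "(\<Sum>k\<in>carrier G. \<kappa> x k) = 0" using h by simp
      then show ?thesis using False by simp
    qed
    \<comment> \<open>If all these averages vanished, their sum over \<open>h\<close> would vanish
      as well; by orthogonality only the terms with \<open>x \<in> Z\<close> survive, and each of
      them is the same multiple of \<open>A\<close>.\<close>
    have "0\<^sub>m D d = msum D d (\<lambda>h. msum D d (\<lambda>x. \<kappa> x h \<cdot>\<^sub>m E x) (carrier G)) (carrier G)"
      by (rule msum_zero[symmetric]) (rule z2)
    also have "\<dots> = msum D d (\<lambda>x. (\<Sum>h\<in>carrier G. \<kappa> x h) \<cdot>\<^sub>m E x) (carrier G)"
      by (subst msum_swap) (intro msum_cong refl msum_smult_const Ec)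
    also have "\<dots> = msum D d (\<lambda>x. (\<Sum>h\<in>carrier G. \<kappa> x h) \<cdot>\<^sub>m E x) Z"
      by (rule msum_mono_neutral[OF fin Z(1)]) (use sum in \<open>auto simp: zero_smult_mat[OF Ec]\<close>)
    also have "\<dots> = msum D d (\<lambda>x. of_nat (card (carrier G)) \<cdot>\<^sub>m A) Z"
    proof (rule msum_cong[OF refl])
      fix x assume x: "x \<in> Z"
      then have xc: "x \<in> carrier G" using Z by auto
      have "E x = A * (\<pi> x * \<pi> (inv x))"
        unfolding E_def A(3)[OF x] \<pi>Z[OF x] using xc
        by (simp add: mat_smult_left mat_smult_right dims left_mult_one_mat[OF mrepD(1)[OF \<pi>]])
      then have "E x = A" using mrep_inv[OF \<pi> xc] A(1) by simp
      then show "(\<Sum>h\<in>carrier G. \<kappa> x h) \<cdot>\<^sub>m E x = of_nat (card (carrier G)) \<cdot>\<^sub>m A"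
        using sum[OF xc] x by simp
    qed
    also have "\<dots> = (of_nat (card Z) * of_nat (card (carrier G))) \<cdot>\<^sub>m A"
      using msum_smult_const[OF A(1), of "\<lambda>_. of_nat (card (carrier G))" Z] by simp
    finally have "(of_nat (card Z) * of_nat (card (carrier G))) \<cdot>\<^sub>m A = 0 \<cdot>\<^sub>m A" unfolding zero_smult_mat[OF A(1)] by (rule sym)
    then have "of_nat (card Z) * of_nat (card (carrier G)) = (0::complex)" by (rule smult_mat_cancel[OF A(1,2)])
    then show False using Z fin by (auto simp: finite_subset)
  qed
  then obtain h where h: "h \<in> carrier G" "avg G D d R \<pi> (R h * A) \<noteq> 0\<^sub>m D d" by blast
  show ?thesis
  proof (rule that[OF _ h(2)])
    show "avg G D d R \<pi> (R h * A) \<in> carrier_mat D d" by (simp add: avg_def)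
    show "R x * avg G D d R \<pi> (R h * A) = avg G D d R \<pi> (R h * A) * \<pi> x" if "x \<in> carrier G" for x
      by (rule avg_intertwines[OF \<pi> R _ that, symmetric]) (use mrepD(1)[OF R h(1)] A(1) in auto)
  qed
qed

section \<open>Block matrices and transversals\<close>

definition bm :: "nat \<Rightarrow> nat \<Rightarrow> nat \<Rightarrow> nat \<Rightarrow> (nat \<Rightarrow> nat \<Rightarrow> complex mat) \<Rightarrow> complex mat" where
  "bm m m' d d' B = mat (m * d) (m' * d') (\<lambda>(i, j). B (i div d) (j div d') $$ (i mod d, j mod d'))"

text \<open>Block and inner index are quotient and remainder of the index by the block size, as in
  the matrix of \<open>induced_rep\<close>.\<close>

definition blk :: "nat \<Rightarrow> nat \<Rightarrow> complex mat \<Rightarrow> nat \<Rightarrow> nat \<Rightarrow> complex mat" where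
  "blk d d' A a b = mat d d' (\<lambda>(i, j). A $$ (a * d + i, b * d' + j))"

lemma blk_carrier [simp, intro]: "blk d d' A a b \<in> carrier_mat d d'"
  by (simp add: blk_def)

lemma bm_carrier [simp, intro]: "bm m m' d d' B \<in> carrier_mat (m * d) (m' * d')"
  by (simp add: bm_def)

lemma block_index_less:
  assumes "a < m" "i < (d::nat)"
  shows "a * d + i < m * d"
proof -
  have "a * d + i < Suc a * d" using assms by simp
  also have "\<dots> \<le> m * d" using assms by (intro mult_right_mono) auto
  finally show ?thesis .
qed

lemma bm_index: "a < m \<Longrightarrow> b < m' \<Longrightarrow> i < d \<Longrightarrow> j < d' \<Longrightarrow> bm m m' d d' B $$ (a * d + i, b * d' + j) = B a b $$ (i, j)"
  by (simp add: bm_def block_index_less)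

lemma bm_eqI:
  assumes "A \<in> carrier_mat (m * d) (m' * d')" "A' \<in> carrier_mat (m * d) (m' * d')"
    "\<And>a b i j. a < m \<Longrightarrow> b < m' \<Longrightarrow> i < d \<Longrightarrow> j < d' \<Longrightarrow> A $$ (a * d + i, b * d' + j) = A' $$ (a * d + i, b * d' + j)"
  shows "A = A'"
proof (rule eq_matI)
  fix i j assume "i < dim_row A'" "j < dim_col A'"
  then have ij: "i < m * d" "j < m' * d'" using assms(2) by auto
  then have p: "d > 0" "d' > 0" by (auto intro: Nat.gr0I)
  have "A $$ ((i div d) * d + i mod d, (j div d') * d' + j mod d') = A' $$ ((i div d) * d + i mod d, (j div d') * d' + j mod d')"
    by (rule assms(3)) (use ij p in \<open>auto simp: less_mult_imp_div_less\<close>)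
  then show "A $$ (i, j) = A' $$ (i, j)" by simp
qed (use assms in auto)

lemma bm_cong:
  assumes "\<And>a b. a < m \<Longrightarrow> b < m' \<Longrightarrow> B a b = B' a b"
  shows "bm m m' d d' B = bm m m' d d' B'"
  by (rule bm_eqI[of _ m d m' d']) (use assms in \<open>auto simp: bm_index\<close>)

lemma bm_blk: "A \<in> carrier_mat (m * d) (m' * d') \<Longrightarrow> A = bm m m' d d' (blk d d' A)"
  by (rule bm_eqI[of _ m d m' d']) (auto simp: bm_index blk_def)

lemma blk_bm: "a < m \<Longrightarrow> b < m' \<Longrightarrow> B a b \<in> carrier_mat d d' \<Longrightarrow> blk d d' (bm m m' d d' B) a b = B a b"
  by (rule eq_matI) (auto simp: blk_def bm_index)

lemma sum_blocks: "(\<Sum>k<m * d. f k) = (\<Sum>a<m. \<Sum>i<d. f (a * d + i))" for f :: "nat \<Rightarrow> complex"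
proof (induction m)
  case (Suc m)
  have "{..<Suc m * d} = {..<m * d} \<union> {m * d..<m * d + d}" by auto
  then have "(\<Sum>k<Suc m * d. f k) = (\<Sum>k\<in>{..<m * d} \<union> {m * d..<m * d + d}. f k)" by (simp only:)
  also have "\<dots> = (\<Sum>k<m * d. f k) + (\<Sum>k\<in>{m * d..<m * d + d}. f k)"
    by (rule sum.union_disjoint) auto
  finally have "(\<Sum>k<Suc m * d. f k) = (\<Sum>k<m * d. f k) + (\<Sum>k\<in>{m * d..<m * d + d}. f k)" .
  moreover have "(\<Sum>k\<in>{m * d..<m * d + d}. f k) = (\<Sum>i<d. f (m * d + i))"
    using sum.shift_bounds_nat_ivl[of f 0 "m * d" d] by (simp add: lessThan_atLeast0 add.commute)
  ultimately show ?case using Suc by simp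
qed simp

lemma bm_mult:
  assumes "\<And>a b. a < m \<Longrightarrow> b < m' \<Longrightarrow> B a b \<in> carrier_mat d d'"
    and "\<And>b c. b < m' \<Longrightarrow> c < m'' \<Longrightarrow> C b c \<in> carrier_mat d' d''"
  shows "bm m m' d d' B * bm m' m'' d' d'' C = bm m m'' d d'' (\<lambda>a c. msum d d'' (\<lambda>b. B a b * C b c) {..<m'})"
proof (rule bm_eqI[of _ m d m'' d''])
  fix a c i j assume h: "a < m" "c < m''" "i < d" "j < d''"
  have "(bm m m' d d' B * bm m' m'' d' d'' C) $$ (a * d + i, c * d'' + j) =
      (\<Sum>k<m' * d'. bm m m' d d' B $$ (a * d + i, k) * bm m' m'' d' d'' C $$ (k, c * d'' + j))"
    by (rule mult_index_sum) (use h block_index_less in auto)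
  also have "\<dots> = (\<Sum>b<m'. \<Sum>k<d'. B a b $$ (i, k) * C b c $$ (k, j))"
    unfolding sum_blocks using h by (simp add: bm_index)
  also have "\<dots> = (\<Sum>b<m'. (B a b * C b c) $$ (i, j))"
    by (rule sum.cong[OF refl], rule mult_index_sum[symmetric, OF assms]) (use h in auto)
  also have "\<dots> = bm m m'' d d'' (\<lambda>a c. msum d d'' (\<lambda>b. B a b * C b c) {..<m'}) $$ (a * d + i, c * d'' + j)"
    using h by (simp add: bm_index msum_index)
  finally show "(bm m m' d d' B * bm m' m'' d' d'' C) $$ (a * d + i, c * d'' + j) = \<dots>" .
qed (auto intro: mult_carrier_mat)

lemma bm_one: "bm m m d d (\<lambda>a b. if a = b then 1\<^sub>m d else 0\<^sub>m d d) = 1\<^sub>m (m * d)"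
proof (rule bm_eqI[of _ m d m d])
  fix a b i j assume h: "a < m" "b < m" "i < d" "j < d"
  have "a * d + i = b * d + j \<longleftrightarrow> a = b \<and> i = j"
  proof
    assume e: "a * d + i = b * d + j"
    have "(a * d + i) div d = a" "(b * d + j) div d = b" "(a * d + i) mod d = i" "(b * d + j) mod d = j" using h by auto
    then show "a = b \<and> i = j" using e by metis
  qed auto
  then show "bm m m d d (\<lambda>a b. if a = b then 1\<^sub>m d else 0\<^sub>m d d) $$ (a * d + i, b * d + j) = 1\<^sub>m (m * d) $$ (a * d + i, b * d + j)"
    using h by (simp add: bm_index block_index_less)
qed auto

lemma bm_smult:
  assumes "\<And>a b. a < m \<Longrightarrow> b < m' \<Longrightarrow> B a b \<in> carrier_mat d d'"
  shows "c \<cdot>\<^sub>m bm m m' d d' B = bm m m' d d' (\<lambda>a b. c \<cdot>\<^sub>m B a b)"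
  by (rule bm_eqI[of _ m d m' d'])
     (auto simp: bm_index block_index_less carrier_matD[OF assms] carrier_matD[OF bm_carrier])

lemma bm_add:
  assumes "\<And>a b. a < m \<Longrightarrow> b < m' \<Longrightarrow> B' a b \<in> carrier_mat d d'"
  shows "bm m m' d d' B + bm m m' d d' B' = bm m m' d d' (\<lambda>a b. B a b + B' a b)"
  by (rule bm_eqI[of _ m d m' d'])
     (auto simp: bm_index block_index_less carrier_matD[OF assms] carrier_matD[OF bm_carrier])

lemma bm_msum:
  assumes "\<And>s a b. s \<in> S \<Longrightarrow> a < m \<Longrightarrow> b < m' \<Longrightarrow> B s a b \<in> carrier_mat d d'"
  shows "msum (m * d) (m' * d') (\<lambda>s. bm m m' d d' (B s)) S = bm m m' d d' (\<lambda>a b. msum d d' (\<lambda>s. B s a b) S)"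
  by (rule bm_eqI[of _ m d m' d'])
     (auto simp: bm_index block_index_less msum_index)

lemma bm_zero: "bm m m' d d' (\<lambda>a b. 0\<^sub>m d d') = 0\<^sub>m (m * d) (m' * d')"
  by (rule bm_eqI[of _ m d m' d']) (auto simp: bm_index block_index_less)

lemma bm_zero_iff:
  assumes "\<And>a b. a < m \<Longrightarrow> b < m' \<Longrightarrow> B a b \<in> carrier_mat d d'"
  shows "bm m m' d d' B = 0\<^sub>m (m * d) (m' * d') \<longleftrightarrow> (\<forall>a<m. \<forall>b<m'. B a b = 0\<^sub>m d d')"
proof
  assume z: "bm m m' d d' B = 0\<^sub>m (m * d) (m' * d')"
  have "B a b = blk d d' (0\<^sub>m (m * d) (m' * d')) a b" if "a < m" "b < m'" for a b
    unfolding z[symmetric] by (rule blk_bm[symmetric]) (use that assms in auto)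
  moreover have "blk d d' (0\<^sub>m (m * d) (m' * d')) a b = 0\<^sub>m d d'" if "a < m" "b < m'" for a b
    by (rule eq_matI) (use that in \<open>auto simp: blk_def block_index_less\<close>)
  ultimately show "\<forall>a<m. \<forall>b<m'. B a b = 0\<^sub>m d d'" by simp
next
  assume "\<forall>a<m. \<forall>b<m'. B a b = 0\<^sub>m d d'"
  then have "bm m m' d d' B = bm m m' d d' (\<lambda>a b. 0\<^sub>m d d')" by (intro bm_cong) auto
  then show "bm m m' d d' B = 0\<^sub>m (m * d) (m' * d')" by (simp add: bm_zero)
qed

lemma (in group) cancel_inv:
  assumes "x \<in> carrier G" "y \<in> carrier G"
  shows "x \<otimes> (inv x \<otimes> y) = y" "inv x \<otimes> (x \<otimes> y) = y"
  using assms by (simp_all add: m_assoc[symmetric])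

text \<open>The representatives come from a choice operator, so an enumeration of the left cosets
  has to be exhibited before anything is known about them. The last two claims express that each
  coset is hit exactly once, in the form in which \<open>induced_rep\<close> tests
  membership.\<close>

lemma (in group) transversal:
  assumes "finite (carrier G)" "subgroup T G"
  shows "i < left_index G T \<Longrightarrow> transversal G T i \<in> carrier G"
    and "x \<in> carrier G \<Longrightarrow> \<exists>i<left_index G T. inv (transversal G T i) \<otimes> x \<in> T"
    and "i < left_index G T \<Longrightarrow> j < left_index G T \<Longrightarrow> inv (transversal G T i) \<otimes> transversal G T j \<in> T \<Longrightarrow> i = j"
proof -
  interpret T: subgroup T G by fact
  let ?C = "(\<lambda>a. a <# T) ` carrier G" and ?m = "left_index G T" and ?t = "transversal G T"
  have "finite ?C" using assms(1) by simp
  then obtain f where f: "bij_betw f {0..<?m} ?C"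
    using ex_bij_betw_nat_finite unfolding left_index_def by blast
  then have "f i \<in> ?C" if "i < ?m" for i using bij_betwE[OF f] that by simp
  then have "\<forall>i<?m. \<exists>a\<in>carrier G. f i = a <# T" by blast
  then obtain t where t: "\<And>i. i < ?m \<Longrightarrow> t i \<in> carrier G \<and> f i = t i <# T" by metis
  have "bij_betw (\<lambda>i. t i <# T) {..<?m} ?C"
    using f t bij_betw_cong[of "{..<?m}" f "\<lambda>i. t i <# T" ?C] by (simp add: lessThan_atLeast0)
  then have "\<exists>t. (\<forall>i<?m. t i \<in> carrier G) \<and> bij_betw (\<lambda>i. t i <# T) {..<?m} ?C" using t by blast
  from someI_ex[OF this] have tr: "\<And>i. i < ?m \<Longrightarrow> ?t i \<in> carrier G" "bij_betw (\<lambda>i. ?t i <# T) {..<?m} ?C"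
    by (simp_all add: transversal_def)
  have mem: "x \<in> a <# T \<longleftrightarrow> inv a \<otimes> x \<in> T" if "a \<in> carrier G" "x \<in> carrier G" for a x
  proof
    assume "x \<in> a <# T"
    then obtain h where "h \<in> T" "x = a \<otimes> h" by (auto simp: l_coset_def)
    then show "inv a \<otimes> x \<in> T" using that by (simp add: m_assoc[symmetric])
  next
    assume "inv a \<otimes> x \<in> T"
    moreover have "x = a \<otimes> (inv a \<otimes> x)" using that by (simp add: m_assoc[symmetric])
    ultimately show "x \<in> a <# T" unfolding l_coset_def by blast
  qed
  show "i < ?m \<Longrightarrow> ?t i \<in> carrier G" by (rule tr)
  show "\<exists>i<?m. inv (?t i) \<otimes> x \<in> T" if x: "x \<in> carrier G"
  proof -
    have "x <# T \<in> ?C" using x by blast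
    then have "x <# T \<in> (\<lambda>i. ?t i <# T) ` {..<?m}" using tr(2) by (simp add: bij_betw_def)
    then obtain i where i: "i < ?m" "x <# T = ?t i <# T" by blast
    have "x \<in> x <# T" using mem[OF x x] x by simp
    then show ?thesis using i mem[OF tr(1)[OF i(1)] x] by auto
  qed
  show "i = j" if "i < ?m" "j < ?m" "inv (?t i) \<otimes> ?t j \<in> T"
  proof -
    have "?t j \<in> ?t i <# T" using mem tr(1) that by simp
    then have "?t i <# T = ?t j <# T" using l_repr_independence tr(1) that(1) assms(2) by blast
    then show ?thesis using tr(2) that by (auto simp: bij_betw_def inj_on_def)
  qed
qed

lemma mrep_restrict: "mrep G d \<rho> \<Longrightarrow> subgroup H G \<Longrightarrow> mrep (G\<lparr>carrier := H\<rparr>) d \<rho>"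
  using subgroup.subset[of H G] by (auto simp: mrep_def subset_iff)

section \<open>Integral bases\<close>

lemma ringL_simps [simp]:
  "carrier ringL = UNIV" "x \<otimes>\<^bsub>ringL\<^esub> y = x * y" "\<one>\<^bsub>ringL\<^esub> = 1" "\<zero>\<^bsub>ringL\<^esub> = 0" "x \<oplus>\<^bsub>ringL\<^esub> y = x + y"
  by (simp_all add: ring_of_type_algebra_def)

lemma ringL_a_inv [simp]: "\<ominus>\<^bsub>ringL\<^esub> (x :: 'a::Fields.field) = - x"
proof -
  interpret R: ring "ringL :: 'a ring" by (rule ring_from_type_algebra)
  show ?thesis using R.minus_equality[of "- x" x] by simp
qed

section \<open>Spans of powers of one element\<close>

definition power_span :: "'a::Fields.field set \<Rightarrow> 'a \<Rightarrow> nat \<Rightarrow> 'a set" where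
  "power_span E b k = {\<Sum>i<k. a i * b ^ i | a. \<forall>i. a i \<in> E}"

text \<open>The highest power comes first, so that passing from \<open>k\<close> to
  \<open>Suc k\<close> adds the head of the list, as in the recursion for spans and
  independence.\<close>

definition power_list :: "'a::Fields.field \<Rightarrow> nat \<Rightarrow> 'a list" where "power_list b k = map (\<lambda>i. b ^ i) (rev [0..<k])"

definition semiring_set :: "'a::Fields.field set \<Rightarrow> bool" where
  "semiring_set E \<longleftrightarrow> 0 \<in> E \<and> 1 \<in> E \<and> (\<forall>x\<in>E. \<forall>y\<in>E. x + y \<in> E \<and> x * y \<in> E)"

context
  fixes E :: "'a::Fields.field set"
  assumes E: "semiring_set E"
begin

lemma E_closed: "0 \<in> E" "1 \<in> E" "x \<in> E \<Longrightarrow> y \<in> E \<Longrightarrow> x + y \<in> E" "x \<in> E \<Longrightarrow> y \<in> E \<Longrightarrow> x * y \<in> E"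
  using E by (auto simp: semiring_set_def)

lemma power_span_closed:
  shows "0 \<in> power_span E b k" "x \<in> power_span E b k \<Longrightarrow> y \<in> power_span E b k \<Longrightarrow> x + y \<in> power_span E b k"
    "c \<in> E \<Longrightarrow> x \<in> power_span E b k \<Longrightarrow> c * x \<in> power_span E b k"
    "i < k \<Longrightarrow> b ^ i \<in> power_span E b k"
proof -
  show "0 \<in> power_span E b k" unfolding power_span_def by (auto intro!: exI[of _ "\<lambda>_. 0"] simp: E_closed)
  show "x + y \<in> power_span E b k" if xy: "x \<in> power_span E b k" "y \<in> power_span E b k"
  proof -
    obtain a a' where "\<forall>i. a i \<in> E" "x = (\<Sum>i<k. a i * b ^ i)" "\<forall>i. a' i \<in> E" "y = (\<Sum>i<k. a' i * b ^ i)"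
      using xy by (auto simp: power_span_def)
    then show ?thesis unfolding power_span_def
      by (intro CollectI exI[of _ "\<lambda>i. a i + a' i"]) (auto simp: sum.distrib distrib_right E_closed)
  qed
  show "c * x \<in> power_span E b k" if cx: "c \<in> E" "x \<in> power_span E b k"
  proof -
    obtain a where "\<forall>i. a i \<in> E" "x = (\<Sum>i<k. a i * b ^ i)" using cx by (auto simp: power_span_def)
    then show ?thesis unfolding power_span_def using cx(1)
      by (intro CollectI exI[of _ "\<lambda>i. c * a i"]) (auto simp: sum_distrib_left mult.assoc E_closed)
  qed
  show "b ^ i \<in> power_span E b k" if "i < k"
  proof -
    have "b ^ i = (\<Sum>j<k. (if j = i then 1 else 0) * b ^ j)" using that by (simp add: if_distrib[of "\<lambda>x. x * _"] cong: if_cong)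
    then show ?thesis unfolding power_span_def
      by (intro CollectI exI[of _ "\<lambda>j. if j = i then 1 else 0"]) (auto simp: E_closed)
  qed
qed

lemma power_span_mult:
  assumes "b ^ k \<in> power_span E b k" "x \<in> power_span E b k"
  shows "x * b \<in> power_span E b k"
proof -
  obtain a where a: "\<forall>i. a i \<in> E" "x = (\<Sum>i<k. a i * b ^ i)" using assms(2) by (auto simp: power_span_def)
  have "b ^ Suc i \<in> power_span E b k" if "i < k" for i
    using that assms(1) power_span_closed(4)[of "Suc i" k b] by (cases "Suc i = k") auto
  then have t: "a i * b ^ Suc i \<in> power_span E b k" if "i < k" for i using that a(1) power_span_closed(3) by blast
  have s: "sum f S \<in> power_span E b k" if "finite S" "\<And>i. i \<in> S \<Longrightarrow> f i \<in> power_span E b k" for f and S :: "nat set"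
    using that by (induction S rule: finite_induct) (auto simp: power_span_closed)
  have "x * b = (\<Sum>i<k. a i * b ^ Suc i)" unfolding a(2) sum_distrib_right by (rule sum.cong) auto
  then show ?thesis using s[of "{..<k}" "\<lambda>i. a i * b ^ Suc i"] t by simp
qed

end

context
  fixes E :: "'a::Fields.field set"
  assumes E: "subfield E ringL"
begin

interpretation R: ring "ringL :: 'a ring" by (rule ring_from_type_algebra)

lemma subfield_closed:
  shows "0 \<in> E" "1 \<in> E" "x \<in> E \<Longrightarrow> y \<in> E \<Longrightarrow> x + y \<in> E" "x \<in> E \<Longrightarrow> y \<in> E \<Longrightarrow> x * y \<in> E" "x \<in> E \<Longrightarrow> - x \<in> E"
  using subringE[OF subfieldE(1)[OF E]] by auto

lemma subfield_inverse: "x \<in> E \<Longrightarrow> inverse x \<in> E"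
proof (cases "x = 0")
  case False
  assume "x \<in> E"
  then have "x \<in> E - {\<zero>\<^bsub>ringL\<^esub>}" using False by simp
  from R.subfield_m_inv[OF E this] have "inv\<^bsub>ringL\<^esub> x \<in> E" "x * inv\<^bsub>ringL\<^esub> x = 1" by auto
  then show ?thesis using False by (metis inverse_unique)
qed (use subfield_closed in simp)

lemma subfield_diff: "x \<in> E \<Longrightarrow> y \<in> E \<Longrightarrow> x - y \<in> E"
  using subfield_closed(3)[of x "- y"] subfield_closed(5) by simp

lemma subfield_divide: "x \<in> E \<Longrightarrow> y \<in> E \<Longrightarrow> x / y \<in> E"
  by (simp add: divide_inverse subfield_closed subfield_inverse)

lemma subfield_sum: "(\<And>i. i \<in> S \<Longrightarrow> f i \<in> E) \<Longrightarrow> sum f S \<in> E"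
  by (induction S rule: infinite_finite_induct) (auto simp: subfield_closed)

lemma subfield_of_nat: "of_nat k \<in> E"
  by (induction k) (auto simp: subfield_closed)

lemma subfield_power: "x \<in> E \<Longrightarrow> x ^ k \<in> E"
  by (induction k) (auto simp: subfield_closed)

lemma Span_powers: "R.Span E (power_list b k) = power_span E b k"
proof (induction k)
  case 0
  show ?case by (auto simp: power_list_def power_span_def intro: exI[of _ "\<lambda>_. 0"] subfield_closed)
next
  case (Suc k)
  have "R.Span E (power_list b (Suc k)) = R.line_extension E (b ^ k) (R.Span E (power_list b k))" by (simp add: power_list_def)
  also have "\<dots> = power_span E b (Suc k)"
  proof (rule Set.set_eqI)
    fix x :: 'a
    have "x \<in> R.line_extension E (b ^ k) (R.Span E (power_list b k)) \<longleftrightarrow> (\<exists>c\<in>E. \<exists>v\<in>power_span E b k. x = c * b ^ k + v)"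
      unfolding R.line_extension_mem_iff Suc by simp
    also have "\<dots> \<longleftrightarrow> x \<in> power_span E b (Suc k)"
    proof
      assume "\<exists>c\<in>E. \<exists>v\<in>power_span E b k. x = c * b ^ k + v"
      then obtain c a where c: "c \<in> E" "\<forall>i. a i \<in> E" "x = c * b ^ k + (\<Sum>i<k. a i * b ^ i)" by (auto simp: power_span_def)
      have "x = (\<Sum>i<Suc k. (a(k := c)) i * b ^ i)" using c(3) by (simp add: add.commute)
      then show "x \<in> power_span E b (Suc k)" using c unfolding power_span_def by (intro CollectI exI[of _ "a(k := c)"]) auto
    next
      assume "x \<in> power_span E b (Suc k)"
      then obtain a where a: "\<forall>i. a i \<in> E" "x = (\<Sum>i<Suc k. a i * b ^ i)" by (auto simp: power_span_def)
      then have "x = a k * b ^ k + (\<Sum>i<k. a i * b ^ i)" by simp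
      then show "\<exists>c\<in>E. \<exists>v\<in>power_span E b k. x = c * b ^ k + v" using a(1) unfolding power_span_def by blast
    qed
    finally show "x \<in> R.line_extension E (b ^ k) (R.Span E (power_list b k)) \<longleftrightarrow> x \<in> power_span E b (Suc k)" .
  qed
  finally show ?case .
qed

lemma independent_powers: "(\<And>j. j < k \<Longrightarrow> b ^ j \<notin> power_span E b j) \<Longrightarrow> R.independent E (power_list b k)"
proof (induction k)
  case (Suc k)
  have "power_list b (Suc k) = b ^ k # power_list b k" by (simp add: power_list_def)
  then show ?case using Suc by (auto intro!: R.li_Cons simp: Span_powers simp del: R.Span.simps)
qed (simp add: power_list_def)

lemma dimension_power_span:
  assumes "\<And>j. j < k \<Longrightarrow> b ^ j \<notin> power_span E b j"
  shows "R.dimension k E (power_span E b k)"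
  using R.dimensionI[OF E independent_powers[OF assms] Span_powers] by (simp add: power_list_def)

text \<open>Otherwise the first \<open>N + 1\<close> powers would be independent in a space of
  dimension \<open>N\<close>.\<close>

lemma power_span_exists:
  assumes "R.dimension N E V" "\<And>i. b ^ i \<in> V"
  shows "\<exists>k\<le>N. b ^ k \<in> power_span E b k"
proof (rule ccontr)
  assume "\<not> ?thesis"
  then have "R.independent E (power_list b (Suc N))" by (intro independent_powers) auto
  then have "length (power_list b (Suc N)) \<le> N"
    by (rule R.independent_length_le_dimension[OF E assms(1)]) (use assms(2) in \<open>auto simp: power_list_def\<close>)
  then show False by (simp add: power_list_def)
qed

lemma power_span_independent:
  assumes "\<And>j. j < k \<Longrightarrow> b ^ j \<notin> power_span E b j" "\<And>i. i < k \<Longrightarrow> a i \<in> E" "(\<Sum>i<k. a i * b ^ i) = 0" "i < k"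
  shows "a i = 0"
  using assms
proof (induction k)
  case (Suc k)
  have "a k = 0"
  proof (rule ccontr)
    assume k: "a k \<noteq> 0"
    have "a k * b ^ k = - (\<Sum>i<k. a i * b ^ i)" using Suc.prems(3) by (simp add: add_eq_0_iff)
    then have "b ^ k = (- 1 / a k) * (\<Sum>i<k. a i * b ^ i)" using k by (simp add: field_simps)
    also have "\<dots> = (\<Sum>i<k. (if i < k then (- 1 / a k) * a i else 0) * b ^ i)"
      unfolding sum_distrib_left by (rule sum.cong) (auto simp: mult.assoc)
    finally have "b ^ k \<in> power_span E b k"
      unfolding power_span_def using Suc.prems(2) subfield_closed subfield_divide
      by (intro CollectI exI[of _ "\<lambda>i. if i < k then (- 1 / a k) * a i else 0"]) auto
    then show False using Suc.prems(1) by blast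
  qed
  then show ?case using Suc by (cases "i = k") auto
qed simp

end

section \<open>Bases over a subring and the trace of an endomorphism\<close>

definition basis_on :: "'a::Fields.field set \<Rightarrow> 'a set \<Rightarrow> nat \<Rightarrow> (nat \<Rightarrow> 'a) \<Rightarrow> bool" where
  "basis_on R M N b \<longleftrightarrow> b ` {..<N} \<subseteq> M \<and>
     (\<forall>x\<in>M. \<exists>!a. a \<in> {..<N} \<rightarrow>\<^sub>E R \<and> x = (\<Sum>i<N. a i * b i))"

text \<open>\<open>trace_on\<close> asks for a unique extensional coefficient function; here and in
  the next lemma this is exchanged for agreement of coefficients below \<open>N\<close>.\<close>

lemma basis_onI:
  assumes "\<And>i. i < N \<Longrightarrow> b i \<in> M"
    and ex: "\<And>x. x \<in> M \<Longrightarrow> \<exists>a. (\<forall>i<N. a i \<in> R) \<and> x = (\<Sum>i<N. a i * b i)"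
    and uniq: "\<And>a a' i. (\<And>i. i < N \<Longrightarrow> a i \<in> R \<and> a' i \<in> R) \<Longrightarrow> (\<Sum>i<N. a i * b i) = (\<Sum>i<N. a' i * b i) \<Longrightarrow> i < N \<Longrightarrow> a i = a' i"
  shows "basis_on R M N b"
  unfolding basis_on_def
proof (intro conjI ballI ex_ex1I)
  fix x assume "x \<in> M"
  then obtain a where a: "\<forall>i<N. a i \<in> R" "x = (\<Sum>i<N. a i * b i)" using ex by blast
  then show "\<exists>a. a \<in> {..<N} \<rightarrow>\<^sub>E R \<and> x = (\<Sum>i<N. a i * b i)"
    by (intro exI[of _ "restrict a {..<N}"]) auto
next
  fix x a a' assume "a \<in> {..<N} \<rightarrow>\<^sub>E R \<and> x = (\<Sum>i<N. a i * b i)" "a' \<in> {..<N} \<rightarrow>\<^sub>E R \<and> x = (\<Sum>i<N. a' i * b i)"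
  then show "a = a'" using uniq[of a a'] by (intro PiE_ext[of _ "{..<N}" "\<lambda>_. R"]) auto
qed (use assms(1) in auto)

lemma basis_onD:
  assumes "basis_on R M N b"
  shows "i < N \<Longrightarrow> b i \<in> M"
    and "x \<in> M \<Longrightarrow> \<exists>a. (\<forall>i<N. a i \<in> R) \<and> x = (\<Sum>i<N. a i * b i)"
    and "(\<And>i. i < N \<Longrightarrow> a i \<in> R \<and> a' i \<in> R) \<Longrightarrow> (\<Sum>i<N. a i * b i) \<in> M \<Longrightarrow>
      (\<Sum>i<N. a i * b i) = (\<Sum>i<N. a' i * b i) \<Longrightarrow> i < N \<Longrightarrow> a i = a' i"
proof -
  show "i < N \<Longrightarrow> b i \<in> M" using assms by (auto simp: basis_on_def)
  show "\<exists>a. (\<forall>i<N. a i \<in> R) \<and> x = (\<Sum>i<N. a i * b i)" if "x \<in> M"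
  proof -
    have "\<exists>!a. a \<in> {..<N} \<rightarrow>\<^sub>E R \<and> x = (\<Sum>i<N. a i * b i)"
      using assms[unfolded basis_on_def, THEN conjunct2] that by (rule bspec)
    from ex1_implies_ex[OF this] obtain a where "a \<in> {..<N} \<rightarrow>\<^sub>E R" "x = (\<Sum>i<N. a i * b i)" by (elim exE conjE)
    then show ?thesis by (intro exI[of _ a]) auto
  qed
  assume h: "\<And>i. i < N \<Longrightarrow> a i \<in> R \<and> a' i \<in> R" "(\<Sum>i<N. a i * b i) \<in> M"
    "(\<Sum>i<N. a i * b i) = (\<Sum>i<N. a' i * b i)" "i < N"
  let ?P = "\<lambda>c. c \<in> {..<N} \<rightarrow>\<^sub>E R \<and> (\<Sum>i<N. a i * b i) = (\<Sum>i<N. c i * b i)"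
  have "?P (restrict a {..<N})" "?P (restrict a' {..<N})" using h by auto
  moreover have "\<exists>!c. ?P c" using assms h(2) unfolding basis_on_def by blast
  ultimately have "restrict a {..<N} = restrict a' {..<N}" by blast
  then show "a i = a' i" using h(4) by (metis lessThan_iff restrict_apply')
qed

lemma sum_sum_assoc:
  "(\<Sum>k<(A::nat). x k * (\<Sum>i<(B::nat). y i k * z i)) = (\<Sum>i<B. (\<Sum>k<A. y i k * x k) * (z i :: 'a::comm_ring))"
proof -
  have "(\<Sum>k<A. x k * (\<Sum>i<B. y i k * z i)) = (\<Sum>k<A. \<Sum>i<B. y i k * x k * z i)" by (simp add: sum_distrib_left mult_ac)
  also have "\<dots> = (\<Sum>i<B. \<Sum>k<A. y i k * x k * z i)" by (rule sum.swap)
  finally show ?thesis by (simp add: sum_distrib_right)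
qed

text \<open>Independence of the basis, over a set \<open>R\<close> that need not be a field and for
  bases whose lengths are not known to agree. With transition matrices \<open>P\<close> and
  \<open>Qm\<close>, the linearity of \<open>f\<close> gives \<open>c P = P c'\<close>; then the
  trace of \<open>c\<close> equals that of \<open>c P Qm = P c' Qm\<close>, hence that of
  \<open>c' Qm P = c'\<close>.\<close>

theorem trace_on_eq:
  assumes R: "0 \<in> R" "1 \<in> R" "\<And>x y. x \<in> R \<Longrightarrow> y \<in> R \<Longrightarrow> x + y \<in> R" "\<And>x y. x \<in> R \<Longrightarrow> y \<in> R \<Longrightarrow> x * y \<in> R"
    and lin: "\<And>N a m. (\<And>i. i < N \<Longrightarrow> a i \<in> R) \<Longrightarrow> (\<And>i. i < N \<Longrightarrow> m i \<in> M) \<Longrightarrow> f (\<Sum>i<(N::nat). a i * m i) = (\<Sum>i<N. a i * f (m i))"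
    and M: "\<And>x. x \<in> M \<Longrightarrow> f x \<in> M"
    and b: "basis_on R M N b" and c: "\<And>i j. i < N \<Longrightarrow> j < N \<Longrightarrow> c i j \<in> R"
    and fc: "\<And>j. j < N \<Longrightarrow> f (b j) = (\<Sum>i<N. c i j * b i)"
  shows "trace_on R M f = (\<Sum>i<N. c i i)"
proof -
  have Rsum: "(\<And>i. i \<in> S \<Longrightarrow> g i \<in> R) \<Longrightarrow> sum g S \<in> R" for g and S :: "nat set"
    by (induction S rule: infinite_finite_induct) (auto simp: R)
  \<comment> \<open>The basis and its length are quantified too, so that the claim can be used in
    both directions of the base change.\<close>
  have delta: "(\<Sum>i<N. Qm k i * P i j) = (if k = j then 1 else 0)"
    if b': "basis_on R M N' b'" and P: "\<And>i j. i < N \<Longrightarrow> j < N' \<Longrightarrow> P i j \<in> R" "\<And>j. j < N' \<Longrightarrow> b' j = (\<Sum>i<N. P i j * b i)"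
      and Q: "\<And>i j. i < N' \<Longrightarrow> j < N \<Longrightarrow> Qm i j \<in> R" "\<And>j. j < N \<Longrightarrow> b j = (\<Sum>i<N'. Qm i j * b' i)"
      and kj: "k < N'" "j < N'" for N' b' P Qm k j and N :: nat and b :: "nat \<Rightarrow> 'a"
  proof -
    have "b' j = (\<Sum>i<N. P i j * (\<Sum>k<N'. Qm k i * b' k))" using P(2)[OF kj(2)] Q(2) by simp
    also have "\<dots> = (\<Sum>k<N'. (\<Sum>i<N. Qm k i * P i j) * b' k)" by (rule sum_sum_assoc)
    finally have e: "(\<Sum>k<N'. (\<Sum>i<N. Qm k i * P i j) * b' k) = b' j" ..
    have e2: "b' j = (\<Sum>k<N'. (if k = j then 1 else 0) * b' k)"
      using kj by (simp add: if_distrib[of "\<lambda>x. x * _"] cong: if_cong)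
    have in_R: "(\<Sum>i<N. Qm k i * P i j) \<in> R" if "k < N'" for k by (intro Rsum R(4) P(1) Q(1)) (use kj that in auto)
    show ?thesis
    proof (rule basis_onD(3)[OF b', of "\<lambda>k. \<Sum>i<N. Qm k i * P i j" "\<lambda>k. if k = j then 1 else 0" k])
      show "(\<Sum>k<N'. (\<Sum>i<N. Qm k i * P i j) * b' k) \<in> M" unfolding e by (rule basis_onD(1)[OF b' kj(2)])
      show "(\<Sum>k<N'. (\<Sum>i<N. Qm k i * P i j) * b' k) = (\<Sum>k<N'. (if k = j then 1 else 0) * b' k)" using e e2 by simp
    qed (use in_R R kj in auto)
  qed
  have uniq: "(\<Sum>i<N'. c' i i) = (\<Sum>i<N. c i i)"
    if b': "basis_on R M N' b'" and c': "\<And>i j. i < N' \<Longrightarrow> j < N' \<Longrightarrow> c' i j \<in> R"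
      and fc': "\<And>j. j < N' \<Longrightarrow> f (b' j) = (\<Sum>i<N'. c' i j * b' i)" for N' b' c'
  proof -
    have "\<forall>j. \<exists>a. j < N' \<longrightarrow> (\<forall>i<N. a i \<in> R) \<and> b' j = (\<Sum>i<N. a i * b i)" using basis_onD(2)[OF b] basis_onD(1)[OF b'] by blast
    then obtain P' where P': "\<And>j i. j < N' \<Longrightarrow> i < N \<Longrightarrow> P' j i \<in> R" "\<And>j. j < N' \<Longrightarrow> b' j = (\<Sum>i<N. P' j i * b i)" by metis
    define P where "P i j = P' j i" for i j
    note P = P'[folded P_def]
    have "\<forall>j. \<exists>a. j < N \<longrightarrow> (\<forall>i<N'. a i \<in> R) \<and> b j = (\<Sum>i<N'. a i * b' i)" using basis_onD(2)[OF b'] basis_onD(1)[OF b] by blast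
    then obtain Q' where Q': "\<And>j i. j < N \<Longrightarrow> i < N' \<Longrightarrow> Q' j i \<in> R" "\<And>j. j < N \<Longrightarrow> b j = (\<Sum>i<N'. Q' j i * b' i)" by metis
    define Qm where "Qm i j = Q' j i" for i j
    note Q = Q'[folded Qm_def]
    note QP = delta[OF b' P(1) P(2) Q(1) Q(2)] and PQ = delta[OF b Q(1) Q(2) P(1) P(2)]
    have comm: "(\<Sum>k<N'. P i k * c' k j) = (\<Sum>k<N. c i k * P k j)" if i: "i < N" and j: "j < N'" for i j
    proof -
      have "f (b' j) = (\<Sum>k<N'. c' k j * (\<Sum>i<N. P i k * b i))" using fc'[OF j] P(2) by simp
      also have "\<dots> = (\<Sum>i<N. (\<Sum>k<N'. P i k * c' k j) * b i)" by (rule sum_sum_assoc)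
      finally have 1: "f (b' j) = (\<Sum>i<N. (\<Sum>k<N'. P i k * c' k j) * b i)" .
      have "f (b' j) = (\<Sum>k<N. P k j * f (b k))"
        unfolding P(2)[OF j] by (rule lin) (use j P(1) basis_onD(1)[OF b] in auto)
      also have "\<dots> = (\<Sum>k<N. P k j * (\<Sum>i<N. c i k * b i))" using fc by simp
      also have "\<dots> = (\<Sum>i<N. (\<Sum>k<N. c i k * P k j) * b i)" by (rule sum_sum_assoc)
      finally have 2: "f (b' j) = (\<Sum>i<N. (\<Sum>k<N. c i k * P k j) * b i)" .
      have in_R: "(\<Sum>k<N'. P i k * c' k j) \<in> R" "(\<Sum>k<N. c i k * P k j) \<in> R" if "i < N" for i
        by (intro Rsum R(4) P(1) c c'; use j that in auto)+
      show ?thesis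
        by (rule basis_onD(3)[OF b, of "\<lambda>i. \<Sum>k<N'. P i k * c' k j" "\<lambda>i. \<Sum>k<N. c i k * P k j"])
           (use 1 2 i in_R M[OF basis_onD(1)[OF b' j]] in auto)
    qed
    have "(\<Sum>i<N. c i i) = (\<Sum>i<N. \<Sum>k<N. c i k * (if k = i then 1 else 0))"
      by (simp add: if_distrib cong: if_cong)
    also have "\<dots> = (\<Sum>i<N. \<Sum>k<N. c i k * (\<Sum>j<N'. P k j * Qm j i))" using PQ by simp
    also have "\<dots> = (\<Sum>i<N. \<Sum>j<N'. (\<Sum>k<N. c i k * P k j) * Qm j i)"
    proof (rule sum.cong[OF refl])
      fix i
      have "(\<Sum>k<N. c i k * (\<Sum>j<N'. P k j * Qm j i)) = (\<Sum>k<N. \<Sum>j<N'. c i k * P k j * Qm j i)" by (simp add: sum_distrib_left mult_ac)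
      also have "\<dots> = (\<Sum>j<N'. \<Sum>k<N. c i k * P k j * Qm j i)" by (rule sum.swap)
      finally show "(\<Sum>k<N. c i k * (\<Sum>j<N'. P k j * Qm j i)) = (\<Sum>j<N'. (\<Sum>k<N. c i k * P k j) * Qm j i)"
        by (simp add: sum_distrib_right)
    qed
    also have "\<dots> = (\<Sum>i<N. \<Sum>j<N'. (\<Sum>k<N'. P i k * c' k j) * Qm j i)" using comm by simp
    also have "\<dots> = (\<Sum>i<N. \<Sum>j<N'. \<Sum>k<N'. c' k j * (Qm j i * P i k))"
      by (intro sum.cong refl) (simp add: sum_distrib_left sum_distrib_right mult_ac)
    also have "\<dots> = (\<Sum>j<N'. \<Sum>k<N'. \<Sum>i<N. c' k j * (Qm j i * P i k))" by (subst sum.swap) (rule sum.cong[OF refl], rule sum.swap)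
    also have "\<dots> = (\<Sum>j<N'. \<Sum>k<N'. c' k j * (if j = k then 1 else 0))" using QP by (simp add: sum_distrib_left[symmetric])
    also have "\<dots> = (\<Sum>j<N'. c' j j)" by (simp add: if_distrib cong: if_cong)
    finally show ?thesis ..
  qed
  have "trace_on R M f = (THE t. \<exists>(N'::nat) b' c'. basis_on R M N' b' \<and> (\<forall>i<N'. \<forall>j<N'. c' i j \<in> R) \<and>
     (\<forall>j<N'. f (b' j) = (\<Sum>i<N'. c' i j * b' i)) \<and> t = (\<Sum>i<N'. c' i i))"
    by (simp add: trace_on_def basis_on_def conj_assoc)
  also have "\<dots> = (\<Sum>i<N. c i i)" by (rule the_equality) (use b c fc uniq in blast)+
  finally show ?thesis .
qed

section \<open>The absolute value and the powers of the maximal ideal\<close>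

context unramified_unitary_datum
begin

abbreviation "v \<equiv> absv D"
abbreviation "w \<equiv> unif D"
abbreviation "F \<equiv> subF D"
abbreviation "K \<equiv> subK D"
abbreviation "I \<equiv> idl D"
abbreviation "\<iota> \<equiv> invol D"

lemmas F_closed = subfield_closed[OF subfields(1)] subfield_diff[OF subfields(1)] subfield_inverse[OF subfields(1)]
  subfield_divide[OF subfields(1)] subfield_sum[OF subfields(1)] subfield_of_nat[OF subfields(1)] subfield_power[OF subfields(1)]
lemmas K_closed = subfield_closed[OF subfields(2)] subfield_diff[OF subfields(2)] subfield_inverse[OF subfields(2)]
  subfield_divide[OF subfields(2)] subfield_sum[OF subfields(2)] subfield_of_nat[OF subfields(2)] subfield_power[OF subfields(2)]

lemma v_zero [simp]: "v 0 = 0" by (simp add: absv_zero_iff)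
lemma v_one [simp]: "v 1 = 1"
proof -
  have "v 1 * v 1 = v 1" using absv_mult[of 1 1] by simp
  moreover have "v 1 \<noteq> 0" by (simp add: absv_zero_iff)
  ultimately show ?thesis by simp
qed
lemma v_minus [simp]: "v (- x) = v x"
proof -
  have "v (- 1) * v (- 1) = 1" using absv_mult[of "- 1" "- 1"] by simp
  then have "v (- 1) = 1" using absv_nonneg[of "- 1"] by (auto simp: square_eq_1_iff)
  then show ?thesis using absv_mult[of "- 1" x] by simp
qed
lemma v_power: "v (x ^ k) = v x ^ k" by (induction k) (auto simp: absv_mult)
lemma v_diff: "v (x - y) \<le> max (v x) (v y)" using absv_ultra[of x "- y"] by simp
lemma v_divide: "v (x / y) = v x / v y"
proof (cases "y = 0")
  case False
  then have "v (x / y) * v y = v x" by (simp add: absv_mult[symmetric])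
  then show ?thesis using False by (metis absv_zero_iff eq_divide_imp)
qed simp
lemma v_inverse: "v (inverse x) = inverse (v x)" using v_divide[of 1 x] by (simp add: divide_inverse)
lemma v_pos: "x \<noteq> 0 \<Longrightarrow> v x > 0" using absv_nonneg[of x] absv_zero_iff[of x] by linarith
lemma v_sum_le: "0 \<le> c \<Longrightarrow> (\<And>i. i \<in> S \<Longrightarrow> v (f i) \<le> c) \<Longrightarrow> v (sum f S) \<le> c"
proof (induction S rule: infinite_finite_induct)
  case (insert x S)
  have "v (f x) \<le> c" "v (sum f S) \<le> c" using insert by auto
  then show ?case using absv_ultra[of "f x" "sum f S"] insert.hyps by simp
qed auto

lemma w0: "w \<noteq> 0" by (rule unif_F)
lemma wF: "w \<in> F" by (rule unif_F)
lemma v_w_pos: "v w > 0" by (rule v_pos[OF w0])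
lemma v_w_less: "v w < 1"
proof -
  have "w * 1 \<in> (\<lambda>x. w * x) ` ints D F" by (rule imageI) (simp add: ints_def F_closed)
  then have "w \<in> max_ideal D F" unfolding unif_F(3) by simp
  then show ?thesis by (simp add: max_ideal_def)
qed
lemma v_w_le: "v w ^ k \<le> 1" using v_w_less v_w_pos by (simp add: power_le_one)

lemma OL_iff: "x \<in> OL D \<longleftrightarrow> v x \<le> 1" by (simp add: ints_def)
lemma OF_iff: "x \<in> OF D \<longleftrightarrow> x \<in> F \<and> v x \<le> 1" by (simp add: ints_def)
lemma OF_OL: "x \<in> OF D \<Longrightarrow> x \<in> OL D" by (simp add: ints_def)

text \<open>Turns ideal membership into an inequality, so that closure properties follow from the
  ultrametric inequality and multiplicativity.\<close>

lemma I_iff: "x \<in> I m \<longleftrightarrow> v x \<le> v w ^ m"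
proof
  assume "x \<in> I m"
  then obtain y where "x = w ^ m * y" "v y \<le> 1" by (auto simp: idl_def ints_def)
  then show "v x \<le> v w ^ m" using v_w_pos by (simp add: absv_mult v_power mult_left_le)
next
  assume h: "v x \<le> v w ^ m"
  have "x = w ^ m * (x / w ^ m)" using w0 by simp
  moreover have "v (x / w ^ m) \<le> 1" using h v_w_pos by (simp add: v_divide v_power)
  ultimately show "x \<in> I m" unfolding idl_def by (intro image_eqI[of _ _ "x / w ^ m"]) (auto simp: ints_def)
qed

lemma OL_closed: "0 \<in> OL D" "1 \<in> OL D" "x \<in> OL D \<Longrightarrow> y \<in> OL D \<Longrightarrow> x + y \<in> OL D"
  "x \<in> OL D \<Longrightarrow> y \<in> OL D \<Longrightarrow> x - y \<in> OL D" "x \<in> OL D \<Longrightarrow> y \<in> OL D \<Longrightarrow> x * y \<in> OL D"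
  "x \<in> OL D \<Longrightarrow> - x \<in> OL D" "x \<in> OL D \<Longrightarrow> x ^ k \<in> OL D" "w \<in> OL D"
  using absv_ultra[of x y] v_diff[of x y] absv_nonneg v_w_less
  by (auto simp: OL_iff absv_mult v_power intro: mult_le_one power_le_one)

lemma OL_sum: "(\<And>i. i \<in> S \<Longrightarrow> f i \<in> OL D) \<Longrightarrow> sum f S \<in> OL D"
  using v_sum_le[of 1 S f] by (simp add: OL_iff)

lemma OL_of_nat: "of_nat k \<in> OL D" by (induction k) (auto simp: OL_closed)

lemma OF_closed: "0 \<in> OF D" "1 \<in> OF D" "x \<in> OF D \<Longrightarrow> y \<in> OF D \<Longrightarrow> x + y \<in> OF D"
  "x \<in> OF D \<Longrightarrow> y \<in> OF D \<Longrightarrow> x - y \<in> OF D" "x \<in> OF D \<Longrightarrow> y \<in> OF D \<Longrightarrow> x * y \<in> OF D"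
  "x \<in> OF D \<Longrightarrow> - x \<in> OF D" "x \<in> OF D \<Longrightarrow> x ^ k \<in> OF D" "w \<in> OF D"
  using OL_closed F_closed wF by (auto simp: OL_iff OF_iff)

lemma OF_sum: "(\<And>i. i \<in> S \<Longrightarrow> f i \<in> OF D) \<Longrightarrow> sum f S \<in> OF D"
  using v_sum_le[of 1 S f] subfield_sum[OF subfields(1), of S f] by (simp add: OF_iff)

lemma I_closed: "0 \<in> I m" "x \<in> I m \<Longrightarrow> y \<in> I m \<Longrightarrow> x + y \<in> I m" "x \<in> I m \<Longrightarrow> y \<in> I m \<Longrightarrow> x - y \<in> I m"
  "x \<in> I m \<Longrightarrow> - x \<in> I m" "a \<in> OL D \<Longrightarrow> x \<in> I m \<Longrightarrow> a * x \<in> I m" "a \<in> OL D \<Longrightarrow> x \<in> I m \<Longrightarrow> x * a \<in> I m"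
  using absv_ultra[of x y] v_diff[of x y] v_w_pos absv_nonneg[of a] absv_nonneg[of x] mult_mono[of "v a" 1 "v x" "v w ^ m"]
  by (auto simp: I_iff OL_iff absv_mult mult.commute)

lemma I_sum: "(\<And>i. i \<in> S \<Longrightarrow> f i \<in> I m) \<Longrightarrow> sum f S \<in> I m"
  using v_sum_le[of "v w ^ m" S f] v_w_pos by (simp add: I_iff)

lemma I_antimono: "k \<le> m \<Longrightarrow> x \<in> I m \<Longrightarrow> x \<in> I k"
  using power_decreasing[of k m "v w"] v_w_pos v_w_less unfolding I_iff by (meson less_imp_le order_trans)

lemma I_zero: "I 0 = OL D" by (auto simp: I_iff OL_iff)
lemma I_OL: "x \<in> I m \<Longrightarrow> x \<in> OL D" using v_w_le[of m] by (auto simp: I_iff OL_iff)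
lemma w_I: "x \<in> I k \<Longrightarrow> w ^ m * x \<in> I (k + m)"
  using v_w_pos by (auto simp: I_iff absv_mult v_power power_add mult.commute)
lemma w_I_iff: "w ^ m * x \<in> I (m + k) \<longleftrightarrow> x \<in> I k"
  using v_w_pos by (auto simp: I_iff absv_mult v_power power_add)
lemma I_E: "x \<in> I m \<Longrightarrow> \<exists>y\<in>OL D. x = w ^ m * y" by (auto simp: idl_def)
lemma I_cong: "x - y \<in> I m \<Longrightarrow> x \<in> I m \<longleftrightarrow> y \<in> I m"
  using I_closed(2)[of "x - y" m y] I_closed(3)[of x m "x - y"] by auto

lemma I_limit: "(\<And>m. x \<in> I m) \<Longrightarrow> x = 0"
proof (rule ccontr)
  assume h: "\<And>m. x \<in> I m" "x \<noteq> 0"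
  obtain m where "v w ^ m < v x" using real_arch_pow_inv[OF v_pos[OF h(2)] v_w_less] by blast
  then show False using h(1)[of m] by (simp add: I_iff)
qed

lemma max_ideal_I: "max_ideal D UNIV = I 1"
  unfolding unramified(2) idl_def by simp

lemma v_less_one: "v x < 1 \<longleftrightarrow> x \<in> I 1"
  using max_ideal_I by (auto simp: max_ideal_def)

lemma I_prime: "x * y \<in> I 1 \<Longrightarrow> x \<in> OL D \<Longrightarrow> y \<in> OL D \<Longrightarrow> x \<in> I 1 \<or> y \<in> I 1"
  unfolding v_less_one[symmetric] absv_mult OL_iff by (metis less_eq_real_def mult_1 less_irrefl)

lemma I_power_prime: "x ^ k \<in> I 1 \<Longrightarrow> x \<in> OL D \<Longrightarrow> x \<in> I 1"
  using v_less_one[of "x ^ k"] v_less_one[of x] by (auto simp: v_power OL_iff)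

text \<open>After scaling by a power of \<open>w\<close>, \<open>x\<close> is integral and lies in a
  last ideal \<open>I j\<close>. The cofactor of \<open>w ^ j\<close> is then outside
  \<open>I 1\<close>, which is the maximal ideal of \<open>O_L\<close> because \<open>L\<close> is
  unramified, so it has absolute value one.\<close>

lemma valuation_exists:
  assumes x: "x \<noteq> 0"
  shows "\<exists>i j. v (w ^ i * x) = v w ^ j"
proof -
  obtain i where "v w ^ i < 1 / v x" using real_arch_pow_inv[OF _ v_w_less, of "1 / v x"] v_pos[OF x] by auto
  define y where "y = w ^ i * x"
  have y: "v y \<le> 1" "y \<noteq> 0" using \<open>v w ^ i < 1 / v x\<close> v_pos[OF x] x w0
    by (auto simp: y_def absv_mult v_power field_simps)
  have "\<not> (\<forall>j. y \<in> I j)" using I_limit y(2) by blast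
  then have ex: "\<exists>j. y \<notin> I j" by blast
  define J where "J = (LEAST j. y \<notin> I j)"
  have J: "y \<notin> I J" using LeastI_ex[OF ex] by (simp add: J_def)
  have "J \<noteq> 0" using J y(1) by (auto simp: I_zero OL_iff intro: ccontr)
  then obtain j where j: "J = Suc j" by (cases J) auto
  have "y \<in> I j" using not_less_Least[of j "\<lambda>j. y \<notin> I j"] j by (auto simp: J_def)
  then obtain u where u: "u \<in> OL D" "y = w ^ j * u" using I_E by blast
  have "u \<notin> I 1" using J j u w_I[of u 1 j] by auto
  then have "v u = 1" using u(1) v_less_one[of u] by (auto simp: OL_iff)
  then show ?thesis using u(2) unfolding y_def by (intro exI[of _ i] exI[of _ j]) (simp add: absv_mult v_power)
qed

lemma invol_hom: "\<iota> (x + y) = \<iota> x + \<iota> y" "\<iota> (x * y) = \<iota> x * \<iota> y" "\<iota> 1 = 1" "\<iota> (\<iota> x) = x"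
  using invol_aut(1) ring_iso_memE[OF invol_aut(1)] invol_order_2(1) by (auto simp: fun_eq_iff)

lemma invol_zero [simp]: "\<iota> 0 = 0"
proof -
  have "\<iota> 0 + \<iota> 0 = \<iota> 0 + 0" using invol_hom(1)[of 0 0] by simp
  then show ?thesis by (rule add_left_imp_eq)
qed
lemma invol_minus: "\<iota> (- x) = - \<iota> x" using invol_hom(1)[of x "- x"] by (simp add: eq_neg_iff_add_eq_0 add.commute)
lemma invol_diff: "\<iota> (x - y) = \<iota> x - \<iota> y" using invol_hom(1)[of x "- y"] invol_minus by simp
lemma invol_power: "\<iota> (x ^ k) = \<iota> x ^ k" by (induction k) (auto simp: invol_hom)
lemma invol_sum: "\<iota> (sum f S) = (\<Sum>i\<in>S. \<iota> (f i))" by (induction S rule: infinite_finite_induct) (auto simp: invol_hom)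
lemma invol_inverse: "\<iota> (inverse x) = inverse (\<iota> x)"
proof (cases "x = 0")
  case False
  then have "\<iota> x * \<iota> (inverse x) = 1" using invol_hom(2)[of x "inverse x"] invol_hom(3) by simp
  then show ?thesis by (metis inverse_unique)
qed simp
lemma invol_divide: "\<iota> (x / y) = \<iota> x / \<iota> y" by (simp add: divide_inverse invol_hom invol_inverse)

end

text \<open>Completeness is given for \<open>F\<close>. Limits in \<open>L\<close> will be taken
  coordinate by coordinate, and for this the precision of the approximation is kept in the
  conclusion.\<close>

lemma (in unramified_unitary_datum) complete_limit:
  assumes B: "\<And>m. B m \<in> F" "\<And>m. B (Suc m) - B m \<in> I m"
  obtains l where "l \<in> F" "\<And>m. l - B m \<in> I m"
proof -
  let ?d = "\<lambda>x y. v (x - y)"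
  interpret M: Metric_space F ?d
  proof
    show "0 \<le> v (x - y)" for x y by (rule absv_nonneg)
    show "v (x - y) = v (y - x)" for x y using v_minus[of "x - y"] by simp
    show "v (x - y) = 0 \<longleftrightarrow> x = y" for x y by (simp add: absv_zero_iff)
    show "v (x - z) \<le> v (x - y) + v (y - z)" for x y z
      using absv_ultra[of "x - y" "y - z"] absv_nonneg[of "x - y"] absv_nonneg[of "y - z"] by simp
  qed
  have mono: "B (m + k) - B m \<in> I m" for m k
  proof (induction k)
    case (Suc k)
    have "B (m + Suc k) - B m = (B (Suc (m + k)) - B (m + k)) + (B (m + k) - B m)" by simp
    then show ?case using Suc I_antimono[OF _ B(2)[of "m + k"], of m] I_closed(2) by (metis le_add1)
  qed (simp add: I_closed)
  have mono': "B k - B m \<in> I m" if "m \<le> k" for m k using mono[of m "k - m"] that by simp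
  have "M.MCauchy B"
    unfolding M.MCauchy_def
  proof (intro conjI allI impI)
    show "range B \<subseteq> F" using B by auto
    fix \<epsilon> :: real assume "0 < \<epsilon>"
    then obtain m where m: "v w ^ m < \<epsilon>" using real_arch_pow_inv[OF _ v_w_less] by blast
    show "\<exists>N. \<forall>k k'. N \<le> k \<longrightarrow> N \<le> k' \<longrightarrow> v (B k - B k') < \<epsilon>"
    proof (intro exI allI impI)
      fix k k' assume "m \<le> k" "m \<le> k'"
      then have "(B k - B m) - (B k' - B m) \<in> I m" by (intro I_closed(3) mono')
      then show "v (B k - B k') < \<epsilon>" using m by (simp add: I_iff)
    qed
  qed
  then obtain l where l: "limitin M.mtopology B l sequentially" using complete by (auto simp: M.mcomplete_def)
  then have lim: "l \<in> F" "\<And>\<epsilon>. \<epsilon> > 0 \<Longrightarrow> \<exists>N. \<forall>k\<ge>N. v (B k - l) < \<epsilon>"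
    unfolding M.limit_metric_sequentially by blast+
  have "l - B m \<in> I m" for m
  proof -
    obtain N where N: "\<forall>k\<ge>N. v (B k - l) < v w ^ m" using lim(2)[of "v w ^ m"] v_w_pos by auto
    define k where "k = max N m"
    have "v (B k - l) < v w ^ m" using N by (simp add: k_def)
    then have "B k - l \<in> I m" by (simp add: I_iff)
    moreover have "B k - B m \<in> I m" by (rule mono') (simp add: k_def)
    ultimately have "(B k - B m) - (B k - l) \<in> I m" using I_closed(3) by blast
    then show ?thesis by simp
  qed
  then show ?thesis using that lim(1) by blast
qed

section \<open>The powers of beta as a basis of L over F and of its integers\<close>

locale unramified_generator = unramified_unitary_datum D n for D :: "'a::Fields.field unitary_datum" and n :: nat +
  fixes \<beta> :: 'a
  assumes n_ge: "n \<ge> 3" and n_odd: "odd n" and beta_OL: "\<beta> \<in> OL D" and beta_skew: "invol D \<beta> + \<beta> = 0"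
    and generates: "OL D = ring.simple_extension ringL (OF D) \<beta>"
begin

lemma beta_invol: "\<iota> \<beta> = - \<beta>" using beta_skew by (simp add: eq_neg_iff_add_eq_0)

text \<open>The hypothesis \<open>generates\<close> as Horner's scheme: the simple extension is
  inductively generated by multiplying with \<open>\<beta>\<close> and adding a constant.\<close>

lemma OL_induct [consumes 1, case_names zero lin]:
  assumes "x \<in> OL D" "P 0" "\<And>y c. y \<in> OL D \<Longrightarrow> P y \<Longrightarrow> c \<in> OF D \<Longrightarrow> P (y * \<beta> + c)"
  shows "P x"
proof -
  interpret R: ring "ringL :: 'a ring" by (rule ring_from_type_algebra)
  have "x \<in> R.simple_extension (OF D) \<beta>" using assms(1) generates by simp
  then show ?thesis
  proof (induction rule: R.simple_extension.induct)
    case zero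
    then show ?case using assms(2) by simp
  next
    case (lin y c)
    then show ?case using assms(3)[of y c] generates by simp
  qed
qed

lemma n_pos: "n > 0" using n_ge by simp

lemma OL_scale: obtains i where "w ^ i * x \<in> OL D"
proof (cases "x = 0")
  case False
  then obtain i j where "v (w ^ i * x) = v w ^ j" using valuation_exists by blast
  then have "w ^ i * x \<in> OL D" using v_w_le by (simp add: OL_iff)
  then show ?thesis by (rule that)
qed (use that OL_closed in simp)

text \<open>Let \<open>N\<close> be the first exponent for which \<open>\<beta> ^ N\<close> depends
  on lower powers. Horner's scheme puts all integers into the span of the lower powers, scaling by
  powers of \<open>w\<close> puts all of \<open>L\<close> there, and the dimension of
  \<open>L\<close> over \<open>F\<close> forces \<open>N = 2 * n\<close>.\<close>

lemma F_basis:
  shows beta_min: "\<And>j. j < 2 * n \<Longrightarrow> \<beta> ^ j \<notin> power_span F \<beta> j" and F_span: "power_span F \<beta> (2 * n) = UNIV"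
proof -
  interpret R: ring "ringL :: 'a ring" by (rule ring_from_type_algebra)
  have F: "semiring_set F" using F_closed(1-4) by (auto simp: semiring_set_def)
  note ps = power_span_closed[OF F] and pm = power_span_mult[OF F]
  have "\<exists>k. \<beta> ^ k \<in> power_span F \<beta> k" using power_span_exists[OF subfields(1) degrees(2)] by auto
  then obtain N where N: "\<beta> ^ N \<in> power_span F \<beta> N" "\<And>j. j < N \<Longrightarrow> \<beta> ^ j \<notin> power_span F \<beta> j"
    using exists_least_iff[of "\<lambda>k. \<beta> ^ k \<in> power_span F \<beta> k"] by blast
  have "N > 0" using N(1) by (auto simp: power_span_def intro: ccontr)
  then have one: "1 \<in> power_span F \<beta> N" using ps(4)[of 0 N \<beta>] by simp
  have OL: "x \<in> power_span F \<beta> N" if "x \<in> OL D" for x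
    using that
  proof (induction rule: OL_induct)
    case (lin y c)
    have "c * 1 \<in> power_span F \<beta> N" using lin.hyps one by (intro ps(3)) (auto simp: OF_iff)
    then show ?case using pm[OF N(1) lin.IH] ps(2) by simp
  qed (rule ps(1))
  have "x \<in> power_span F \<beta> N" for x :: 'a
  proof -
    obtain i where "w ^ i * x \<in> OL D" by (rule OL_scale)
    then have "(1 / w ^ i) * (w ^ i * x) \<in> power_span F \<beta> N"
      by (intro ps(3) OL F_closed(2) subfield_divide[OF subfields(1)] subfield_power[OF subfields(1)] wF)
    then show "x \<in> power_span F \<beta> N" using w0 by simp
  qed
  then have span: "power_span F \<beta> N = UNIV" by auto
  have "R.dimension N F (power_span F \<beta> N)" by (rule dimension_power_span[OF subfields(1) N(2)])
  then have "R.dimension N F UNIV" unfolding span .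
  then have "N = 2 * n" using R.dimension_is_inj[OF subfields(1) _ degrees(2)] by blast
  then show "\<And>j. j < 2 * n \<Longrightarrow> \<beta> ^ j \<notin> power_span F \<beta> j" "power_span F \<beta> (2 * n) = UNIV" using N span by auto
qed

text \<open>The chosen coefficients lie in \<open>F\<close> at every index, so
  \<open>coef i x \<in> F\<close> holds without a bound on \<open>i\<close>; the values at
  \<open>i \<ge> 2 * n\<close> have no meaning.\<close>

definition coef :: "nat \<Rightarrow> 'a \<Rightarrow> 'a" where
  "coef i x = (SOME a. (\<forall>i. a i \<in> F) \<and> x = (\<Sum>i<2*n. a i * \<beta> ^ i)) i"

lemma coef: "coef i x \<in> F" "(\<Sum>i<2*n. coef i x * \<beta> ^ i) = x"
proof -
  have "\<exists>a. (\<forall>i. a i \<in> F) \<and> x = (\<Sum>i<2*n. a i * \<beta> ^ i)" using F_span unfolding power_span_def by blast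
  from someI_ex[OF this] show "coef i x \<in> F" "(\<Sum>i<2*n. coef i x * \<beta> ^ i) = x" unfolding coef_def by auto
qed

lemma F_independent: "(\<And>i. i < 2 * n \<Longrightarrow> a i \<in> F) \<Longrightarrow> (\<Sum>i<2*n. a i * \<beta> ^ i) = 0 \<Longrightarrow> i < 2 * n \<Longrightarrow> a i = 0"
  by (rule power_span_independent[OF subfields(1) beta_min])

lemma coef_eqI: "(\<And>i. i < 2 * n \<Longrightarrow> a i \<in> F) \<Longrightarrow> (\<Sum>i<2*n. a i * \<beta> ^ i) = x \<Longrightarrow> i < 2 * n \<Longrightarrow> coef i x = a i"
  using F_independent[of "\<lambda>i. coef i x - a i" i] coef subfield_diff[OF subfields(1)]
  by (simp add: left_diff_distrib sum_subtractf)

lemma coef_add: "i < 2 * n \<Longrightarrow> coef i (x + y) = coef i x + coef i y"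
  by (rule coef_eqI) (auto simp: distrib_right sum.distrib coef F_closed)

lemma coef_scale: "c \<in> F \<Longrightarrow> i < 2 * n \<Longrightarrow> coef i (c * x) = c * coef i x"
  by (rule coef_eqI) (auto simp: mult.assoc sum_distrib_left[symmetric] coef F_closed)

lemma coef_zero: "i < 2 * n \<Longrightarrow> coef i 0 = 0" using coef_scale[of 0 i 0] F_closed by simp

lemma coef_sum: "i < 2 * n \<Longrightarrow> coef i (sum f S) = (\<Sum>s\<in>S. coef i (f s))"
  by (induction S rule: infinite_finite_induct) (auto simp: coef_zero coef_add)

lemma coef_diff: "i < 2 * n \<Longrightarrow> coef i (x - y) = coef i x - coef i y"
  using coef_add[of i "x - y" y] by simp

lemma coef_power: "i < 2 * n \<Longrightarrow> j < 2 * n \<Longrightarrow> coef i (\<beta> ^ j) = (if i = j then 1 else 0)"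
  by (rule coef_eqI) (auto simp: F_closed if_distrib[of "\<lambda>x. x * _"] cong: if_cong)

text \<open>The relation of degree \<open>2 * n\<close> for \<open>\<beta>\<close> is not yet known
  to be integral. Dividing it by a coefficient of largest absolute value makes it integral and
  nonzero modulo the maximal ideal; its degree there is the largest index \<open>e\<close> of a unit
  coefficient, and modulo that ideal it expresses \<open>\<beta> ^ e\<close> by lower
  powers.\<close>

lemma OL_residue_span:
  obtains e where "e \<le> 2 * n" "\<And>x. x \<in> OL D \<Longrightarrow> \<exists>s\<in>power_span (OF D) \<beta> e. x - s \<in> I 1"
proof -
  have OF: "semiring_set (OF D)" using OF_closed(1,2,3,5) by (auto simp: semiring_set_def)
  note ps = power_span_closed[OF OF]
  \<comment> \<open>The top coefficient is \<open>- 1\<close>, which keeps the maximum of the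
    absolute values away from zero.\<close>
  define d where "d i = (if i < 2 * n then coef i (\<beta> ^ (2 * n)) else - 1)" for i
  have dF: "d i \<in> F" for i by (simp add: d_def coef F_closed)
  have dsum: "(\<Sum>i\<le>2*n. d i * \<beta> ^ i) = 0"
    using coef(2)[of "\<beta> ^ (2 * n)"] by (simp add: d_def lessThan_Suc_atMost[symmetric])
  obtain m where m: "m \<le> 2 * n" "\<And>i. i \<le> 2 * n \<Longrightarrow> v (d i) \<le> v (d m)"
  proof -
    have "Max ((\<lambda>i. v (d i)) ` {..2*n}) \<in> (\<lambda>i. v (d i)) ` {..2*n}" by (rule Max_in) auto
    then obtain m where "Max ((\<lambda>i. v (d i)) ` {..2*n}) = v (d m)" "m \<in> {..2*n}" by (rule imageE)
    then show ?thesis using that[of m] Max_ge[of "(\<lambda>i. v (d i)) ` {..2*n}"] by simp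
  qed
  have dm: "d m \<noteq> 0"
  proof
    assume "d m = 0"
    then have "v (d (2 * n)) \<le> 0" using m(2)[of "2 * n"] by simp
    then show False by (simp add: d_def)
  qed
  define q where "q i = d i / d m" for i
  have qF: "q i \<in> F" for i unfolding q_def by (rule subfield_divide[OF subfields(1) dF dF])
  have vq: "v (q i) \<le> 1" if "i \<le> 2 * n" for i
    using m(2)[OF that] v_pos[OF dm] by (simp add: q_def v_divide)
  have qO: "q i \<in> OF D" if "i \<le> 2 * n" for i using qF vq that by (simp add: OF_iff)
  have qsum: "(\<Sum>i\<le>2*n. q i * \<beta> ^ i) = 0"
    using dsum by (simp add: q_def sum_divide_distrib[symmetric])
  define A where "A = {i. i \<le> 2 * n \<and> v (q i) = 1}"
  have A: "finite A" "m \<in> A" unfolding A_def q_def using m(1) dm by auto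
  define e where "e = Max A"
  have eA: "e \<in> A" unfolding e_def using A by (intro Max_in) auto
  then have e: "e \<le> 2 * n" "v (q e) = 1" by (auto simp: A_def)
  have above: "q i \<in> I 1" if "e < i" "i \<le> 2 * n" for i
  proof -
    have "i \<notin> A" using that Max_ge[OF A(1), of i] by (auto simp: e_def)
    then show ?thesis using vq[OF that(2)] that v_less_one[of "q i"] by (auto simp: A_def)
  qed
  have qe0: "q e \<noteq> 0" using e(2) by auto
  have split: "{..2*n} = {..<e} \<union> {e} \<union> {e<..2*n}" using e(1) by auto
  have total: "(\<Sum>i\<le>2*n. q i * \<beta> ^ i) = (\<Sum>i<e. q i * \<beta> ^ i) + q e * \<beta> ^ e + (\<Sum>i\<in>{e<..2*n}. q i * \<beta> ^ i)"
    unfolding split by (subst sum.union_disjoint; auto simp: sum.union_disjoint)+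
  then have rel: "q e * \<beta> ^ e = - (\<Sum>i<e. q i * \<beta> ^ i) - (\<Sum>i\<in>{e<..2*n}. q i * \<beta> ^ i)"
  proof -
    have "q e * \<beta> ^ e = (\<Sum>i\<le>2*n. q i * \<beta> ^ i) - (\<Sum>i<e. q i * \<beta> ^ i) - (\<Sum>i\<in>{e<..2*n}. q i * \<beta> ^ i)"
      unfolding total by simp
    then show ?thesis using qsum by simp
  qed
  have hi: "(\<Sum>i\<in>{e<..2*n}. q i * \<beta> ^ i) \<in> I 1"
    by (rule I_sum) (use above in \<open>auto intro!: I_closed OL_closed beta_OL\<close>)
  have ie: "1 / q e \<in> OF D" using e(2) qF F_closed by (auto simp: OF_iff v_divide intro!: subfield_divide[OF subfields(1)])
  define se where "se = (- 1 / q e) * (\<Sum>i<e. q i * \<beta> ^ i)"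
  have lo: "(\<Sum>i<e. q i * \<beta> ^ i) \<in> power_span (OF D) \<beta> e"
  proof -
    have "(\<Sum>i<e. q i * \<beta> ^ i) = (\<Sum>i<e. (if i < e then q i else 0) * \<beta> ^ i)" by (rule sum.cong) auto
    then show ?thesis unfolding power_span_def using qO e(1) OF_closed(1) by (intro CollectI exI[of _ "\<lambda>i. if i < e then q i else 0"]) auto
  qed
  have se: "se \<in> power_span (OF D) \<beta> e" unfolding se_def
    using ps(3)[OF OF_closed(6)[OF ie] lo] by simp
  have be: "\<beta> ^ e - se \<in> I 1"
  proof -
    have "\<beta> ^ e - se = - ((1 / q e) * (\<Sum>i\<in>{e<..2*n}. q i * \<beta> ^ i))"
    proof -
      have "\<beta> ^ e - se = (1 / q e) * (q e * \<beta> ^ e) - se" using qe0 by simp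
      also have "\<dots> = - ((1 / q e) * (\<Sum>i\<in>{e<..2*n}. q i * \<beta> ^ i))"
        unfolding se_def rel by (simp add: right_diff_distrib diff_divide_distrib)
      finally show ?thesis .
    qed
    then show ?thesis using I_closed(4)[OF I_closed(5)[OF OF_OL[OF ie] hi]] by simp
  qed
  have e0: "e > 0"
  proof (rule ccontr)
    assume "\<not> e > 0"
    then have "1 \<in> I 1" using be se by (auto simp: power_span_def)
    then show False using v_w_less by (simp add: I_iff)
  qed
  then obtain e' where e': "e = Suc e'" by (cases e) auto
  have "\<exists>s\<in>power_span (OF D) \<beta> e. x - s \<in> I 1" if "x \<in> OL D" for x
    using that
  proof (induction rule: OL_induct)
    case zero
    then show ?case using ps(1) I_closed(1) by (intro bexI[of _ 0]) auto
  next
    case (lin y c)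
    from lin.IH obtain s where s: "s \<in> power_span (OF D) \<beta> e" "y - s \<in> I 1" by blast
    then obtain a where a: "\<And>i. a i \<in> OF D" "s = (\<Sum>i<e. a i * \<beta> ^ i)" by (auto simp: power_span_def)
    have sb: "s * \<beta> = (\<Sum>i<e'. a i * \<beta> ^ Suc i) + a e' * \<beta> ^ e"
      unfolding a(2) e' by (simp add: sum_distrib_left distrib_left mult_ac)
    define t where "t = (\<Sum>i<e'. a i * \<beta> ^ Suc i) + a e' * se + c * 1"
    have sumc: "sum f S \<in> power_span (OF D) \<beta> e" if "finite S" "\<And>i. i \<in> S \<Longrightarrow> f i \<in> power_span (OF D) \<beta> e" for f and S :: "nat set"
      using that by (induction S rule: finite_induct) (auto simp: ps)
    have "t \<in> power_span (OF D) \<beta> e" unfolding t_def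
      using ps(4)[of 0 e \<beta>] e0 e' a(1) se lin.hyps by (intro ps(2,3) sumc ps(4)) auto
    moreover have "y * \<beta> + c - t = (y - s) * \<beta> + a e' * (\<beta> ^ e - se)"
      unfolding t_def using sb by (simp add: algebra_simps)
    then have "y * \<beta> + c - t \<in> I 1"
      using I_closed(2)[OF I_closed(6)[OF beta_OL s(2)] I_closed(5)[OF OF_OL[OF a(1)[of e']] be]] by simp
    ultimately show ?case by blast
  qed
  then show ?thesis using that e(1) by blast
qed

text \<open>Successive approximation: an integer is a combination of the first \<open>e\<close>
  powers plus \<open>w\<close> times an integer, and repeating this gives expansions in powers of
  \<open>w\<close> whose coefficients converge in \<open>F\<close>. So the first \<open>e\<close>
  powers span \<open>O_L\<close> over the integers of \<open>F\<close>, and \<open>e < 2 * n\<close>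
  would make \<open>\<beta> ^ e\<close> depend on lower powers.\<close>

lemma OL_coef_iff: "x \<in> OL D \<longleftrightarrow> (\<forall>i<2*n. coef i x \<in> OF D)"
proof -
  obtain e where e: "e \<le> 2 * n" "\<And>x. x \<in> OL D \<Longrightarrow> \<exists>s\<in>power_span (OF D) \<beta> e. x - s \<in> I 1"
    by (rule OL_residue_span) blast
  have "\<exists>a y. x \<in> OL D \<longrightarrow> (\<forall>i. a i \<in> OF D) \<and> y \<in> OL D \<and> x = (\<Sum>i<e. a i * \<beta> ^ i) + w * y" for x
  proof (cases "x \<in> OL D")
    case True
    then obtain s where s: "s \<in> power_span (OF D) \<beta> e" "x - s \<in> I 1" using e by blast
    then obtain a where "\<forall>i. a i \<in> OF D" "s = (\<Sum>i<e. a i * \<beta> ^ i)" by (auto simp: power_span_def)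
    moreover obtain y where "y \<in> OL D" "x - s = w * y" using I_E[OF s(2)] by auto
    then have "y \<in> OL D" "x = s + w * y" by (auto simp: algebra_simps)
    ultimately show ?thesis by blast
  qed simp
  then obtain ac yc where ay: "\<And>x. x \<in> OL D \<Longrightarrow> (\<forall>i. ac x i \<in> OF D) \<and> yc x \<in> OL D \<and> x = (\<Sum>i<e. ac x i * \<beta> ^ i) + w * yc x" by metis
  have ex: "x \<in> power_span (OF D) \<beta> e" if x: "x \<in> OL D" for x
  proof -
    \<comment> \<open>\<open>xs k\<close> is the remainder after \<open>k\<close> steps, and
      \<open>B i m\<close> below is the \<open>i\<close>-th coefficient of the \<open>m\<close>-th
      partial sum.\<close>
    define xs where "xs k = rec_nat x (\<lambda>_. yc) k" for k
    have xs: "xs k \<in> OL D" for k by (induction k) (use x ay in \<open>auto simp: xs_def\<close>)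
    define B where "B i m = (\<Sum>k<m. w ^ k * ac (xs k) i)" for i m
    have acO: "ac (xs k) i \<in> OF D" for k i using ay xs by blast
    have BO: "B i m \<in> OF D" for i m unfolding B_def by (intro OF_sum OF_closed acO)
    have step: "xs k = (\<Sum>i<e. ac (xs k) i * \<beta> ^ i) + w * xs (Suc k)" for k using ay[OF xs[of k]] by (simp add: xs_def)
    have partial: "x - (\<Sum>i<e. B i m * \<beta> ^ i) = w ^ m * xs m" for m
    proof (induction m)
      case 0
      then show ?case by (simp add: B_def xs_def)
    next
      case (Suc m)
      have "x - (\<Sum>i<e. B i (Suc m) * \<beta> ^ i) = (x - (\<Sum>i<e. B i m * \<beta> ^ i)) - w ^ m * (\<Sum>i<e. ac (xs m) i * \<beta> ^ i)"
        by (simp add: B_def distrib_right sum.distrib sum_distrib_left mult.assoc)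
      also have "\<dots> = w ^ m * (xs m - (\<Sum>i<e. ac (xs m) i * \<beta> ^ i))" unfolding Suc by (simp add: algebra_simps)
      also have "xs m - (\<Sum>i<e. ac (xs m) i * \<beta> ^ i) = w * xs (Suc m)" by (metis add_diff_cancel_left' step)
      finally show ?case by (simp add: mult_ac)
    qed
    have "\<exists>l\<in>F. \<forall>m. l - B i m \<in> I m" for i
    proof -
      have "B i (Suc m) - B i m \<in> I m" for m unfolding B_def using w_I[of "ac (xs m) i" 0 m] acO OF_OL by (auto simp: I_zero)
      then show ?thesis using complete_limit[of "B i"] BO by (metis OF_iff)
    qed
    then obtain l where l: "\<And>i. l i \<in> F" "\<And>i m. l i - B i m \<in> I m" by metis
    have lO: "l i \<in> OF D" for i using l(1) l(2)[of i 0] by (simp add: B_def I_zero OF_iff OL_iff)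
    have "x - (\<Sum>i<e. l i * \<beta> ^ i) \<in> I m" for m
    proof -
      have "x - (\<Sum>i<e. l i * \<beta> ^ i) = w ^ m * xs m - (\<Sum>i<e. (l i - B i m) * \<beta> ^ i)"
        unfolding partial[symmetric] by (simp add: left_diff_distrib sum_subtractf)
      moreover have "w ^ m * xs m \<in> I m" using w_I[of "xs m" 0 m] xs by (simp add: I_zero)
      moreover have "(\<Sum>i<e. (l i - B i m) * \<beta> ^ i) \<in> I m"
        by (intro I_sum I_closed(6) l(2) OL_closed(7) beta_OL)
      ultimately show ?thesis using I_closed(3) by simp
    qed
    then have "x = (\<Sum>i<e. l i * \<beta> ^ i)" using I_limit by fastforce
    then show ?thesis using lO unfolding power_span_def by blast
  qed
  have "e = 2 * n"
  proof (rule ccontr)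
    assume "e \<noteq> 2 * n"
    then have "e < 2 * n" using e(1) by simp
    moreover have "\<beta> ^ e \<in> power_span F \<beta> e"
      using ex[of "\<beta> ^ e"] OL_closed beta_OL by (auto simp: power_span_def OF_iff)
    ultimately show False using beta_min by blast
  qed
  show ?thesis
  proof
    assume "x \<in> OL D"
    then obtain a where a: "\<And>i. a i \<in> OF D" "x = (\<Sum>i<2*n. a i * \<beta> ^ i)" using ex \<open>e = 2 * n\<close> by (auto simp: power_span_def)
    then show "\<forall>i<2*n. coef i x \<in> OF D" using coef_eqI[of a x] by (auto simp: OF_iff)
  next
    assume "\<forall>i<2*n. coef i x \<in> OF D"
    then have "(\<Sum>i<2*n. coef i x * \<beta> ^ i) \<in> OL D" by (intro OL_sum OL_closed beta_OL) (auto simp: OF_OL)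
    then show "x \<in> OL D" by (simp add: coef)
  qed
qed

end

section \<open>The residue field: its characteristic and its Frobenius map\<close>

context unramified_unitary_datum
begin

lemma ring_ints_ring:
  assumes "\<And>x y. x \<in> ints D E \<Longrightarrow> y \<in> ints D E \<Longrightarrow> x + y \<in> ints D E \<and> x * y \<in> ints D E \<and> - x \<in> ints D E" "1 \<in> ints D E"
  shows "cring (ring_ints D E)"
proof -
  interpret R: cring "ringL :: 'a ring" by (rule cring_from_type_algebra)
  have "subcring (ints D E) (ringL :: 'a ring)"
    by (rule R.subcringI'[OF R.subringI]) (use assms in auto)
  then show ?thesis unfolding ring_ints_def by (rule R.subcring_iff[THEN iffD1, rotated]) simp
qed

lemma ring_ints_ideal:
  assumes R: "cring (ring_ints D E)" and J: "J \<subseteq> ints D E" "0 \<in> J" "\<And>x y. x \<in> J \<Longrightarrow> y \<in> J \<Longrightarrow> x + y \<in> J" "\<And>x. x \<in> J \<Longrightarrow> - x \<in> J"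
    "\<And>a x. a \<in> ints D E \<Longrightarrow> x \<in> J \<Longrightarrow> a * x \<in> J"
  shows "ideal J (ring_ints D E)"
proof -
  interpret R: cring "ring_ints D E" by (rule R)
  have s: "carrier (ring_ints D E) = ints D E" "\<And>x y. x \<otimes>\<^bsub>ring_ints D E\<^esub> y = x * y" "\<And>x y. x \<oplus>\<^bsub>ring_ints D E\<^esub> y = x + y"
    "\<zero>\<^bsub>ring_ints D E\<^esub> = 0" by (simp_all add: ring_ints_def ring_of_type_algebra_def)
  have neg: "\<ominus>\<^bsub>ring_ints D E\<^esub> x = - x" if "x \<in> J" for x
    by (rule R.minus_equality) (use that J s in auto)
  show ?thesis
  proof (rule idealI)
    show "ring (ring_ints D E)" by (rule R.ring_axioms)
    show "subgroup J (add_monoid (ring_ints D E))"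
      by (rule R.add.subgroupI) (use J s neg in \<open>auto simp: a_inv_def[symmetric]\<close>)
    fix a x assume ax: "a \<in> J" "x \<in> carrier (ring_ints D E)"
    then have "x * a \<in> J" using J(5)[of x a] s by simp
    then show "x \<otimes>\<^bsub>ring_ints D E\<^esub> a \<in> J" "a \<otimes>\<^bsub>ring_ints D E\<^esub> x \<in> J" using s by (simp_all add: mult.commute)
  qed
qed

lemma OF_ring: "cring (ring_ints D F)"
  by (rule ring_ints_ring) (use OF_closed in auto)

lemma OL_ring: "cring (ROL D)"
  by (rule ring_ints_ring) (use OL_closed in auto)

lemma I_ideal: "ideal (I m) (ROL D)"
  by (rule ring_ints_ideal[OF OL_ring]) (use I_closed I_OL in auto)

text \<open>The additive order \<open>k\<close> of the identity is odd, and its image lies in the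
  maximal ideal. As that ideal is prime, one of the prime factors of \<open>k\<close> lies in it,
  and a factor of an odd number is odd.\<close>

lemma residue_char:
  obtains p where "Factorial_Ring.prime p" "odd p" "of_nat p \<in> I 1"
proof -
  let ?A = "ring_ints D F" and ?M = "max_ideal D F"
  interpret A: cring ?A by (rule OF_ring)
  have M: "x \<in> ?M \<longleftrightarrow> x \<in> F \<and> x \<in> I 1" for x by (auto simp: max_ideal_def v_less_one)
  interpret M: ideal ?M ?A
    by (rule ring_ints_ideal[OF OF_ring]) (use M I_closed F_closed OF_OL I_OL in \<open>auto simp: OF_iff OL_iff[symmetric]\<close>)
  interpret Q: cring "residue_ring_F D" unfolding residue_ring_F_def by (rule M.quotient_is_cring[OF A.cring_axioms])
  let ?G = "add_monoid (residue_ring_F D)"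
  define k where "k = group.ord ?G \<one>\<^bsub>residue_ring_F D\<^esub>"
  have hom: "(+>\<^bsub>?A\<^esub>) ?M \<in> Ring.ring_hom ?A (residue_ring_F D)" unfolding residue_ring_F_def by (rule M.rcos_ring_hom)
  have s: "carrier ?A = OF D" "\<And>x y. x \<oplus>\<^bsub>?A\<^esub> y = x + y" "\<zero>\<^bsub>?A\<^esub> = 0" "\<one>\<^bsub>?A\<^esub> = 1"
    by (simp_all add: ring_ints_def ring_of_type_algebra_def)
  have nat: "of_nat j \<in> OF D" for j using OL_of_nat F_closed(10) subfield_of_nat[OF subfields(1)] by (simp add: OF_iff OL_iff)
  have "\<one>\<^bsub>residue_ring_F D\<^esub> [^]\<^bsub>?G\<^esub> j = ?M +>\<^bsub>?A\<^esub> of_nat j" for j :: nat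
  proof (induction j)
    case 0
    have "?M +>\<^bsub>?A\<^esub> \<zero>\<^bsub>?A\<^esub> = \<zero>\<^bsub>residue_ring_F D\<^esub>" by (rule ring_hom_zero[OF hom A.ring_axioms Q.ring_axioms])
    then show ?case by (simp add: nat_pow_def s)
  next
    case (Suc j)
    have "?M +>\<^bsub>?A\<^esub> of_nat (Suc j) = (?M +>\<^bsub>?A\<^esub> of_nat j) \<oplus>\<^bsub>residue_ring_F D\<^esub> (?M +>\<^bsub>?A\<^esub> 1)"
      using ring_hom_add[OF hom, of "of_nat j" 1] nat[of j] OF_closed(2) by (simp add: s add.commute)
    also have "?M +>\<^bsub>?A\<^esub> 1 = \<one>\<^bsub>residue_ring_F D\<^esub>" using ring_hom_one[OF hom] by (simp add: s)
    finally show ?case using Suc by simp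
  qed
  moreover have "\<one>\<^bsub>residue_ring_F D\<^esub> [^]\<^bsub>?G\<^esub> k = \<one>\<^bsub>?G\<^esub>"
    unfolding k_def by (rule group.pow_ord_eq_1[OF Q.a_group]) simp
  ultimately have "?M +>\<^bsub>?A\<^esub> of_nat k = ?M" unfolding residue_ring_F_def FactRing_def by simp
  then have "of_nat k \<in> ?M" using M.a_rcos_self[of "of_nat k"] nat[of k] by (simp add: s)
  then have kI: "of_nat k \<in> I 1" using M by blast
  have "odd k" using residue_odd by (simp add: k_def)
  have "\<exists>p. Factorial_Ring.prime p \<and> p dvd k \<and> of_nat p \<in> I 1"
    using kI \<open>odd k\<close>
  proof (induction k rule: less_induct)
    case (less k)
    have "k \<noteq> 1" using less.prems v_w_less by (auto simp: I_iff)
    moreover have "k \<noteq> 0" using odd_pos[OF less.prems(2)] by simp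
    ultimately obtain p where p: "Factorial_Ring.prime p" "p dvd k" using prime_factor_nat by blast
    then obtain m where m: "k = p * m" by auto
    have "of_nat p \<in> I 1 \<or> of_nat m \<in> I 1" using less.prems(1) unfolding m of_nat_mult by (rule I_prime) (simp_all add: OL_of_nat)
    then show ?case
    proof
      assume "of_nat m \<in> I 1"
      moreover have "m < k" "odd m" using m \<open>k \<noteq> 0\<close> less.prems(2) prime_gt_1_nat[OF p(1)] by auto
      ultimately obtain q where "Factorial_Ring.prime q" "q dvd m" "of_nat q \<in> I 1" using less.IH by blast
      then show ?thesis using m by auto
    qed (use p in blast)
  qed
  then show ?thesis using that \<open>odd k\<close> by (metis dvd_trans)
qed

lemma one_not_I: "1 \<notin> I 1" using v_w_less by (simp add: I_iff)

lemma v_two: "v 2 = 1"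
proof -
  obtain p where p: "Factorial_Ring.prime p" "odd p" "of_nat p \<in> I 1" by (rule residue_char)
  have "2 \<notin> I 1"
  proof
    assume h: "2 \<in> I 1"
    obtain k where k: "p = 2 * k + 1" using p(2) by (auto elim: oddE)
    have "of_nat p - of_nat k * 2 \<in> I 1" using p(3) h I_closed(3) I_closed(5)[OF OL_of_nat] by blast
    then show False using one_not_I by (simp add: k)
  qed
  then show ?thesis using v_less_one[of 2] OL_of_nat[of 2] by (auto simp: OL_iff)
qed

lemma two_nonzero: "(2::'a) \<noteq> 0" using v_two by auto

lemma half_OF: "1 / 2 \<in> OF D"
  using v_two F_closed(2) subfield_of_nat[OF subfields(1), of 2] subfield_divide[OF subfields(1)] by (simp add: OF_iff v_divide)

lemma frobenius_add:
  assumes "Factorial_Ring.prime p" "of_nat p \<in> I 1" "x \<in> OL D" "y \<in> OL D"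
  shows "(x + y) ^ p - (x ^ p + y ^ p) \<in> I 1"
proof -
  have "p > 0" using assms(1) prime_gt_0_nat by blast
  have split: "{..p} = {0<..<p} \<union> {0, p}" using \<open>p > 0\<close> by auto
  have "(x + y) ^ p = (\<Sum>k\<in>{0<..<p}. of_nat (p choose k) * x ^ k * y ^ (p - k)) + (x ^ p + y ^ p)"
    unfolding binomial_ring split using \<open>p > 0\<close> by (subst sum.union_disjoint) (auto simp: add.commute)
  moreover have "(\<Sum>k\<in>{0<..<p}. of_nat (p choose k) * x ^ k * y ^ (p - k)) \<in> I 1"
  proof (rule I_sum)
    fix k assume "k \<in> {0<..<p}"
    then have "p dvd (p choose k)" using assms(1) by (intro dvd_choose_prime) auto
    then obtain m where "p choose k = p * m" by auto
    then have "of_nat (p choose k) \<in> I 1" using I_closed(6)[OF OL_of_nat assms(2)] by simp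
    then show "of_nat (p choose k) * x ^ k * y ^ (p - k) \<in> I 1" using assms OL_closed(7) by (intro I_closed(6))
  qed
  ultimately show ?thesis by simp
qed

lemma frobenius_sum:
  assumes p: "Factorial_Ring.prime p" "of_nat p \<in> I 1" and f: "\<And>i. i \<in> S \<Longrightarrow> f i \<in> OL D"
  shows "sum f S ^ p - (\<Sum>i\<in>S. f i ^ p) \<in> I 1"
  using f
proof (induction S rule: infinite_finite_induct)
  case (insert i S)
  have "(f i + sum f S) ^ p - (f i ^ p + sum f S ^ p) \<in> I 1"
    by (rule frobenius_add[OF p]) (use insert.prems OL_sum[of S f] in auto)
  moreover have "sum f S ^ p - (\<Sum>i\<in>S. f i ^ p) \<in> I 1" using insert by auto
  ultimately have "((f i + sum f S) ^ p - (f i ^ p + sum f S ^ p)) + (sum f S ^ p - (\<Sum>i\<in>S. f i ^ p)) \<in> I 1" by (rule I_closed(2))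
  then show ?case using insert.hyps by (simp add: algebra_simps)
qed (use prime_gt_0_nat[OF p(1)] I_closed(1) in \<open>auto simp: zero_power\<close>)

text \<open>Additivity modulo the ideal is applied to \<open>x\<close> and \<open>- y\<close>; odd
  \<open>p\<close> lets the sign pass through the power.\<close>

lemma frobenius_inj:
  assumes p: "Factorial_Ring.prime p" "odd p" "of_nat p \<in> I 1" and "x \<in> OL D" "y \<in> OL D" "x ^ p - y ^ p \<in> I 1"
  shows "x - y \<in> I 1"
proof -
  have "(x + (- y)) ^ p - (x ^ p + (- y) ^ p) \<in> I 1"
    by (rule frobenius_add[OF p(1,3) assms(4)]) (use assms OL_closed in auto)
  then have "(x - y) ^ p - (x ^ p - y ^ p) \<in> I 1" using p(2) by (simp add: power_minus_odd)
  then have "(x - y) ^ p \<in> I 1" using assms(6) I_cong by blast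
  then show ?thesis by (rule I_power_prime) (rule OL_closed(4)[OF assms(4,5)])
qed

lemma residue_reps:
  obtains S where "finite S" "S \<subseteq> OF D" "\<And>x. x \<in> OF D \<Longrightarrow> \<exists>s\<in>S. x - s \<in> I 1"
proof -
  let ?A = "ring_ints D F" and ?M = "max_ideal D F"
  have carr: "carrier (residue_ring_F D) = (\<lambda>x. ?M +>\<^bsub>?A\<^esub> x) ` OF D"
    by (auto simp: residue_ring_F_def FactRing_def A_RCOSETS_def' ring_ints_def)
  have coset: "?M +>\<^bsub>?A\<^esub> x = (\<lambda>m. m + x) ` ?M" for x
    by (auto simp: a_r_coset_def' ring_ints_def ring_of_type_algebra_def)
  have fin: "finite ((\<lambda>x. (\<lambda>m. m + x) ` ?M) ` OF D)" using residue_finite unfolding carr coset .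
  obtain S where S: "S \<subseteq> OF D" "finite S" "(\<lambda>x. (\<lambda>m. m + x) ` ?M) ` OF D = (\<lambda>x. (\<lambda>m. m + x) ` ?M) ` S"
    using finite_subset_image[OF fin subset_refl] by (elim exE conjE) (rule that)
  have "\<exists>s\<in>S. x - s \<in> I 1" if "x \<in> OF D" for x
  proof -
    have "(\<lambda>m. m + x) ` ?M \<in> (\<lambda>x. (\<lambda>m. m + x) ` ?M) ` S" using S(3) that by blast
    then obtain s where s: "s \<in> S" "(\<lambda>m. m + x) ` ?M = (\<lambda>m. m + s) ` ?M" by blast
    have "0 + x \<in> (\<lambda>m. m + x) ` ?M" by (rule imageI) (simp add: max_ideal_def F_closed)
    then obtain m where "m \<in> ?M" "x = m + s" using s(2) by auto
    then show ?thesis using s(1) by (intro bexI[of _ s]) (auto simp: max_ideal_def v_less_one)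
  qed
  then show ?thesis using that S by blast
qed

text \<open>The residue field of \<open>F\<close> is finite, so an injective map of it to itself is
  onto. The argument runs on a finite set \<open>S\<close> of canonical representatives,
  \<open>rp\<close> depending only on the residue class.\<close>

lemma frobenius_surj:
  assumes p: "Factorial_Ring.prime p" "odd p" "of_nat p \<in> I 1" and a: "a \<in> OF D"
  shows "\<exists>e\<in>OF D. e ^ p - a \<in> I 1"
proof -
  obtain S0 where S0: "finite S0" "S0 \<subseteq> OF D" "\<And>x. x \<in> OF D \<Longrightarrow> \<exists>s\<in>S0. x - s \<in> I 1" using residue_reps by metis
  define rp where "rp x = (SOME s. s \<in> S0 \<and> x - s \<in> I 1)" for x
  have rp: "rp x \<in> S0" "x - rp x \<in> I 1" if "x \<in> OF D" for x
    using someI_ex[of "\<lambda>s. s \<in> S0 \<and> x - s \<in> I 1"] S0(3)[OF that] unfolding rp_def by blast+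
  have rp_eq: "rp x = rp y" if "x - y \<in> I 1" for x y
  proof -
    have "x - s \<in> I 1 \<longleftrightarrow> y - s \<in> I 1" for s using I_cong[of "x - s" "y - s"] that by simp
    then show ?thesis by (simp add: rp_def)
  qed
  define S where "S = rp ` OF D"
  have Sf: "finite S" "S \<subseteq> OF D" using rp S0 finite_subset[of S S0] by (auto simp: S_def)
  have rpS: "rp s = s" if "s \<in> S" for s
  proof -
    obtain x where x: "x \<in> OF D" "s = rp x" using \<open>s \<in> S\<close> unfolding S_def by blast
    show ?thesis using rp_eq[OF rp(2)[OF x(1)]] x(2) by simp
  qed
  have "inj_on (\<lambda>s. rp (s ^ p)) S"
  proof (rule inj_onI)
    fix s t assume st: "s \<in> S" "t \<in> S" "rp (s ^ p) = rp (t ^ p)"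
    have O: "s \<in> OF D" "t \<in> OF D" "s ^ p \<in> OF D" "t ^ p \<in> OF D" using st Sf OF_closed by auto
    have "(s ^ p - rp (s ^ p)) - (t ^ p - rp (t ^ p)) \<in> I 1" using I_closed(3) rp(2) O by blast
    then have "s ^ p - t ^ p \<in> I 1" using st(3) by simp
    then have "s - t \<in> I 1" using frobenius_inj[OF p] O OF_OL by blast
    then show "s = t" using rp_eq rpS st by metis
  qed
  moreover have "(\<lambda>s. rp (s ^ p)) ` S \<subseteq> S" using Sf OF_closed by (auto simp: S_def)
  ultimately have "(\<lambda>s. rp (s ^ p)) ` S = S" using Sf(1) endo_inj_surj by blast
  moreover have "rp a \<in> S" using a by (simp add: S_def)
  ultimately have "rp a \<in> (\<lambda>s. rp (s ^ p)) ` S" by simp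
  then obtain e where e: "rp a = rp (e ^ p)" "e \<in> S" by (rule imageE)
  have O: "e \<in> OF D" "e ^ p \<in> OF D" using e Sf OF_closed by auto
  have "(e ^ p - rp (e ^ p)) - (a - rp a) \<in> I 1" using I_closed(3) rp(2) O a by blast
  then show ?thesis using O e(1) by (intro bexI[of _ e]) auto
qed

lemma K_span:
  assumes e: "e \<in> K" "e \<notin> F"
  shows "K = power_span F e 2"
proof -
  interpret R: ring "ringL :: 'a ring" by (rule ring_from_type_algebra)
  note s1 = subfields(1) and s2 = subfields(2)
  have "e ^ j \<notin> power_span F e j" if "j < 2" for j
  proof -
    have "j = 0 \<or> j = 1" using that by linarith
    then show ?thesis using e(2) by (auto simp: power_span_def)
  qed
  then have ind: "R.independent F (power_list e 2)" by (rule independent_powers[OF s1])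
  have "set (power_list e 2) \<subseteq> K" "length (power_list e 2) = 2"
    using subfield_power[OF s2 e(1)] by (auto simp: power_list_def)
  then have "R.Span F (power_list e 2) = K"
    using R.independent_length_eq_dimension[OF s1 degrees(1) ind] by blast
  then show ?thesis using Span_powers[OF s1, of e 2] by simp
qed

lemma four_nonzero: "(4::'a) \<noteq> 0"
  using two_nonzero by (metis mult_2 mult_eq_0_iff numeral_Bit0)

end

section \<open>The involution, the subfield K and coordinates over K\<close>

context unramified_generator
begin

abbreviation "b \<equiv> \<beta> ^ 2"

lemma coef_invol: "i < 2 * n \<Longrightarrow> coef i (\<iota> x) = (- 1) ^ i * coef i x"
proof (rule coef_eqI)
  show "(- 1) ^ i * coef i x \<in> F" for i using coef(1) F_closed(2,4,5) subfield_power[OF subfields(1)] by simp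
  have "\<iota> x = (\<Sum>i<2*n. \<iota> (coef i x * \<beta> ^ i))" by (subst coef(2)[symmetric], rule invol_sum)
  also have "\<dots> = (\<Sum>i<2*n. (- 1) ^ i * coef i x * \<beta> ^ i)"
  proof (rule sum.cong[OF refl])
    fix i
    show "\<iota> (coef i x * \<beta> ^ i) = (- 1) ^ i * coef i x * \<beta> ^ i"
      using power_minus[of \<beta> i] by (simp add: invol_hom invol_power beta_invol invol_aut(2) coef)
  qed
  finally show "(\<Sum>i<2*n. (- 1) ^ i * coef i x * \<beta> ^ i) = \<iota> x" ..
qed

text \<open>Integrality is read off from the coordinates, of which \<open>\<iota>\<close> only
  changes the signs. That \<open>\<iota>\<close> preserves the ideals then follows from
  \<open>\<iota> w = w\<close>.\<close>

lemma invol_OL: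
  assumes "x \<in> OL D"
  shows "\<iota> x \<in> OL D"
proof -
  from assms have "\<forall>i<2*n. (- 1) ^ i * coef i x \<in> OF D" using OF_closed unfolding OL_coef_iff by auto
  then show ?thesis unfolding OL_coef_iff by (simp add: coef_invol)
qed

lemma invol_w: "\<iota> w = w" by (rule invol_aut(2)[OF wF])

lemma invol_I:
  assumes "x \<in> I m"
  shows "\<iota> x \<in> I m"
proof -
  from assms obtain y where "y \<in> OL D" "x = w ^ m * y" using I_E by blast
  then show ?thesis using w_I[of "\<iota> y" 0 m] invol_OL by (simp add: invol_hom invol_power invol_w I_zero)
qed

lemma coef_I:
  assumes x: "x \<in> I m" and i: "i < 2 * n"
  shows "coef i x \<in> I m"
proof -
  from assms obtain y where y: "y \<in> OL D" "x = w ^ m * y" using I_E by blast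
  have "coef i x = w ^ m * coef i y" unfolding y(2) by (rule coef_scale[OF _ i]) (rule subfield_power[OF subfields(1) wF])
  then show ?thesis using w_I[of "coef i y" 0 m] y(1) i OF_OL by (simp add: I_zero OL_coef_iff)
qed

lemma sum_even_odd: "(\<Sum>i<2*m. f i) = (\<Sum>i<m. f (2 * i) + f (2 * i + 1))" for f :: "nat \<Rightarrow> 'a"
  by (induction m) (auto simp: add_ac)

lemma beta_power: "\<beta> ^ (2 * i) = b ^ i" by (simp add: power_mult)

text \<open>The odd powers of \<open>\<beta>\<close> are negated by \<open>\<iota>\<close> and
  cancel, which leaves a polynomial in \<open>b\<close>.\<close>

lemma even_expansion: "(x + \<iota> x) / 2 = (\<Sum>i<n. coef (2 * i) x * b ^ i)"
proof -
  have "x + \<iota> x = (\<Sum>i<2*n. coef i x * \<beta> ^ i) + (\<Sum>i<2*n. coef i (\<iota> x) * \<beta> ^ i)" by (simp add: coef)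
  also have "\<dots> = (\<Sum>i<2*n. coef i x * \<beta> ^ i + (- 1) ^ i * coef i x * \<beta> ^ i)"
    by (simp add: sum.distrib coef_invol)
  also have "\<dots> = (\<Sum>i<n. 2 * (coef (2 * i) x * b ^ i))"
    unfolding sum_even_odd by (rule sum.cong) (auto simp: beta_power)
  also have "\<dots> = 2 * (\<Sum>i<n. coef (2 * i) x * b ^ i)" by (rule sum_distrib_left[symmetric])
  finally show ?thesis using two_nonzero by simp
qed

lemma fixed_expansion: "\<iota> x = x \<Longrightarrow> x = (\<Sum>i<n. coef (2 * i) x * b ^ i)"
  using even_expansion[of x] two_nonzero by (simp add: mult_2[symmetric])

lemma coef_even_eqI:
  assumes "\<And>i. i < n \<Longrightarrow> a i \<in> F" "i < n"
  shows "coef (2 * i) (\<Sum>i<n. a i * b ^ i) = a i"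
proof -
  have "coef (2 * i) (\<Sum>i<n. a i * b ^ i) = (\<Sum>j<n. coef (2 * i) (a j * b ^ j))" using assms by (intro coef_sum) simp
  also have "\<dots> = (\<Sum>j<n. a j * (if i = j then 1 else 0))"
    using assms by (intro sum.cong refl) (simp add: coef_scale beta_power[symmetric] coef_power)
  also have "\<dots> = a i" using assms by (simp add: if_distrib cong: if_cong)
  finally show ?thesis .
qed

lemma b_invol: "\<iota> (b ^ i) = b ^ i" by (simp add: invol_power beta_invol)

text \<open>Completing the square gives a generator \<open>d0\<close> of \<open>K\<close> with
  square in \<open>F\<close>, so \<open>\<iota>\<close> fixes or negates it. It cannot be fixed,
  because \<open>n\<close> is odd. Scaling by powers of \<open>w\<close> then produces absolute
  value one, which is possible since \<open>L\<close> is unramified over \<open>F\<close>.\<close>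

lemma K_skew_unit:
  obtains d where "d \<in> K" "\<iota> d = - d" "v d = 1"
proof -
  interpret R: ring "ringL :: 'a ring" by (rule ring_from_type_algebra)
  note s1 = subfields(1) and s2 = subfields(2)
  have "\<not> K \<subseteq> F"
  proof
    assume "K \<subseteq> F"
    then have "K = F" using subfields(3) by auto
    then have "R.dimension 2 F F" using degrees(1) by simp
    then have "(2::nat) = 1" using R.dimension_is_inj[OF s1 _ R.dimension_one[OF s1]] by blast
    then show False by simp
  qed
  then obtain z where z: "z \<in> K" "z \<notin> F" by blast
  have "\<exists>k\<le>2. z ^ k \<in> power_span F z k"
    by (rule power_span_exists[OF s1 degrees(1)]) (rule subfield_power[OF s2 z(1)])
  then obtain k where k: "k \<le> 2" "z ^ k \<in> power_span F z k" by blast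
  have "k \<noteq> 0" using k(2) by (auto simp: power_span_def intro: ccontr)
  moreover have "k \<noteq> 1" using k(2) z(2) by (auto simp: power_span_def)
  ultimately have "k = 2" using k(1) by simp
  then obtain a where a: "\<And>i. a i \<in> F" "z ^ 2 = (\<Sum>i<2. a i * z ^ i)" using k(2) by (auto simp: power_span_def)
  have z2: "z ^ 2 = a 0 + a 1 * z" using a(2) by (simp add: numeral_2_eq_2)
  define d0 where "d0 = z - a 1 / 2"
  have half: "a 1 / 2 \<in> F" using subfield_divide[OF s1 a(1) subfield_of_nat[OF s1, of 2]] by simp
  have "d0 ^ 2 = z ^ 2 - a 1 * z + (a 1 / 2) ^ 2" using two_nonzero by (simp add: d0_def power2_diff)
  then have d2: "d0 ^ 2 = a 0 + (a 1 / 2) ^ 2" by (simp add: z2)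
  have d2F: "d0 ^ 2 \<in> F" unfolding d2 using a(1) half F_closed(3) subfield_power[OF s1] by simp
  have dK: "d0 \<in> K" unfolding d0_def using z(1) half subfields(3) subfield_diff[OF s2] by auto
  have dF: "d0 \<notin> F" using subfield_closed(3)[OF s1, of d0 "a 1 / 2"] half z(2) by (auto simp: d0_def)
  have "\<iota> d0 ^ 2 = d0 ^ 2" using invol_power[of d0 2] invol_aut(2)[OF d2F] by simp
  then have "\<iota> d0 = d0 \<or> \<iota> d0 = - d0" by (simp add: power2_eq_iff)
  moreover have "\<iota> d0 \<noteq> d0"
  proof
    assume d0: "\<iota> d0 = d0"
    let ?L0 = "{x. \<iota> x = x}"
    have Kspan: "K = power_span F d0 2" by (rule K_span[OF dK dF])
    have KL0: "K \<subseteq> ?L0"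
    proof
      fix x assume "x \<in> K"
      then obtain a where "\<And>i. a i \<in> F" "x = (\<Sum>i<2. a i * d0 ^ i)" unfolding Kspan power_span_def by blast
      then show "x \<in> ?L0" using d0 by (simp add: invol_sum invol_hom invol_power invol_aut(2))
    qed
    \<comment> \<open>With \<open>E = F\<close> this gives the fixed field dimension
      \<open>n\<close> over \<open>F\<close>, with \<open>E = K\<close> it makes it a
      finite-dimensional space over \<open>K\<close>; multiplicativity of degrees would then make
      \<open>n\<close> even.\<close>
    have L0: "power_span E b n = ?L0" if E: "F \<subseteq> E" "E \<subseteq> ?L0" for E
    proof
      show "power_span E b n \<subseteq> ?L0" using E by (auto simp: power_span_def invol_sum invol_hom b_invol subset_iff)
      show "?L0 \<subseteq> power_span E b n"
      proof
        fix x assume "x \<in> ?L0"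
        then have "x = (\<Sum>i<n. coef (2 * i) x * b ^ i)" using fixed_expansion by simp
        moreover have "coef (2 * i) x \<in> E" for i using coef(1) E by blast
        ultimately show "x \<in> power_span E b n" unfolding power_span_def
          by (intro CollectI exI[of _ "\<lambda>i. coef (2 * i) x"]) auto
      qed
    qed
    note L0K = L0[OF subfields(3) KL0] and L0F = L0[OF subset_refl subset_trans[OF subfields(3) KL0]]
    have bmin: "b ^ j \<notin> power_span F b j" if "j < n" for j
    proof
      assume "b ^ j \<in> power_span F b j"
      then obtain a where a: "\<And>i. a i \<in> F" "b ^ j = (\<Sum>i<j. a i * b ^ i)" by (auto simp: power_span_def)
      have "(\<Sum>i<2*j. (if even i then a (i div 2) else 0) * \<beta> ^ i) = (\<Sum>i<j. a i * b ^ i)"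
        unfolding sum_even_odd by (rule sum.cong) (auto simp: beta_power)
      then have "\<beta> ^ (2 * j) = (\<Sum>i<2*j. (if even i then a (i div 2) else 0) * \<beta> ^ i)" using a(2) by (simp add: beta_power)
      then have "\<beta> ^ (2 * j) \<in> power_span F \<beta> (2 * j)" unfolding power_span_def using a(1) F_closed(1)
        by (intro CollectI exI[of _ "\<lambda>i. if even i then a (i div 2) else 0"]) auto
      then show False using beta_min[of "2 * j"] that by simp
    qed
    have "R.dimension n F (power_span F b n)" by (rule dimension_power_span[OF s1 bmin])
    then have dimF: "R.dimension n F ?L0" unfolding L0F .
    have "R.finite_dimension K ?L0"
      using R.Span_finite_dimension[OF s2, of "power_list b n"] Span_powers[OF s2, of b n] L0K by simp
    then obtain m where "R.dimension m K ?L0" by (rule R.finite_dimensionE')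
    from R.telescopic_base[OF s1 s2 degrees(1) this] have "2 * m = n" using R.dimension_is_inj[OF s1 _ dimF] by blast
    then show False using n_odd by auto
  qed
  ultimately have di: "\<iota> d0 = - d0" by simp
  have "d0 \<noteq> 0" using dF F_closed(1) by auto
  then obtain i j where ij: "v (w ^ i * d0) = v w ^ j" using valuation_exists by blast
  have wK: "w ^ i \<in> K" for i using subfield_power[OF s1 wF] subfields(3) by blast
  show ?thesis
  proof (rule that[of "w ^ i * d0 / w ^ j"])
    show "w ^ i * d0 / w ^ j \<in> K" by (intro subfield_divide[OF s2] K_closed(4) wK dK)
    show "\<iota> (w ^ i * d0 / w ^ j) = - (w ^ i * d0 / w ^ j)" by (simp add: invol_divide invol_hom invol_power invol_w di)
    show "v (w ^ i * d0 / w ^ j) = 1" using ij v_w_pos by (simp add: v_divide v_power)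
  qed
qed

definition d :: 'a where "d = (SOME d. d \<in> K \<and> \<iota> d = - d \<and> v d = 1)"

lemma d: "d \<in> K" "\<iota> d = - d" "v d = 1"
proof -
  have "\<exists>d. d \<in> K \<and> \<iota> d = - d \<and> v d = 1" using K_skew_unit by blast
  from someI_ex[OF this] show "d \<in> K" "\<iota> d = - d" "v d = 1" by (simp_all add: d_def)
qed

lemma d_nonzero: "d \<noteq> 0" using d(3) by auto
lemma d_OL: "d \<in> OL D" using d(3) by (simp add: OL_iff)
lemma inverse_d_OL: "inverse d \<in> OL D" using d(3) by (simp add: OL_iff v_inverse)

lemma K_decomp:
  assumes "z \<in> K" obtains x y where "x \<in> F" "y \<in> F" "z = x + d * y"
proof -
  interpret R: ring "ringL :: 'a ring" by (rule ring_from_type_algebra)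
  note s1 = subfields(1) and s2 = subfields(2)
  have dF: "d \<notin> F"
  proof
    assume "d \<in> F"
    then have "d = - d" using invol_aut(2)[of d] d(2) by simp
    then have "d + d = 0" by (metis add.right_inverse)
    then have "2 * d = 0" by (simp only: mult_2)
    then show False using two_nonzero d_nonzero by simp
  qed
  have "z \<in> power_span F d 2" using K_span[OF d(1) dF] assms by simp
  then obtain a where "\<And>i. a i \<in> F" "z = (\<Sum>i<2. a i * d ^ i)" by (auto simp: power_span_def)
  then show ?thesis using that[of "a 0" "a 1"] by (simp add: numeral_2_eq_2 mult.commute)
qed

lemma d2_F: "d ^ 2 \<in> F"
proof -
  have "d ^ 2 \<in> K" by (rule subfield_power[OF subfields(2) d(1)])
  then obtain x y where xy: "x \<in> F" "y \<in> F" "d ^ 2 = x + d * y" by (rule K_decomp)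
  have "\<iota> (d ^ 2) = d ^ 2" by (simp add: invol_power d(2))
  moreover have "\<iota> (d ^ 2) = x - d * y" using xy by (simp add: invol_hom d(2) invol_aut(2))
  ultimately have "2 * (d * y) = 0" using xy(3) by (simp add: algebra_simps)
  then show ?thesis using xy d_nonzero two_nonzero by simp
qed

text \<open>For \<open>z\<close> in \<open>K\<close> this is the component in \<open>F\<close> of
  the decomposition along \<open>1\<close> and \<open>d\<close>; the component along
  \<open>d\<close> is \<open>re (z / d)\<close>.\<close>

definition re :: "'a \<Rightarrow> 'a" where "re z = (z + \<iota> z) / 2"

lemma re_FK: "x \<in> F \<Longrightarrow> y \<in> F \<Longrightarrow> re (x + d * y) = x"
  using two_nonzero by (simp add: re_def invol_hom invol_aut(2) d(2))
lemma re_F: "z \<in> K \<Longrightarrow> re z \<in> F" using K_decomp re_FK by metis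
lemma re_im: "z = re z + d * re (z / d)"
  using d_nonzero two_nonzero by (simp add: re_def invol_divide d(2) field_simps four_nonzero)
lemma re_add: "re (x + y) = re x + re y" by (simp add: re_def invol_hom add_divide_distrib)
lemma re_scale: "c \<in> F \<Longrightarrow> re (c * x) = c * re x"
  using two_nonzero by (simp add: re_def invol_hom invol_aut(2) field_simps)
lemma re_invol: "re (\<iota> x) = re x" by (simp add: re_def invol_hom add.commute)
lemma half_OL: "1 / 2 \<in> OL D" using half_OF OF_OL by blast
lemma re_I: "x \<in> I m \<Longrightarrow> re x \<in> I m"
  using I_closed(6)[OF half_OL I_closed(2)[OF _ invol_I]] by (simp add: re_def)
lemma re_sum: "re (sum f S) = (\<Sum>i\<in>S. re (f i))"
  by (induction S rule: infinite_finite_induct) (auto simp: re_add re_def[of 0])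

text \<open>The coordinate of \<open>x\<close> at \<open>b ^ i\<close> over \<open>K\<close>. The
  expansion over \<open>F\<close> in powers of \<open>b\<close> sees only the part fixed by
  \<open>\<iota>\<close>; since \<open>\<iota>\<close> negates \<open>d\<close>, the other part is
  reached through \<open>x / d\<close>.\<close>

definition kc :: "nat \<Rightarrow> 'a \<Rightarrow> 'a" where "kc i x = coef (2 * i) x + d * coef (2 * i) (x / d)"

lemma F_K: "x \<in> F \<Longrightarrow> x \<in> K" using subfields(3) by blast
lemma kc_K: "kc i x \<in> K" unfolding kc_def by (intro K_closed F_K coef(1) d)
lemma re_kc: "re (kc i x) = coef (2 * i) x" unfolding kc_def by (intro re_FK coef(1))
lemma im_kc: "re (kc i x / d) = coef (2 * i) (x / d)"
proof -
  have "kc i x / d = coef (2 * i) (x / d) + d * (coef (2 * i) x / d ^ 2)"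
    using d_nonzero by (simp add: kc_def field_simps power2_eq_square)
  then show ?thesis using re_FK[OF coef(1) subfield_divide[OF subfields(1) coef(1) d2_F]] by simp
qed

lemma kc_expansion: "x = (\<Sum>i<n. kc i x * b ^ i)"
proof -
  have "(\<Sum>i<n. kc i x * b ^ i) = (x + \<iota> x) / 2 + d * ((x / d + \<iota> (x / d)) / 2)"
    unfolding even_expansion kc_def by (simp add: distrib_right sum.distrib sum_distrib_left mult.assoc)
  also have "\<dots> = x" using d_nonzero two_nonzero by (simp add: invol_divide d(2) field_simps four_nonzero)
  finally show ?thesis ..
qed

lemma kc_add: "i < n \<Longrightarrow> kc i (x + y) = kc i x + kc i y"
  by (simp add: kc_def add_divide_distrib coef_add algebra_simps)

lemma kc_scale:
  assumes c: "c \<in> K" and i: "i < n"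
  shows "kc i (c * x) = c * kc i x"
proof -
  obtain p q where pq: "p \<in> F" "q \<in> F" "c = p + d * q" using K_decomp[OF c] by blast
  have F: "kc i (p * x) = p * kc i x" if "p \<in> F" for p x
    using that i by (simp add: kc_def coef_scale distrib_left mult_ac times_divide_eq_right[symmetric] del: times_divide_eq_right)
  have D: "kc i (d * x) = d * kc i x" for x
  proof -
    have "coef (2 * i) (d * x) = d ^ 2 * coef (2 * i) (x / d)"
      using coef_scale[OF d2_F, of "2 * i" "x / d"] i d_nonzero by (simp add: power2_eq_square)
    then show ?thesis using d_nonzero by (simp add: kc_def distrib_left power2_eq_square mult_ac)
  qed
  have "kc i (c * x) = kc i (p * x) + kc i (d * (q * x))" unfolding pq(3) using i by (simp add: distrib_right kc_add mult.assoc)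
  also have "\<dots> = c * kc i x" unfolding D F[OF pq(1)] F[OF pq(2)] pq(3) by (simp add: algebra_simps)
  finally show ?thesis .
qed

lemma kc_I:
  assumes x: "x \<in> I m" and i: "i < n"
  shows "kc i x \<in> I m"
proof -
  have "x / d \<in> I m" using I_closed(6)[OF inverse_d_OL x] by (simp add: divide_inverse)
  then show ?thesis unfolding kc_def using x i by (intro I_closed(2) I_closed(5)[OF d_OL] coef_I) auto
qed

lemma K_basis_unique:
  assumes "\<And>i. i < n \<Longrightarrow> a i \<in> K" "i < n"
  shows "kc i (\<Sum>i<n. a i * b ^ i) = a i"
proof -
  have b: "kc i (b ^ j) = (if i = j then 1 else 0)" if "j < n" for j
  proof -
    have "\<iota> (b ^ j / d) = - (b ^ j / d)" by (simp add: invol_divide b_invol d(2))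
    then have "coef (2 * i) (b ^ j / d) = coef (2 * i) (- (b ^ j / d))" using coef_invol[of "2 * i" "b ^ j / d"] assms(2) by simp
    then have "2 * coef (2 * i) (b ^ j / d) = 0" using coef_add[of "2 * i" "b ^ j / d" "- (b ^ j / d)"] assms(2) by (simp add: coef_zero)
    then show ?thesis using two_nonzero coef_power[of "2 * i" "2 * j"] assms(2) that by (simp add: kc_def beta_power)
  qed
  have z: "kc i 0 = 0" using assms(2) by (simp add: kc_def coef_zero)
  have s: "kc i (sum f S) = (\<Sum>s\<in>S. kc i (f s))" for f and S :: "nat set"
    by (induction S rule: infinite_finite_induct) (auto simp: z kc_add assms(2))
  have "kc i (\<Sum>j<n. a j * b ^ j) = (\<Sum>j<n. a j * (if i = j then 1 else 0))"
    unfolding s by (rule sum.cong) (use assms b in \<open>auto simp: kc_scale\<close>)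
  then show ?thesis using assms by (simp add: if_distrib cong: if_cong)
qed

lemma K_basis: "basis_on K UNIV n (\<lambda>i. b ^ i)"
proof (rule basis_onI)
  show "\<exists>a. (\<forall>i<n. a i \<in> K) \<and> x = (\<Sum>i<n. a i * b ^ i)" for x
    using kc_expansion[of x] kc_K by (intro exI[of _ "\<lambda>i. kc i x"]) auto
  fix a a' i assume "\<And>i. i < n \<Longrightarrow> a i \<in> K \<and> a' i \<in> K" "(\<Sum>i<n. a i * b ^ i) = (\<Sum>i<n. a' i * b ^ i)" "i < n"
  then show "a i = a' i" using K_basis_unique[of a i] K_basis_unique[of a' i] by metis
qed auto

lemma field_trace_K: "field_trace K x = (\<Sum>i<n. kc i (x * b ^ i))"
  unfolding field_trace_def
proof (rule trace_on_eq[where c = "\<lambda>i j. kc i (x * b ^ j)", OF K_closed(1-4) _ _ K_basis])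
  show "x * b ^ j = (\<Sum>i<n. kc i (x * b ^ j) * b ^ i)" for j by (rule kc_expansion)
qed (auto simp: kc_K sum_distrib_left mult_ac)

end

declare One_nat_def [simp del]

context unramified_generator
begin

text \<open>
  Euler's formula: \<open>fa\<close> are the coefficients of the minimal polynomial of \<open>b\<close> over \<open>K\<close> and \<open>gb j\<close> is the value at
  \<open>b\<close> of its \<open>j\<close>-th Horner quotient. The basis dual to the powers of \<open>b\<close> under the trace from \<open>L\<close> to \<open>K\<close> is
  \<open>gb j / dlt\<close>, and \<open>dlt\<close> is the derivative at \<open>b\<close>.
\<close>

definition fa :: "nat \<Rightarrow> 'a" where "fa i = (if i < n then - coef (2 * i) (b ^ n) else 1)"
definition gb :: "nat \<Rightarrow> 'a" where "gb j = (\<Sum>t<n - j. fa (t + j + 1) * b ^ t)"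
definition dlt :: 'a where "dlt = (\<Sum>i<n. of_nat (i + 1) * fa (i + 1) * b ^ i)"
text \<open>Euler's functional, the trace from \<open>L\<close> to \<open>K\<close> of
  \<open>x / dlt\<close>. In coordinates it only picks the coefficient of the highest power, so it
  takes integral values on \<open>O_L\<close>.\<close>

abbreviation "Lam \<equiv> kc (n - 1)"

lemma b_OL: "b ^ i \<in> OL D" by (intro OL_closed(7) beta_OL)

lemma fa_OF: "fa i \<in> OF D"
  using b_OL[of n] OL_coef_iff OF_closed by (auto simp: fa_def)

lemma fa_zero: "(\<Sum>i\<le>n. fa i * b ^ i) = 0"
proof -
  have "(\<Sum>i\<le>n. fa i * b ^ i) = (\<Sum>i<n. fa i * b ^ i) + fa n * b ^ n" by (simp add: lessThan_Suc_atMost[symmetric])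
  also have "(\<Sum>i<n. fa i * b ^ i) = - (\<Sum>i<n. coef (2 * i) (b ^ n) * b ^ i)"
    unfolding sum_negf[symmetric] by (rule sum.cong) (auto simp: fa_def)
  also have "(\<Sum>i<n. coef (2 * i) (b ^ n) * b ^ i) = b ^ n" using fixed_expansion[OF b_invol] by simp
  finally show ?thesis by (simp add: fa_def)
qed

lemma gb_Suc:
  assumes "j < n"
  shows "gb j = b * gb (Suc j) + fa (Suc j)"
proof -
  from assms have e: "n - j = Suc (n - Suc j)" by simp
  have "gb j = fa (Suc j) + (\<Sum>t<n - Suc j. fa (t + Suc j + 1) * b ^ Suc t)"
    unfolding gb_def e by (subst sum.lessThan_Suc_shift) (simp add: One_nat_def)
  then show ?thesis by (simp add: gb_def sum_distrib_left mult_ac)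
qed

lemma gb_0: "b * gb 0 = - fa 0"
proof -
  have "(\<Sum>i<Suc n. fa i * b ^ i) = fa 0 + (\<Sum>t<n. fa (Suc t) * b ^ Suc t)"
    by (simp add: sum.lessThan_Suc_shift del: power_Suc sum.lessThan_Suc)
  also have "(\<Sum>t<n. fa (Suc t) * b ^ Suc t) = b * gb 0" by (simp add: gb_def sum_distrib_left mult_ac One_nat_def)
  finally show ?thesis using fa_zero by (simp add: lessThan_Suc_atMost eq_neg_iff_add_eq_0 add.commute)
qed

lemma gb_OL: "gb j \<in> OL D" unfolding gb_def by (intro OL_sum OL_closed(5) b_OL OF_OL fa_OF)

lemma kc_zero: "i < n \<Longrightarrow> kc i 0 = 0" by (simp add: kc_def coef_zero)
lemma kc_sum: "i < n \<Longrightarrow> kc i (sum f S) = (\<Sum>s\<in>S. kc i (f s))"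
  by (induction S rule: infinite_finite_induct) (auto simp: kc_zero kc_add)
lemma kc_minus: "i < n \<Longrightarrow> kc i (- x) = - kc i x"
  using kc_add[of i x "- x"] by (simp add: kc_zero eq_neg_iff_add_eq_0 add.commute)
lemma kc_diff: "i < n \<Longrightarrow> kc i (x - y) = kc i x - kc i y"
  using kc_add[of i x "- y"] by (simp add: kc_minus)
lemma kc_power:
  assumes "i < n" "j < n"
  shows "kc i (b ^ j) = (if i = j then 1 else 0)"
proof -
  have "(\<Sum>k<n. (if k = j then 1 else 0) * b ^ k) = b ^ j"
    using \<open>j < n\<close> by (simp add: if_distrib[of "\<lambda>x. x * _"] cong: if_cong)
  then show ?thesis using assms K_basis_unique[of "\<lambda>k. if k = j then 1 else 0" i] K_closed(1,2) by auto
qed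

lemma fa_K: "fa i \<in> K" using fa_OF[of i] F_K by (auto simp: OF_iff)

text \<open>Induction on \<open>i\<close>: by the Horner recursion
  \<open>b ^ Suc i * gb (Suc k)\<close> equals \<open>b ^ i * gb k\<close> up to a multiple of
  \<open>b ^ i\<close>, and \<open>Lam\<close> kills \<open>b ^ i\<close> for
  \<open>i < n - 1\<close>.\<close>

lemma Lam_dual: "i < n \<Longrightarrow> j < n \<Longrightarrow> Lam (b ^ i * gb j) = (if i = j then 1 else 0)"
proof (induction i arbitrary: j)
  case 0
  have "Lam (gb j) = (\<Sum>t<n - j. fa (t + j + 1) * (if n - 1 = t then 1 else 0))"
    unfolding gb_def using 0 n_pos by (simp add: kc_sum) (intro sum.cong, auto simp: kc_scale fa_K kc_power)
  also have "\<dots> = (\<Sum>t<n - j. if n - 1 = t then fa (t + j + 1) else 0)" by (rule sum.cong) auto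
  also have "\<dots> = (if j = 0 then fa n else 0)" using 0 n_pos by (auto simp: sum.delta)
  finally show ?case by (auto simp: fa_def)
next
  case (Suc i)
  have l: "Lam (fa k * b ^ i) = 0" for k using Suc.prems by (simp add: kc_scale fa_K kc_power)
  show ?case
  proof (cases j)
    case 0
    have "b ^ Suc i * gb j = b ^ i * (b * gb 0)" using 0 by (simp add: mult_ac)
    also have "\<dots> = - (fa 0 * b ^ i)" unfolding gb_0 by simp
    finally show ?thesis using l[of 0] 0 n_pos by (simp add: kc_minus)
  next
    case (Suc k)
    have "b ^ Suc i * gb j = b ^ i * gb k - fa (Suc k) * b ^ i"
      using gb_Suc[of k] Suc Suc.prems by (simp add: algebra_simps)
    then have "Lam (b ^ Suc i * gb j) = Lam (b ^ i * gb k)" using l n_pos by (simp add: kc_diff)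
    then show ?thesis using Suc.IH[of k] Suc Suc.prems by simp
  qed
qed

lemma kc_dual:
  assumes i: "i < n"
  shows "kc i x = Lam (x * gb i)"
proof -
  have "x * gb i = (\<Sum>k<n. kc k x * (b ^ k * gb i))"
    by (subst kc_expansion[of x]) (simp add: sum_distrib_right mult.assoc)
  then have "Lam (x * gb i) = (\<Sum>k<n. kc k x * Lam (b ^ k * gb i))" using n_pos by (simp add: kc_sum kc_scale kc_K)
  also have "\<dots> = (\<Sum>k<n. kc k x * (if k = i then 1 else 0))" using i by (simp add: Lam_dual)
  finally show ?thesis using i by (simp add: if_distrib cong: if_cong)
qed

text \<open>When the double sum is ordered by the exponent \<open>k\<close>, the term
  \<open>fa (k + 1) * b ^ k\<close> occurs \<open>k + 1\<close> times, as in the derivative.\<close>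

lemma sum_gb: "(\<Sum>i<n. b ^ i * gb i) = dlt"
proof -
  have "(\<Sum>i<n. b ^ i * gb i) = (\<Sum>i<n. \<Sum>t<n - i. fa (i + t + 1) * b ^ (i + t))"
    unfolding gb_def sum_distrib_left by (intro sum.cong refl) (simp add: power_add power_mult mult_ac add_ac)
  also have "\<dots> = (\<Sum>(i, t)\<in>{(i, t). i + t < n}. fa (i + t + 1) * b ^ (i + t))"
    by (subst sum.Sigma) (auto intro!: sum.cong)
  also have "\<dots> = (\<Sum>k<n. \<Sum>i\<le>k. fa (i + (k - i) + 1) * b ^ (i + (k - i)))"
    by (rule sum.triangle_reindex)
  also have "\<dots> = dlt" unfolding dlt_def by (intro sum.cong refl) (simp add: mult.assoc)
  finally show ?thesis .
qed

lemma dlt_OL: "dlt \<in> OL D"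
  unfolding dlt_def by (intro OL_sum OL_closed(5) OL_of_nat b_OL OF_OL fa_OF)

lemma fa_n: "fa n = 1" by (simp add: fa_def)

text \<open>If the derivative \<open>dlt\<close> of the minimal polynomial of \<open>b\<close> were not a unit, then modulo \<open>\<pp>\<close> the minimal
  polynomial would be a polynomial in the \<open>p\<close>-th power of the variable, hence a \<open>p\<close>-th power.\<close>

lemma dlt_unit: "dlt \<notin> I 1"
proof
  assume dl: "dlt \<in> I 1"
  obtain p where p: "Factorial_Ring.prime p" "odd p" "of_nat p \<in> I 1" by (rule residue_char)
  have p0: "p > 0" using prime_gt_0_nat[OF p(1)] .
  have faF: "fa i \<in> F" for i using fa_OF by (simp add: OF_iff)
  \<comment> \<open>The coordinate of \<open>dlt\<close> at \<open>b ^ (k - 1)\<close> is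
    \<open>k\<close> times this coefficient, and \<open>k\<close> is invertible modulo the maximal
    ideal when \<open>p\<close> does not divide it.\<close>
  have small: "fa k \<in> I 1" if k: "\<not> p dvd k" "k \<le> n" for k
  proof -
    have "k \<noteq> 0" using k(1) by (auto intro: ccontr)
    then obtain i where i: "k = Suc i" by (cases k) auto
    have "coef (2 * i) dlt = of_nat (i + 1) * fa (i + 1)" unfolding dlt_def
    proof (rule coef_even_eqI)
      show "of_nat (j + 1) * fa (j + 1) \<in> F" for j by (rule F_closed(4)[OF subfield_of_nat[OF subfields(1)] faF])
    qed (use k i in simp)
    then have "of_nat k * fa k \<in> I 1" using coef_I[OF dl, of "2 * i"] k(2) i by (simp add: One_nat_def add.commute)
    then consider "of_nat k \<in> I 1" | "fa k \<in> I 1" using I_prime OL_of_nat OF_OL fa_OF by blast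
    then show ?thesis
    proof cases
      case 1
      have "coprime p k" using p(1) k(1) by (simp add: prime_imp_coprime)
      then have "coprime (int p) (int k)" by simp
      then obtain s t where st: "s * int p + t * int k = 1"
        using bezout_int[of "int p" "int k"] by (auto simp: coprime_iff_gcd_eq_1)
      have oi: "of_int j \<in> OL D" for j by (cases j rule: int_cases2) (auto simp: OL_of_nat OL_closed(6))
      have "of_int s * of_nat p + of_int t * of_nat k \<in> I 1" using p(3) 1 by (intro I_closed(2) I_closed(5) oi)
      moreover have "of_int s * of_nat p + of_int t * of_nat k = (of_int (s * int p + t * int k) :: 'a)" by simp
      ultimately show ?thesis using st one_not_I by simp
    qed
  qed
  have "p dvd n" using small[of n] one_not_I by (auto simp: fa_n)
  then obtain m where m: "n = p * m" by auto
  have m0: "m > 0" using m n_pos by (auto intro: Nat.gr0I)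
  have mn: "m < n" using m m0 prime_gt_1_nat[OF p(1)] by simp
  have "\<forall>j. \<exists>e\<in>OF D. e ^ p - fa (p * j) \<in> I 1" using frobenius_surj[OF p fa_OF] by blast
  then obtain e where e: "\<And>j. e j \<in> OF D" "\<And>j. e j ^ p - fa (p * j) \<in> I 1" by metis
  \<comment> \<open>The \<open>p\<close>-th power of \<open>?s\<close> is congruent to the minimal
    polynomial at \<open>b\<close>, which is zero, so \<open>?s\<close> is in the ideal. Its degree
    \<open>m\<close> is less than \<open>n\<close>, so its top coordinate \<open>e m\<close> would
    be in the ideal, although \<open>e m ^ p\<close> is congruent to
    \<open>fa n = 1\<close>.\<close>
  let ?s = "\<Sum>j\<le>m. e j * b ^ j"
  have split: "{..n} = (\<lambda>j. p * j) ` {..m} \<union> {k. k \<le> n \<and> \<not> p dvd k}"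
    using p0 by (auto simp: m image_iff elim!: dvdE)
  have "(\<Sum>k\<le>n. fa k * b ^ k) = (\<Sum>k\<in>(\<lambda>j. p * j) ` {..m}. fa k * b ^ k) + (\<Sum>k | k \<le> n \<and> \<not> p dvd k. fa k * b ^ k)"
    unfolding split by (rule sum.union_disjoint) auto
  also have "(\<Sum>k\<in>(\<lambda>j. p * j) ` {..m}. fa k * b ^ k) = (\<Sum>j\<le>m. fa (p * j) * b ^ (p * j))"
    by (subst sum.reindex) (use p0 in \<open>auto simp: inj_on_def\<close>)
  finally have "(\<Sum>j\<le>m. fa (p * j) * b ^ (p * j)) = - (\<Sum>k | k \<le> n \<and> \<not> p dvd k. fa k * b ^ k)"
    using fa_zero by (simp add: eq_neg_iff_add_eq_0)
  moreover have "(\<Sum>k | k \<le> n \<and> \<not> p dvd k. fa k * b ^ k) \<in> I 1"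
    by (rule I_sum) (use small b_OL in \<open>auto intro: I_closed(6)\<close>)
  ultimately have A: "(\<Sum>j\<le>m. fa (p * j) * b ^ (p * j)) \<in> I 1" using I_closed(4) by simp
  have B: "(\<Sum>j\<le>m. (e j * b ^ j) ^ p) - (\<Sum>j\<le>m. fa (p * j) * b ^ (p * j)) \<in> I 1"
  proof -
    have "(\<Sum>j\<le>m. (e j * b ^ j) ^ p) - (\<Sum>j\<le>m. fa (p * j) * b ^ (p * j)) = (\<Sum>j\<le>m. (e j ^ p - fa (p * j)) * b ^ (p * j))"
      unfolding sum_subtractf[symmetric] by (intro sum.cong refl) (simp add: power_mult_distrib power_mult[symmetric] algebra_simps)
    also have "\<dots> \<in> I 1" by (intro I_sum I_closed(6) e(2) b_OL)
    finally show ?thesis .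
  qed
  have C: "?s ^ p - (\<Sum>j\<le>m. (e j * b ^ j) ^ p) \<in> I 1"
    by (rule frobenius_sum[OF p(1,3)]) (intro OL_closed(5) b_OL OF_OL e(1))
  have "(\<Sum>j\<le>m. (e j * b ^ j) ^ p) \<in> I 1" using I_cong[OF B] A by blast
  then have "?s ^ p \<in> I 1" using I_cong[OF C] by blast
  then have sI: "?s \<in> I 1" by (rule I_power_prime) (intro OL_sum OL_closed(5) b_OL OF_OL e(1))
  let ?a = "\<lambda>j. if j \<le> m then e j else 0"
  have "?s = (\<Sum>j<n. ?a j * b ^ j)"
    by (rule sum.mono_neutral_cong_left) (use mn in auto)
  moreover have "coef (2 * m) (\<Sum>j<n. ?a j * b ^ j) = ?a m"
    by (rule coef_even_eqI) (use mn e(1) F_closed(1) in \<open>auto simp: OF_iff\<close>)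
  ultimately have "e m \<in> I 1" using coef_I[OF sI, of "2 * m"] mn by simp
  then have "e m ^ p \<in> I 1" using I_closed(5)[OF OL_closed(7)[OF OF_OL[OF e(1)]], of "e m" 1 m "p - 1"] power_minus_mult[OF p0, of "e m"]
    by simp
  then have "fa (p * m) \<in> I 1" using I_cong[OF e(2)[of m]] by blast
  then show False using one_not_I fa_n m by simp
qed

text \<open>The trace of \<open>x\<close> from \<open>L\<close> to \<open>K\<close> is
  \<open>Lam (dlt * x)\<close>, so \<open>u\<close> is the factor that turns the Hermitian form into
  the functional \<open>Lam\<close>.\<close>

definition u :: 'a where "u = dlt * eps D"

lemma eps_OL: "eps D \<in> OL D" "inverse (eps D) \<in> OL D" "eps D \<noteq> 0"
proof -
  have e: "eps D \<in> OL D" "\<exists>y\<in>OL D. y * eps D = 1" using eps_unit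
    by (auto simp: Units_def ring_ints_def ring_of_type_algebra_def)
  then obtain y where y: "y \<in> OL D" "y * eps D = 1" by blast
  then have "y = inverse (eps D)" by (metis inverse_unique mult.commute)
  then show "eps D \<in> OL D" "inverse (eps D) \<in> OL D" "eps D \<noteq> 0" using e y by auto
qed

lemma v_eps: "v (eps D) = 1"
proof -
  have "v (eps D) \<le> 1" "inverse (v (eps D)) \<le> 1" using eps_OL by (auto simp: OL_iff v_inverse)
  moreover have "v (eps D) > 0" using eps_OL v_pos by simp
  ultimately show ?thesis using one_le_inverse_iff[of "v (eps D)"] by (simp add: inverse_le_1_iff)
qed

lemma v_u: "v u = 1"
  using dlt_unit dlt_OL v_less_one[of dlt] v_eps by (auto simp: u_def absv_mult OL_iff)

lemma u_facts: "u \<in> OL D" "inverse u \<in> OL D" "u \<noteq> 0" "\<iota> u = u"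
proof -
  show "u \<in> OL D" "inverse u \<in> OL D" using v_u by (auto simp: OL_iff v_inverse)
  show "u \<noteq> 0" using v_u by auto
  have "\<iota> dlt = dlt" unfolding dlt_def invol_sum
    by (intro sum.cong refl) (use fa_OF F_closed subfield_of_nat[OF subfields(1)] in \<open>simp add: invol_hom b_invol invol_aut(2) OF_iff\<close>)
  then show "\<iota> u = u" by (simp add: u_def invol_hom eps_fixed)
qed

section \<open>The Hermitian form in coordinates\<close>

abbreviation "S \<equiv> herm D"

lemma S_eq: "S x y = Lam (u * x * \<iota> y)"
proof -
  have "S x y = (\<Sum>i<n. Lam (eps D * x * \<iota> y * b ^ i * gb i))"
    unfolding herm_def field_trace_K by (intro sum.cong refl kc_dual) simp
  also have "\<dots> = Lam (\<Sum>i<n. eps D * x * \<iota> y * b ^ i * gb i)" using n_pos by (simp add: kc_sum)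
  also have "(\<Sum>i<n. eps D * x * \<iota> y * b ^ i * gb i) = eps D * x * \<iota> y * dlt"
    unfolding sum_gb[symmetric] sum_distrib_left by (simp add: mult.assoc)
  finally show ?thesis by (simp add: u_def mult_ac)
qed

lemma S_K: "S x y \<in> K" unfolding S_eq by (rule kc_K)

lemma S_add: "S (x + x') y = S x y + S x' y" "S x (y + y') = S x y + S x y'"
  using n_pos by (simp_all add: S_eq invol_hom algebra_simps kc_add)
lemma S_zero: "S 0 y = 0" "S x 0 = 0" using n_pos by (simp_all add: S_eq kc_zero)
lemma S_minus: "S (- x) y = - S x y" "S x (- y) = - S x y"
  using n_pos by (simp_all add: S_eq invol_minus kc_minus)
lemma S_diff: "S (x - x') y = S x y - S x' y" "S x (y - y') = S x y - S x y'"
  using n_pos by (simp_all add: S_eq invol_diff algebra_simps kc_diff)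
lemma S_sum: "S (sum f A) y = (\<Sum>i\<in>A. S (f i) y)" "S x (sum f A) = (\<Sum>i\<in>A. S x (f i))"
  by (induction A rule: infinite_finite_induct) (auto simp: S_add S_zero)

lemma invol_K:
  assumes "c \<in> K"
  shows "\<iota> c \<in> K"
proof -
  from assms obtain x y where "x \<in> F" "y \<in> F" "c = x + d * y" by (rule K_decomp)
  then show ?thesis using d F_K K_closed by (simp add: invol_hom invol_aut(2))
qed

lemma S_scale: "c \<in> K \<Longrightarrow> S (c * x) y = c * S x y" "c \<in> K \<Longrightarrow> S x (c * y) = \<iota> c * S x y"
proof -
  assume c: "c \<in> K"
  have e: "u * (c * x) * \<iota> y = c * (u * x * \<iota> y)" "u * x * (\<iota> c * \<iota> y) = \<iota> c * (u * x * \<iota> y)" by (simp_all add: mult_ac)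
  show "S (c * x) y = c * S x y" unfolding S_eq e using c n_pos by (intro kc_scale) auto
  show "S x (c * y) = \<iota> c * S x y" unfolding S_eq invol_hom e using invol_K[OF c] n_pos by (intro kc_scale) auto
qed

lemma kc_invol:
  assumes i: "i < n"
  shows "kc i (\<iota> x) = \<iota> (kc i x)"
proof -
  have "\<iota> x / d = - \<iota> (x / d)" by (simp add: invol_divide d(2))
  then have "coef (2 * i) (\<iota> x / d) = - coef (2 * i) (\<iota> (x / d))" using coef_scale[of "- 1" "2 * i" "\<iota> (x / d)"] i F_closed by simp
  also have "\<dots> = - coef (2 * i) (x / d)" using i by (simp add: coef_invol)
  finally show ?thesis using i by (simp add: kc_def coef_invol invol_hom d(2) invol_aut(2) coef)
qed

lemma S_sym: "S y x = \<iota> (S x y)"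
  using n_pos by (simp add: S_eq kc_invol[symmetric] invol_hom u_facts mult_ac)

lemma S_I: "x \<in> I m \<Longrightarrow> y \<in> OL D \<Longrightarrow> S x y \<in> I m" "x \<in> OL D \<Longrightarrow> y \<in> I m \<Longrightarrow> S x y \<in> I m"
  unfolding S_eq
  using kc_I[OF I_closed(6)[OF invol_OL I_closed(5)[OF u_facts(1)]], of y x m "n - 1"]
    kc_I[OF I_closed(5)[OF OL_closed(5)[OF u_facts(1)] invol_I], of x y m "n - 1"] n_pos by auto

lemma S_OL: "x \<in> OL D \<Longrightarrow> y \<in> OL D \<Longrightarrow> S x y \<in> OL D" using S_I(1)[of x 0 y] by (simp add: I_zero)

text \<open>The elements dual to the powers of \<open>b\<close> under \<open>S\<close>; dividing by
  \<open>u\<close> keeps them integral because \<open>u\<close> is a unit.\<close>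

definition bs :: "nat \<Rightarrow> 'a" where "bs i = \<iota> (gb i / u)"

lemma bs_OL: "bs i \<in> OL D" unfolding bs_def divide_inverse by (intro invol_OL OL_closed(5) gb_OL u_facts)

lemma S_bs:
  assumes i: "i < n"
  shows "S x (bs i) = kc i x"
proof -
  have e: "u * x * (gb i / u) = x * gb i" using u_facts(3) by simp
  show ?thesis unfolding S_eq bs_def invol_hom(4) e by (rule kc_dual[OF i, symmetric])
qed

lemma S_expansion: "x = (\<Sum>i<n. S x (bs i) * b ^ i)"
  by (subst kc_expansion) (simp add: S_bs)

text \<open>The coordinates of \<open>x\<close> over \<open>K\<close> are the values of
  \<open>S\<close> at the integral elements \<open>bs i\<close>, so no power of \<open>w\<close> is
  lost.\<close>

lemma S_nondeg: "(\<And>y. y \<in> OL D \<Longrightarrow> S x y \<in> I m) \<Longrightarrow> x \<in> I m"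
  by (subst S_expansion) (intro I_sum I_closed(6) b_OL, simp add: bs_OL)

text \<open>The difference of the two sides is orthogonal to all powers of \<open>b\<close>, hence
  to everything.\<close>

lemma S_expansion': "x = (\<Sum>i<n. S x (b ^ i) * bs i)"
proof -
  define z where "z = x - (\<Sum>i<n. S x (b ^ i) * bs i)"
  have bb: "S (bs i) (b ^ j) = (if i = j then 1 else 0)" if "i < n" "j < n" for i j
    using S_sym[of "bs i" "b ^ j"] S_bs[OF that(1)] kc_power[OF that] invol_hom(3) by auto
  have "S z (b ^ j) = 0" if "j < n" for j
  proof -
    have "S (\<Sum>i<n. S x (b ^ i) * bs i) (b ^ j) = (\<Sum>i<n. S x (b ^ i) * (if i = j then 1 else 0))"
      unfolding S_sum by (intro sum.cong refl) (simp add: S_scale S_K bb that)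
    then show ?thesis using that by (simp add: z_def S_diff if_distrib cong: if_cong)
  qed
  then have "S z y = 0" for y
    by (subst kc_expansion[of y]) (simp add: S_sum S_scale kc_K)
  then have "z = 0" by (subst S_expansion) simp
  then show ?thesis by (simp add: z_def)
qed

section \<open>Endomorphisms of the integers of L and their trace\<close>

abbreviation "E \<equiv> End_OL D"

lemma E_D: "f \<in> E \<Longrightarrow> x \<in> OL D \<Longrightarrow> f x \<in> OL D"
  "f \<in> E \<Longrightarrow> x \<in> OL D \<Longrightarrow> y \<in> OL D \<Longrightarrow> f (x + y) = f x + f y"
  "f \<in> E \<Longrightarrow> a \<in> OF D \<Longrightarrow> x \<in> OL D \<Longrightarrow> f (a * x) = a * f x"
  by (auto simp: End_OL_def)

lemma E_I: "(\<And>x. x \<in> OL D \<Longrightarrow> f x \<in> OL D) \<Longrightarrow> (\<And>x y. x \<in> OL D \<Longrightarrow> y \<in> OL D \<Longrightarrow> f (x + y) = f x + f y) \<Longrightarrow>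
  (\<And>a x. a \<in> OF D \<Longrightarrow> x \<in> OL D \<Longrightarrow> f (a * x) = a * f x) \<Longrightarrow> f \<in> E"
  by (auto simp: End_OL_def)

lemma E_zero: "f \<in> E \<Longrightarrow> f 0 = 0" using E_D(3)[of f 0 0] OF_closed OL_closed by simp
lemma E_minus: "f \<in> E \<Longrightarrow> x \<in> OL D \<Longrightarrow> f (- x) = - f x" using E_D(3)[of f "- 1" x] OF_closed by simp
lemma E_diff: "f \<in> E \<Longrightarrow> x \<in> OL D \<Longrightarrow> y \<in> OL D \<Longrightarrow> f (x - y) = f x - f y"
  using E_D(2)[of f x "- y"] E_minus[of f y] OL_closed by simp
lemma E_sum: "f \<in> E \<Longrightarrow> (\<And>i. i \<in> A \<Longrightarrow> g i \<in> OL D) \<Longrightarrow> f (sum g A) = (\<Sum>i\<in>A. f (g i))"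
  by (induction A rule: infinite_finite_induct) (auto simp: E_zero E_D OL_sum)
lemma wF_power: "w ^ m \<in> OF D" by (intro OF_closed)
lemma w_OL: "w ^ m \<in> OL D" by (intro OL_closed)
lemma E_w: "f \<in> E \<Longrightarrow> x \<in> OL D \<Longrightarrow> f (w ^ m * x) = w ^ m * f x" by (rule E_D(3)[OF _ wF_power])
lemma E_ideal: "f \<in> E \<Longrightarrow> x \<in> I m \<Longrightarrow> f x \<in> I m"
  using I_E[of x m] w_I[of _ 0 m] E_D(1) by (auto simp: E_w I_zero)

lemma E_comp: "f \<in> E \<Longrightarrow> g \<in> E \<Longrightarrow> f \<circ> g \<in> E" by (rule E_I) (auto simp: E_D)
lemma E_add: "f \<in> E \<Longrightarrow> g \<in> E \<Longrightarrow> (\<lambda>x. f x + g x) \<in> E" by (rule E_I) (auto simp: E_D OL_closed distrib_left)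
lemma E_sub: "f \<in> E \<Longrightarrow> g \<in> E \<Longrightarrow> (\<lambda>x. f x - g x) \<in> E" by (rule E_I) (auto simp: E_D OL_closed right_diff_distrib)
lemma E_mult: "f \<in> E \<Longrightarrow> a \<in> OL D \<Longrightarrow> (\<lambda>x. a * f x) \<in> E" by (rule E_I) (auto simp: E_D OL_closed distrib_left)
lemma E_mult_by: "a \<in> OL D \<Longrightarrow> mult_by a \<in> E" unfolding mult_by_def by (rule E_I) (auto simp: OL_closed algebra_simps)
lemma E_id: "id \<in> E" "(\<lambda>x. x) \<in> E" by (rule E_I; simp)+
lemma E_one_plus: "f \<in> E \<Longrightarrow> one_plus D m f \<in> E" unfolding one_plus_def by (intro E_add E_id E_mult w_OL)
lemma E_sum_fun: "(\<And>i. i \<in> A \<Longrightarrow> f i \<in> E) \<Longrightarrow> (\<lambda>x. \<Sum>i\<in>A. f i x) \<in> E"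
  by (rule E_I) (auto simp: E_D OL_sum sum.distrib sum_distrib_left)

lemma E_expansion:
  assumes f: "f \<in> E" and x: "x \<in> OL D"
  shows "f x = (\<Sum>i<2*n. coef i x * f (\<beta> ^ i))"
proof -
  have c: "coef i x \<in> OF D" if "i < 2 * n" for i using x that OL_coef_iff by blast
  have "f x = f (\<Sum>i<2*n. coef i x * \<beta> ^ i)" by (simp add: coef)
  also have "\<dots> = (\<Sum>i<2*n. f (coef i x * \<beta> ^ i))"
    by (rule E_sum[OF f]) (use c OF_OL OL_closed beta_OL in auto)
  also have "\<dots> = (\<Sum>i<2*n. coef i x * f (\<beta> ^ i))"
    by (intro sum.cong refl E_D(3)[OF f]) (use c OL_closed beta_OL in auto)
  finally show ?thesis .
qed

lemma E_coef:
  assumes h: "\<And>i. h i \<in> OL D"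
  shows "(\<lambda>x. \<Sum>i<2*n. coef i x * h i) \<in> E"
proof (rule E_I)
  show "(\<Sum>i<2*n. coef i x * h i) \<in> OL D" if "x \<in> OL D" for x
    using that OL_coef_iff by (intro OL_sum OL_closed(5) h) (auto intro: OF_OL)
qed (simp_all add: coef_add coef_scale OF_iff sum.distrib distrib_right sum_distrib_left mult.assoc)

lemma beta_basis: "basis_on (OF D) (OL D) (2 * n) (\<lambda>i. \<beta> ^ i)" "basis_on F UNIV (2 * n) (\<lambda>i. \<beta> ^ i)"
proof -
  have u: "a i = a' i" if "\<And>i. i < 2 * n \<Longrightarrow> a i \<in> F \<and> a' i \<in> F" "(\<Sum>i<2*n. a i * \<beta> ^ i) = (\<Sum>i<2*n. a' i * \<beta> ^ i)" "i < 2 * n" for a a' i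
    using coef_eqI[of a "\<Sum>i<2*n. a i * \<beta> ^ i" i] coef_eqI[of a' "\<Sum>i<2*n. a' i * \<beta> ^ i" i] that by simp
  show "basis_on (OF D) (OL D) (2 * n) (\<lambda>i. \<beta> ^ i)"
  proof (rule basis_onI)
    show "\<exists>a. (\<forall>i<2*n. a i \<in> OF D) \<and> x = (\<Sum>i<2*n. a i * \<beta> ^ i)" if "x \<in> OL D" for x
      using that OL_coef_iff coef(2)[of x] by (intro exI[of _ "\<lambda>i. coef i x"]) auto
    show "a i = a' i" if "\<And>i. i < 2 * n \<Longrightarrow> a i \<in> OF D \<and> a' i \<in> OF D" "(\<Sum>i<2*n. a i * \<beta> ^ i) = (\<Sum>i<2*n. a' i * \<beta> ^ i)" "i < 2 * n" for a a' i
      using u[of a a' i] that by (auto simp: OF_iff)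
  qed (use OL_closed beta_OL in auto)
  show "basis_on F UNIV (2 * n) (\<lambda>i. \<beta> ^ i)"
  proof (rule basis_onI)
    show "\<exists>a. (\<forall>i<2*n. a i \<in> F) \<and> x = (\<Sum>i<2*n. a i * \<beta> ^ i)" for x
      using coef(1) coef(2)[of x] by (intro exI[of _ "\<lambda>i. coef i x"]) auto
  qed (use u in auto)
qed

definition tr :: "('a \<Rightarrow> 'a) \<Rightarrow> 'a" where "tr f = trace_on (OF D) (OL D) f"

lemma E_lin: "f \<in> E \<Longrightarrow> (\<And>i. i < N \<Longrightarrow> a i \<in> OF D) \<Longrightarrow> (\<And>i. i < N \<Longrightarrow> m i \<in> OL D) \<Longrightarrow>
    f (\<Sum>i<(N::nat). a i * m i) = (\<Sum>i<N. a i * f (m i))"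
  by (subst E_sum) (auto simp: OL_closed OF_OL E_D)

lemma tr_eq: "f \<in> E \<Longrightarrow> tr f = (\<Sum>i<2*n. coef i (f (\<beta> ^ i)))"
  unfolding tr_def
  by (rule trace_on_eq[where c = "\<lambda>i j. coef i (f (\<beta> ^ j))", OF OF_closed(1-3,5) E_lin _ beta_basis(1)])
     (use E_D(1)[OF _ OL_closed(7)[OF beta_OL]] OL_coef_iff E_D(1) coef(2) in auto)

lemma field_trace_F:
  assumes x: "x \<in> OL D"
  shows "field_trace F (\<beta> * x) = tr (mult_by x \<circ> mult_by \<beta>)"
proof -
  have "field_trace F (\<beta> * x) = (\<Sum>i<2*n. coef i (\<beta> * x * \<beta> ^ i))" unfolding field_trace_def
  proof (rule trace_on_eq[where c = "\<lambda>i j. coef i (\<beta> * x * \<beta> ^ j)", OF F_closed(1-4) _ _ beta_basis(2)])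
    show "\<beta> * x * (\<Sum>i<N. a i * m i) = (\<Sum>i<N. a i * (\<beta> * x * m i))" for a m and N :: nat
      unfolding sum_distrib_left by (intro sum.cong refl) (simp only: mult_ac)
  qed (simp_all add: coef)
  also have "\<dots> = tr (mult_by x \<circ> mult_by \<beta>)"
    by (subst tr_eq[OF E_comp[OF E_mult_by[OF x] E_mult_by[OF beta_OL]]]) (simp add: mult_by_def mult_ac)
  finally show ?thesis .
qed

lemma tr_add: "f \<in> E \<Longrightarrow> g \<in> E \<Longrightarrow> tr (\<lambda>x. f x + g x) = tr f + tr g"
  by (simp add: tr_eq E_add coef_add sum.distrib)
lemma tr_diff: "f \<in> E \<Longrightarrow> g \<in> E \<Longrightarrow> tr (\<lambda>x. f x - g x) = tr f - tr g"
  by (simp add: tr_eq E_sub coef_diff sum_subtractf)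
lemma tr_scale: "f \<in> E \<Longrightarrow> c \<in> OF D \<Longrightarrow> tr (\<lambda>x. c * f x) = c * tr f"
  by (simp add: tr_eq E_mult OF_OL coef_scale sum_distrib_left OF_iff)
lemma tr_cong: "f \<in> E \<Longrightarrow> g \<in> E \<Longrightarrow> (\<And>x. x \<in> OL D \<Longrightarrow> f x = g x) \<Longrightarrow> tr f = tr g"
  using OL_closed(7)[OF beta_OL] by (simp add: tr_eq)
lemma tr_I: "f \<in> E \<Longrightarrow> (\<And>x. x \<in> OL D \<Longrightarrow> f x \<in> I m) \<Longrightarrow> tr f \<in> I m"
  unfolding tr_eq by (intro I_sum coef_I) (use OL_closed(7)[OF beta_OL] in auto)
lemma tr_OF: "f \<in> E \<Longrightarrow> tr f \<in> OF D"
  unfolding tr_eq using E_D(1)[OF _ OL_closed(7)[OF beta_OL]] OL_coef_iff by (intro OF_sum) auto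

lemma tr_comm:
  assumes f: "f \<in> E" and g: "g \<in> E"
  shows "tr (f \<circ> g) = tr (g \<circ> f)"
proof -
  have t: "tr (f \<circ> g) = (\<Sum>j<2*n. \<Sum>k<2*n. coef k (g (\<beta> ^ j)) * coef j (f (\<beta> ^ k)))" if f: "f \<in> E" and g: "g \<in> E" for f g
  proof -
    have "coef j (f (g (\<beta> ^ j))) = (\<Sum>k<2*n. coef k (g (\<beta> ^ j)) * coef j (f (\<beta> ^ k)))" if "j < 2 * n" for j
    proof -
      have "f (g (\<beta> ^ j)) = (\<Sum>k<2*n. coef k (g (\<beta> ^ j)) * f (\<beta> ^ k))"
        by (rule E_expansion[OF f E_D(1)[OF g OL_closed(7)[OF beta_OL]]])
      then show ?thesis using that by (simp add: coef_sum coef_scale coef(1))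
    qed
    then show ?thesis using tr_eq[OF E_comp[OF f g]] by simp
  qed
  show ?thesis unfolding t[OF f g] t[OF g f] by (subst sum.swap) (simp add: mult.commute)
qed

lemma trace_form_eq: "trace_form D f g = tr (f \<circ> g)" by (simp add: trace_form_def tr_def)

text \<open>The trace in the basis formed by the \<open>b ^ i\<close> and the
  \<open>d * b ^ i\<close>, which is compatible with the structure over \<open>K\<close>.\<close>

lemma tr_alt:
  assumes f: "f \<in> E"
  shows "tr f = (\<Sum>i<n. coef (2 * i) (f (b ^ i)) + coef (2 * i) (f (d * b ^ i) / d))"
proof -
  \<comment> \<open>Even indices enumerate the \<open>b ^ i\<close>, odd ones the
    \<open>d * b ^ i\<close>; \<open>c j\<close> is the matching coordinate.\<close>
  define e where "e j = (if even j then b ^ (j div 2) else d * b ^ (j div 2))" for j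
  define c where "c j x = (if even j then coef (2 * (j div 2)) x else coef (2 * (j div 2)) (x / d))" for j x
  have eOL: "e j \<in> OL D" for j using b_OL OL_closed(5)[OF d_OL b_OL] by (simp add: e_def)
  have cF: "c j x \<in> F" for j x by (simp add: c_def coef)
  have cO: "c j x \<in> OF D" if "x \<in> OL D" "j < 2 * n" for j x
  proof -
    have "x / d \<in> OL D" using OL_closed(5)[OF that(1) inverse_d_OL] by (simp add: divide_inverse)
    then show ?thesis using that OL_coef_iff by (auto simp: c_def)
  qed
  have exp: "(\<Sum>j<2*n. c j x * e j) = x" for x
  proof -
    have "(\<Sum>j<2*n. c j x * e j) = (\<Sum>i<n. coef (2 * i) x * b ^ i + coef (2 * i) (x / d) * (d * b ^ i))"
      unfolding sum_even_odd by (intro sum.cong) (auto simp: c_def e_def)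
    also have "\<dots> = (\<Sum>i<n. kc i x * b ^ i)" by (intro sum.cong) (auto simp: kc_def algebra_simps)
    finally show ?thesis using kc_expansion by simp
  qed
  have c_sum: "c j (\<Sum>i<2*n. a i * e i) = a j" if a: "\<And>i. i < 2 * n \<Longrightarrow> a i \<in> F" and j: "j < 2 * n" for a j
  proof -
    have "(\<Sum>i<2*n. a i * e i) = (\<Sum>i<n. (a (2 * i) + d * a (2 * i + 1)) * b ^ i)"
      unfolding sum_even_odd by (intro sum.cong) (auto simp: e_def algebra_simps)
    then have k: "kc i (\<Sum>i<2*n. a i * e i) = a (2 * i) + d * a (2 * i + 1)" if "i < n" for i
      using K_basis_unique[of "\<lambda>i. a (2 * i) + d * a (2 * i + 1)" i] a that d(1) F_K K_closed(3,4) by simp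
    have i: "j div 2 < n" using j by auto
    then have aF: "a (2 * (j div 2)) \<in> F" "a (2 * (j div 2) + 1) \<in> F" using a by auto
    have "coef (2 * (j div 2)) (\<Sum>i<2*n. a i * e i) = a (2 * (j div 2))"
      using re_kc[of "j div 2" "\<Sum>i<2*n. a i * e i"] k[OF i] re_FK[OF aF] by simp
    moreover have "coef (2 * (j div 2)) ((\<Sum>i<2*n. a i * e i) / d) = a (2 * (j div 2) + 1)"
    proof -
      have "(a (2 * (j div 2)) + d * a (2 * (j div 2) + 1)) / d = a (2 * (j div 2) + 1) + d * (a (2 * (j div 2)) / d ^ 2)"
        using d_nonzero by (simp add: field_simps power2_eq_square)
      then show ?thesis using im_kc[of "j div 2" "\<Sum>i<2*n. a i * e i"] k[OF i] re_FK[OF aF(2) subfield_divide[OF subfields(1) aF(1) d2_F]] by simp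
    qed
    moreover have "2 * (j div 2) = j" if "even j" using that by auto
    moreover have "2 * (j div 2) + 1 = j" if "odd j" using that by presburger
    ultimately show ?thesis unfolding c_def by metis
  qed
  have basis: "basis_on (OF D) (OL D) (2 * n) e"
  proof (rule basis_onI)
    show "\<exists>a. (\<forall>i<2*n. a i \<in> OF D) \<and> x = (\<Sum>i<2*n. a i * e i)" if "x \<in> OL D" for x
      using exp[of x] cO[OF that] by (intro exI[of _ "\<lambda>i. c i x"]) auto
    show "a i = a' i" if "\<And>i. i < 2 * n \<Longrightarrow> a i \<in> OF D \<and> a' i \<in> OF D" "(\<Sum>i<2*n. a i * e i) = (\<Sum>i<2*n. a' i * e i)" "i < 2 * n" for a a' i
      using c_sum[of a i] c_sum[of a' i] that by (simp add: OF_iff)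
  qed (use eOL in auto)
  have "tr f = (\<Sum>j<2*n. c j (f (e j)))" unfolding tr_def
    by (rule trace_on_eq[where c = "\<lambda>i j. c i (f (e j))", OF OF_closed(1-3,5) E_lin[OF f] _ basis])
       (use E_D(1)[OF f] cO eOL exp in auto)
  also have "\<dots> = (\<Sum>i<n. coef (2 * i) (f (b ^ i)) + coef (2 * i) (f (d * b ^ i) / d))"
    unfolding sum_even_odd by (intro sum.cong) (auto simp: c_def e_def)
  finally show ?thesis .
qed

text \<open>Over \<open>K\<close> the trace is \<open>S a c\<close>; the trace from \<open>K\<close>
  to \<open>F\<close> turns it into \<open>S a c + \<iota> (S a c)\<close>, which is
  \<open>2 * re (S a c)\<close>.\<close>

lemma tr_rank_one:
  assumes a: "a \<in> OL D" and c: "c \<in> OL D"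
  shows "(\<lambda>x. S x c * a) \<in> E" "tr (\<lambda>x. S x c * a) = 2 * re (S a c)"
proof -
  show f: "(\<lambda>x. S x c * a) \<in> E"
    by (rule E_I) (use a c S_OL OL_closed(5) F_K in \<open>auto simp: S_add S_scale algebra_simps OF_iff\<close>)
  have "tr (\<lambda>x. S x c * a) = (\<Sum>i<n. 2 * re (S (b ^ i) c * kc i a))"
    unfolding tr_alt[OF f]
  proof (rule sum.cong[OF refl])
    fix i assume "i \<in> {..<n}"
    then have i: "i < n" by simp
    have "coef (2 * i) (S (b ^ i) c * a) = re (S (b ^ i) c * kc i a)"
      using re_kc[of i "S (b ^ i) c * a"] kc_scale[OF S_K i] by simp
    moreover have "S (d * b ^ i) c * a / d = S (b ^ i) c * a" using d_nonzero by (simp add: S_scale d(1))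
    ultimately show "coef (2 * i) (S (b ^ i) c * a) + coef (2 * i) (S (d * b ^ i) c * a / d) = 2 * re (S (b ^ i) c * kc i a)"
      by simp
  qed
  also have "\<dots> = 2 * re (\<Sum>i<n. S (b ^ i) c * kc i a)" by (simp add: re_sum sum_distrib_left)
  also have "(\<Sum>i<n. S (b ^ i) c * kc i a) = S a c"
    by (subst (3) kc_expansion) (simp add: S_sum S_scale kc_K mult.commute)
  finally show "tr (\<lambda>x. S x c * a) = 2 * re (S a c)" .
qed

section \<open>Skew endomorphisms and the trace form\<close>

text \<open>Represents an element of the Lie algebra modulo the \<open>m\<close>-th power of the
  maximal ideal. Linearity over \<open>K\<close> is a consequence, again modulo that power.\<close>

definition skew :: "nat \<Rightarrow> ('a \<Rightarrow> 'a) \<Rightarrow> bool" where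
  "skew m f \<longleftrightarrow> f \<in> E \<and> (\<forall>x\<in>OL D. \<forall>y\<in>OL D. S (f x) y + S x (f y) \<in> I m)"

lemma skewD: "skew m f \<Longrightarrow> f \<in> E" "skew m f \<Longrightarrow> x \<in> OL D \<Longrightarrow> y \<in> OL D \<Longrightarrow> S (f x) y + S x (f y) \<in> I m"
  by (auto simp: skew_def)

lemma lie_E: "f \<in> lie_O D \<Longrightarrow> f \<in> E" by (simp add: lie_O_def)
lemma lie_skew: "f \<in> lie_O D \<Longrightarrow> skew m f" by (simp add: lie_O_def skew_def I_closed)

lemma OL_K_split:
  assumes z: "z \<in> K" "z \<in> OL D"
  shows "re z \<in> OF D \<and> re (z / d) \<in> OF D"
proof -
  have "z / d \<in> K" "z / d \<in> OL D"
    using subfield_divide[OF subfields(2) z(1) d(1)] OL_closed(5)[OF z(2) inverse_d_OL] by (auto simp: divide_inverse)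
  then show ?thesis using z re_I[of z 0] re_I[of "z / d" 0] re_F by (auto simp: I_zero OF_iff OL_iff)
qed

text \<open>Moving \<open>f\<close> across the form and back shows that
  \<open>S (f (d * x)) y\<close> and \<open>d * S (f x) y\<close> agree modulo \<open>I m\<close>,
  and the form is non-degenerate there. Linearity over the integers of \<open>F\<close> does the
  rest, since the components of \<open>z\<close> along \<open>1\<close> and \<open>d\<close> are
  integral.\<close>

lemma skew_K_linear:
  assumes f: "skew m f" and z: "z \<in> K" "z \<in> OL D" and x: "x \<in> OL D"
  shows "f (z * x) - z * f x \<in> I m"
proof -
  note fE = skewD(1)[OF f]
  have D: "f (d * x) - d * f x \<in> I m" if x: "x \<in> OL D" for x
  proof (rule S_nondeg)
    fix y assume y: "y \<in> OL D"
    note O = OL_closed(5)[OF d_OL x]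
    have "S (f (d * x) - d * f x) y = (S (f (d * x)) y + S (d * x) (f y)) - d * (S (f x) y + S x (f y))"
      unfolding S_diff S_scale(1)[OF d(1)] by (simp add: distrib_left)
    then show "S (f (d * x) - d * f x) y \<in> I m"
      using I_closed(3)[OF skewD(2)[OF f O y] I_closed(5)[OF d_OL skewD(2)[OF f x y]]] by simp
  qed
  let ?p = "re z" and ?q = "re (z / d)"
  have pq: "?p \<in> OF D" "?q \<in> OF D" using OL_K_split[OF z] by auto
  have e: "z * x = ?p * x + d * (?q * x)" by (subst re_im[of z]) (simp add: algebra_simps)
  have O: "?p * x \<in> OL D" "?q * x \<in> OL D" "d * (?q * x) \<in> OL D" using pq OF_OL x OL_closed(5) d_OL by auto
  have "f (z * x) = ?p * f x + f (d * (?q * x))"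
    unfolding e E_D(2)[OF fE O(1,3)] E_D(3)[OF fE pq(1) x] ..
  moreover have "z * f x = ?p * f x + d * f (?q * x)"
    unfolding E_D(3)[OF fE pq(2) x] by (subst re_im[of z]) (simp only: distrib_right mult.assoc)
  ultimately have "f (z * x) - z * f x = f (d * (?q * x)) - d * f (?q * x)" by (simp only: add_diff_cancel_left)
  then show ?thesis using D[OF O(2)] by simp
qed

text \<open>These elements of the Lie algebra, of rank at most two over \<open>K\<close>, suffice for the perfect pairing.\<close>

definition xab :: "'a \<Rightarrow> 'a \<Rightarrow> 'a \<Rightarrow> 'a" where "xab a c x = S x c * a - S x a * c"

lemma xab_lie:
  assumes ac: "a \<in> OL D" "c \<in> OL D"
  shows "xab a c \<in> lie_O D"
proof -
  have "xab a c \<in> E" unfolding xab_def[abs_def] by (intro E_sub tr_rank_one(1) ac)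
  moreover have "S (xab a c x) y + S x (xab a c y) = 0" for x y
  proof -
    have "S x (xab a c y) = S c y * S x a - S a y * S x c"
      by (simp add: xab_def S_diff S_scale S_K S_sym[of c y, symmetric] S_sym[of a y, symmetric] S_sym[symmetric])
    then show ?thesis by (simp add: xab_def S_diff S_scale S_K)
  qed
  ultimately show ?thesis by (simp add: lie_O_def)
qed

lemma xab_scale: "t \<in> F \<Longrightarrow> xab (t * a) c = (\<lambda>x. t * xab a c x)"
  unfolding xab_def S_scale(2)[OF F_K] by (rule ext) (simp add: invol_aut(2) right_diff_distrib)

text \<open>Modulo \<open>I m\<close>, \<open>f\<close> is linear over \<open>K\<close>, so
  \<open>f \<circ> xab a c\<close> is a difference of two rank one maps, with traces
  \<open>2 * re (S (f a) c)\<close> and \<open>2 * re (S (f c) a)\<close>. Skewness of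
  \<open>f\<close> makes the second the negative of the first.\<close>

lemma tr_xab:
  assumes f: "skew m f" and a: "a \<in> OL D" and c: "c \<in> OL D"
  shows "tr (xab a c \<circ> f) - 4 * re (S (f a) c) \<in> I m"
proof -
  note fE = skewD(1)[OF f]
  note fa = E_D(1)[OF fE a] and fc = E_D(1)[OF fE c]
  have E1: "f \<circ> xab a c \<in> E" by (intro E_comp fE lie_E xab_lie a c)
  let ?g = "\<lambda>x. S x c * f a - S x a * f c"
  have E2: "?g \<in> E" by (intro E_sub tr_rank_one(1) fa fc a c)
  have "(f \<circ> xab a c) x - ?g x \<in> I m" if x: "x \<in> OL D" for x
  proof -
    have O: "S x c \<in> OL D" "S x a \<in> OL D" using S_OL x a c by auto
    have "(f \<circ> xab a c) x - ?g x = (f (S x c * a) - S x c * f a) - (f (S x a * c) - S x a * f c)"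
      using E_diff[OF fE OL_closed(5)[OF O(1) a] OL_closed(5)[OF O(2) c]] by (simp add: xab_def)
    also have "\<dots> \<in> I m" by (intro I_closed(3) skew_K_linear[OF f] S_K O a c)
    finally show ?thesis .
  qed
  then have t1: "tr (f \<circ> xab a c) - tr ?g \<in> I m"
    using tr_I[OF E_sub[OF E1 E2], of m] tr_diff[OF E1 E2] by simp
  have "tr ?g = 2 * re (S (f a) c) - 2 * re (S (f c) a)"
    using tr_diff[OF tr_rank_one(1)[OF fa c] tr_rank_one(1)[OF fc a]] tr_rank_one(2)[OF fa c] tr_rank_one(2)[OF fc a] by simp
  moreover have "re (S (f c) a) + re (S (f a) c) \<in> I m"
  proof -
    have "S (f c) a + S c (f a) \<in> I m" by (rule skewD(2)[OF f c a])
    then have "re (S (f c) a + S c (f a)) \<in> I m" by (rule re_I)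
    then show ?thesis using re_invol[of "S (f a) c"] S_sym[of c "f a"] by (simp add: re_add)
  qed
  then have "of_nat 2 * (re (S (f c) a) + re (S (f a) c)) \<in> I m" by (rule I_closed(5)[OF OL_of_nat])
  then have "- (of_nat 2 * (re (S (f c) a) + re (S (f a) c))) \<in> I m" by (rule I_closed(4))
  moreover have "2 * p - 2 * q - 4 * p = - (of_nat 2 * (q + p))" for p q :: 'a by simp
  ultimately have "tr ?g - 4 * re (S (f a) c) \<in> I m" by (simp only:)
  then have "(tr (f \<circ> xab a c) - tr ?g) + (tr ?g - 4 * re (S (f a) c)) \<in> I m" using t1 I_closed(2) by blast
  then show ?thesis using tr_comm[OF fE lie_E[OF xab_lie[OF a c]]] by simp
qed

abbreviation "\<tau> \<equiv> tau D"

lemma tau_OF: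
  assumes "x \<in> OF D"
  shows "\<tau> x = 1"
proof -
  from assms have "x \<in> {x \<in> F. \<forall>y\<in>OF D. \<tau> (x * y) = 1}" by (simp only: tau_conductor)
  then show ?thesis using OF_closed(2) by force
qed

lemma tau_conductorD: "x \<in> F \<Longrightarrow> (\<And>y. y \<in> OF D \<Longrightarrow> \<tau> (x * y) = 1) \<Longrightarrow> x \<in> OF D"
  by (subst tau_conductor[symmetric]) simp

lemma tau_cong: "x \<in> F \<Longrightarrow> y \<in> F \<Longrightarrow> x - y \<in> OL D \<Longrightarrow> \<tau> x = \<tau> y"
  using tau_add[of "x - y" y] tau_OF[of "x - y"] subfield_diff[OF subfields(1)] by (simp add: OF_iff OL_iff)

lemma iw_F: "inverse (w ^ m) \<in> F" using subfield_inverse[OF subfields(1)] subfield_power[OF subfields(1)] wF by blast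
lemma iw_I: "inverse (w ^ m) * x \<in> OL D \<longleftrightarrow> x \<in> I m"
proof -
  have "w ^ m * (inverse (w ^ m) * x) = x" using w0 by simp
  then show ?thesis using w_I_iff[of m "inverse (w ^ m) * x" 0] by (simp only: I_zero add.right_neutral)
qed

text \<open>Testing against \<open>xab (y * a) c\<close> for all integers \<open>y\<close> of
  \<open>F\<close>, the conductor of \<open>\<tau>\<close> turns triviality of the character into a
  congruence for \<open>4 * re (S (f a) c)\<close>, and \<open>4\<close> is a unit. This controls
  one component of \<open>S (f a) c\<close>; the other follows with \<open>c / d\<close> in place of
  \<open>c\<close>.\<close>

theorem trace_perfect:
  assumes f: "skew m f" and t: "\<And>g. g \<in> lie_O D \<Longrightarrow> \<tau> (inverse (w ^ m) * tr (g \<circ> f)) = 1" and a: "a \<in> OL D"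
  shows "f a \<in> I m"
proof -
  note fE = skewD(1)[OF f]
  have re: "re (S (f a) c) \<in> I m" if c: "c \<in> OL D" for c
  proof -
    note xE = lie_E[OF xab_lie[OF a c]]
    have trF: "tr (xab a c \<circ> f) \<in> F" using tr_OF[OF E_comp[OF xE fE]] by (simp add: OF_iff)
    have "inverse (w ^ m) * tr (xab a c \<circ> f) \<in> OF D"
    proof (rule tau_conductorD)
      show "inverse (w ^ m) * tr (xab a c \<circ> f) \<in> F" using F_closed(4) iw_F trF by simp
      fix y assume y: "y \<in> OF D"
      have "tr (xab (y * a) c \<circ> f) = y * tr (xab a c \<circ> f)"
        using tr_scale[OF E_comp[OF xE fE] y] xab_scale[of y a c] y by (simp add: comp_def OF_iff)
      then show "\<tau> (inverse (w ^ m) * tr (xab a c \<circ> f) * y) = 1"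
        using t[OF xab_lie[OF OL_closed(5)[OF OF_OL[OF y] a] c]] by (simp add: mult_ac)
    qed
    then have "tr (xab a c \<circ> f) \<in> I m" using iw_I OF_OL by blast
    then have "4 * re (S (f a) c) \<in> I m" using I_cong[OF tr_xab[OF f a c]] by blast
    then have "(1 / 2 * (1 / 2)) * (4 * re (S (f a) c)) \<in> I m" using I_closed(5)[OF OL_closed(5)[OF half_OL half_OL]] by blast
    then show ?thesis using two_nonzero four_nonzero by simp
  qed
  show ?thesis
  proof (rule S_nondeg)
    fix c assume c: "c \<in> OL D"
    have "S (f a) (c / d) = - (S (f a) c / d)"
      using S_scale(2)[OF subfield_inverse[OF subfields(2) d(1)], of "f a" c] by (simp add: divide_inverse invol_inverse d(2) mult.commute)
    moreover have "c / d \<in> OL D" using OL_closed(5)[OF c inverse_d_OL] by (simp add: divide_inverse)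
    ultimately have "re (- (S (f a) c / d)) \<in> I m" using re[of "c / d"] by simp
    then have "re (S (f a) c / d) \<in> I m" using I_closed(4) re_scale[of "- 1" "S (f a) c / d"] F_closed(2,5) by fastforce
    then show "S (f a) c \<in> I m" by (subst re_im) (intro I_closed(2) I_closed(5)[OF d_OL] re c)
  qed
qed

text \<open>For an exactly skew \<open>f\<close>, expanding \<open>x\<close> and \<open>f x\<close>
  gives \<open>f x\<close> both as the sum of the \<open>S x (bs i) * f (b ^ i)\<close> and as minus
  the sum of the \<open>S x (f (b ^ i)) * bs i\<close>. The mean of these is half a sum of maps
  \<open>xab\<close>, which is exactly skew even if \<open>f\<close> is so only modulo
  \<open>I m\<close>, and then it agrees with \<open>f\<close> modulo \<open>I m\<close>. It is
  needed because \<open>psi\<close> is defined through exact elements of the Lie algebra.\<close>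

theorem skew_lift:
  assumes f: "skew m f"
  obtains g where "g \<in> lie_O D" "\<And>x. x \<in> OL D \<Longrightarrow> g x - f x \<in> I m"
proof -
  note fE = skewD(1)[OF f]
  define g where "g x = (\<Sum>i<n. (1 / 2) * xab (f (b ^ i)) (bs i) x)" for x
  have fb: "f (b ^ i) \<in> OL D" for i by (rule E_D(1)[OF fE b_OL])
  have xl: "xab (f (b ^ i)) (bs i) \<in> lie_O D" for i by (rule xab_lie[OF fb bs_OL])
  have half: "1 / 2 \<in> F" using half_OF by (simp add: OF_iff)
  have "g \<in> E" unfolding g_def[abs_def] by (intro E_sum_fun E_mult half_OL lie_E xl)
  moreover have "S (g x) y + S x (g y) = 0" if "x \<in> OL D" "y \<in> OL D" for x y
  proof -
    have "S (g x) y + S x (g y) = (\<Sum>i<n. (1 / 2) * (S (xab (f (b ^ i)) (bs i) x) y + S x (xab (f (b ^ i)) (bs i) y)))"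
      using half by (simp only: g_def S_sum S_scale F_K invol_aut(2) sum.distrib[symmetric] distrib_left)
    also have "\<dots> = 0" using xl that by (intro sum.neutral) (auto simp: lie_O_def)
    finally show ?thesis .
  qed
  ultimately have gl: "g \<in> lie_O D" by (simp add: lie_O_def)
  have "g x - f x \<in> I m" if x: "x \<in> OL D" for x
  proof -
    have kO: "S x (bs i) \<in> OL D" for i by (rule S_OL[OF x bs_OL])
    have A: "(\<Sum>i<n. S x (bs i) * f (b ^ i)) - f x \<in> I m"
    proof -
      have "f x = (\<Sum>i<n. f (S x (bs i) * b ^ i))"
        by (subst S_expansion[of x], rule E_sum[OF fE]) (intro OL_closed(5) kO b_OL)
      then have "f x - (\<Sum>i<n. S x (bs i) * f (b ^ i)) = (\<Sum>i<n. f (S x (bs i) * b ^ i) - S x (bs i) * f (b ^ i))"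
        by (simp add: sum_subtractf)
      also have "\<dots> \<in> I m" by (intro I_sum skew_K_linear[OF f] S_K kO b_OL)
      finally have "- (f x - (\<Sum>i<n. S x (bs i) * f (b ^ i))) \<in> I m" by (rule I_closed(4))
      then show ?thesis by simp
    qed
    have B: "(\<Sum>i<n. S x (f (b ^ i)) * bs i) + f x \<in> I m"
    proof -
      have "(\<Sum>i<n. S x (f (b ^ i)) * bs i) + f x = (\<Sum>i<n. (S (f x) (b ^ i) + S x (f (b ^ i))) * bs i)"
        unfolding distrib_right sum.distrib S_expansion'[of "f x", symmetric] by (rule add.commute)
      also have "\<dots> \<in> I m" by (intro I_sum I_closed(6) bs_OL skewD(2)[OF f x b_OL])
      finally show ?thesis .
    qed
    have "g x = (1 / 2) * ((\<Sum>i<n. S x (bs i) * f (b ^ i)) - (\<Sum>i<n. S x (f (b ^ i)) * bs i))"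
      unfolding g_def xab_def by (simp add: sum_subtractf sum_distrib_left right_diff_distrib)
    moreover have "1 / 2 * (p - q) - z = 1 / 2 * ((p - z) - (q + z))" for p q z :: 'a
      using two_nonzero by (simp add: field_simps)
    ultimately have "g x - f x = (1 / 2) * (((\<Sum>i<n. S x (bs i) * f (b ^ i)) - f x) - ((\<Sum>i<n. S x (f (b ^ i)) * bs i) + f x))"
      by (simp only:)
    then show ?thesis using I_closed(5)[OF half_OL I_closed(3)[OF A B]] by (simp only:)
  qed
  then show ?thesis using that gl by blast
qed

section \<open>Reduction modulo powers of the maximal ideal\<close>

lemma ROL_simps: "x \<oplus>\<^bsub>ROL D\<^esub> y = x + y" "x \<otimes>\<^bsub>ROL D\<^esub> y = x * y" "\<zero>\<^bsub>ROL D\<^esub> = 0" "\<one>\<^bsub>ROL D\<^esub> = 1" "carrier (ROL D) = OL D"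
  by (simp_all add: ring_ints_def ring_of_type_algebra_def)

lemma cls_eq_set: "cls D m x = {y. y - x \<in> I m}"
proof -
  have "cls D m x = (\<lambda>h. h + x) ` I m" by (auto simp: cls_def a_r_coset_def' ROL_simps)
  moreover have "y \<in> (\<lambda>h. h + x) ` I m \<longleftrightarrow> y - x \<in> I m" for y
    using image_eqI[of y "\<lambda>h. h + x" "y - x" "I m"] by auto
  ultimately show ?thesis by auto
qed

lemma cls_refl: "x \<in> cls D m x" by (simp add: cls_eq_set I_closed)

lemma cls_eq: "cls D m x = cls D m y \<longleftrightarrow> x - y \<in> I m"
proof
  assume "cls D m x = cls D m y"
  then show "x - y \<in> I m" using cls_refl[of x m] by (simp add: cls_eq_set)
next
  assume h: "x - y \<in> I m"
  have "z - x \<in> I m \<longleftrightarrow> z - y \<in> I m" for z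
    using I_closed(2)[OF _ h, of "z - x"] I_closed(3)[OF _ h, of "z - y"] by auto
  then show "cls D m x = cls D m y" by (simp add: cls_eq_set)
qed

lemma cls_mem: "y \<in> cls D m x \<longleftrightarrow> y - x \<in> I m" by (simp add: cls_eq_set)

lemma cls_OL: "x \<in> OL D \<Longrightarrow> y \<in> cls D m x \<Longrightarrow> y \<in> OL D"
  using OL_closed(3)[of "y - x" x] I_OL by (fastforce simp: cls_mem)

lemma carrier_Q: "carrier (Q D m) = cls D m ` OL D"
  by (auto simp: Q_def FactRing_def A_RCOSETS_def' cls_def ROL_simps)

lemma cls_Q: "x \<in> OL D \<Longrightarrow> cls D m x \<in> carrier (Q D m)" by (simp add: carrier_Q)

lemma Q_E: "C \<in> carrier (Q D m) \<Longrightarrow> (\<And>x. x \<in> OL D \<Longrightarrow> C = cls D m x \<Longrightarrow> P) \<Longrightarrow> P" by (auto simp: carrier_Q)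

lemma Q_ops: "x \<in> OL D \<Longrightarrow> y \<in> OL D \<Longrightarrow> cls D m x \<oplus>\<^bsub>Q D m\<^esub> cls D m y = cls D m (x + y)"
  "x \<in> OL D \<Longrightarrow> y \<in> OL D \<Longrightarrow> cls D m x \<otimes>\<^bsub>Q D m\<^esub> cls D m y = cls D m (x * y)" "\<zero>\<^bsub>Q D m\<^esub> = cls D m 0"
proof -
  interpret ideal "I m" "ROL D" by (rule I_ideal)
  note h = rcos_ring_hom
  show "x \<in> OL D \<Longrightarrow> y \<in> OL D \<Longrightarrow> cls D m x \<oplus>\<^bsub>Q D m\<^esub> cls D m y = cls D m (x + y)"
    using ring_hom_add[OF h, of x y] by (simp add: Q_def cls_def ROL_simps)
  show "x \<in> OL D \<Longrightarrow> y \<in> OL D \<Longrightarrow> cls D m x \<otimes>\<^bsub>Q D m\<^esub> cls D m y = cls D m (x * y)"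
    using ring_hom_mult[OF h, of x y] by (simp add: Q_def cls_def ROL_simps)
  show "\<zero>\<^bsub>Q D m\<^esub> = cls D m 0" by (simp add: Q_def FactRing_def cls_eq_set)
qed

text \<open>Operations on cosets are defined as unions over representatives; a constant family
  collapses to its value, as cosets are not empty.\<close>

lemma cls_UN: "(\<And>y. y \<in> cls D m x \<Longrightarrow> f y = c) \<Longrightarrow> (\<Union>y\<in>cls D m x. f y) = c"
  using cls_refl by fastforce

text \<open>Representatives are functions on the whole field, of which only the values on
  \<open>O_L\<close> matter.\<close>

definition cg :: "nat \<Rightarrow> ('a \<Rightarrow> 'a) \<Rightarrow> ('a \<Rightarrow> 'a) \<Rightarrow> bool" where
  "cg m f g \<longleftrightarrow> (\<forall>x\<in>OL D. f x - g x \<in> I m)"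

lemma cgD: "cg m f g \<Longrightarrow> x \<in> OL D \<Longrightarrow> f x - g x \<in> I m" by (simp add: cg_def)
lemma cgI: "(\<And>x. x \<in> OL D \<Longrightarrow> f x - g x \<in> I m) \<Longrightarrow> cg m f g" by (simp add: cg_def)
lemma cg_refl: "cg m f f" by (simp add: cg_def I_closed)
lemma cg_sym: "cg m f g \<Longrightarrow> cg m g f" unfolding cg_def using I_closed(4) by fastforce
lemma cg_trans: "cg m f g \<Longrightarrow> cg m g h \<Longrightarrow> cg m f h" unfolding cg_def using I_closed(2) by fastforce
lemma cg_antimono: "cg m f g \<Longrightarrow> k \<le> m \<Longrightarrow> cg k f g" unfolding cg_def using I_antimono by blast
lemma cg_comp: "cg m f f' \<Longrightarrow> cg m g g' \<Longrightarrow> f \<in> E \<Longrightarrow> g \<in> E \<Longrightarrow> g' \<in> E \<Longrightarrow> cg m (f \<circ> g) (f' \<circ> g')"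
proof (rule cgI)
  fix x assume h: "cg m f f'" "cg m g g'" "f \<in> E" "g \<in> E" "g' \<in> E" and x: "x \<in> OL D"
  have "f (g x) - f (g' x) \<in> I m"
    using E_ideal[OF h(3) cgD[OF h(2) x]] E_diff[OF h(3) E_D(1)[OF h(4) x] E_D(1)[OF h(5) x]] by simp
  moreover have "f (g' x) - f' (g' x) \<in> I m" by (rule cgD[OF h(1) E_D(1)[OF h(5) x]])
  ultimately have "(f (g x) - f (g' x)) + (f (g' x) - f' (g' x)) \<in> I m" by (rule I_closed(2))
  then show "(f \<circ> g) x - (f' \<circ> g') x \<in> I m" by simp
qed
lemma cg_tr: "f \<in> E \<Longrightarrow> g \<in> E \<Longrightarrow> cg m f g \<Longrightarrow> tr f - tr g \<in> I m"
  using tr_I[OF E_sub[of f g], of m] tr_diff[of f g] by (simp add: cg_def)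

lemma red_End_cls:
  assumes f: "f \<in> E" and x: "x \<in> OL D"
  shows "red_End D m f (cls D m x) = cls D m (f x)"
proof -
  have "(\<Union>y\<in>cls D m x. cls D m (f y)) = cls D m (f x)"
  proof (rule cls_UN)
    fix y assume y: "y \<in> cls D m x"
    then have "f (y - x) \<in> I m" using E_ideal[OF f] by (simp add: cls_mem)
    then show "cls D m (f y) = cls D m (f x)" using E_diff[OF f cls_OL[OF x y] x] by (simp add: cls_eq)
  qed
  then show ?thesis by (simp add: red_End_def cls_Q x)
qed

lemma red_End_ext: "red_End D m f \<in> extensional (carrier (Q D m))" by (simp add: red_End_def)

lemma ext_eqI: "g \<in> extensional (carrier (Q D m)) \<Longrightarrow> h \<in> extensional (carrier (Q D m)) \<Longrightarrow>
   (\<And>x. x \<in> OL D \<Longrightarrow> g (cls D m x) = h (cls D m x)) \<Longrightarrow> g = h"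
  by (rule extensionalityI) (auto simp: carrier_Q)

lemma red_End_eq: "f \<in> E \<Longrightarrow> g \<in> E \<Longrightarrow> red_End D m f = red_End D m g \<longleftrightarrow> cg m f g"
proof
  assume h: "f \<in> E" "g \<in> E" "red_End D m f = red_End D m g"
  show "cg m f g"
  proof (rule cgI)
    fix x assume x: "x \<in> OL D"
    have "cls D m (f x) = cls D m (g x)" using red_End_cls[OF h(1) x, of m] red_End_cls[OF h(2) x, of m] h(3) by simp
    then show "f x - g x \<in> I m" by (simp only: cls_eq)
  qed
next
  assume h: "f \<in> E" "g \<in> E" "cg m f g"
  show "red_End D m f = red_End D m g"
    by (rule ext_eqI[OF red_End_ext red_End_ext]) (simp only: red_End_cls h(1,2) cls_eq cgD[OF h(3)])
qed

lemma red_End_carrier: "f \<in> E \<Longrightarrow> C \<in> carrier (Q D m) \<Longrightarrow> red_End D m f C \<in> carrier (Q D m)"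
  by (erule Q_E) (simp add: red_End_cls cls_Q E_D)

lemma red_End_comp: "f \<in> E \<Longrightarrow> g \<in> E \<Longrightarrow>
  compose (carrier (Q D m)) (red_End D m f) (red_End D m g) = red_End D m (f \<circ> g)"
  by (rule ext_eqI[OF _ red_End_ext]) (auto simp: compose_def cls_Q red_End_cls E_comp E_D)

lemma red_End_End_Q:
  assumes f: "f \<in> E"
  shows "red_End D m f \<in> End_Q D m"
proof -
  have "red_End D m f \<in> hom (add_monoid (Q D m)) (add_monoid (Q D m))"
  proof (rule homI; simp)
    fix C C' assume "C \<in> carrier (Q D m)" "C' \<in> carrier (Q D m)"
    then show "red_End D m f (C \<oplus>\<^bsub>Q D m\<^esub> C') = red_End D m f C \<oplus>\<^bsub>Q D m\<^esub> red_End D m f C'"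
      by (elim Q_E) (simp add: Q_ops red_End_cls f E_D OL_closed(3))
  qed (rule red_End_carrier[OF f])
  moreover have "red_End D m f (cls D m a \<otimes>\<^bsub>Q D m\<^esub> C) = cls D m a \<otimes>\<^bsub>Q D m\<^esub> red_End D m f C" if "a \<in> OF D" "C \<in> carrier (Q D m)" for a C
    using that(2) by (rule Q_E) (simp add: that(1) Q_ops red_End_cls f E_D OL_closed OF_OL)
  ultimately show ?thesis by (simp add: End_Q_def red_End_ext)
qed

text \<open>\<open>O_L\<close> is free on the powers of \<open>\<beta>\<close>, so representatives
  of the images of these powers can be chosen freely and extended linearly.\<close>

lemma End_Q_lift:
  assumes "g \<in> End_Q D m" obtains f where "f \<in> E" "g = red_End D m f"
proof -
  have g: "g \<in> carrier (Q D m) \<rightarrow> carrier (Q D m)"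
    "\<And>C C'. C \<in> carrier (Q D m) \<Longrightarrow> C' \<in> carrier (Q D m) \<Longrightarrow> g (C \<oplus>\<^bsub>Q D m\<^esub> C') = g C \<oplus>\<^bsub>Q D m\<^esub> g C'"
    "\<And>a C. a \<in> OF D \<Longrightarrow> C \<in> carrier (Q D m) \<Longrightarrow> g (cls D m a \<otimes>\<^bsub>Q D m\<^esub> C) = cls D m a \<otimes>\<^bsub>Q D m\<^esub> g C"
    "g \<in> extensional (carrier (Q D m))"
    using assms by (auto simp: End_Q_def hom_def)
  have "\<exists>y. y \<in> OL D \<and> g (cls D m x) = cls D m y" if "x \<in> OL D" for x
    using funcset_mem[OF g(1) cls_Q[OF that]] by (auto simp: carrier_Q)
  then obtain h where h: "\<And>x. x \<in> OL D \<Longrightarrow> h x \<in> OL D \<and> g (cls D m x) = cls D m (h x)" by metis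
  define f where "f x = (\<Sum>i<2*n. coef i x * h (\<beta> ^ i))" for x
  have bO: "\<beta> ^ i \<in> OL D" for i by (rule OL_closed(7)[OF beta_OL])
  have f: "f \<in> E" unfolding f_def[abs_def] by (rule E_coef) (use h bO in blast)
  have z: "g (cls D m 0) = cls D m 0"
    using g(3)[OF OF_closed(1) cls_Q[OF OL_closed(1)]] h[OF OL_closed(1)] by (simp add: Q_ops OL_closed)
  have lin: "g (cls D m (\<Sum>i<N. a i * \<beta> ^ i)) = cls D m (\<Sum>i<N. a i * h (\<beta> ^ i))" if "\<And>i. i < N \<Longrightarrow> a i \<in> OF D" for a and N :: nat
    using that
  proof (induction N)
    case 0
    then show ?case by (simp add: z)
  next
    case (Suc N)
    have a: "a N \<in> OF D" "a N \<in> OL D" and aO: "\<And>i. i < N \<Longrightarrow> a i \<in> OL D" using Suc.prems OF_OL by auto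
    have s: "(\<Sum>i<N. a i * \<beta> ^ i) \<in> OL D" "(\<Sum>i<N. a i * h (\<beta> ^ i)) \<in> OL D" using aO h bO by (auto intro!: OL_sum OL_closed(5))
    have t: "a N * \<beta> ^ N \<in> OL D" "a N * h (\<beta> ^ N) \<in> OL D" using a h bO by (auto intro!: OL_closed(5))
    have "g (cls D m (a N * \<beta> ^ N)) = cls D m (a N * h (\<beta> ^ N))"
      using g(3)[OF a(1) cls_Q[OF bO], of N] h[OF bO[of N]] a(2) bO[of N] by (simp add: Q_ops)
    then show ?case using g(2)[OF cls_Q[OF s(1)] cls_Q[OF t(1)]] Suc s t by (simp add: Q_ops)
  qed
  have "g = red_End D m f"
  proof (rule ext_eqI[OF g(4) red_End_ext])
    fix x assume x: "x \<in> OL D"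
    then show "g (cls D m x) = red_End D m f (cls D m x)"
      using lin[of "2 * n" "\<lambda>i. coef i x"] OL_coef_iff by (simp add: coef red_End_cls f f_def[of x])
  qed
  then show ?thesis using that f by blast
qed

lemma herm_Q_cls:
  assumes x: "x \<in> OL D" and y: "y \<in> OL D"
  shows "herm_Q D m (cls D m x) (cls D m y) = cls D m (S x y)"
proof -
  have "cls D m (S x' y') = cls D m (S x y)" if "x' \<in> cls D m x" "y' \<in> cls D m y" for x' y'
  proof -
    have "S x' y' - S x y = S (x' - x) y' + S x (y' - y)" by (simp add: S_diff)
    then show ?thesis using S_I(1)[of "x' - x" m y'] S_I(2)[of x "y' - y" m] x cls_OL[OF y that(2)] that I_closed(2)
      by (simp add: cls_eq cls_mem)
  qed
  then show ?thesis unfolding herm_Q_def by (intro cls_UN) blast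
qed

lemma lie_Q_red_End: "f \<in> E \<Longrightarrow> red_End D m f \<in> lie_Q D m \<longleftrightarrow> skew m f"
  by (auto simp: lie_Q_def skew_def red_End_End_Q carrier_Q red_End_cls herm_Q_cls Q_ops cls_eq E_D S_OL)

lemma lie_Q_iff: "g \<in> lie_Q D m \<longleftrightarrow> (\<exists>f. skew m f \<and> g = red_End D m f)"
  using End_Q_lift[of g m] lie_Q_red_End skewD(1) by (metis (no_types, lifting) lie_Q_def mem_Collect_eq)

section \<open>Isometries modulo a power of the maximal ideal and the unitary groups\<close>

definition isom :: "nat \<Rightarrow> ('a \<Rightarrow> 'a) \<Rightarrow> bool" where
  "isom m f \<longleftrightarrow> f \<in> E \<and> (\<forall>x\<in>OL D. \<forall>y\<in>OL D. S (f x) (f y) - S x y \<in> I m)"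

lemma isomD: "isom m f \<Longrightarrow> f \<in> E" "isom m f \<Longrightarrow> x \<in> OL D \<Longrightarrow> y \<in> OL D \<Longrightarrow> S (f x) (f y) - S x y \<in> I m"
  by (auto simp: isom_def)

lemma isom_antimono: "isom m f \<Longrightarrow> k \<le> m \<Longrightarrow> isom k f" unfolding isom_def using I_antimono by blast

lemma isom_comp: "isom m f \<Longrightarrow> isom m g \<Longrightarrow> isom m (f \<circ> g)"
  unfolding isom_def
proof (intro conjI ballI)
  fix x y assume h: "f \<in> E \<and> (\<forall>x\<in>OL D. \<forall>y\<in>OL D. S (f x) (f y) - S x y \<in> I m)" "g \<in> E \<and> (\<forall>x\<in>OL D. \<forall>y\<in>OL D. S (g x) (g y) - S x y \<in> I m)"
    and xy: "x \<in> OL D" "y \<in> OL D"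
  then have "(S (f (g x)) (f (g y)) - S (g x) (g y)) + (S (g x) (g y) - S x y) \<in> I m" by (intro I_closed(2)) (auto simp: E_D)
  then show "S ((f \<circ> g) x) ((f \<circ> g) y) - S x y \<in> I m" by simp
qed (auto simp: E_comp)

lemma isom_id: "isom m id" "isom m (\<lambda>x. x)" by (auto simp: isom_def E_id I_closed)

lemma isom_cg: "isom m f \<Longrightarrow> cg m f g \<Longrightarrow> g \<in> E \<Longrightarrow> isom m g"
  unfolding isom_def
proof (intro conjI ballI)
  fix x y assume h: "f \<in> E \<and> (\<forall>x\<in>OL D. \<forall>y\<in>OL D. S (f x) (f y) - S x y \<in> I m)" "cg m f g" "g \<in> E" and xy: "x \<in> OL D" "y \<in> OL D"
  have "S (f x - g x) (f y) \<in> I m" "S (g x) (f y - g y) \<in> I m"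
    using S_I(1)[OF cgD[OF h(2) xy(1)], of "f y"] S_I(2)[OF _ cgD[OF h(2) xy(2)], of "g x"] xy h E_D(1) by auto
  moreover have "S (f x) (f y) - S x y \<in> I m" using h xy by blast
  ultimately have "(S (f x) (f y) - S x y) - (S (f x - g x) (f y) + S (g x) (f y - g y)) \<in> I m"
    by (intro I_closed(3)[OF _ I_closed(2)])
  then show "S (g x) (g y) - S x y \<in> I m" by (simp add: S_diff)
qed auto

text \<open>Digit expansions: \<open>T\<close> represents \<open>O_L\<close> modulo
  \<open>w\<close>, with coordinates from representatives of the residue field of \<open>F\<close>,
  and each further power of \<open>w\<close> adds one digit.\<close>

lemma finite_Q: "finite (carrier (Q D m))"
proof -
  obtain R where R: "finite R" "R \<subseteq> OF D" "\<And>x. x \<in> OF D \<Longrightarrow> \<exists>s\<in>R. x - s \<in> I 1" by (rule residue_reps) blast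
  define T where "T = (\<lambda>a. \<Sum>i<2*n. a i * \<beta> ^ i) ` ({..<2*n} \<rightarrow>\<^sub>E R)"
  have bO: "\<beta> ^ i \<in> OL D" for i by (rule OL_closed(7)[OF beta_OL])
  have T: "finite T" "T \<subseteq> OL D" unfolding T_def
    using R(1,2) by (auto intro!: finite_PiE OL_sum OL_closed(5) bO) (metis OF_OL PiE_mem lessThan_iff subsetD)
  have T': "\<exists>t\<in>T. x - t \<in> I 1" if x: "x \<in> OL D" for x
  proof -
    have "\<exists>s. s \<in> R \<and> coef i x - s \<in> I 1" if "i < 2 * n" for i using R(3) OL_coef_iff x that by blast
    then obtain s where s: "\<And>i. i < 2 * n \<Longrightarrow> s i \<in> R \<and> coef i x - s i \<in> I 1" by metis
    have "x - (\<Sum>i<2*n. s i * \<beta> ^ i) = (\<Sum>i<2*n. (coef i x - s i) * \<beta> ^ i)"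
      by (simp add: left_diff_distrib sum_subtractf coef)
    also have "\<dots> \<in> I 1" using s by (intro I_sum I_closed(6) bO) auto
    also have "(\<Sum>i<2*n. s i * \<beta> ^ i) = (\<Sum>i<2*n. (\<lambda>i\<in>{..<2*n}. s i) i * \<beta> ^ i)" by (intro sum.cong) auto
    finally have "x - (\<Sum>i<2*n. (\<lambda>i\<in>{..<2*n}. s i) i * \<beta> ^ i) \<in> I 1" .
    moreover have "(\<lambda>i\<in>{..<2*n}. s i) \<in> {..<2*n} \<rightarrow>\<^sub>E R" using s by simp
    ultimately show ?thesis unfolding T_def by blast
  qed
  have "\<exists>A. finite A \<and> (\<forall>x\<in>OL D. \<exists>t\<in>A. x - t \<in> I m)"
  proof (induction m)
    case 0
    show ?case by (intro exI[of _ "{0}"]) (auto simp: I_zero)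
  next
    case (Suc m)
    then obtain A where A: "finite A" "\<forall>x\<in>OL D. \<exists>t\<in>A. x - t \<in> I m" by blast
    have "\<exists>t\<in>(\<lambda>(a, t). a + w ^ m * t) ` (A \<times> T). x - t \<in> I (Suc m)" if x: "x \<in> OL D" for x
    proof -
      obtain a where a: "a \<in> A" "x - a \<in> I m" using A x by blast
      obtain y where y: "y \<in> OL D" "x - a = w ^ m * y" using I_E[OF a(2)] by blast
      obtain t where t: "t \<in> T" "y - t \<in> I 1" using T'[OF y(1)] by blast
      have "x - (a + w ^ m * t) = w ^ m * (y - t)" using y(2) by (simp add: algebra_simps)
      then have "x - (a + w ^ m * t) \<in> I (Suc m)" using w_I[OF t(2), of m] by (simp only: plus_1_eq_Suc)
      then show ?thesis using a t by (intro bexI[of _ "a + w ^ m * t"]) auto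
    qed
    then show ?case using A(1) T(1) by (intro exI[of _ "(\<lambda>(a, t). a + w ^ m * t) ` (A \<times> T)"]) auto
  qed
  then obtain A where A: "finite A" "\<forall>x\<in>OL D. \<exists>t\<in>A. x - t \<in> I m" by blast
  have "carrier (Q D m) \<subseteq> cls D m ` A"
  proof
    fix C assume "C \<in> carrier (Q D m)"
    then obtain x where x: "x \<in> OL D" "C = cls D m x" by (rule Q_E)
    then obtain t where "t \<in> A" "x - t \<in> I m" using A by blast
    then show "C \<in> cls D m ` A" using x cls_eq by blast
  qed
  then show ?thesis using A(1) finite_surj by blast
qed

lemma isom_inj: "isom m f \<Longrightarrow> x \<in> OL D \<Longrightarrow> f x \<in> I m \<Longrightarrow> x \<in> I m"
proof (rule S_nondeg)
  fix y assume h: "isom m f" "x \<in> OL D" "f x \<in> I m" "y \<in> OL D"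
  show "S x y \<in> I m" using I_cong[OF isomD(2)[OF h(1,2,4)]] S_I(1)[OF h(3) E_D(1)[OF isomD(1)[OF h(1)] h(4)]] by blast
qed

text \<open>An isometry is injective modulo the ideal by non-degeneracy, and the quotient is
  finite.\<close>

lemma isom_surj:
  assumes f: "isom m f" and y: "y \<in> OL D"
  shows "\<exists>x\<in>OL D. f x - y \<in> I m"
proof -
  note fE = isomD(1)[OF f]
  have "inj_on (red_End D m f) (carrier (Q D m))"
  proof (rule inj_onI, elim Q_E)
    fix C C' x x' assume h: "red_End D m f C = red_End D m f C'" "x \<in> OL D" "C = cls D m x" "x' \<in> OL D" "C' = cls D m x'"
    then have "f (x - x') \<in> I m" by (simp add: red_End_cls fE cls_eq E_diff)
    then show "C = C'" using isom_inj[OF f OL_closed(4)[OF h(2,4)]] h by (simp add: cls_eq)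
  qed
  then have "red_End D m f ` carrier (Q D m) = carrier (Q D m)"
    by (intro endo_inj_surj finite_Q) (auto intro: red_End_carrier[OF fE])
  then have "cls D m y \<in> red_End D m f ` carrier (Q D m)" using cls_Q[OF y] by simp
  then show ?thesis by (auto simp: carrier_Q red_End_cls fE cls_eq) (metis I_closed(4) minus_diff_eq)
qed

text \<open>The inverse on cosets has to be represented by an endomorphism of \<open>O_L\<close>:
  preimages of the powers of \<open>\<beta>\<close> are lifted and extended linearly. Injectivity
  turns the right inverse into a left inverse.\<close>

lemma isom_inverse:
  assumes f: "isom m f"
  obtains g where "isom m g" "cg m (f \<circ> g) id" "cg m (g \<circ> f) id"
proof -
  note fE = isomD(1)[OF f]
  have bO: "\<beta> ^ i \<in> OL D" for i by (rule OL_closed(7)[OF beta_OL])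
  have "\<exists>x. x \<in> OL D \<and> f x - \<beta> ^ i \<in> I m" for i using isom_surj[OF f bO] by blast
  then obtain h where h: "\<And>i. h i \<in> OL D \<and> f (h i) - \<beta> ^ i \<in> I m" by metis
  define g where "g x = (\<Sum>i<2*n. coef i x * h i)" for x
  have gE: "g \<in> E" unfolding g_def[abs_def] by (rule E_coef) (use h in blast)
  have fg: "cg m (f \<circ> g) id"
  proof (rule cgI)
    fix x assume x: "x \<in> OL D"
    have "f (g x) = (\<Sum>i<2*n. coef i x * f (h i))"
      unfolding g_def using x OL_coef_iff h by (intro E_lin[OF fE]) auto
    then have "f (g x) - x = (\<Sum>i<2*n. coef i x * (f (h i) - \<beta> ^ i))"
      by (simp add: right_diff_distrib sum_subtractf coef)
    also have "\<dots> \<in> I m"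
    proof (intro I_sum I_closed(5))
      fix i assume "i \<in> {..<2*n}"
      then have "coef i x \<in> OF D" using x OL_coef_iff by simp
      then show "coef i x \<in> OL D" by (rule OF_OL)
    qed (use h in blast)
    finally show "(f \<circ> g) x - id x \<in> I m" by simp
  qed
  have gi: "isom m g"
    unfolding isom_def
  proof (intro conjI ballI gE)
    fix x y assume xy: "x \<in> OL D" "y \<in> OL D"
    have a: "S (f (g x)) (f (g y)) - S x y \<in> I m"
      using isomD(2)[OF isom_cg[OF isom_id(1) cg_sym[OF fg] E_comp[OF fE gE]] xy] by simp
    have "S (f (g x)) (f (g y)) - S (g x) (g y) \<in> I m" using isomD(2)[OF f] xy E_D(1)[OF gE] by blast
    from I_closed(3)[OF a this] show "S (g x) (g y) - S x y \<in> I m" by simp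
  qed
  have "cg m (g \<circ> f) id"
  proof (rule cgI)
    fix x assume x: "x \<in> OL D"
    note O = E_D(1)[OF gE E_D(1)[OF fE x]]
    have "f (g (f x) - x) \<in> I m" using cgD[OF fg E_D(1)[OF fE x]] E_diff[OF fE O x] by simp
    then show "(g \<circ> f) x - id x \<in> I m" using isom_inj[OF f OL_closed(4)[OF O x]] by simp
  qed
  then show ?thesis using that gi fg by blast
qed

abbreviation "UG \<equiv> unitary_group D"

lemma red_End_Bij:
  assumes f: "isom m f"
  shows "red_End D m f \<in> Bij (carrier (Q D m))"
proof -
  obtain g where g: "isom m g" "cg m (f \<circ> g) id" "cg m (g \<circ> f) id" using isom_inverse[OF f] .
  note E = isomD(1)[OF f] isomD(1)[OF g(1)]
  have "bij_betw (red_End D m f) (carrier (Q D m)) (carrier (Q D m))"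
    by (rule bij_betw_byWitness[where f' = "red_End D m g"])
       (use cgD[OF g(2)] cgD[OF g(3)] E in \<open>auto simp: carrier_Q red_End_cls E_D cls_eq\<close>)
  then show ?thesis by (simp add: Bij_def red_End_ext)
qed

text \<open>From here on group elements are handled through representatives: the product is
  composition, and equality is congruence on \<open>O_L\<close>.\<close>

lemma carrier_UG: "g \<in> carrier (UG m) \<longleftrightarrow> (\<exists>f. isom m f \<and> g = red_End D m f)"
proof
  assume g: "g \<in> carrier (UG m)"
  then obtain f where f: "f \<in> E" "g = red_End D m f" using End_Q_lift[of g m] by (auto simp: unitary_group_def)
  have "S (f x) (f y) - S x y \<in> I m" if "x \<in> OL D" "y \<in> OL D" for x y
  proof -
    have "herm_Q D m (g (cls D m x)) (g (cls D m y)) = herm_Q D m (cls D m x) (cls D m y)"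
      using g cls_Q[OF that(1)] cls_Q[OF that(2)] by (simp add: unitary_group_def)
    then show ?thesis using that by (simp add: f red_End_cls herm_Q_cls E_D cls_eq)
  qed
  then show "\<exists>f. isom m f \<and> g = red_End D m f" using f by (auto simp: isom_def)
next
  assume "\<exists>f. isom m f \<and> g = red_End D m f"
  then obtain f where f: "isom m f" "g = red_End D m f" by blast
  then show "g \<in> carrier (UG m)" using red_End_Bij[OF f(1)] red_End_End_Q[OF isomD(1)[OF f(1)]] isomD[OF f(1)]
    by (auto simp: unitary_group_def carrier_Q red_End_cls herm_Q_cls E_D cls_eq)
qed

lemma red_UG: "isom m f \<Longrightarrow> red_End D m f \<in> carrier (UG m)" using carrier_UG by blast

lemma UG_mult: "isom m f \<Longrightarrow> isom m g \<Longrightarrow> red_End D m f \<otimes>\<^bsub>UG m\<^esub> red_End D m g = red_End D m (f \<circ> g)"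
  by (simp add: unitary_group_def BijGroup_def red_End_Bij red_End_comp isomD)

lemma UG_one: "\<one>\<^bsub>UG m\<^esub> = red_End D m id"
  by (rule ext_eqI[OF _ red_End_ext]) (auto simp: unitary_group_def BijGroup_def cls_Q red_End_cls E_id)

lemma UG_group: "group (UG m)"
proof (rule groupI)
  show "\<one>\<^bsub>UG m\<^esub> \<in> carrier (UG m)" by (simp add: UG_one red_UG isom_id)
  fix x y assume "x \<in> carrier (UG m)" "y \<in> carrier (UG m)"
  then obtain f g where f: "isom m f" "x = red_End D m f" and g: "isom m g" "y = red_End D m g" by (auto simp: carrier_UG)
  show "x \<otimes>\<^bsub>UG m\<^esub> y \<in> carrier (UG m)" by (simp add: f g UG_mult red_UG isom_comp)
  fix z assume "z \<in> carrier (UG m)"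
  then obtain h where h: "isom m h" "z = red_End D m h" by (auto simp: carrier_UG)
  show "x \<otimes>\<^bsub>UG m\<^esub> y \<otimes>\<^bsub>UG m\<^esub> z = x \<otimes>\<^bsub>UG m\<^esub> (y \<otimes>\<^bsub>UG m\<^esub> z)" by (simp add: f g h UG_mult isom_comp comp_assoc)
next
  fix x assume "x \<in> carrier (UG m)"
  then obtain f where f: "isom m f" "x = red_End D m f" by (auto simp: carrier_UG)
  show "\<one>\<^bsub>UG m\<^esub> \<otimes>\<^bsub>UG m\<^esub> x = x" by (simp add: f UG_one UG_mult isom_id)
  obtain g where g: "isom m g" "cg m (f \<circ> g) id" "cg m (g \<circ> f) id" using isom_inverse[OF f(1)] .
  show "\<exists>y\<in>carrier (UG m). y \<otimes>\<^bsub>UG m\<^esub> x = \<one>\<^bsub>UG m\<^esub>"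
    using g f by (intro bexI[of _ "red_End D m g"]) (auto simp: UG_mult red_UG UG_one red_End_eq E_comp E_id isomD)
qed

lemma UG_inv: "isom m f \<Longrightarrow> isom m g \<Longrightarrow> cg m (g \<circ> f) id \<Longrightarrow> inv\<^bsub>UG m\<^esub> (red_End D m f) = red_End D m g"
  using group.inv_equality[OF UG_group, of m "red_End D m g" "red_End D m f"]
  by (simp add: UG_mult red_UG UG_one red_End_eq E_comp E_id isomD)

lemma UG_finite: "finite (carrier (UG m))"
proof (rule finite_subset)
  show "carrier (UG m) \<subseteq> carrier (Q D m) \<rightarrow>\<^sub>E carrier (Q D m)"
    using red_End_carrier isomD(1) red_End_ext by (auto simp: carrier_UG PiE_def)
  show "finite (carrier (Q D m) \<rightarrow>\<^sub>E carrier (Q D m))" by (intro finite_PiE finite_Q)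
qed

lemma red_group_red_End: "m \<le> r \<Longrightarrow> f \<in> E \<Longrightarrow> red_group D r m (red_End D r f) = red_End D m f"
proof (rule ext_eqI[OF _ red_End_ext])
  fix x assume h: "m \<le> r" "f \<in> E" "x \<in> OL D"
  have "(\<Union>x'\<in>cls D m x. \<Union>y\<in>red_End D r f (cls D r x'). cls D m y) = cls D m (f x)"
  proof (rule cls_UN)
    fix x' assume x': "x' \<in> cls D m x"
    note O = cls_OL[OF h(3) x']
    have "(\<Union>y\<in>cls D r (f x'). cls D m y) = cls D m (f x')"
      by (rule cls_UN) (use h(1) I_antimono in \<open>auto simp: cls_eq cls_mem\<close>)
    also have "\<dots> = cls D m (f x)" using E_ideal[OF h(2), of "x' - x" m] E_diff[OF h(2) O h(3)] x' by (simp add: cls_eq cls_mem)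
    finally show "(\<Union>y\<in>red_End D r f (cls D r x'). cls D m y) = cls D m (f x)" by (simp add: red_End_cls h(2) O)
  qed
  then show "red_group D r m (red_End D r f) (cls D m x) = red_End D m f (cls D m x)"
    by (simp add: red_group_def cls_Q h red_End_cls)
qed (simp add: red_group_def)

lemma cong_subgroup_iff: "m \<le> r \<Longrightarrow> g \<in> cong_subgroup D m r \<longleftrightarrow> (\<exists>f. isom r f \<and> cg m f id \<and> g = red_End D r f)"
  by (auto simp: cong_subgroup_def kernel_def carrier_UG red_group_red_End isomD UG_one red_End_eq E_id)

lemma red_cong: "m \<le> r \<Longrightarrow> isom r f \<Longrightarrow> red_End D r f \<in> cong_subgroup D m r \<longleftrightarrow> cg m f id"
  by (auto simp: cong_subgroup_def kernel_def red_UG red_group_red_End isomD UG_one red_End_eq E_id)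

lemma cg_one_plus:
  assumes f: "f \<in> E" and c: "cg m f id"
  shows "\<exists>g\<in>E. f = one_plus D m g"
proof -
  define g where "g x = inverse (w ^ m) * (f x - x)" for x
  have "g \<in> E"
  proof (rule E_I)
    show "g x \<in> OL D" if "x \<in> OL D" for x unfolding g_def iw_I using cgD[OF c that] by simp
  qed (use f in \<open>auto simp: g_def E_D distrib_left right_diff_distrib mult.left_commute\<close>)
  moreover have "w ^ m * (inverse (w ^ m) * y) = y" for y using w0 by simp
  then have "f = one_plus D m g" by (intro ext) (simp only: one_plus_def g_def, simp)
  ultimately show ?thesis by blast
qed

lemma one_plus_cg: "f \<in> E \<Longrightarrow> cg m (one_plus D m f) id"
  by (rule cgI) (use E_D(1) in \<open>auto simp: one_plus_def idl_def\<close>)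

section \<open>The centralizer and the stabilizer\<close>

abbreviation "mb \<equiv> mult_by"

lemma mult_by_comp: "mb a \<circ> mb c = mb (a * c)" by (rule ext) (simp add: mult_by_def mult_ac)
lemma mult_by_one: "mb 1 = id" by (rule ext) (simp add: mult_by_def)
lemma mult_by_E: "mb \<beta> \<in> E" by (rule E_mult_by[OF beta_OL])

lemma cg_mult_by: "a \<in> OL D \<Longrightarrow> c \<in> OL D \<Longrightarrow> cg m (mb a) (mb c) \<longleftrightarrow> a - c \<in> I m"
proof
  assume h: "cg m (mb a) (mb c)"
  show "a - c \<in> I m" using cgD[OF h OL_closed(2)] by (simp add: mult_by_def)
next
  assume h: "a - c \<in> I m"
  show "cg m (mb a) (mb c)"
    by (rule cgI) (use I_closed(5)[OF _ h] in \<open>simp add: mult_by_def right_diff_distrib\<close>)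
qed

definition cmt :: "nat \<Rightarrow> ('a \<Rightarrow> 'a) \<Rightarrow> bool" where "cmt m f \<longleftrightarrow> (\<forall>x\<in>OL D. f (x * \<beta>) - f x * \<beta> \<in> I m)"

lemma cmtD: "cmt m f \<Longrightarrow> x \<in> OL D \<Longrightarrow> f (x * \<beta>) - f x * \<beta> \<in> I m" by (simp add: cmt_def)

lemma cmt_iff: "cmt m f \<longleftrightarrow> cg m (f \<circ> mb \<beta>) (mb \<beta> \<circ> f)" by (simp add: cmt_def cg_def mult_by_def)

lemma cmt_mult_by: "cmt m (mb a)" by (simp add: cmt_def mult_by_def I_closed mult_ac)

lemma cmt_cg: "cmt m f \<Longrightarrow> cg m f g \<Longrightarrow> cmt m g"
  unfolding cmt_def
proof
  fix x assume h: "\<forall>x\<in>OL D. f (x * \<beta>) - f x * \<beta> \<in> I m" "cg m f g" and x: "x \<in> OL D"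
  have "(f (x * \<beta>) - f x * \<beta>) - ((f (x * \<beta>) - g (x * \<beta>)) - (f x - g x) * \<beta>) \<in> I m"
    by (rule I_closed(3)[OF bspec[OF h(1) x] I_closed(3)[OF cgD[OF h(2) OL_closed(5)[OF x beta_OL]] I_closed(6)[OF beta_OL cgD[OF h(2) x]]]])
  moreover have "p - q * \<beta> - ((p - p') - (q - q') * \<beta>) = p' - q' * \<beta>" for p q p' q' by (simp add: algebra_simps)
  ultimately show "g (x * \<beta>) - g x * \<beta> \<in> I m" by (simp only:)
qed

lemma cmt_add: "cmt m f \<Longrightarrow> cmt m g \<Longrightarrow> cmt m (\<lambda>x. f x + g x)"
  unfolding cmt_def distrib_right add_diff_add by (blast intro: I_closed(2))

text \<open>Horner induction on \<open>x\<close>: modulo \<open>I m\<close>, a map that commutes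
  with \<open>\<beta>\<close> and with the integers of \<open>F\<close> is determined by its value
  at \<open>1\<close>.\<close>

lemma cmt_mult:
  assumes f: "f \<in> E" "cmt m f"
  shows "cg m f (mb (f 1))"
proof (rule cgI)
  have "f x - x * f 1 \<in> I m" if "x \<in> OL D" for x
    using that
  proof (induction x rule: OL_induct)
    case zero
    then show ?case by (simp add: E_zero f I_closed)
  next
    case (lin y c)
    note O = OL_closed(5)[OF lin(1) beta_OL]
    have "f (y * \<beta> + c) = f (y * \<beta>) + c * f 1"
      using E_D(2)[OF f(1) O OF_OL[OF lin(2)]] E_D(3)[OF f(1) lin(2) OL_closed(2)] by simp
    then have "f (y * \<beta> + c) - (y * \<beta> + c) * f 1 = (f (y * \<beta>) - f y * \<beta>) + (f y - y * f 1) * \<beta>"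
      by (simp add: algebra_simps)
    then show ?case using I_closed(2)[OF cmtD[OF f(2) lin(1)] I_closed(6)[OF beta_OL lin(3)]] by simp
  qed
  then show "f x - mb (f 1) x \<in> I m" if "x \<in> OL D" for x using that by (simp add: mult_by_def)
qed

lemma S_mult: "S (x * a) y = S x (y * \<iota> a)"
  by (simp add: S_eq invol_hom mult_ac)

lemma isom_mult_by:
  assumes a: "a \<in> OL D"
  shows "isom m (mb a) \<longleftrightarrow> a * \<iota> a - 1 \<in> I m"
proof -
  have e: "S (x * a) (y * a) - S x y = S (x * (a * \<iota> a - 1)) y" for x y
  proof -
    have "S (x * (a * \<iota> a)) y = S (x * a) (y * a)" unfolding S_mult[of x "a * \<iota> a" y] S_mult[of x a "y * a"]
      by (simp add: invol_hom mult_ac)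
    then show ?thesis by (simp add: right_diff_distrib S_diff)
  qed
  show ?thesis
  proof
    assume h: "isom m (mb a)"
    show "a * \<iota> a - 1 \<in> I m"
    proof (rule S_nondeg)
      fix y assume "y \<in> OL D"
      then show "S (a * \<iota> a - 1) y \<in> I m" using isomD(2)[OF h OL_closed(2), of y] e[of 1 y] by (simp add: mult_by_def)
    qed
  next
    assume h: "a * \<iota> a - 1 \<in> I m"
    show "isom m (mb a)"
      unfolding isom_def by (intro conjI ballI E_mult_by a) (simp add: mult_by_def e, intro S_I(1) I_closed(5) h)
  qed
qed

text \<open>Lifting by Hilbert's theorem 90: one of \<open>c = 1 + g\<close> and \<open>c = 1 - g\<close> is a unit, and then \<open>c / \<iota> c\<close>, up to sign,
  has norm one and is congruent to \<open>g\<close>.\<close>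

lemma norm_one_lift:
  assumes g: "g \<in> OL D" "g * \<iota> g - 1 \<in> I m"
  obtains g' where "g' \<in> OL D" "g' * \<iota> g' = 1" "g' - g \<in> I m"
proof -
  note goal_rule = that
  have lift: ?thesis if c: "c = 1 + s * g" "c \<notin> I 1" and s: "s * s = 1" "\<iota> s = s" "s \<in> OL D" for c s
  proof -
    have cO: "c \<in> OL D" unfolding c by (intro OL_closed g s)
    have ic: "\<iota> c \<notin> I 1" using invol_I[of "\<iota> c" 1] c(2) by (auto simp: invol_hom)
    have v: "v c = 1" "v (\<iota> c) = 1" using c(2) ic cO invol_OL[OF cO] v_less_one[of c] v_less_one[of "\<iota> c"] by (auto simp: OL_iff)
    have nz: "c \<noteq> 0" "\<iota> c \<noteq> 0" using v by auto
    have "s * c - g * \<iota> c = s * (1 - g * \<iota> g)"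
      unfolding c by (simp add: invol_hom s algebra_simps)
    moreover have "s * c / \<iota> c - g = (s * c - g * \<iota> c) / \<iota> c" using nz by (simp add: diff_divide_distrib)
    moreover have "s * (1 - g * \<iota> g) / \<iota> c = - (s / \<iota> c) * (g * \<iota> g - 1)" by (simp add: algebra_simps diff_divide_distrib)
    ultimately have "s * c / \<iota> c - g = - (s / \<iota> c) * (g * \<iota> g - 1)" by (simp only:)
    moreover have "- (s / \<iota> c) \<in> OL D" using s(3) v by (simp add: OL_iff v_divide)
    ultimately have "s * c / \<iota> c - g \<in> I m" using I_closed(5)[OF _ g(2)] by (simp only:)
    moreover have "s * c / \<iota> c \<in> OL D" using s(3) v by (simp add: OL_iff v_divide absv_mult)
    moreover have "s * c / \<iota> c * \<iota> (s * c / \<iota> c) = 1" using nz s by (simp add: invol_hom invol_divide)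
    ultimately show ?thesis by (intro goal_rule)
  qed
  show ?thesis
  proof (cases "1 + g \<in> I 1")
    case False
    then show ?thesis using lift[of "1 + g" 1] OL_closed by (simp add: invol_hom)
  next
    case True
    have "1 - g \<notin> I 1"
    proof
      assume "1 - g \<in> I 1"
      then have "2 \<in> I 1" using I_closed(2)[OF True] by fastforce
      then show False using v_two v_less_one[of 2] by simp
    qed
    then show ?thesis using lift[of "1 - g" "- 1"] OL_closed by (simp add: invol_hom invol_minus)
  qed
qed

section \<open>Elements of norm one and the product decomposition of the stabilizer\<close>

definition N1 :: "'a set" where "N1 = {g \<in> OL D. g * \<iota> g = 1}"

lemma N1: "g \<in> N1 \<Longrightarrow> g \<in> OL D" "g \<in> N1 \<Longrightarrow> g * \<iota> g = 1" "g \<in> N1 \<Longrightarrow> \<iota> g * g = 1"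
  "g \<in> N1 \<Longrightarrow> h \<in> N1 \<Longrightarrow> g * h \<in> N1" "g \<in> N1 \<Longrightarrow> \<iota> g \<in> N1" "1 \<in> N1"
  unfolding N1_def using invol_hom OL_closed invol_OL by (auto simp: mult_ac)

lemma norm_one_group: "carrier (norm_one_group D) = N1" "x \<otimes>\<^bsub>norm_one_group D\<^esub> y = x * y"
proof -
  interpret cring "ROL D" by (rule OL_ring)
  have "g \<in> Units (ROL D)" if "g \<in> OL D" "g * \<iota> g = 1" for g
    using that invol_OL[OF that(1)] by (auto simp: Units_def ROL_simps mult.commute intro!: bexI[of _ "\<iota> g"])
  then show "carrier (norm_one_group D) = N1" by (auto simp: norm_one_group_def N1_def Units_def ROL_simps)
  show "x \<otimes>\<^bsub>norm_one_group D\<^esub> y = x * y" by (simp add: norm_one_group_def units_of_def ROL_simps)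
qed

lemma isom_N1: "g \<in> N1 \<Longrightarrow> isom m (mb g)" using N1 by (simp add: isom_mult_by I_closed)

text \<open>For \<open>m = l'\<close> this is the stabilizer, for \<open>m = r\<close> the
  centralizer of \<open>\<beta>\<close>; the common treatment yields the subgroup property of
  both.\<close>

definition cent :: "nat \<Rightarrow> nat \<Rightarrow> ('a set \<Rightarrow> 'a set) set" where
  "cent m r = {red_End D r f |f. isom r f \<and> cmt m f}"

lemma red_cent: "m \<le> r \<Longrightarrow> isom r f \<Longrightarrow> red_End D r f \<in> cent m r \<longleftrightarrow> cmt m f"
proof
  assume h: "m \<le> r" "isom r f" "red_End D r f \<in> cent m r"
  then obtain g where g: "isom r g" "cmt m g" "red_End D r f = red_End D r g" by (auto simp: cent_def)
  then have "cg r f g" using h by (simp add: red_End_eq isomD)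
  then have "cg m g f" by (intro cg_antimono[OF cg_sym h(1)])
  then show "cmt m f" using g cmt_cg by blast
qed (auto simp: cent_def)

lemma cent_subgroup:
  assumes mr: "m \<le> r"
  shows "subgroup (cent m r) (UG r)"
proof -
  interpret group "UG r" by (rule UG_group)
  show ?thesis
  proof (rule subgroupI)
    show "cent m r \<subseteq> carrier (UG r)" using red_UG by (auto simp: cent_def)
    have "cmt m id" using cmt_mult_by[of m 1] by (simp add: mult_by_one)
    then show "cent m r \<noteq> {}" using isom_id(1)[of r] by (auto simp: cent_def)
  next
    fix a assume "a \<in> cent m r"
    then obtain f where f: "isom r f" "cmt m f" "a = red_End D r f" by (auto simp: cent_def)
    obtain g where g: "isom r g" "cg r (f \<circ> g) id" "cg r (g \<circ> f) id" using isom_inverse[OF f(1)] .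
    note fE = isomD(1)[OF f(1)] and gE = isomD(1)[OF g(1)]
    have "cmt m g" unfolding cmt_def
    proof
      fix x assume x: "x \<in> OL D"
      note xb = OL_closed(5)[OF x beta_OL]
      note O = E_D(1)[OF gE xb] OL_closed(5)[OF E_D(1)[OF gE x] beta_OL]
      have "(f (g (x * \<beta>)) - x * \<beta>) - ((f (g x * \<beta>) - f (g x) * \<beta>) + (f (g x) - x) * \<beta>) \<in> I m"
        using I_closed(3)[OF cgD[OF cg_antimono[OF g(2) mr] xb] I_closed(2)[OF cmtD[OF f(2) E_D(1)[OF gE x]]
          I_closed(6)[OF beta_OL cgD[OF cg_antimono[OF g(2) mr] x]]]] by simp
      moreover have "p - x * \<beta> - ((q - s * \<beta>) + (s - x) * \<beta>) = p - q" for p q s by (simp add: algebra_simps)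
      ultimately have "f (g (x * \<beta>)) - f (g x * \<beta>) \<in> I m" by (simp only:)
      then have "f (g (x * \<beta>) - g x * \<beta>) \<in> I m" by (simp add: E_diff[OF fE O])
      then show "g (x * \<beta>) - g x * \<beta> \<in> I m" by (rule isom_inj[OF isom_antimono[OF f(1) mr] OL_closed(4)[OF O]])
    qed
    then show "inv\<^bsub>UG r\<^esub> a \<in> cent m r" using f g UG_inv[OF f(1) g(1,3)] by (auto simp: cent_def)
  next
    fix a b assume "a \<in> cent m r" "b \<in> cent m r"
    then obtain f g where f: "isom r f" "cmt m f" "a = red_End D r f" and g: "isom r g" "cmt m g" "b = red_End D r g" by (auto simp: cent_def)
    note fE = isomD(1)[OF f(1)] and gE = isomD(1)[OF g(1)]
    have "cmt m (f \<circ> g)" unfolding cmt_def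
    proof
      fix x assume x: "x \<in> OL D"
      note xb = OL_closed(5)[OF x beta_OL]
      note O = E_D(1)[OF gE xb] OL_closed(5)[OF E_D(1)[OF gE x] beta_OL]
      have "f (g (x * \<beta>) - g x * \<beta>) + (f (g x * \<beta>) - f (g x) * \<beta>) \<in> I m"
        by (intro I_closed(2) E_ideal[OF fE] cmtD[OF f(2)] cmtD[OF g(2)] x E_D(1)[OF gE x])
      then show "(f \<circ> g) (x * \<beta>) - (f \<circ> g) x * \<beta> \<in> I m" by (simp add: E_diff[OF fE O])
    qed
    then show "a \<otimes>\<^bsub>UG r\<^esub> b \<in> cent m r" using f g isom_comp[OF f(1) g(1)] by (auto simp: cent_def UG_mult)
  qed
qed

text \<open>Commuting with \<open>\<beta>\<close> makes \<open>f\<close> the multiplication by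
  \<open>f 1\<close>, the isometry condition makes the norm of \<open>f 1\<close> congruent to one,
  and such an element is congruent to one of norm exactly one.\<close>

lemma cent_mult:
  assumes "m \<le> r" "isom r f" "cmt m f"
  obtains g where "g \<in> N1" "cg m f (mb g)"
proof -
  note fE = isomD(1)[OF assms(2)]
  note c = cmt_mult[OF fE assms(3)]
  have O: "f 1 \<in> OL D" by (rule E_D(1)[OF fE OL_closed(2)])
  have "isom m (mb (f 1))" by (rule isom_cg[OF isom_antimono[OF assms(2,1)] c E_mult_by[OF O]])
  then obtain g where g: "g \<in> OL D" "g * \<iota> g = 1" "g - f 1 \<in> I m" using norm_one_lift[OF O] isom_mult_by[OF O] by blast
  have "cg m (mb (f 1)) (mb g)" using cg_mult_by[OF g(1) O] g(3) cg_sym by blast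
  then show ?thesis using that[of g] g cg_trans[OF c] by (simp add: N1_def)
qed

lemma centralizer_cent: "centralizer D r \<beta> = cent r r"
  by (auto simp: centralizer_def cent_def carrier_UG red_End_comp isomD mult_by_E red_End_eq E_comp cmt_iff)

lemma centralizer_eq: "centralizer D r \<beta> = (\<lambda>g. red_End D r (mb g)) ` N1"
proof
  show "centralizer D r \<beta> \<subseteq> (\<lambda>g. red_End D r (mb g)) ` N1"
  proof
    fix a assume "a \<in> centralizer D r \<beta>"
    then obtain f where f: "isom r f" "cmt r f" "a = red_End D r f" by (auto simp: centralizer_cent cent_def)
    obtain g where "g \<in> N1" "cg r f (mb g)" using cent_mult[OF order_refl f(1,2)] .
    moreover from this have "a = red_End D r (mb g)" using f by (simp add: red_End_eq isomD E_mult_by N1)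
    ultimately show "a \<in> (\<lambda>g. red_End D r (mb g)) ` N1" by blast
  qed
  show "(\<lambda>g. red_End D r (mb g)) ` N1 \<subseteq> centralizer D r \<beta>"
    using isom_N1 cmt_mult_by by (auto simp: centralizer_cent cent_def)
qed

lemma cmt_conj:
  assumes E: "f \<in> E" "g \<in> E" and c: "cg m (f \<circ> g) id" "cmt m f"
  shows "cg m (f \<circ> mb \<beta> \<circ> g) (mb \<beta>)"
proof -
  have "cg m (f \<circ> mb \<beta> \<circ> g) (mb \<beta> \<circ> f \<circ> g)" by (intro cg_comp c(2)[unfolded cmt_iff] cg_refl E_comp E mult_by_E)
  moreover have "cg m (mb \<beta> \<circ> (f \<circ> g)) (mb \<beta> \<circ> id)" by (intro cg_comp c(1) cg_refl E_comp E_id E mult_by_E)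
  ultimately show ?thesis using cg_trans by (metis comp_assoc comp_id)
qed

lemma stab_cent:
  assumes mr: "m \<le> r"
  shows "stab D r m \<beta> = cent m r"
proof -
  have "red_End D r f \<in> stab D r m \<beta> \<longleftrightarrow> cmt m f" if f: "isom r f" for f
  proof -
    obtain g where g: "isom m g" "cg m (f \<circ> g) id" "cg m (g \<circ> f) id" using isom_inverse[OF isom_antimono[OF f mr]] .
    note fE = isomD(1)[OF f] and gE = isomD(1)[OF g(1)]
    have "red_End D r f \<in> stab D r m \<beta> \<longleftrightarrow> cg m (f \<circ> mb \<beta> \<circ> g) (mb \<beta>)"
      using f mr UG_inv[OF isom_antimono[OF f mr] g(1,3)]
      by (simp add: stab_def red_UG red_group_red_End fE Ad_Q_def red_End_comp gE mult_by_E E_comp red_End_eq)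
    also have "\<dots> \<longleftrightarrow> cmt m f"
    proof
      assume h: "cg m (f \<circ> mb \<beta> \<circ> g) (mb \<beta>)"
      have "cg m (f \<circ> mb \<beta> \<circ> g \<circ> f) (mb \<beta> \<circ> f)" by (intro cg_comp h cg_refl E_comp fE gE mult_by_E)
      moreover have "cg m (f \<circ> mb \<beta> \<circ> (g \<circ> f)) (f \<circ> mb \<beta> \<circ> id)" by (intro cg_comp g cg_refl E_comp E_id fE gE mult_by_E)
      ultimately show "cmt m f" unfolding cmt_iff using cg_trans cg_sym by (metis comp_assoc comp_id)
    qed (rule cmt_conj[OF fE gE g(2)])
    finally show ?thesis .
  qed
  moreover have "stab D r m \<beta> \<subseteq> carrier (UG r)" by (auto simp: stab_def)
  ultimately show ?thesis by (fastforce simp: cent_def carrier_UG subset_iff)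
qed

lemma red_group_hom: "m \<le> r \<Longrightarrow> group_hom (UG r) (UG m) (red_group D r m)"
proof (unfold group_hom_def group_hom_axioms_def, intro conjI UG_group homI)
  fix a b assume mr: "m \<le> r" and "a \<in> carrier (UG r)" "b \<in> carrier (UG r)"
  then obtain f g where "isom r f" "a = red_End D r f" "isom r g" "b = red_End D r g" by (auto simp: carrier_UG)
  then show "red_group D r m (a \<otimes>\<^bsub>UG r\<^esub> b) = red_group D r m a \<otimes>\<^bsub>UG m\<^esub> red_group D r m b"
    using mr isom_antimono[OF _ mr] by (simp add: UG_mult red_group_red_End isomD E_comp)
next
  fix a assume mr: "m \<le> r" and "a \<in> carrier (UG r)"
  then obtain f where "isom r f" "a = red_End D r f" by (auto simp: carrier_UG)
  then show "red_group D r m a \<in> carrier (UG m)"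
    using mr isom_antimono[OF _ mr] by (simp add: red_UG red_group_red_End isomD)
qed

lemma cong_subgroup_normal: "m \<le> r \<Longrightarrow> normal (cong_subgroup D m r) (UG r)"
  unfolding cong_subgroup_def by (rule group_hom.normal_kernel[OF red_group_hom])

lemma cong_subgroup_conj: "m \<le> r \<Longrightarrow> g \<in> carrier (UG r) \<Longrightarrow> h \<in> cong_subgroup D m r \<Longrightarrow>
  inv\<^bsub>UG r\<^esub> g \<otimes>\<^bsub>UG r\<^esub> h \<otimes>\<^bsub>UG r\<^esub> g \<in> cong_subgroup D m r"
  using normal.inv_op_closed1[OF cong_subgroup_normal] .

lemma cong_cent: "m \<le> k \<Longrightarrow> k \<le> r \<Longrightarrow> cong_subgroup D k r \<subseteq> cent m r"
proof
  fix a assume h: "m \<le> k" "k \<le> r" "a \<in> cong_subgroup D k r"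
  then obtain f where f: "isom r f" "cg k f id" "a = red_End D r f" by (auto simp: cong_subgroup_iff)
  have "cmt m f" using cmt_cg[of m id f] cg_antimono[OF cg_sym[OF f(2)] h(1)] cmt_mult_by[of m 1] by (simp add: mult_by_one)
  then show "a \<in> cent m r" using f by (auto simp: cent_def)
qed

lemma cong_antimono: "m \<le> k \<Longrightarrow> k \<le> r \<Longrightarrow> cong_subgroup D k r \<subseteq> cong_subgroup D m r"
proof
  fix a assume h: "m \<le> k" "k \<le> r" "a \<in> cong_subgroup D k r"
  then obtain f where f: "isom r f" "cg k f id" "a = red_End D r f" by (auto simp: cong_subgroup_iff)
  then show "a \<in> cong_subgroup D m r" using red_cong[of m r f] cg_antimono[OF f(2) h(1)] h by simp
qed

text \<open>The factor of norm one is exact and so defines an element of the centralizer at level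
  \<open>r\<close>, although it approximates \<open>f\<close> only modulo \<open>I m\<close>; what
  remains after dividing is in the congruence subgroup.\<close>

lemma cent_prod:
  assumes "m \<le> r" "a \<in> cent m r"
  shows "\<exists>g\<in>centralizer D r \<beta>. \<exists>h\<in>cong_subgroup D m r. a = g \<otimes>\<^bsub>UG r\<^esub> h"
proof -
  obtain f where f: "isom r f" "cmt m f" "a = red_End D r f" using assms by (auto simp: cent_def)
  obtain g where g: "g \<in> N1" "cg m f (mb g)" using cent_mult[OF assms(1) f(1,2)] .
  let ?h = "mb (\<iota> g) \<circ> f"
  have h: "isom r ?h" by (intro isom_comp isom_N1 f N1 g)
  have "cg m ?h (mb (\<iota> g) \<circ> mb g)" by (intro cg_comp g cg_refl E_mult_by isomD(1)[OF f(1)] N1)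
  then have "cg m ?h id" by (simp add: mult_by_comp N1 g mult_by_one)
  then have H: "red_End D r ?h \<in> cong_subgroup D m r" using h assms(1) by (simp add: red_cong)
  have "mb g \<circ> ?h = f" by (simp add: comp_assoc[symmetric] mult_by_comp N1 g mult_by_one)
  then have "a = red_End D r (mb g) \<otimes>\<^bsub>UG r\<^esub> red_End D r ?h" using f by (simp add: UG_mult isom_N1[OF g(1)] h)
  then show ?thesis using H g(1) by (auto simp: centralizer_eq)
qed

lemma UG_mult_by: "g \<in> N1 \<Longrightarrow> h \<in> N1 \<Longrightarrow> red_End D r (mb g) \<otimes>\<^bsub>UG r\<^esub> red_End D r (mb h) = red_End D r (mb (g * h))"
  by (simp add: UG_mult isom_N1 mult_by_comp)

lemma centralizer_comm: "a \<in> centralizer D r \<beta> \<Longrightarrow> c \<in> centralizer D r \<beta> \<Longrightarrow> a \<otimes>\<^bsub>UG r\<^esub> c = c \<otimes>\<^bsub>UG r\<^esub> a"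
  by (auto simp: centralizer_eq UG_mult_by mult.commute)

lemma red_mult_by_eq: "g \<in> N1 \<Longrightarrow> h \<in> N1 \<Longrightarrow> red_End D r (mb g) = red_End D r (mb h) \<longleftrightarrow> g - h \<in> I r"
  by (simp add: red_End_eq E_mult_by N1 cg_mult_by)

end

section \<open>The character of the congruence subgroup\<close>

text \<open>The bounds leave \<open>l = l'\<close> and \<open>l = l' + 1\<close>, the two parities
  of \<open>r\<close>.\<close>

locale unramified_level = unramified_generator D n \<beta> for D :: "'a::Fields.field unitary_datum" and n :: nat and \<beta> :: 'a +
  fixes l l' :: nat
  assumes l'_pos: "l' \<ge> 1" and l'_le: "l' \<le> l" and l_le: "l \<le> l' + 1"
begin

abbreviation "r \<equiv> l + l'"
abbreviation mul (infixl "\<odot>" 70) where "g \<odot> h \<equiv> g \<otimes>\<^bsub>UG r\<^esub> h"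
abbreviation "iv \<equiv> m_inv (UG r)"
abbreviation "cm g h \<equiv> iv g \<odot> iv h \<odot> g \<odot> h"
abbreviation "rd \<equiv> red_End D r"
abbreviation "pl \<equiv> one_plus D l"
abbreviation "\<psi> \<equiv> psi D l l' \<beta>"
abbreviation "KN \<equiv> cong_subgroup D l r"
abbreviation "\<Theta> \<equiv> theta_set D l l' \<beta>"
abbreviation "tq \<equiv> theta_Q D r"
abbreviation "Gb \<equiv> centralizer D r \<beta>"

definition tb :: "('a \<Rightarrow> 'a) \<Rightarrow> 'a" where "tb f = tr (f \<circ> mb \<beta>)"

lemma tb_OF: "f \<in> E \<Longrightarrow> tb f \<in> OF D" unfolding tb_def by (intro tr_OF E_comp mult_by_E)
lemma tb_F: "f \<in> E \<Longrightarrow> tb f \<in> F" using tb_OF by (simp add: OF_iff)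
lemma tb_add: "f \<in> E \<Longrightarrow> g \<in> E \<Longrightarrow> tb (\<lambda>x. f x + g x) = tb f + tb g"
  using tr_add[OF E_comp[OF _ mult_by_E] E_comp[OF _ mult_by_E]] by (simp add: tb_def comp_def)
lemma tb_scale: "f \<in> E \<Longrightarrow> c \<in> OF D \<Longrightarrow> tb (\<lambda>x. c * f x) = c * tb f"
  using tr_scale[OF E_comp[OF _ mult_by_E]] by (simp add: tb_def comp_def)
lemma tb_cg: "f \<in> E \<Longrightarrow> g \<in> E \<Longrightarrow> cg m f g \<Longrightarrow> tb f - tb g \<in> I m"
  unfolding tb_def by (intro cg_tr E_comp mult_by_E cg_comp cg_refl)

lemma tau_iw: "x \<in> OF D \<Longrightarrow> y \<in> OF D \<Longrightarrow> x - y \<in> I m \<Longrightarrow> \<tau> (inverse (w ^ m) * x) = \<tau> (inverse (w ^ m) * y)"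
  by (rule tau_cong) (simp_all add: F_closed(4)[OF iw_F] OF_iff right_diff_distrib[symmetric] iw_I)

lemma tau_iw_add: "x \<in> OF D \<Longrightarrow> y \<in> OF D \<Longrightarrow> \<tau> (inverse (w ^ m) * (x + y)) = \<tau> (inverse (w ^ m) * x) * \<tau> (inverse (w ^ m) * y)"
  unfolding distrib_left by (rule tau_add) (simp_all add: F_closed(4)[OF iw_F] OF_iff)

lemma tau_nonzero: "x \<in> F \<Longrightarrow> \<tau> x \<noteq> 0" using tau_unitary[of x] by auto

lemma one_plus_cg_iff: "f \<in> E \<Longrightarrow> g \<in> E \<Longrightarrow> cg (m + k) (one_plus D m f) (one_plus D m g) \<longleftrightarrow> cg k f g"
  by (simp add: cg_def one_plus_def right_diff_distrib[symmetric] w_I_iff)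

lemma S_w: "S (w ^ m * x) y = w ^ m * S x y" "S x (w ^ m * y) = w ^ m * S x y"
  using S_scale[OF F_K] wF_power[of m] by (simp_all add: OF_iff invol_power invol_w)

text \<open>The failure of \<open>1 + w ^ m f\<close> to be an isometry is \<open>w ^ m\<close>
  times the failure of \<open>f\<close> to be skew, up to a quadratic term with factor
  \<open>w ^ (2 * m)\<close>, which vanishes modulo \<open>I (m + k)\<close> since
  \<open>k \<le> m\<close>.\<close>

lemma one_plus_isom_skew:
  assumes f: "f \<in> E" and k: "k \<le> m"
  shows "isom (m + k) (one_plus D m f) \<longleftrightarrow> skew k f"
proof -
  have "S (one_plus D m f x) (one_plus D m f y) - S x y - w ^ m * (S (f x) y + S x (f y)) \<in> I (m + k)" if xy: "x \<in> OL D" "y \<in> OL D" for x y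
  proof -
    have "S (one_plus D m f x) (one_plus D m f y) - S x y - w ^ m * (S (f x) y + S x (f y)) = w ^ m * (w ^ m * S (f x) (f y))"
      unfolding one_plus_def S_add S_w by (simp add: distrib_left)
    moreover have "w ^ m * (w ^ m * S (f x) (f y)) \<in> I (m + k)"
      unfolding w_I_iff using w_I[of "S (f x) (f y)" 0 m] S_OL[OF E_D(1)[OF f xy(1)] E_D(1)[OF f xy(2)]] I_antimono[OF k] by (simp add: I_zero)
    ultimately show ?thesis by simp
  qed
  then have "S (one_plus D m f x) (one_plus D m f y) - S x y \<in> I (m + k) \<longleftrightarrow> S (f x) y + S x (f y) \<in> I k" if xy: "x \<in> OL D" "y \<in> OL D" for x y
    using I_cong w_I_iff that by blast
  then show ?thesis using f E_one_plus by (simp add: isom_def skew_def)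
qed

lemma pl_isom: "f \<in> E \<Longrightarrow> isom r (pl f) \<longleftrightarrow> skew l' f" by (rule one_plus_isom_skew[OF _ l'_le])

lemma pl_red_eq: "f \<in> E \<Longrightarrow> g \<in> E \<Longrightarrow> rd (pl f) = rd (pl g) \<longleftrightarrow> cg l' f g"
  by (simp add: red_End_eq E_one_plus one_plus_cg_iff)

lemma psi_lie:
  assumes f: "f \<in> lie_O D"
  shows "\<psi> (rd (pl f)) = \<tau> (inverse (w ^ l') * tb f)"
  unfolding psi_def
proof (rule the_equality)
  show "\<exists>Y\<in>lie_O D. rd (pl f) = rd (pl Y) \<and> \<tau> (inverse (w ^ l') * tb f) = \<tau> (inverse (w ^ l') * trace_form D Y (mb \<beta>))"
    using f by (auto simp: trace_form_eq tb_def)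
  fix z assume "\<exists>Y\<in>lie_O D. rd (pl f) = rd (pl Y) \<and> z = \<tau> (inverse (w ^ l') * trace_form D Y (mb \<beta>))"
  then obtain g where g: "g \<in> lie_O D" "rd (pl f) = rd (pl g)" "z = \<tau> (inverse (w ^ l') * tb g)"
    by (auto simp: trace_form_eq tb_def)
  then have "cg l' f g" using pl_red_eq lie_E f by blast
  then show "z = \<tau> (inverse (w ^ l') * tb f)"
    using g(3) tau_iw[OF tb_OF tb_OF tb_cg] lie_E f g(1) by metis
qed

text \<open>Elements of \<open>KN\<close> come with representatives that are skew only modulo
  \<open>I l'\<close>; \<open>skew_lift\<close> supplies the exactly skew ones from which
  \<open>psi\<close> is defined, and the value depends only on the class modulo
  \<open>I l'\<close>.\<close>

lemma psi_eval:
  assumes f: "skew l' f"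
  shows "\<psi> (rd (pl f)) = \<tau> (inverse (w ^ l') * tb f)"
proof -
  obtain g where g: "g \<in> lie_O D" "\<And>x. x \<in> OL D \<Longrightarrow> g x - f x \<in> I l'" using skew_lift[OF f] by blast
  have c: "cg l' g f" using g(2) by (simp add: cg_def)
  have "rd (pl f) = rd (pl g)" using pl_red_eq[OF skewD(1)[OF f] lie_E[OF g(1)]] cg_sym[OF c] by simp
  then show ?thesis using psi_lie[OF g(1)] tau_iw[OF tb_OF tb_OF tb_cg[OF _ _ c]] lie_E[OF g(1)] skewD(1)[OF f] by metis
qed

lemma KN_iff: "a \<in> KN \<longleftrightarrow> (\<exists>f. skew l' f \<and> a = rd (pl f))"
proof
  assume "a \<in> KN"
  then obtain f where f: "isom r f" "cg l f id" "a = rd f" by (auto simp: cong_subgroup_iff)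
  then obtain g where "g \<in> E" "f = pl g" using cg_one_plus[OF isomD(1)[OF f(1)] f(2)] by blast
  then show "\<exists>f. skew l' f \<and> a = rd (pl f)" using f pl_isom by blast
next
  assume "\<exists>f. skew l' f \<and> a = rd (pl f)"
  then obtain f where f: "skew l' f" "a = rd (pl f)" by blast
  then show "a \<in> KN" using pl_isom[OF skewD(1)[OF f(1)]] red_cong[of l r "pl f"] one_plus_cg[OF skewD(1)[OF f(1)]] by simp
qed

lemma skew_add: "skew m f \<Longrightarrow> skew m g \<Longrightarrow> skew m (\<lambda>x. f x + g x)"
  unfolding skew_def
proof (intro conjI ballI)
  fix x y assume h: "f \<in> E \<and> (\<forall>x\<in>OL D. \<forall>y\<in>OL D. S (f x) y + S x (f y) \<in> I m)" "g \<in> E \<and> (\<forall>x\<in>OL D. \<forall>y\<in>OL D. S (g x) y + S x (g y) \<in> I m)" "x \<in> OL D" "y \<in> OL D"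
  then have "S (f x) y + S x (f y) \<in> I m" "S (g x) y + S x (g y) \<in> I m" by auto
  then have "(S (f x) y + S x (f y)) + (S (g x) y + S x (g y)) \<in> I m" by (rule I_closed(2))
  then show "S (f x + g x) y + S x (f y + g y) \<in> I m" by (simp add: S_add ac_simps)
qed (auto intro: E_add)

text \<open>The product has one extra term, with factor \<open>w ^ (2 * l)\<close>, and
  \<open>r \<le> 2 * l\<close>.\<close>

lemma pl_mult:
  assumes f: "skew l' f" and g: "skew l' g"
  shows "rd (pl f) \<odot> rd (pl g) = rd (pl (\<lambda>x. f x + g x))"
proof -
  note E = skewD(1)[OF f] skewD(1)[OF g]
  have "cg r (pl f \<circ> pl g) (pl (\<lambda>x. f x + g x))"
  proof (rule cgI)
    fix x assume x: "x \<in> OL D"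
    note O = E_D(1)[OF E(2) x]
    have "(pl f \<circ> pl g) x - pl (\<lambda>x. f x + g x) x = w ^ l * (w ^ l * f (g x))"
      unfolding one_plus_def comp_def E_D(2)[OF E(1) x OL_closed(5)[OF w_OL O]] E_w[OF E(1) O] by (simp add: distrib_left)
    also have "\<dots> \<in> I r" unfolding w_I_iff
      using w_I[of "f (g x)" 0 l] E_D(1)[OF E(1) O] I_antimono[OF l'_le] by (simp add: I_zero)
    finally show "(pl f \<circ> pl g) x - pl (\<lambda>x. f x + g x) x \<in> I r" .
  qed
  then show ?thesis using f g E by (simp add: UG_mult pl_isom red_End_eq E_comp E_one_plus E_add)
qed

lemma psi_mult: "h \<in> KN \<Longrightarrow> k \<in> KN \<Longrightarrow> \<psi> (h \<odot> k) = \<psi> h * \<psi> k"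
  by (auto simp: KN_iff pl_mult psi_eval skew_add tb_add tau_iw_add tb_OF skewD(1))

lemma psi_nonzero: "h \<in> KN \<Longrightarrow> \<psi> h \<noteq> 0"
  by (auto simp: KN_iff psi_eval tau_nonzero F_closed(4)[OF iw_F] tb_F skewD(1))

lemma beta_skew_S: "S (x * \<beta>) y = - S x (y * \<beta>)" by (simp add: S_mult beta_invol S_minus)

lemma conj_cg:
  assumes f: "f \<in> E" and g: "g \<in> E" and Y: "Y \<in> E" and c: "cg r (g \<circ> f) id"
  shows "cg r (g \<circ> pl Y \<circ> f) (pl (g \<circ> Y \<circ> f))"
proof (rule cgI)
  fix x assume x: "x \<in> OL D"
  note O = E_D(1)[OF f x] E_D(1)[OF Y E_D(1)[OF f x]]
  have "(g \<circ> pl Y \<circ> f) x - pl (g \<circ> Y \<circ> f) x = g (f x) - x"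
    by (simp add: one_plus_def E_D(2)[OF g O(1) OL_closed(5)[OF w_OL O(2)]] E_w[OF g O(2)])
  then show "(g \<circ> pl Y \<circ> f) x - pl (g \<circ> Y \<circ> f) x \<in> I r" using cgD[OF c x] by simp
qed

text \<open>Cyclicity of the trace moves the conjugation from the Lie algebra element to
  \<open>\<beta>\<close>: \<open>f \<circ> mb \<beta> \<circ> g\<close> is the adjoint action of
  \<open>f\<close> on \<open>\<beta>\<close>.\<close>

lemma psi_conj:
  assumes f: "isom r f" and Y: "skew l' Y" and g: "isom r g" "cg r (f \<circ> g) id" "cg r (g \<circ> f) id"
  shows "\<psi> (iv (rd f) \<odot> rd (pl Y) \<odot> rd f) = \<tau> (inverse (w ^ l') * tr (Y \<circ> (f \<circ> mb \<beta> \<circ> g)))"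
proof -
  note E = isomD(1)[OF f] isomD(1)[OF g(1)] skewD(1)[OF Y]
  have iY: "isom r (pl Y)" using Y pl_isom E by blast
  have i: "isom r (g \<circ> pl Y \<circ> f)" by (intro isom_comp f g iY)
  have c: "cg r (g \<circ> pl Y \<circ> f) (pl (g \<circ> Y \<circ> f))" by (rule conj_cg[OF E g(3)])
  have gYf: "g \<circ> Y \<circ> f \<in> E" by (intro E_comp E)
  have sk: "skew l' (g \<circ> Y \<circ> f)" using isom_cg[OF i c E_one_plus[OF gYf]] pl_isom[OF gYf] by simp
  have "iv (rd f) \<odot> rd (pl Y) \<odot> rd f = rd (pl (g \<circ> Y \<circ> f))"
    using c E gYf by (simp add: UG_inv[OF f g(1,3)] UG_mult f g iY isom_comp red_End_eq E_comp E_one_plus)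
  then have "\<psi> (iv (rd f) \<odot> rd (pl Y) \<odot> rd f) = \<tau> (inverse (w ^ l') * tb (g \<circ> Y \<circ> f))"
    using psi_eval[OF sk] by simp
  also have "tb (g \<circ> Y \<circ> f) = tr (Y \<circ> (f \<circ> mb \<beta> \<circ> g))"
    unfolding tb_def using tr_comm[OF E(2) E_comp[OF E_comp[OF E(3,1)] mult_by_E]] by (simp add: comp_assoc)
  finally show ?thesis .
qed

lemma psi_stab:
  assumes a: "a \<in> cent l' r" and h: "h \<in> KN"
  shows "\<psi> (iv a \<odot> h \<odot> a) = \<psi> h"
proof -
  obtain f where f: "isom r f" "cmt l' f" "a = rd f" using a by (auto simp: cent_def)
  obtain g where g: "isom r g" "cg r (f \<circ> g) id" "cg r (g \<circ> f) id" using isom_inverse[OF f(1)] .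
  obtain Y where Y: "skew l' Y" "h = rd (pl Y)" using h KN_iff by blast
  note E = isomD(1)[OF f(1)] isomD(1)[OF g(1)] skewD(1)[OF Y(1)]
  have "cg l' (f \<circ> mb \<beta> \<circ> g) (mb \<beta>)" by (rule cmt_conj[OF E(1,2) cg_antimono[OF g(2)] f(2)]) simp
  then have "cg l' (Y \<circ> (f \<circ> mb \<beta> \<circ> g)) (Y \<circ> mb \<beta>)" by (intro cg_comp cg_refl E_comp E mult_by_E)
  then have "tr (Y \<circ> (f \<circ> mb \<beta> \<circ> g)) - tb Y \<in> I l'" unfolding tb_def by (intro cg_tr E_comp E mult_by_E)
  then show ?thesis
    unfolding f(3) Y(2) psi_conj[OF f(1) Y(1) g] psi_eval[OF Y(1)]
    by (intro tau_iw tr_OF E_comp E mult_by_E tb_OF)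
qed

text \<open>If \<open>a\<close> fixed the character, the difference \<open>W\<close> of the
  conjugate of \<open>\<beta>\<close> and \<open>\<beta>\<close> would be skew and would pair
  trivially with the whole Lie algebra. The perfect pairing makes it vanish modulo
  \<open>I l'\<close>, and then \<open>a\<close> commutes with \<open>\<beta>\<close> there.\<close>

lemma psi_not_stab:
  assumes a: "a \<in> carrier (UG r)" "a \<notin> cent l' r"
  shows "\<exists>h\<in>KN. \<psi> (iv a \<odot> h \<odot> a) \<noteq> \<psi> h"
proof (rule ccontr)
  assume n: "\<not> (\<exists>h\<in>KN. \<psi> (iv a \<odot> h \<odot> a) \<noteq> \<psi> h)"
  obtain f where f: "isom r f" "a = rd f" using a by (auto simp: carrier_UG)
  obtain g where g: "isom r g" "cg r (f \<circ> g) id" "cg r (g \<circ> f) id" using isom_inverse[OF f(1)] .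
  note E = isomD(1)[OF f(1)] isomD(1)[OF g(1)]
  define fbg where "fbg = f \<circ> mb \<beta> \<circ> g"
  have fbgE: "fbg \<in> E" unfolding fbg_def by (intro E_comp E mult_by_E)
  define W where "W x = fbg x - x * \<beta>" for x
  have WE: "W \<in> E" unfolding W_def[abs_def] using E_sub[OF fbgE mult_by_E] by (simp add: mult_by_def)
  \<comment> \<open>Since \<open>f\<close> is an isometry with inverse \<open>g\<close>, moving
    \<open>f\<close> across the form turns it into \<open>g\<close>. This transports the skewness of
    \<open>\<beta>\<close> to its conjugate.\<close>
  have key: "S (fbg x) y - S (g x * \<beta>) (g y) \<in> I r" "S x (fbg y) - S (g x) (g y * \<beta>) \<in> I r" if xy: "x \<in> OL D" "y \<in> OL D" for x y
  proof -
    note O = OL_closed(5)[OF E_D(1)[OF E(2) xy(1)] beta_OL] OL_closed(5)[OF E_D(1)[OF E(2) xy(2)] beta_OL] E_D(1)[OF E(2) xy(1)] E_D(1)[OF E(2) xy(2)]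
    have "(S (f (g x * \<beta>)) (f (g y)) - S (g x * \<beta>) (g y)) - S (f (g x * \<beta>)) (f (g y) - y) \<in> I r"
      using I_closed(3)[OF isomD(2)[OF f(1) O(1,4)] S_I(2)[OF E_D(1)[OF E(1) O(1)] cgD[OF g(2) xy(2)]]] by simp
    then show "S (fbg x) y - S (g x * \<beta>) (g y) \<in> I r" by (simp add: fbg_def mult_by_def S_diff)
    have "(S (f (g x)) (f (g y * \<beta>)) - S (g x) (g y * \<beta>)) - S (f (g x) - x) (f (g y * \<beta>)) \<in> I r"
      using I_closed(3)[OF isomD(2)[OF f(1) O(3,2)] S_I(1)[OF cgD[OF g(2) xy(1)] E_D(1)[OF E(1) O(2)]]] by simp
    then show "S x (fbg y) - S (g x) (g y * \<beta>) \<in> I r" by (simp add: fbg_def mult_by_def S_diff)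
  qed
  have "skew l' W" unfolding skew_def
  proof (intro conjI ballI WE)
    fix x y assume xy: "x \<in> OL D" "y \<in> OL D"
    have "S (fbg x) y + S x (fbg y) \<in> I r" using I_closed(2)[OF key[OF xy]] beta_skew_S[of "g x" "g y"] by simp
    then have "S (W x) y + S x (W y) \<in> I r" using beta_skew_S[of x y] by (simp add: W_def S_diff)
    then show "S (W x) y + S x (W y) \<in> I l'" using I_antimono by (meson le_add2)
  qed
  moreover have "\<tau> (inverse (w ^ l') * tr (Y \<circ> W)) = 1" if Y: "Y \<in> lie_O D" for Y
  proof -
    note YE = lie_E[OF Y] and Ys = lie_skew[OF Y, of l']
    have "rd (pl Y) \<in> KN" using Ys KN_iff by blast
    then have "\<psi> (iv a \<odot> rd (pl Y) \<odot> a) = \<psi> (rd (pl Y))" using n by blast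
    then have e: "\<tau> (inverse (w ^ l') * tr (Y \<circ> fbg)) = \<tau> (inverse (w ^ l') * tb Y)"
      unfolding f(2) psi_conj[OF f(1) Ys g] psi_eval[OF Ys] fbg_def .
    have "tr (Y \<circ> W) = tr (Y \<circ> fbg) - tb Y"
    proof -
      have "tr (Y \<circ> W) = tr (\<lambda>x. (Y \<circ> fbg) x - (Y \<circ> mb \<beta>) x)"
        by (rule tr_cong[OF E_comp[OF YE WE] E_sub[OF E_comp[OF YE fbgE] E_comp[OF YE mult_by_E]]])
          (simp add: W_def mult_by_def E_diff[OF YE] E_D(1)[OF fbgE] OL_closed(5)[OF _ beta_OL])
      then show ?thesis unfolding tb_def using tr_diff[OF E_comp[OF YE fbgE] E_comp[OF YE mult_by_E]] by simp
    qed
    moreover have "\<tau> (inverse (w ^ l') * ((tr (Y \<circ> fbg) - tb Y) + tb Y)) = \<tau> (inverse (w ^ l') * (tr (Y \<circ> fbg) - tb Y)) * \<tau> (inverse (w ^ l') * tb Y)"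
      using tr_OF[OF E_comp[OF YE fbgE]] tb_OF[OF YE]
      by (intro tau_iw_add tb_OF YE) (auto simp: OF_iff intro: order_trans[OF v_diff] subfield_diff[OF subfields(1)])
    ultimately show ?thesis using e tau_nonzero[OF F_closed(4)[OF iw_F tb_F[OF YE]], of l'] by simp
  qed
  ultimately have Wz: "W x \<in> I l'" if "x \<in> OL D" for x using trace_perfect[of l' W x] that by blast
  have "cmt l' f" unfolding cmt_def
  proof
    fix x assume x: "x \<in> OL D"
    note fx = E_D(1)[OF E(1) x]
    note O = E_D(1)[OF E(2) fx]
    have "f (mb \<beta> (g (f x) - x)) \<in> I r" using cgD[OF g(3) x] by (intro E_ideal[OF E(1)] E_ideal[OF mult_by_E]) simp
    then have "f (g (f x) * \<beta> - x * \<beta>) \<in> I l'" using I_antimono[of l' r] by (simp add: mult_by_def left_diff_distrib)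
    then have "f (g (f x) * \<beta>) - f (x * \<beta>) \<in> I l'"
      using E_diff[OF E(1) OL_closed(5)[OF O beta_OL] OL_closed(5)[OF x beta_OL]] by simp
    from I_closed(3)[OF Wz[OF fx] this] show "f (x * \<beta>) - f x * \<beta> \<in> I l'" by (simp add: W_def fbg_def mult_by_def)
  qed
  then show False using a f red_cent[of l' r f] by simp
qed

section \<open>Characters of the norm one group and of the centralizer\<close>

lemma theta_setD:
  assumes "\<theta> \<in> \<Theta>"
  shows "\<And>g h. g \<in> N1 \<Longrightarrow> h \<in> N1 \<Longrightarrow> \<theta> (g * h) = \<theta> g * \<theta> h" "\<And>g. g \<in> N1 \<Longrightarrow> \<theta> g \<noteq> 0" "\<theta> \<in> extensional N1"
    "\<And>g h. g \<in> N1 \<Longrightarrow> h \<in> N1 \<Longrightarrow> g - h \<in> I r \<Longrightarrow> \<theta> g = \<theta> h"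
    "\<And>x. x \<in> OL D \<Longrightarrow> 1 + w ^ l * x \<in> N1 \<Longrightarrow> \<theta> (1 + w ^ l * x) = \<tau> (inverse (w ^ l') * tb (mb x))"
  using assms by (auto simp: theta_set_def chars_def norm_one_group field_trace_F tb_def hom_def Cx_def Pi_iff)

lemma theta_setI:
  assumes "\<And>g h. g \<in> N1 \<Longrightarrow> h \<in> N1 \<Longrightarrow> \<theta> (g * h) = \<theta> g * \<theta> h" "\<And>g. g \<in> N1 \<Longrightarrow> \<theta> g \<noteq> 0" "\<theta> \<in> extensional N1"
    "\<And>g h. g \<in> N1 \<Longrightarrow> h \<in> N1 \<Longrightarrow> g - h \<in> I r \<Longrightarrow> \<theta> g = \<theta> h"
    "\<And>x. x \<in> OL D \<Longrightarrow> 1 + w ^ l * x \<in> N1 \<Longrightarrow> \<theta> (1 + w ^ l * x) = \<tau> (inverse (w ^ l') * tb (mb x))"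
  shows "\<theta> \<in> \<Theta>"
  using assms by (auto simp: theta_set_def chars_def norm_one_group field_trace_F tb_def hom_def Cx_def)

lemma theta_Q_eval: "\<theta> \<in> \<Theta> \<Longrightarrow> g \<in> N1 \<Longrightarrow> tq \<theta> (rd (mb g)) = \<theta> g"
  unfolding theta_Q_def norm_one_group
proof (rule the_equality)
  assume h: "\<theta> \<in> \<Theta>" "g \<in> N1"
  show "\<exists>\<gamma>\<in>N1. rd (mb g) = rd (mb \<gamma>) \<and> \<theta> g = \<theta> \<gamma>" using h by blast
  show "z = \<theta> g" if "\<exists>\<gamma>\<in>N1. rd (mb g) = rd (mb \<gamma>) \<and> z = \<theta> \<gamma>" for z
    using that h(2) theta_setD(4)[OF h] by (auto simp: red_mult_by_eq)
qed

lemma one_plus_mult_by: "one_plus D m (mb x) = mb (1 + w ^ m * x)"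
  by (rule ext) (simp add: one_plus_def mult_by_def algebra_simps)

lemma mult_by_pl:
  assumes g: "g \<in> N1" "rd (mb g) \<in> KN"
  obtains x where "x \<in> OL D" "g = 1 + w ^ l * x" "skew l' (mb x)" "rd (mb g) = rd (pl (mb x))"
proof -
  have "cg l (mb g) (mb 1)" using g red_cong[of l r "mb g"] isom_N1[OF g(1)] by (simp add: mult_by_one)
  then have "g - 1 \<in> I l" using cg_mult_by N1(1)[OF g(1)] OL_closed(2) by blast
  then obtain x where x: "x \<in> OL D" "g - 1 = w ^ l * x" using I_E by blast
  then have e: "g = 1 + w ^ l * x" by (simp add: algebra_simps)
  then have "pl (mb x) = mb g" by (simp add: one_plus_mult_by)
  moreover have "skew l' (mb x)" using pl_isom[OF E_mult_by[OF x(1)]] isom_N1[OF g(1)] calculation by simp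
  ultimately show ?thesis using that x(1) e by simp
qed

lemma tq_psi:
  assumes th: "\<theta> \<in> \<Theta>" and a: "a \<in> Gb" "a \<in> KN"
  shows "tq \<theta> a = \<psi> a"
proof -
  from assms obtain g where g: "g \<in> N1" "a = rd (mb g)" by (auto simp: centralizer_eq)
  obtain x where x: "x \<in> OL D" "g = 1 + w ^ l * x" "skew l' (mb x)" "rd (mb g) = rd (pl (mb x))"
    using mult_by_pl[OF g(1)] a g(2) by blast
  have "tq \<theta> a = \<theta> g" using theta_Q_eval[OF th g(1)] g(2) by simp
  also have "\<dots> = \<psi> a" using theta_setD(5)[OF th x(1)] g x psi_eval[OF x(3)] by simp
  finally show ?thesis .
qed

text \<open>\<open>\<eta>\<close> is pulled back to the elements of norm one; its agreement with
  \<open>\<psi>\<close> on \<open>KN\<close> becomes the trace condition of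
  \<open>theta_set\<close>.\<close>

lemma tq_surj:
  assumes "\<And>g h. g \<in> Gb \<Longrightarrow> h \<in> Gb \<Longrightarrow> \<eta> (g \<odot> h) = \<eta> g * \<eta> h" "\<And>g. g \<in> Gb \<Longrightarrow> \<eta> g \<noteq> (0::complex)"
    "\<And>g. g \<in> Gb \<Longrightarrow> g \<in> KN \<Longrightarrow> \<eta> g = \<psi> g"
  shows "\<exists>\<theta>\<in>\<Theta>. \<forall>g\<in>Gb. tq \<theta> g = \<eta> g"
proof -
  define \<theta> where "\<theta> = (\<lambda>g\<in>N1. \<eta> (rd (mb g)))"
  have G: "rd (mb g) \<in> Gb" if "g \<in> N1" for g using that by (auto simp: centralizer_eq)
  have th: "\<theta> \<in> \<Theta>"
  proof (rule theta_setI)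
    show "\<theta> (g * h) = \<theta> g * \<theta> h" if "g \<in> N1" "h \<in> N1" for g h
      using that assms(1)[OF G[OF that(1)] G[OF that(2)]] by (simp add: \<theta>_def N1 UG_mult_by)
    show "\<theta> g \<noteq> 0" if "g \<in> N1" for g using that assms(2)[OF G[OF that]] by (simp add: \<theta>_def)
    show "\<theta> \<in> extensional N1" by (simp add: \<theta>_def)
    show "\<theta> g = \<theta> h" if "g \<in> N1" "h \<in> N1" "g - h \<in> I r" for g h using that red_mult_by_eq[of g h r] by (simp add: \<theta>_def)
    show "\<theta> (1 + w ^ l * x) = \<tau> (inverse (w ^ l') * tb (mb x))" if x: "x \<in> OL D" "1 + w ^ l * x \<in> N1" for x
    proof -
      have e: "pl (mb x) = mb (1 + w ^ l * x)" by (simp add: one_plus_mult_by)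
      have s: "skew l' (mb x)" using pl_isom[OF E_mult_by[OF x(1)]] isom_N1[OF x(2)] e by simp
      then have "rd (mb (1 + w ^ l * x)) \<in> KN" using KN_iff e by metis
      then show ?thesis using assms(3)[OF G[OF x(2)]] psi_eval[OF s] e x(2) by (simp add: \<theta>_def)
    qed
  qed
  then show ?thesis by (intro bexI[OF _ th] ballI) (auto simp: centralizer_eq theta_Q_eval, simp add: \<theta>_def)
qed

lemma tq_inj:
  assumes "\<theta> \<in> \<Theta>" "\<theta>' \<in> \<Theta>" "\<And>g. g \<in> Gb \<Longrightarrow> tq \<theta> g = tq \<theta>' g"
  shows "\<theta> = \<theta>'"
proof (rule extensionalityI[OF theta_setD(3)[OF assms(1)] theta_setD(3)[OF assms(2)]])
  fix g assume g: "g \<in> N1"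
  then show "\<theta> g = \<theta>' g" using assms(3)[of "rd (mb g)"] theta_Q_eval assms(1,2) by (auto simp: centralizer_eq)
qed

end

section \<open>The group of odd level\<close>

locale unramified_odd = unramified_level +
  assumes l_eq: "l = l' + 1"
begin

abbreviation "pm \<equiv> one_plus D l'"
abbreviation "KH \<equiv> cong_subgroup D l' r"
abbreviation "Lc \<equiv> lie_centralizer D 1 \<beta>"
abbreviation "ZG \<equiv> Zgrp D l l' \<beta>"
abbreviation "psr \<equiv> psi_rho D l l' \<beta>"

lemma l_le_double: "l \<le> l' + l'" using l_eq l'_pos by simp
lemma r_le_triple: "r \<le> l' + l' + l'" using l_eq l'_pos by simp
lemma w_l: "w ^ l = w * w ^ l'" by (simp add: l_eq power_add)

text \<open>Here \<open>2 * l' < r\<close>, so the quadratic term survives and the condition on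
  \<open>f\<close> is not linear; modulo the maximal ideal it reduces to skewness.\<close>

lemma pm_isom: "f \<in> E \<Longrightarrow> isom r (pm f) \<longleftrightarrow> (\<forall>x\<in>OL D. \<forall>y\<in>OL D. S (f x) y + S x (f y) + w ^ l' * S (f x) (f y) \<in> I l)"
proof -
  have "S (pm f x) (pm f y) - S x y = w ^ l' * (S (f x) y + S x (f y) + w ^ l' * S (f x) (f y))" for x y
    unfolding one_plus_def S_add S_w by (simp add: distrib_left)
  then show "f \<in> E \<Longrightarrow> ?thesis" using w_I_iff[of l' _ l] E_one_plus by (simp add: isom_def add.commute)
qed

lemma pm_skew: "f \<in> E \<Longrightarrow> isom r (pm f) \<Longrightarrow> skew 1 f"
  unfolding skew_def
proof (intro conjI ballI)
  fix x y assume h: "f \<in> E" "isom r (pm f)" "x \<in> OL D" "y \<in> OL D"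
  have "S (f x) y + S x (f y) + w ^ l' * S (f x) (f y) \<in> I l" using h pm_isom by blast
  then have a: "S (f x) y + S x (f y) + w ^ l' * S (f x) (f y) \<in> I 1" using I_antimono[of 1 l] l_eq by simp
  have "S (f x) (f y) \<in> OL D" using h E_D(1) S_OL by blast
  then have "w ^ l' * S (f x) (f y) \<in> I 1" using w_I[of _ 0 l'] I_antimono[OF l'_pos] by (simp add: I_zero)
  from I_closed(3)[OF a this] show "S (f x) y + S x (f y) \<in> I 1" by simp
qed

lemma pm_red_eq: "f \<in> E \<Longrightarrow> g \<in> E \<Longrightarrow> rd (pm f) = rd (pm g) \<longleftrightarrow> cg l f g"
  using one_plus_cg_iff[of f g l' l] by (simp add: red_End_eq E_one_plus add.commute)

lemma red_pm_KH: "f \<in> E \<Longrightarrow> isom r (pm f) \<Longrightarrow> rd (pm f) \<in> KH"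
  using red_cong[of l' r "pm f"] one_plus_cg by simp

lemma KH_E:
  assumes "a \<in> KH" obtains f where "f \<in> E" "isom r (pm f)" "a = rd (pm f)"
proof -
  obtain f where f: "isom r f" "cg l' f id" "a = rd f" using assms by (auto simp: cong_subgroup_iff)
  then obtain g where "g \<in> E" "f = pm g" using cg_one_plus[OF isomD(1)[OF f(1)] f(2)] by blast
  then show ?thesis using that f by blast
qed

lemma red_Lc: "f \<in> E \<Longrightarrow> red_End D 1 f \<in> carrier Lc \<longleftrightarrow> skew 1 f \<and> cmt 1 f"
  by (simp add: lie_centralizer_def lie_Q_red_End red_End_comp mult_by_E red_End_eq E_comp cmt_iff)

lemma Lc_E: assumes "C \<in> carrier Lc" obtains f where "skew 1 f" "cmt 1 f" "C = red_End D 1 f"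
proof -
  obtain f where "skew 1 f" "C = red_End D 1 f" using assms lie_Q_iff by (auto simp: lie_centralizer_def)
  then show ?thesis using that assms red_Lc[OF skewD(1)] by blast
qed

lemma Lc_mult: "f \<in> E \<Longrightarrow> g \<in> E \<Longrightarrow> red_End D 1 f \<otimes>\<^bsub>Lc\<^esub> red_End D 1 g = red_End D 1 (\<lambda>x. f x + g x)"
  by (rule ext_eqI[OF _ red_End_ext])
     (auto simp: lie_centralizer_def cls_Q red_End_cls E_D Q_ops E_add)

lemma ZG_iff: "a \<in> ZG \<longleftrightarrow> (\<exists>f\<in>E. isom r (pm f) \<and> cmt 1 f \<and> a = rd (pm f))"
proof
  assume "a \<in> ZG"
  then obtain f where f: "a \<in> KH" "f \<in> E" "a = rd (pm f)" "red_End D 1 f \<in> carrier Lc" by (auto simp: Zgrp_def)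
  obtain g where g: "g \<in> E" "isom r (pm g)" "a = rd (pm g)" using KH_E[OF f(1)] .
  have "cg r (pm g) (pm f)" using f g by (simp add: red_End_eq E_one_plus)
  then have "isom r (pm f)" using isom_cg[OF g(2) _ E_one_plus[OF f(2)]] by simp
  then show "\<exists>f\<in>E. isom r (pm f) \<and> cmt 1 f \<and> a = rd (pm f)" using f red_Lc by blast
next
  assume "\<exists>f\<in>E. isom r (pm f) \<and> cmt 1 f \<and> a = rd (pm f)"
  then obtain f where f: "f \<in> E" "isom r (pm f)" "cmt 1 f" "a = rd (pm f)" by blast
  then show "a \<in> ZG" using red_pm_KH pm_skew red_Lc by (auto simp: Zgrp_def)
qed

lemma N1_one_plus: "g \<in> N1 \<Longrightarrow> g - 1 \<in> I l' \<Longrightarrow> \<exists>x\<in>OL D. g = 1 + w ^ l' * x"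
  using I_E[of "g - 1" l'] by (auto simp: algebra_simps)

lemma pm_mult_by: "pm (mb x) = mb (1 + w ^ l' * x)" by (rule one_plus_mult_by)

lemma skew_mult_by: "skew 1 (mb x) \<Longrightarrow> x + \<iota> x \<in> I 1"
proof (rule S_nondeg)
  fix y assume h: "skew 1 (mb x)" "y \<in> OL D"
  show "S (x + \<iota> x) y \<in> I 1"
    using skewD(2)[OF h(1) OL_closed(2) h(2)] S_mult[of 1 "\<iota> x" y] by (simp add: mult_by_def S_add invol_hom)
qed

text \<open>\<open>f\<close> is multiplication by some \<open>y\<close> with
  \<open>y + \<iota> y\<close> in \<open>I 1\<close>. Replacing \<open>y\<close> by the exactly skew
  \<open>x0\<close> makes the norm of \<open>1 + w ^ l' * x0\<close> equal to one modulo
  \<open>I (2 * l')\<close>, hence modulo \<open>I l\<close>; the correction to norm one then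
  changes \<open>x0\<close> only modulo \<open>I 1\<close>.\<close>

lemma cmt_lift:
  assumes f: "skew 1 f" "cmt 1 f"
  obtains x where "x \<in> OL D" "1 + w ^ l' * x \<in> N1" "cg 1 f (mb x)"
proof -
  note fE = skewD(1)[OF f(1)]
  define y where "y = f 1"
  have yO: "y \<in> OL D" unfolding y_def by (rule E_D(1)[OF fE OL_closed(2)])
  have c: "cg 1 f (mb y)" unfolding y_def by (rule cmt_mult[OF fE f(2)])
  have "skew 1 (mb y)" unfolding skew_def
  proof (intro conjI ballI E_mult_by yO)
    fix a c' assume ac: "a \<in> OL D" "c' \<in> OL D"
    have "S (f a - mb y a) c' \<in> I 1" "S a (f c' - mb y c') \<in> I 1" using S_I cgD[OF c] ac by auto
    from I_closed(3)[OF skewD(2)[OF f(1) ac] I_closed(2)[OF this]] show "S (mb y a) c' + S a (mb y c') \<in> I 1" by (simp add: S_diff)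
  qed
  then have y: "y + \<iota> y \<in> I 1" by (rule skew_mult_by)
  define x0 where "x0 = 1 / 2 * (y - \<iota> y)"
  have x0O: "x0 \<in> OL D" unfolding x0_def by (intro OL_closed half_OL yO invol_OL)
  have "1 / 2 \<in> F" using half_OF by (simp add: OF_iff)
  then have h: "\<iota> (1 / 2) = 1 / 2" by (rule invol_aut(2))
  have ix0: "\<iota> x0 = - x0"
    unfolding x0_def invol_hom(2) h invol_diff invol_hom(4) by (metis minus_diff_eq mult_minus_right)
  have x0y: "x0 - y \<in> I 1"
  proof -
    have "x0 - y = 1 / 2 * (- (y + \<iota> y))" using two_nonzero by (simp add: x0_def field_simps)
    then show ?thesis using I_closed(5)[OF half_OL I_closed(4)[OF y]] by (simp only:)
  qed
  define g where "g = 1 + w ^ l' * x0"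
  have gO: "g \<in> OL D" unfolding g_def by (intro OL_closed w_OL x0O)
  have "g * \<iota> g - 1 = w ^ l' * (w ^ l' * - (x0 * x0))"
    by (simp add: g_def invol_hom invol_power invol_w ix0 algebra_simps)
  moreover have "w ^ l' * (w ^ l' * - (x0 * x0)) \<in> I (l' + l')"
    unfolding w_I_iff using w_I[of "- (x0 * x0)" 0 l'] OL_closed(5)[OF x0O x0O] I_closed(4)[of "x0 * x0" 0] by (simp add: I_zero)
  ultimately have "g * \<iota> g - 1 \<in> I l" using I_antimono[OF l_le_double] by simp
  then obtain g' where g': "g' \<in> OL D" "g' * \<iota> g' = 1" "g' - g \<in> I l" using norm_one_lift[OF gO] by blast
  have "w ^ l' * x0 \<in> I l'" using w_I[of x0 0 l'] x0O by (simp add: I_zero)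
  then have "(g' - g) + w ^ l' * x0 \<in> I l'" using I_antimono[OF l'_le g'(3)] I_closed(2) by blast
  then have "g' - 1 \<in> I l'" by (simp add: g_def)
  moreover have gN: "g' \<in> N1" using g' by (simp add: N1_def)
  ultimately obtain x where x: "x \<in> OL D" "g' = 1 + w ^ l' * x" using N1_one_plus by blast
  have "w ^ l' * (x - x0) \<in> I (l' + 1)" using g'(3) x(2) by (simp add: g_def l_eq right_diff_distrib)
  then have "x - x0 \<in> I 1" by (simp only: w_I_iff)
  then have "(x - x0) + (x0 - y) \<in> I 1" using x0y by (rule I_closed(2))
  then have "cg 1 (mb y) (mb x)" using cg_mult_by[OF x(1) yO] cg_sym by simp
  then show ?thesis using that[OF x(1)] gN x(2) cg_trans[OF c] by simp
qed

text \<open>\<open>ZG\<close> is the product of \<open>Gb \<inter> KH\<close> and \<open>KN\<close>;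
  this predicate keeps the element \<open>g\<close> of norm one with which a representative agrees
  modulo \<open>I l\<close>.\<close>

definition Zc :: "('a \<Rightarrow> 'a) \<Rightarrow> 'a \<Rightarrow> bool" where
  "Zc f g \<longleftrightarrow> isom r f \<and> g \<in> N1 \<and> g - 1 \<in> I l' \<and> cg l f (mb g)"

lemma ZG_Zc: "a \<in> ZG \<longleftrightarrow> (\<exists>f g. Zc f g \<and> a = rd f)"
proof
  assume "a \<in> ZG"
  then obtain f where f: "f \<in> E" "isom r (pm f)" "cmt 1 f" "a = rd (pm f)" using ZG_iff by blast
  obtain x where x: "x \<in> OL D" "1 + w ^ l' * x \<in> N1" "cg 1 f (mb x)" using cmt_lift[OF pm_skew[OF f(1,2)] f(3)] .
  have "cg l (pm f) (mb (1 + w ^ l' * x))"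
    using one_plus_cg_iff[OF f(1) E_mult_by[OF x(1)], of l' 1] x(3) by (simp add: pm_mult_by l_eq)
  moreover have "w ^ l' * x \<in> I l'" using w_I[of x 0 l'] x(1) by (simp add: I_zero)
  ultimately have "Zc (pm f) (1 + w ^ l' * x)" using f x by (simp add: Zc_def)
  then show "\<exists>f g. Zc f g \<and> a = rd f" using f(4) by blast
next
  assume "\<exists>f g. Zc f g \<and> a = rd f"
  then obtain f g where h: "isom r f" "g \<in> N1" "g - 1 \<in> I l'" "cg l f (mb g)" "a = rd f" by (auto simp: Zc_def)
  obtain x where x: "x \<in> OL D" "g = 1 + w ^ l' * x" using N1_one_plus[OF h(2,3)] by blast
  have "cg l' (mb g) id" using h(3) cg_mult_by[OF N1(1)[OF h(2)] OL_closed(2)] by (simp add: mult_by_one)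
  then have "cg l' f id" using cg_trans[OF cg_antimono[OF h(4) l'_le]] by blast
  then obtain f' where f': "f' \<in> E" "f = pm f'" using cg_one_plus[OF isomD(1)[OF h(1)]] by blast
  have "cg 1 f' (mb x)"
    using one_plus_cg_iff[OF f'(1) E_mult_by[OF x(1)], of l' 1] h(4) by (simp add: pm_mult_by l_eq f'(2) x(2))
  then have "cmt 1 f'" using cmt_cg[OF cmt_mult_by cg_sym] by blast
  then show "a \<in> ZG" using f' h(1,5) ZG_iff by blast
qed

lemma KN_Zc: "a \<in> KN \<longleftrightarrow> (\<exists>f. isom r f \<and> cg l f (mb 1) \<and> a = rd f)"
  using cong_subgroup_iff[of l r a] by (simp add: mult_by_one)

lemma KN_ZG: "KN \<subseteq> ZG"
proof
  fix a assume "a \<in> KN"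
  then obtain f where f: "isom r f" "cg l f (mb 1)" "a = rd f" using KN_Zc by blast
  then have "Zc f 1" by (simp add: Zc_def N1 I_closed)
  then show "a \<in> ZG" using f(3) ZG_Zc by blast
qed

lemma GbH_iff: "g \<in> N1 \<Longrightarrow> rd (mb g) \<in> KH \<longleftrightarrow> g - 1 \<in> I l'"
  using red_cong[of l' r "mb g"] isom_N1[of g r] cg_mult_by[OF N1(1) OL_closed(2), of g l'] by (simp add: mult_by_one)

lemma GbN_iff: "g \<in> N1 \<Longrightarrow> rd (mb g) \<in> KN \<longleftrightarrow> g - 1 \<in> I l"
  using red_cong[of l r "mb g"] isom_N1[of g r] cg_mult_by[OF N1(1) OL_closed(2), of g l] by (simp add: mult_by_one)

lemma GbH: "Gb \<inter> KH = (\<lambda>g. rd (mb g)) ` {g \<in> N1. g - 1 \<in> I l'}"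
  by (auto simp: centralizer_eq GbH_iff)

lemma Z_prod: assumes "z \<in> ZG" shows "\<exists>g\<in>Gb \<inter> KH. \<exists>h\<in>KN. z = g \<odot> h"
proof -
  obtain f g where h: "isom r f" "g \<in> N1" "g - 1 \<in> I l'" "cg l f (mb g)" "z = rd f" using assms by (auto simp: ZG_Zc Zc_def)
  let ?h = "mb (\<iota> g) \<circ> f"
  have hi: "isom r ?h" by (intro isom_comp isom_N1 N1 h)
  have "cg l ?h (mb (\<iota> g) \<circ> mb g)" by (intro cg_comp h cg_refl E_mult_by isomD(1)[OF h(1)] N1)
  then have "rd ?h \<in> KN" using hi by (simp add: red_cong mult_by_comp N1 h mult_by_one)
  moreover have "mb g \<circ> ?h = f" by (simp add: comp_assoc[symmetric] mult_by_comp N1 h mult_by_one)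
  then have "z = rd (mb g) \<odot> rd ?h" using h by (simp add: UG_mult isom_N1[OF h(2)] hi)
  ultimately show ?thesis using GbH h by blast
qed

lemma Zc_mult:
  assumes h: "Zc f g" "Zc f' g'"
  shows "Zc (f \<circ> f') (g * g')"
proof -
  note E = isomD(1)[of r f] isomD(1)[of r f']
  have "cg l (f \<circ> f') (mb g \<circ> mb g')" using h E by (intro cg_comp E_mult_by) (auto simp: Zc_def N1)
  moreover have "g * g' - 1 \<in> I l'"
  proof -
    have "g * (g' - 1) + (g - 1) \<in> I l'" using h by (intro I_closed(2) I_closed(5)) (auto simp: Zc_def N1)
    then show ?thesis by (simp add: right_diff_distrib)
  qed
  ultimately show ?thesis using h by (simp add: Zc_def isom_comp N1 mult_by_comp)
qed

lemma ZG_mult: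
  assumes "a \<in> ZG" "c \<in> ZG"
  shows "a \<odot> c \<in> ZG"
proof -
  from assms obtain f g f' g' where h: "Zc f g" "a = rd f" "Zc f' g'" "c = rd f'" by (auto simp: ZG_Zc)
  then have "a \<odot> c = rd (f \<circ> f')" by (simp add: UG_mult Zc_def)
  then show ?thesis using Zc_mult[OF h(1,3)] ZG_Zc by blast
qed

lemma GbH_ZG: "Gb \<inter> KH \<subseteq> ZG" unfolding GbH by (force simp: ZG_Zc Zc_def isom_N1 cg_refl)

lemma prodZ: "g \<in> Gb \<inter> KH \<Longrightarrow> h \<in> KN \<Longrightarrow> g \<odot> h \<in> ZG" using ZG_mult GbH_ZG KN_ZG by blast

lemma ZG_KH: "ZG \<subseteq> KH" by (auto simp: Zgrp_def)

text \<open>Formally \<open>tb\<close> applied to \<open>w ^ (- r) * log (1 + w ^ l' f)\<close>,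
  with the logarithm cut after the quadratic term; here \<open>r - l' = l\<close> and
  \<open>r - 2 * l' = 1\<close>.\<close>

definition ch :: "('a \<Rightarrow> 'a) \<Rightarrow> 'a" where "ch f = inverse (w ^ l) * tb f - inverse (2 * w) * tb (f \<circ> f)"

lemma i2w: "inverse (2 * w) = 1 / 2 * inverse (w ^ 1)" using two_nonzero w0 by (simp add: field_simps)

lemma i2w_OL: "z \<in> I 1 \<Longrightarrow> inverse (2 * w) * z \<in> OL D"
  using OL_closed(5)[OF half_OL, of "inverse (w ^ 1) * z"] iw_I[of 1 z] unfolding i2w by (simp only: mult.assoc)

lemma i2w_F: "inverse (2 * w) \<in> F" unfolding i2w using half_OF by (intro F_closed(4) iw_F) (simp add: OF_iff)

lemma ch_F: "f \<in> E \<Longrightarrow> ch f \<in> F" unfolding ch_def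
  by (intro subfield_diff[OF subfields(1)] F_closed(4)[OF iw_F] F_closed(4)[OF i2w_F] tb_F E_comp)

lemma ch_cg: "f \<in> E \<Longrightarrow> g \<in> E \<Longrightarrow> cg l f g \<Longrightarrow> \<tau> (ch f) = \<tau> (ch g)"
proof (rule tau_cong)
  assume h: "f \<in> E" "g \<in> E" "cg l f g"
  have a: "inverse (w ^ l) * (tb f - tb g) \<in> OL D" unfolding iw_I by (rule tb_cg[OF h])
  have "cg 1 f g" using cg_antimono[OF h(3)] l_eq by simp
  then have "tb (f \<circ> f) - tb (g \<circ> g) \<in> I 1" by (intro tb_cg cg_comp E_comp h)
  then have c: "inverse (2 * w) * (tb (f \<circ> f) - tb (g \<circ> g)) \<in> OL D" by (rule i2w_OL)
  have "ch f - ch g = inverse (w ^ l) * (tb f - tb g) - inverse (2 * w) * (tb (f \<circ> f) - tb (g \<circ> g))"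
    unfolding ch_def right_diff_distrib by simp
  then show "ch f - ch g \<in> OL D" using OL_closed(4)[OF a c] by simp
qed (simp_all add: ch_F)

lemma psr_eval:
  assumes f: "f \<in> E" "isom r (pm f)" "cmt 1 f"
  shows "psr \<rho> (rd (pm f)) = \<tau> (ch f) * \<rho> (red_End D 1 f)"
  unfolding psi_rho_def
proof (rule the_equality)
  have L: "red_End D 1 f \<in> carrier Lc" using f pm_skew red_Lc by blast
  then show "\<exists>Y\<in>E. rd (pm f) = rd (pm Y) \<and> red_End D 1 Y \<in> carrier Lc \<and>
      \<tau> (ch f) * \<rho> (red_End D 1 f) = \<tau> (inverse (w ^ l) * trace_form D Y (mb \<beta>) - inverse (2 * w) * trace_form D (Y \<circ> Y) (mb \<beta>)) * \<rho> (red_End D 1 Y)"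
    using f by (auto simp: ch_def tb_def trace_form_eq)
  fix z assume "\<exists>Y\<in>E. rd (pm f) = rd (pm Y) \<and> red_End D 1 Y \<in> carrier Lc \<and>
      z = \<tau> (inverse (w ^ l) * trace_form D Y (mb \<beta>) - inverse (2 * w) * trace_form D (Y \<circ> Y) (mb \<beta>)) * \<rho> (red_End D 1 Y)"
  then obtain g where g: "g \<in> E" "rd (pm f) = rd (pm g)" "z = \<tau> (ch g) * \<rho> (red_End D 1 g)"
    by (auto simp: ch_def tb_def trace_form_eq)
  have c: "cg l f g" using pm_red_eq[OF f(1) g(1)] g(2) by simp
  then have "red_End D 1 f = red_End D 1 g" using red_End_eq[OF f(1) g(1)] cg_antimono[OF c] l_eq by simp
  then show "z = \<tau> (ch f) * \<rho> (red_End D 1 f)" using g(3) ch_cg[OF f(1) g(1) c] by simp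
qed

lemma tb_sub: "f \<in> E \<Longrightarrow> g \<in> E \<Longrightarrow> tb (\<lambda>x. f x - g x) = tb f - tb g"
  using tr_diff[OF E_comp[OF _ mult_by_E] E_comp[OF _ mult_by_E]] by (simp add: tb_def comp_def)

text \<open>The trace form of the commutator of \<open>f\<close> and \<open>g\<close> with
  \<open>\<beta>\<close>. By cyclicity it is the trace of \<open>g\<close> against the commutator of
  \<open>\<beta>\<close> and \<open>f\<close>, so it measures how far \<open>f\<close> is from
  commuting with \<open>\<beta>\<close>.\<close>

definition bra :: "('a \<Rightarrow> 'a) \<Rightarrow> ('a \<Rightarrow> 'a) \<Rightarrow> 'a" where "bra f g = tb (f \<circ> g) - tb (g \<circ> f)"

lemma bra_tr:
  assumes f: "f \<in> E" and g: "g \<in> E"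
  shows "(\<lambda>x. f x * \<beta> - f (x * \<beta>)) \<in> E" "bra f g = tr (g \<circ> (\<lambda>x. f x * \<beta> - f (x * \<beta>)))"
proof -
  show W: "(\<lambda>x. f x * \<beta> - f (x * \<beta>)) \<in> E"
    using E_sub[OF E_comp[OF mult_by_E f] E_comp[OF f mult_by_E]] by (simp add: comp_def mult_by_def)
  have "tr (g \<circ> (\<lambda>x. f x * \<beta> - f (x * \<beta>))) = tr (\<lambda>x. (g \<circ> mb \<beta> \<circ> f) x - (g \<circ> f \<circ> mb \<beta>) x)"
    by (rule tr_cong[OF E_comp[OF g W] E_sub[OF E_comp[OF E_comp[OF g mult_by_E] f] E_comp[OF E_comp[OF g f] mult_by_E]]])
       (simp add: mult_by_def E_diff[OF g] E_D(1)[OF f] OL_closed(5)[OF _ beta_OL])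
  also have "\<dots> = tr (g \<circ> mb \<beta> \<circ> f) - tr (g \<circ> f \<circ> mb \<beta>)" by (rule tr_diff) (intro E_comp f g mult_by_E)+
  also have "tr (g \<circ> mb \<beta> \<circ> f) = tr (f \<circ> (g \<circ> mb \<beta>))" by (rule tr_comm) (intro E_comp f g mult_by_E)+
  finally show "bra f g = tr (g \<circ> (\<lambda>x. f x * \<beta> - f (x * \<beta>)))" unfolding bra_def tb_def by (simp only: comp_assoc)
qed

lemma bra_cmt:
  assumes f: "f \<in> E" "cmt 1 f" and g: "g \<in> E"
  shows "bra f g \<in> I 1"
  unfolding bra_tr(2)[OF f(1) g]
proof (rule tr_I[OF E_comp[OF g bra_tr(1)[OF f(1) g]]])
  fix x assume "x \<in> OL D"
  then show "(g \<circ> (\<lambda>x. f x * \<beta> - f (x * \<beta>))) x \<in> I 1"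
    using E_ideal[OF g I_closed(4)[OF cmtD[OF f(2)]], of x] by simp
qed

lemma bra_OF: "f \<in> E \<Longrightarrow> g \<in> E \<Longrightarrow> bra f g \<in> OF D"
  by (simp only: bra_tr(2)) (intro tr_OF E_comp bra_tr(1))

lemma pm_comp:
  assumes f: "f \<in> E" and g: "g \<in> E"
  shows "x \<in> OL D \<Longrightarrow> (pm f \<circ> pm g) x = pm (\<lambda>x. f x + g x + w ^ l' * f (g x)) x"
proof -
  assume x: "x \<in> OL D"
  note O = E_D(1)[OF g x]
  show "(pm f \<circ> pm g) x = pm (\<lambda>x. f x + g x + w ^ l' * f (g x)) x"
    unfolding one_plus_def comp_def E_D(2)[OF f x OL_closed(5)[OF w_OL O]] E_w[OF f O] by (simp add: distrib_left)
qed

text \<open>The quadratic term of the product contributes \<open>tb (f \<circ> g) / w\<close>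
  through the first summand of \<open>ch\<close>, and the second summand takes away half the sum of
  \<open>tb (f \<circ> g)\<close> and \<open>tb (g \<circ> f)\<close> over \<open>w\<close>. What is
  left is \<open>bra f g / (2 * w)\<close>, integral because \<open>f\<close> commutes with
  \<open>\<beta>\<close> modulo the maximal ideal.\<close>

lemma psr_mult:
  assumes \<rho>: "\<rho> \<in> chars Lc" and a: "a \<in> ZG" and c: "c \<in> ZG"
  shows "psr \<rho> (a \<odot> c) = psr \<rho> a * psr \<rho> c"
proof -
  obtain f where f: "f \<in> E" "isom r (pm f)" "cmt 1 f" "a = rd (pm f)" using a ZG_iff by blast
  obtain g where g: "g \<in> E" "isom r (pm g)" "cmt 1 g" "c = rd (pm g)" using c ZG_iff by blast
  define h where "h x = f x + g x + w ^ l' * f (g x)" for x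
  define k where "k x = f x + g x" for x
  have fgE: "f \<circ> g \<in> E" by (rule E_comp[OF f(1) g(1)])
  have kE: "k \<in> E" unfolding k_def[abs_def] by (rule E_add[OF f(1) g(1)])
  have hE: "h \<in> E" using E_add[OF kE E_mult[OF fgE w_OL]] by (simp add: h_def[abs_def] k_def comp_def)
  have cgc: "cg r (pm f \<circ> pm g) (pm h)" by (rule cgI) (simp only: pm_comp[OF f(1) g(1)] h_def[abs_def] diff_self I_closed(1))
  have ac: "a \<odot> c = rd (pm h)"
    using cgc by (simp add: f(4) g(4) UG_mult f(2) g(2) red_End_eq E_comp E_one_plus f(1) g(1) hE)
  have hi: "isom r (pm h)" by (rule isom_cg[OF isom_comp[OF f(2) g(2)] cgc E_one_plus[OF hE]])
  have hk: "cg 1 h k"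
  proof (rule cgI)
    fix x assume "x \<in> OL D"
    then have "f (g x) \<in> I 0" using E_D(1) f(1) g(1) by (simp add: I_zero)
    from I_antimono[OF l'_pos] w_I[OF this, of l'] show "h x - k x \<in> I 1" by (simp add: h_def k_def)
  qed
  have "cmt 1 k" unfolding k_def[abs_def] by (rule cmt_add[OF f(3) g(3)])
  then have hc: "cmt 1 h" using cmt_cg cg_sym[OF hk] by blast
  have "red_End D 1 h = red_End D 1 k" using red_End_eq[OF hE kE] hk by simp
  also have "\<dots> = red_End D 1 f \<otimes>\<^bsub>Lc\<^esub> red_End D 1 g" using Lc_mult[OF f(1) g(1)] by (simp add: k_def[abs_def])
  finally have "\<rho> (red_End D 1 h) = \<rho> (red_End D 1 f) * \<rho> (red_End D 1 g)"
    using hom_mult[of \<rho> Lc Cx "red_End D 1 f" "red_End D 1 g"] \<rho> red_Lc[OF f(1)] red_Lc[OF g(1)] pm_skew f g by (simp add: chars_def Cx_def)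
  moreover have "\<tau> (ch h) = \<tau> (ch f) * \<tau> (ch g)"
  proof -
    have t1: "tb h = tb f + tb g + w ^ l' * tb (f \<circ> g)"
    proof -
      have "h = (\<lambda>x. k x + w ^ l' * (f \<circ> g) x)" by (rule ext) (simp add: h_def k_def)
      then have "tb h = tb k + w ^ l' * tb (f \<circ> g)"
        using tb_add[OF kE E_mult[OF fgE w_OL]] tb_scale[OF fgE wF_power] by simp
      then show ?thesis using tb_add[OF f(1) g(1)] by (simp add: k_def[abs_def])
    qed
    have t2: "tb (k \<circ> k) = (tb (f \<circ> f) + tb (g \<circ> f)) + (tb (f \<circ> g) + tb (g \<circ> g))"
    proof -
      have "tb (k \<circ> k) = tb (\<lambda>x. (k \<circ> f) x + (k \<circ> g) x)"
        unfolding tb_def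
      proof (rule tr_cong[OF E_comp[OF E_comp[OF kE kE] mult_by_E] E_comp[OF E_add[OF E_comp[OF kE f(1)] E_comp[OF kE g(1)]] mult_by_E]])
        fix x assume "x \<in> OL D"
        then have y: "mb \<beta> x \<in> OL D" by (rule E_D(1)[OF mult_by_E])
        have "k (k (mb \<beta> x)) = k (f (mb \<beta> x) + g (mb \<beta> x))" by (simp only: k_def[of "mb \<beta> x"])
        then show "(k \<circ> k \<circ> mb \<beta>) x = ((\<lambda>x. (k \<circ> f) x + (k \<circ> g) x) \<circ> mb \<beta>) x"
          using E_D(2)[OF kE E_D(1)[OF f(1) y] E_D(1)[OF g(1) y]] by simp
      qed
      also have "\<dots> = tb (k \<circ> f) + tb (k \<circ> g)" by (intro tb_add E_comp kE f(1) g(1))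
      also have "tb (k \<circ> f) = tb (f \<circ> f) + tb (g \<circ> f)" using tb_add[OF E_comp[OF f(1) f(1)] E_comp[OF g(1) f(1)]] by (simp add: k_def[abs_def] comp_def)
      also have "tb (k \<circ> g) = tb (f \<circ> g) + tb (g \<circ> g)" using tb_add[OF E_comp[OF f(1) g(1)] E_comp[OF g(1) g(1)]] by (simp add: k_def[abs_def] comp_def)
      finally show ?thesis .
    qed
    have t3: "tb (h \<circ> h) - tb (k \<circ> k) \<in> I 1" by (intro tb_cg E_comp cg_comp hk hE kE)
    have e: "inverse (w ^ l) * w ^ l' = 2 * inverse (2 * w)" using w0 two_nonzero by (simp add: w_l field_simps)
    have "ch h - (ch f + ch g) = (inverse (w ^ l) * w ^ l') * tb (f \<circ> g) - inverse (2 * w) * (tb (h \<circ> h) - tb (f \<circ> f) - tb (g \<circ> g))"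
      unfolding ch_def t1 by (simp add: distrib_left right_diff_distrib)
    also have "\<dots> = inverse (2 * w) * (2 * tb (f \<circ> g) - (tb (h \<circ> h) - tb (f \<circ> f) - tb (g \<circ> g)))"
      unfolding e right_diff_distrib by (simp only: mult_ac)
    also have "2 * tb (f \<circ> g) - (tb (h \<circ> h) - tb (f \<circ> f) - tb (g \<circ> g)) = bra f g - (tb (h \<circ> h) - tb (k \<circ> k))"
      unfolding t2 bra_def by simp
    finally have "ch h - (ch f + ch g) \<in> OL D"
      using i2w_OL[OF I_closed(3)[OF bra_cmt[OF f(1,3) g(1)] t3]] by (simp only:)
    then have "\<tau> (ch h) = \<tau> (ch f + ch g)" by (intro tau_cong ch_F hE F_closed(3) f(1) g(1))
    then show ?thesis using tau_add[OF ch_F[OF f(1)] ch_F[OF g(1)]] by simp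
  qed
  ultimately show ?thesis unfolding ac psr_eval[OF hE hi hc] unfolding f(4) g(4) psr_eval[OF f(1-3)] psr_eval[OF g(1-3)] by simp
qed

lemma E_0: "(\<lambda>x. 0) \<in> E" by (rule E_I) (auto simp: OL_closed)

lemma chars_zero: assumes "\<rho> \<in> chars Lc" shows "\<rho> (red_End D 1 (\<lambda>x. 0)) = 1"
proof -
  let ?z = "red_End D 1 (\<lambda>x. 0)"
  have "skew 1 (\<lambda>x. 0)" "cmt 1 (\<lambda>x. 0)" by (auto simp: skew_def cmt_def E_0 S_zero I_closed)
  then have z: "?z \<in> carrier Lc" using red_Lc[OF E_0] by simp
  have "?z \<otimes>\<^bsub>Lc\<^esub> ?z = ?z" using Lc_mult[OF E_0 E_0] by simp
  then have "\<rho> ?z = \<rho> ?z * \<rho> ?z" using hom_mult[of \<rho> Lc Cx ?z ?z] z assms by (simp add: chars_def Cx_def)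
  moreover have "\<rho> ?z \<noteq> 0" using assms z by (auto simp: chars_def Cx_def hom_def)
  ultimately show ?thesis by simp
qed

text \<open>An element \<open>1 + w ^ l f\<close> of \<open>KN\<close> is
  \<open>1 + w ^ l' g\<close> with \<open>g = w * f\<close>. As \<open>g\<close> vanishes modulo the
  maximal ideal, \<open>\<rho>\<close> contributes \<open>1\<close> and the quadratic term of
  \<open>ch\<close> is integral.\<close>

lemma psr_psi:
  assumes \<rho>: "\<rho> \<in> chars Lc" and h: "h \<in> KN"
  shows "psr \<rho> h = \<psi> h"
proof -
  obtain f where f: "skew l' f" "h = rd (pl f)" using h KN_iff by blast
  note fE = skewD(1)[OF f(1)]
  have wO: "w \<in> OL D" "w \<in> OF D" using w_OL[of 1] wF_power[of 1] by auto
  define g where "g x = w * f x" for x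
  have gE: "g \<in> E" unfolding g_def[abs_def] by (rule E_mult[OF fE wO(1)])
  have e: "pl f = pm g" by (rule ext) (simp add: one_plus_def g_def w_l mult_ac)
  have gi: "isom r (pm g)" using pl_isom[OF fE] f(1) e by simp
  have g0: "cg 1 g (\<lambda>x. 0)"
    by (rule cgI) (use w_I[of _ 0 1] E_D(1)[OF fE] in \<open>auto simp: g_def I_zero\<close>)
  have gc: "cmt 1 g" using cmt_cg[OF _ cg_sym[OF g0]] by (simp add: cmt_def I_closed)
  have "\<rho> (red_End D 1 g) = 1" using chars_zero[OF \<rho>] red_End_eq[OF gE E_0, of 1] g0 by simp
  then have "psr \<rho> h = \<tau> (ch g)" unfolding f(2) e psr_eval[OF gE gi gc] by simp
  also have "\<dots> = \<tau> (inverse (w ^ l') * tb f)"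
  proof (rule tau_cong[OF ch_F[OF gE] F_closed(4)[OF iw_F tb_F[OF fE]]])
    have "tb g = w * tb f" unfolding g_def[abs_def] by (rule tb_scale[OF fE wO(2)])
    moreover have "inverse (w ^ l) * (w * tb f) = inverse (w ^ l') * tb f" using w0 by (simp add: w_l)
    ultimately have "ch g - inverse (w ^ l') * tb f = - (inverse (2 * w) * tb (g \<circ> g))" by (simp add: ch_def)
    moreover have "tb (g \<circ> g) \<in> I 1"
      using tb_cg[OF E_comp[OF gE gE] E_comp[OF E_0 gE] cg_comp[OF g0 cg_refl gE gE gE]] tr_I[of "(\<lambda>x. 0) \<circ> mb \<beta>" 1] E_comp[OF E_0 mult_by_E]
      by (simp add: tb_def comp_def I_closed tr_eq coef_zero)
    ultimately show "ch g - inverse (w ^ l') * tb f \<in> OL D" using i2w_OL I_closed(4)[of _ 0] by (simp add: I_zero)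
  qed
  finally show ?thesis using psi_eval[OF f(1)] f(2) by simp
qed

text \<open>The commutator is \<open>1 + w ^ (2 * l') B\<close> with \<open>B\<close> the commutator
  of \<open>f\<close> and \<open>g\<close>: the inverses in front are congruent to \<open>1\<close>
  modulo \<open>I l'\<close> and change this by terms with factor \<open>w ^ (3 * l')\<close>, and
  \<open>r \<le> 3 * l'\<close>. Since \<open>2 * l' = l + (l' - 1)\<close>, it lies in
  \<open>KN\<close>, with \<open>C = w ^ (l' - 1) B\<close> as its Lie algebra part.\<close>

lemma commutator:
  assumes f: "f \<in> E" "isom r (pm f)" and g: "g \<in> E" "isom r (pm g)"
  defines "c \<equiv> cm (rd (pm f)) (rd (pm g))"
  shows "c \<in> KN" "\<psi> c = \<tau> (inverse w * bra f g)"
proof -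
  obtain f' where f': "isom r f'" "cg r (pm f \<circ> f') id" "cg r (f' \<circ> pm f) id" using isom_inverse[OF f(2)] .
  obtain g' where g': "isom r g'" "cg r (pm g \<circ> g') id" "cg r (g' \<circ> pm g) id" using isom_inverse[OF g(2)] .
  note E = f(1) g(1) isomD(1)[OF f'(1)] isomD(1)[OF g'(1)] E_one_plus[OF f(1), of l'] E_one_plus[OF g(1), of l']
  have inv: "iv (rd (pm f)) = rd f'" "iv (rd (pm g)) = rd g'"
    by (rule UG_inv[OF f(2) f'(1,3)], rule UG_inv[OF g(2) g'(1,3)])
  have sub: "subgroup KH (UG r)" using cong_subgroup_normal[of l' r] by (simp add: normal_def)
  have "rd f' \<in> KH" "rd g' \<in> KH"
    using subgroup.m_inv_closed[OF sub red_pm_KH[OF f]] subgroup.m_inv_closed[OF sub red_pm_KH[OF g]] inv by simp_all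
  then have id: "cg l' f' id" "cg l' g' id" using red_cong[of l' r] f'(1) g'(1) by simp_all
  define B where "B x = (f \<circ> g) x - (g \<circ> f) x" for x
  define C where "C x = w ^ (l' - 1) * B x" for x
  have BE: "B \<in> E" unfolding B_def[abs_def] by (intro E_sub E_comp f g)
  have CE: "C \<in> E" unfolding C_def[abs_def] by (rule E_mult[OF BE w_OL])
  have pw: "w ^ l * (w ^ (l' - 1) * z) = w ^ l' * (w ^ l' * z)" for z
    using l'_pos by (cases l') (simp_all add: l_eq mult_ac power_add)
  have cgc: "cg r (f' \<circ> g' \<circ> pm f \<circ> pm g) (pl C)"
  proof (rule cgI)
    fix x assume x: "x \<in> OL D"
    define y where "y = w ^ l' * (w ^ l' * B x)"
    have BO: "B x \<in> OL D" by (rule E_D(1)[OF BE x])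
    have yO: "y \<in> OL D" unfolding y_def by (intro OL_closed(5) w_OL BO)
    have gfO: "pm g (pm f x) \<in> OL D" "pm f x \<in> OL D" using E_D(1) E x by blast+
    have 1: "pm f (pm g x) = pm g (pm f x) + y"
      using pm_comp[OF E(1,2) x] pm_comp[OF E(2,1) x] by (simp add: one_plus_def y_def B_def distrib_left right_diff_distrib)
    have 2: "f' (g' (pm f (pm g x))) = f' (g' (pm g (pm f x))) + w ^ l' * (w ^ l' * f' (g' (B x)))"
      unfolding 1 E_D(2)[OF E(4) gfO(1) yO] E_D(2)[OF E(3) E_D(1)[OF E(4) gfO(1)] E_D(1)[OF E(4) yO]] unfolding y_def
      using E_w[OF E(4) OL_closed(5)[OF w_OL BO]] E_w[OF E(4) BO] E_w[OF E(3) OL_closed(5)[OF w_OL E_D(1)[OF E(4) BO]]] E_w[OF E(3) E_D(1)[OF E(4) BO]] by simp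
    have 3: "f' (g' (pm g (pm f x))) - x \<in> I r"
    proof -
      have "f' (g' (pm g (pm f x)) - pm f x) \<in> I r" using cgD[OF g'(3) gfO(2)] by (intro E_ideal[OF E(3)]) simp
      then have "f' (g' (pm g (pm f x))) - f' (pm f x) \<in> I r" by (simp add: E_diff[OF E(3) E_D(1)[OF E(4) gfO(1)] gfO(2)])
      from I_closed(2)[OF this cgD[OF f'(3) x]] show ?thesis by simp
    qed
    have "(f' (g' (B x)) - g' (B x)) + (g' (B x) - B x) \<in> I l'"
      using I_closed(2)[OF cgD[OF id(1) E_D(1)[OF E(4) BO]] cgD[OF id(2) BO]] by simp
    then have "w ^ l' * (w ^ l' * (f' (g' (B x)) - B x)) \<in> I (l' + (l' + l'))" by (simp add: w_I_iff)
    then have 4: "w ^ l' * (w ^ l' * (f' (g' (B x)) - B x)) \<in> I r" using I_antimono[OF r_le_triple] by (simp add: add.assoc)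
    have "(f' \<circ> g' \<circ> pm f \<circ> pm g) x - pl C x = (f' (g' (pm g (pm f x))) - x) + w ^ l' * (w ^ l' * (f' (g' (B x)) - B x))"
      using 2 by (simp add: one_plus_def[of D l] C_def pw right_diff_distrib)
    then show "(f' \<circ> g' \<circ> pm f \<circ> pm g) x - pl C x \<in> I r" using I_closed(2)[OF 3 4] by simp
  qed
  have i: "isom r (f' \<circ> g' \<circ> pm f \<circ> pm g)" by (intro isom_comp f g f' g')
  have "isom r (pl C)" by (rule isom_cg[OF i cgc E_one_plus[OF CE]])
  then have sk: "skew l' C" using pl_isom[OF CE] by simp
  have "c = rd (f' \<circ> g' \<circ> pm f \<circ> pm g)" unfolding c_def inv using f g f' g' by (simp add: UG_mult isom_comp)
  then have c: "c = rd (pl C)" using cgc red_End_eq[OF isomD(1)[OF i] E_one_plus[OF CE]] by simp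
  show "c \<in> KN" unfolding c using sk KN_iff by blast
  have "tb B = bra f g" unfolding bra_def B_def[abs_def] by (intro tb_sub E_comp f g)
  then have "tb C = w ^ (l' - 1) * bra f g" unfolding C_def[abs_def] tb_scale[OF BE wF_power] by simp
  moreover have "inverse (w ^ l') * (w ^ (l' - 1) * z) = inverse w * z" for z
    using l'_pos w0 by (cases l') simp_all
  ultimately show "\<psi> c = \<tau> (inverse w * bra f g)" unfolding c psi_eval[OF sk] by (simp only:)
qed

lemma tau_bra: "f \<in> E \<Longrightarrow> g \<in> E \<Longrightarrow> bra f g \<in> I 1 \<Longrightarrow> \<tau> (inverse w * bra f g) = 1"
proof (rule tau_OF)
  assume h: "f \<in> E" "g \<in> E" "bra f g \<in> I 1"
  have "inverse w * bra f g \<in> OL D" using iw_I[of 1] h(3) by simp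
  moreover have "inverse w * bra f g \<in> F" using F_closed(4)[OF iw_F[of 1]] bra_OF[OF h(1,2)] by (simp add: OF_iff)
  ultimately show "inverse w * bra f g \<in> OF D" by (simp add: OF_iff OL_iff)
qed

lemma comm: "x \<in> KH \<Longrightarrow> h \<in> KH \<Longrightarrow> cm x h \<in> KN"
  by (elim KH_E) (simp add: commutator(1))

lemma cent_Z: "x \<in> ZG \<Longrightarrow> h \<in> KH \<Longrightarrow> \<psi> (cm x h) = 1"
  by (elim KH_E) (auto simp: ZG_iff commutator(2) tau_bra bra_cmt)

text \<open>\<open>one_plus D l' f\<close> is the exponential of \<open>w ^ l' Y\<close>, truncated after the quadratic term.\<close>

lemma exp_isom:
  assumes Y: "Y \<in> lie_O D"
  defines "f \<equiv> \<lambda>x. Y x + 1 / 2 * (w ^ l' * Y (Y x))"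
  shows "f \<in> E" "isom r (pm f)" "cg 1 f Y"
proof -
  note YE = lie_E[OF Y]
  have sk: "S (Y x) y = - S x (Y y)" if "x \<in> OL D" "y \<in> OL D" for x y
    using Y that by (simp add: lie_O_def eq_neg_iff_add_eq_0)
  show fE: "f \<in> E" unfolding f_def using E_add[OF YE E_mult[OF E_mult[OF E_comp[OF YE YE] w_OL] half_OL]] by (simp add: comp_def)
  have hF: "1 / 2 \<in> F" using half_OF by (simp add: OF_iff)
  note h = S_scale(1)[OF F_K[OF hF]] S_scale(2)[OF F_K[OF hF], unfolded invol_aut(2)[OF hF]]
  show "isom r (pm f)" unfolding pm_isom[OF fE]
  proof (intro ballI)
    fix x y assume xy: "x \<in> OL D" "y \<in> OL D"
    note O = E_D(1)[OF YE xy(1)] E_D(1)[OF YE xy(2)]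
    note O2 = E_D(1)[OF YE O(1)] E_D(1)[OF YE O(2)]
    let ?p = "S (Y x) (Y y)"
    define z where "z = 1 / 2 * S (Y x) (Y (Y y)) + 1 / 2 * S (Y (Y x)) (Y y) + 1 / 2 * (w ^ l' * (1 / 2 * S (Y (Y x)) (Y (Y y))))"
    have s: "S (Y (Y x)) y = - ?p" "S x (Y (Y y)) = - ?p" "S (Y x) y + S x (Y y) = 0"
      using sk[OF O(1) xy(2)] sk[OF xy(1) O(2)] sk[OF xy] by auto
    have a: "S (f x) y + S x (f y) = - (w ^ l' * ?p)"
    proof -
      have "S (f x) y + S x (f y) = (S (Y x) y + S x (Y y)) + (1 / 2 * (w ^ l' * S (Y (Y x)) y) + 1 / 2 * (w ^ l' * S x (Y (Y y))))"
        unfolding f_def S_add h S_w by (simp only: ac_simps)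
      also have "\<dots> = - (1 / 2 * (w ^ l' * ?p) + 1 / 2 * (w ^ l' * ?p))" unfolding s by simp
      also have "1 / 2 * (w ^ l' * ?p) + 1 / 2 * (w ^ l' * ?p) = w ^ l' * ?p" using two_nonzero by (simp add: field_simps)
      finally show ?thesis .
    qed
    have c: "S (f x) (f y) = ?p + w ^ l' * z"
      unfolding f_def S_add h S_w z_def distrib_left by (simp only: ac_simps mult_ac)
    have "S (f x) y + S x (f y) + w ^ l' * S (f x) (f y) = w ^ l' * (w ^ l' * z)"
      unfolding a c distrib_left by simp
    moreover have "z \<in> OL D" unfolding z_def by (intro OL_closed(3,5) half_OL w_OL S_OL O O2)
    then have "w ^ l' * (w ^ l' * z) \<in> I (l' + l')" unfolding w_I_iff using w_I[of z 0 l'] by (simp add: I_zero)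
    ultimately show "S (f x) y + S x (f y) + w ^ l' * S (f x) (f y) \<in> I l" using I_antimono[OF l_le_double] by simp
  qed
  show "cg 1 f Y"
  proof (rule cgI)
    fix x assume "x \<in> OL D"
    then have "w ^ l' * Y (Y x) \<in> I l'" using w_I[of "Y (Y x)" 0 l'] E_D(1)[OF YE] by (simp add: I_zero)
    then have "1 / 2 * (w ^ l' * Y (Y x)) \<in> I l'" by (rule I_closed(5)[OF half_OL])
    then show "f x - Y x \<in> I 1" using I_antimono[OF l'_pos] by (simp add: f_def)
  qed
qed

text \<open>If \<open>x\<close> pairs trivially with \<open>KH\<close>, the commutator
  \<open>W\<close> of \<open>\<beta>\<close> and \<open>f\<close> is skew modulo the maximal ideal
  and orthogonal to the Lie algebra, so it vanishes there and \<open>x\<close> is in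
  \<open>ZG\<close>. As \<open>1 + w ^ l' Y\<close> need not be an isometry modulo
  \<open>I r\<close>, an element \<open>Y\<close> of the Lie algebra is represented in
  \<open>KH\<close> by the truncated exponential.\<close>

lemma nondeg:
  assumes x: "x \<in> KH" "x \<notin> ZG"
  shows "\<exists>h\<in>KH. \<psi> (cm x h) \<noteq> 1"
proof (rule ccontr)
  assume n: "\<not> ?thesis"
  obtain f where f: "f \<in> E" "isom r (pm f)" "x = rd (pm f)" using KH_E[OF x(1)] .
  note fs = pm_skew[OF f(1,2)]
  define W where "W x = f x * \<beta> - f (x * \<beta>)" for x
  have WE: "W \<in> E" unfolding W_def[abs_def] by (rule bra_tr(1)[OF f(1) f(1)])
  have "skew 1 W" unfolding skew_def
  proof (intro conjI ballI WE)
    fix x y assume xy: "x \<in> OL D" "y \<in> OL D"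
    have "(S (f (x * \<beta>)) y + S (x * \<beta>) (f y)) + (S (f x) (y * \<beta>) + S x (f (y * \<beta>))) \<in> I 1"
      by (rule I_closed(2)) (intro skewD(2)[OF fs] OL_closed(5) xy beta_OL)+
    moreover have "S (W x) y + S x (W y) = - ((S (f (x * \<beta>)) y + S (x * \<beta>) (f y)) + (S (f x) (y * \<beta>) + S x (f (y * \<beta>))))"
      using beta_skew_S[of "f x" y] beta_skew_S[of x "f y"] by (simp add: W_def S_diff)
    ultimately show "S (W x) y + S x (W y) \<in> I 1" using I_closed(4) by (simp only:)
  qed
  moreover have "\<tau> (inverse (w ^ 1) * tr (Y \<circ> W)) = 1" if Y: "Y \<in> lie_O D" for Y
  proof -
    define g where "g x = Y x + 1 / 2 * (w ^ l' * Y (Y x))" for x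
    have g: "g \<in> E" "isom r (pm g)" "cg 1 g Y" unfolding g_def[abs_def] by (rule exp_isom[OF Y])+
    have "\<tau> (inverse w * bra f g) = 1" using n red_pm_KH[OF g(1,2)] commutator(2)[OF f(1,2) g(1,2)] f(3) by auto
    moreover have "bra f g - bra f Y \<in> I 1"
    proof -
      have "tr (g \<circ> W) - tr (Y \<circ> W) \<in> I 1" by (intro cg_tr E_comp cg_comp cg_refl g WE lie_E[OF Y])
      then show ?thesis using bra_tr(2)[OF f(1)] g(1) lie_E[OF Y] by (simp add: W_def[abs_def])
    qed
    ultimately have "\<tau> (inverse (w ^ 1) * bra f Y) = 1"
      using tau_iw[OF bra_OF bra_OF, of f g f Y 1] f(1) g(1) lie_E[OF Y] by simp
    then show ?thesis using bra_tr(2)[OF f(1) lie_E[OF Y]] by (simp add: W_def[abs_def])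
  qed
  ultimately have "W x \<in> I 1" if "x \<in> OL D" for x using trace_perfect[of 1 W x] that by blast
  then have "cmt 1 f" unfolding cmt_def W_def using I_closed(4) by fastforce
  then show False using x(2) f ZG_iff by blast
qed

lemma Lc_lift:
  assumes "C \<in> carrier Lc"
  obtains x where "x \<in> OL D" "1 + w ^ l' * x \<in> N1" "C = red_End D 1 (mb x)"
proof -
  obtain f where f: "skew 1 f" "cmt 1 f" "C = red_End D 1 f" using Lc_E[OF assms] .
  obtain x where x: "x \<in> OL D" "1 + w ^ l' * x \<in> N1" "cg 1 f (mb x)" using cmt_lift[OF f(1,2)] .
  show ?thesis using that[OF x(1,2)] f x red_End_eq[OF skewD(1)[OF f(1)] E_mult_by[OF x(1)]] by simp
qed

lemma psr_mult_by:
  assumes x: "x \<in> OL D" "1 + w ^ l' * x \<in> N1"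
  shows "psr \<rho> (rd (mb (1 + w ^ l' * x))) = \<tau> (ch (mb x)) * \<rho> (red_End D 1 (mb x))"
    "rd (mb (1 + w ^ l' * x)) \<in> Gb \<inter> KH" "red_End D 1 (mb x) \<in> carrier Lc"
proof -
  have i: "isom r (pm (mb x))" using isom_N1[OF x(2)] by (simp add: pm_mult_by)
  show "psr \<rho> (rd (mb (1 + w ^ l' * x))) = \<tau> (ch (mb x)) * \<rho> (red_End D 1 (mb x))"
    using psr_eval[OF E_mult_by[OF x(1)] i cmt_mult_by] by (simp add: pm_mult_by)
  show "rd (mb (1 + w ^ l' * x)) \<in> Gb \<inter> KH"
    using x red_pm_KH[OF E_mult_by[OF x(1)] i] by (auto simp: centralizer_eq pm_mult_by)
  show "red_End D 1 (mb x) \<in> carrier Lc" using red_Lc[OF E_mult_by[OF x(1)]] pm_skew[OF E_mult_by[OF x(1)] i] cmt_mult_by by simp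
qed

text \<open>By \<open>Lc_lift\<close> every element of the residual centralizer comes from
  \<open>Gb \<inter> KH\<close>, and there \<open>psr\<close> is \<open>\<rho>\<close> times a
  nonzero factor that does not depend on \<open>\<rho>\<close>.\<close>

lemma psr_inj:
  assumes \<rho>: "\<rho> \<in> chars Lc" "\<rho>' \<in> chars Lc" and e: "\<And>g. g \<in> Gb \<inter> KH \<Longrightarrow> psr \<rho> g = psr \<rho>' g"
  shows "\<rho> = \<rho>'"
proof (rule extensionalityI[of _ "carrier Lc"])
  show "\<rho> \<in> extensional (carrier Lc)" "\<rho>' \<in> extensional (carrier Lc)" using \<rho> by (auto simp: chars_def)
  fix C assume "C \<in> carrier Lc"
  then obtain x where x: "x \<in> OL D" "1 + w ^ l' * x \<in> N1" "C = red_End D 1 (mb x)" using Lc_lift by blast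
  show "\<rho> C = \<rho>' C"
    using e[OF psr_mult_by(2)[OF x(1,2)]] tau_nonzero[OF ch_F[OF E_mult_by[OF x(1)]]] unfolding psr_mult_by(1)[OF x(1,2)] x(3) by simp
qed

text \<open>Dividing \<open>\<eta>\<close> by \<open>psr\<close> of the trivial character leaves a
  character \<open>\<phi>\<close> of the elements of norm one congruent to \<open>1\<close> modulo
  \<open>I l'\<close>. It is trivial on those congruent to \<open>1\<close> modulo
  \<open>I l\<close>, since numerator and denominator agree with \<open>\<psi>\<close> there, so it
  descends to the residual centralizer; this is \<open>\<rho>\<close>.\<close>

lemma psr_surj:
  assumes m: "\<And>g h. g \<in> Gb \<inter> KH \<Longrightarrow> h \<in> Gb \<inter> KH \<Longrightarrow> \<eta> (g \<odot> h) = \<eta> g * \<eta> h"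
    and nz: "\<And>g. g \<in> Gb \<inter> KH \<Longrightarrow> \<eta> g \<noteq> (0::complex)" and p: "\<And>g. g \<in> Gb \<inter> KH \<Longrightarrow> g \<in> KN \<Longrightarrow> \<eta> g = \<psi> g"
  shows "\<exists>\<rho>\<in>chars Lc. \<forall>g\<in>Gb \<inter> KH. psr \<rho> g = \<eta> g"
proof -
  define \<rho>0 where "\<rho>0 = (\<lambda>C\<in>carrier Lc. 1 :: complex)"
  have Lc_closed: "C \<otimes>\<^bsub>Lc\<^esub> C' \<in> carrier Lc" if CC: "C \<in> carrier Lc" "C' \<in> carrier Lc" for C C'
  proof -
    obtain f where f: "skew 1 f" "cmt 1 f" "C = red_End D 1 f" using Lc_E[OF CC(1)] .
    obtain g where g: "skew 1 g" "cmt 1 g" "C' = red_End D 1 g" using Lc_E[OF CC(2)] .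
    have "cmt 1 (\<lambda>x. f x + g x)" by (rule cmt_add[OF f(2) g(2)])
    then show ?thesis using skew_add[OF f(1) g(1)] f g red_Lc Lc_mult E_add skewD(1) by simp
  qed
  have r0: "\<rho>0 \<in> chars Lc" using Lc_closed by (auto simp: \<rho>0_def chars_def hom_def Cx_def)
  define \<phi> where "\<phi> g = \<eta> (rd (mb g)) / psr \<rho>0 (rd (mb g))" for g
  let ?U = "{g \<in> N1. g - 1 \<in> I l'}"
  have G: "rd (mb g) \<in> Gb \<inter> KH" if "g \<in> ?U" for g using that GbH by blast
  have U: "\<exists>x\<in>OL D. 1 + w ^ l' * x = g" if "g \<in> ?U" for g using that N1_one_plus by blast
  have ps: "psr \<rho>0 (rd (mb (1 + w ^ l' * x))) = \<tau> (ch (mb x))" if "x \<in> OL D" "1 + w ^ l' * x \<in> N1" for x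
    using psr_mult_by[OF that] by (simp add: \<rho>0_def)
  have ps0: "psr \<rho>0 (rd (mb g)) \<noteq> 0" if "g \<in> ?U" for g
  proof -
    obtain x where x: "x \<in> OL D" "1 + w ^ l' * x = g" using U[OF \<open>g \<in> ?U\<close>] by blast
    then show ?thesis using ps[OF x(1)] tau_nonzero[OF ch_F[OF E_mult_by[OF x(1)]]] \<open>g \<in> ?U\<close> by simp
  qed
  have U_mult: "g * h \<in> ?U" if "g \<in> ?U" "h \<in> ?U" for g h
    using that Zc_mult[of "mb g" g "mb h" h] by (simp add: Zc_def isom_N1 cg_refl N1)
  have ph_mult: "\<phi> (g * h) = \<phi> g * \<phi> h" if "g \<in> ?U" "h \<in> ?U" for g h
    using m[OF G[OF that(1)] G[OF that(2)]] psr_mult[OF r0 subsetD[OF GbH_ZG G[OF that(1)]] subsetD[OF GbH_ZG G[OF that(2)]]] that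
    by (simp add: \<phi>_def UG_mult_by)
  have ph_one: "\<phi> g = 1" if g: "g \<in> N1" "g - 1 \<in> I l" for g
  proof -
    have gU: "g \<in> ?U" using g I_antimono[OF l'_le] by simp
    have "rd (mb g) \<in> KN" using GbN_iff[OF g(1)] g(2) by simp
    then show ?thesis using p[OF G[OF gU]] psr_psi[OF r0] psi_nonzero by (simp add: \<phi>_def)
  qed
  have ph_eq: "\<phi> (1 + w ^ l' * x) = \<phi> (1 + w ^ l' * y)"
    if x: "x \<in> OL D" "1 + w ^ l' * x \<in> N1" and y: "y \<in> OL D" "1 + w ^ l' * y \<in> N1" and e: "red_End D 1 (mb x) = red_End D 1 (mb y)" for x y
  proof -
    let ?g = "1 + w ^ l' * x" and ?h = "1 + w ^ l' * y"
    have gU: "?g \<in> ?U" "?h \<in> ?U" using x y w_I[of x 0 l'] w_I[of y 0 l'] by (simp_all add: I_zero)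
    have "x - y \<in> I 1" using e red_End_eq[OF E_mult_by E_mult_by] cg_mult_by x(1) y(1) by blast
    then have "?g - ?h \<in> I l" using w_I_iff[of l' "x - y" 1] by (simp add: right_diff_distrib l_eq)
    then have "(?g - ?h) * \<iota> ?h \<in> I l" by (intro I_closed(6) N1(1) N1(5) y(2))
    moreover have "(?g - ?h) * \<iota> ?h = ?g * \<iota> ?h - 1" by (simp only: left_diff_distrib N1(2)[OF y(2)])
    ultimately have "?g * \<iota> ?h - 1 \<in> I l" by (simp only:)
    with N1(4)[OF x(2) N1(5)[OF y(2)]] have k: "?g * \<iota> ?h \<in> N1" "?g * \<iota> ?h - 1 \<in> I l" .
    have kU: "?g * \<iota> ?h \<in> ?U" using k I_antimono[OF l'_le] by simp
    have "?h * (?g * \<iota> ?h) = ?g * (?h * \<iota> ?h)" by (simp only: mult_ac)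
    then have "?h * (?g * \<iota> ?h) = ?g" by (simp only: N1(2)[OF y(2)] mult_1_right)
    then have "\<phi> ?g = \<phi> ?h * \<phi> (?g * \<iota> ?h)" using ph_mult[OF gU(2) kU] by (simp only:)
    then show ?thesis using ph_one[OF k] by simp
  qed
  have "\<exists>x. x \<in> OL D \<and> 1 + w ^ l' * x \<in> N1 \<and> C = red_End D 1 (mb x)" if "C \<in> carrier Lc" for C using Lc_lift[OF that] by blast
  then obtain sel where sel: "\<And>C. C \<in> carrier Lc \<Longrightarrow> sel C \<in> OL D \<and> 1 + w ^ l' * sel C \<in> N1 \<and> C = red_End D 1 (mb (sel C))" by metis
  define \<rho> where "\<rho> = (\<lambda>C\<in>carrier Lc. \<phi> (1 + w ^ l' * sel C))"
  have rho: "\<rho> (red_End D 1 (mb x)) = \<phi> (1 + w ^ l' * x)" if "x \<in> OL D" "1 + w ^ l' * x \<in> N1" for x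
    using psr_mult_by(3)[OF that] sel[OF psr_mult_by(3)[OF that]] ph_eq[OF _ _ that] by (simp add: \<rho>_def)
  have sU: "1 + w ^ l' * x \<in> ?U" if "x \<in> OL D" "1 + w ^ l' * x \<in> N1" for x using that w_I[of x 0 l'] by (simp add: I_zero)
  have "\<rho> \<in> chars Lc"
  proof -
    have "\<rho> (C \<otimes>\<^bsub>Lc\<^esub> C') = \<rho> C * \<rho> C'" if C: "C \<in> carrier Lc" "C' \<in> carrier Lc" for C C'
    proof -
      obtain x where x: "x \<in> OL D" "1 + w ^ l' * x \<in> N1" "C = red_End D 1 (mb x)" using sel[OF C(1)] by blast
      obtain y where y: "y \<in> OL D" "1 + w ^ l' * y \<in> N1" "C' = red_End D 1 (mb y)" using sel[OF C(2)] by blast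
      \<comment> \<open>The product of \<open>1 + w ^ l' x\<close> and \<open>1 + w ^ l' y\<close>
        is \<open>1 + w ^ l' z\<close>, and modulo the maximal ideal \<open>z\<close> is the
        sum.\<close>
      define z where "z = x + y + w ^ l' * (x * y)"
      have zO: "z \<in> OL D" unfolding z_def by (intro OL_closed w_OL x y)
      have ze: "(1 + w ^ l' * x) * (1 + w ^ l' * y) = 1 + w ^ l' * z" by (simp add: z_def algebra_simps)
      have zN: "1 + w ^ l' * z \<in> N1" using N1(4)[OF x(2) y(2)] ze by simp
      have xyO: "x + y \<in> OL D" by (rule OL_closed(3)[OF x(1) y(1)])
      have "w ^ l' * (x * y) \<in> I l'" using w_I[of "x * y" 0 l'] OL_closed(5)[OF x(1) y(1)] by (simp add: I_zero)
      then have "z - (x + y) \<in> I 1" using I_antimono[OF l'_pos] by (simp add: z_def)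
      then have "red_End D 1 (mb z) = red_End D 1 (mb (x + y))" using red_End_eq[OF E_mult_by[OF zO] E_mult_by[OF xyO]] cg_mult_by[OF zO xyO] by simp
      also have "\<dots> = C \<otimes>\<^bsub>Lc\<^esub> C'" unfolding x(3) y(3) Lc_mult[OF E_mult_by[OF x(1)] E_mult_by[OF y(1)]] by (simp add: mult_by_def[abs_def] distrib_left)
      finally have "\<rho> (C \<otimes>\<^bsub>Lc\<^esub> C') = \<phi> (1 + w ^ l' * z)" using rho[OF zO zN] by simp
      then show ?thesis using ph_mult[OF sU[OF x(1,2)] sU[OF y(1,2)]] ze rho[OF x(1,2)] rho[OF y(1,2)] x(3) y(3) by simp
    qed
    moreover have "\<rho> C \<noteq> 0" if "C \<in> carrier Lc" for C
      using sel[OF that] that nz[OF G[OF sU]] ps0[OF sU] by (simp add: \<rho>_def \<phi>_def)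
    ultimately show ?thesis by (auto simp: chars_def hom_def Cx_def \<rho>_def)
  qed
  moreover have "psr \<rho> a = \<eta> a" if "a \<in> Gb \<inter> KH" for a
  proof -
    obtain g where g: "g \<in> ?U" "a = rd (mb g)" using \<open>a \<in> Gb \<inter> KH\<close> GbH by blast
    obtain x where x: "x \<in> OL D" "1 + w ^ l' * x = g" using U[OF g(1)] by blast
    then have xN: "1 + w ^ l' * x \<in> N1" using g(1) by simp
    show ?thesis unfolding g(2) x(2)[symmetric] psr_mult_by(1)[OF x(1) xN] rho[OF x(1) xN]
      using ps[OF x(1) xN] ps0[OF g(1)] x(2) by (simp add: \<phi>_def)
  qed
  ultimately show ?thesis by blast
qed

end

section \<open>Clifford theory\<close>

text \<open>\<open>stab\<close> and \<open>not_stab\<close> together say that \<open>T\<close> is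
  exactly the inertia group of \<open>\<psi>\<close>.\<close>

locale inertia = group G for G (structure) +
  fixes N T :: "'a set" and \<psi> :: "'a \<Rightarrow> complex"
  assumes fin: "finite (carrier G)"
    and N: "subgroup N G" and N_conj: "\<And>g h. g \<in> carrier G \<Longrightarrow> h \<in> N \<Longrightarrow> inv g \<otimes> h \<otimes> g \<in> N"
    and T: "subgroup T G" and NT: "N \<subseteq> T"
    and psi_mult: "\<And>h k. h \<in> N \<Longrightarrow> k \<in> N \<Longrightarrow> \<psi> (h \<otimes> k) = \<psi> h * \<psi> k"
    and psi_nonzero: "\<And>h. h \<in> N \<Longrightarrow> \<psi> h \<noteq> 0"
    and stab: "\<And>g h. g \<in> T \<Longrightarrow> h \<in> N \<Longrightarrow> \<psi> (inv g \<otimes> h \<otimes> g) = \<psi> h"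
    and not_stab: "\<And>g. g \<in> carrier G \<Longrightarrow> g \<notin> T \<Longrightarrow> \<exists>h\<in>N. \<psi> (inv g \<otimes> h \<otimes> g) \<noteq> \<psi> h"
begin

abbreviation m where "m \<equiv> left_index G T"
abbreviation t where "t \<equiv> transversal G T"

lemmas t_carrier = transversal(1)[OF fin T]
lemmas t_ex = transversal(2)[OF fin T]
lemmas t_inj = transversal(3)[OF fin T]

text \<open>The conjugates of \<open>\<psi>\<close>, one for each left coset of \<open>T\<close>;
  \<open>N\<close> acts on the block of index \<open>i\<close> of the induced representation through
  \<open>psi_at i\<close>.\<close>

definition psi_at :: "nat \<Rightarrow> 'a \<Rightarrow> complex" where "psi_at i h = \<psi> (inv (t i) \<otimes> h \<otimes> t i)"

lemma N_carrier: "h \<in> N \<Longrightarrow> h \<in> carrier G" by (rule subgroup.mem_carrier[OF N])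
lemma T_carrier: "h \<in> T \<Longrightarrow> h \<in> carrier G" by (rule subgroup.mem_carrier[OF T])
lemma T_group: "group (G\<lparr>carrier := T\<rparr>)" by (rule subgroup.subgroup_is_group[OF T is_group])

lemma N_fin: "finite N" using fin N subgroup.subset finite_subset by metis

lemma psi_at_mult:
  assumes "i < m" "h \<in> N" "k \<in> N"
  shows "psi_at i (h \<otimes> k) = psi_at i h * psi_at i k"
proof -
  have "inv (t i) \<otimes> (h \<otimes> k) \<otimes> t i = (inv (t i) \<otimes> h \<otimes> t i) \<otimes> (inv (t i) \<otimes> k \<otimes> t i)"
    using t_carrier[OF assms(1)] N_carrier assms(2,3) by (simp add: m_assoc cancel_inv)
  then show ?thesis unfolding psi_at_def using psi_mult N_conj t_carrier assms by simp
qed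

lemma psi_at_nonzero: "i < m \<Longrightarrow> h \<in> N \<Longrightarrow> psi_at i h \<noteq> 0"
  unfolding psi_at_def using psi_nonzero N_conj t_carrier by simp

text \<open>Equality for \<open>i\<close> and \<open>j\<close> would put
  \<open>inv (t i) \<otimes> t j\<close> into the inertia group, although the two cosets
  differ.\<close>

lemma psi_at_distinct:
  assumes "i < m" "j < m" "i \<noteq> j"
  shows "\<exists>h\<in>N. psi_at j h \<noteq> psi_at i h"
proof -
  let ?g = "inv (t i) \<otimes> t j"
  have c: "t i \<in> carrier G" "t j \<in> carrier G" using t_carrier assms by auto
  have "?g \<notin> T" using t_inj assms by blast
  then obtain h where h: "h \<in> N" "\<psi> (inv ?g \<otimes> h \<otimes> ?g) \<noteq> \<psi> h" using not_stab[of ?g] c by auto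
  let ?k = "t i \<otimes> h \<otimes> inv (t i)"
  have hc: "h \<in> carrier G" using h N_carrier by simp
  have k: "?k \<in> N" using N_conj[of "inv (t i)" h] c h by simp
  have "inv (t j) \<otimes> ?k \<otimes> t j = inv ?g \<otimes> h \<otimes> ?g" using c hc by (simp add: inv_mult_group m_assoc)
  moreover have "inv (t i) \<otimes> ?k \<otimes> t i = h" using c hc by (simp add: m_assoc cancel_inv)
  ultimately show ?thesis using h k unfolding psi_at_def by (intro bexI[of _ ?k]) auto
qed

lemma psi_orth:
  assumes "i < m" "j < m"
  shows "(\<Sum>h\<in>N. psi_at j h / psi_at i h) = (if i = j then of_nat (card N) else 0)"
proof (cases "i = j")
  case True
  have "(\<Sum>h\<in>N. psi_at j h / psi_at i h) = (\<Sum>h\<in>N. 1)"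
    by (rule sum.cong) (use True psi_at_nonzero assms in auto)
  then show ?thesis using True by simp
next
  case False
  then obtain h where h: "h \<in> N" "psi_at j h \<noteq> psi_at i h" using psi_at_distinct assms by blast
  have "bij_betw (\<lambda>g. h \<otimes> g) N N"
    by (rule bij_betw_byWitness[where f' = "\<lambda>g. inv h \<otimes> g"])
       (use h N N_carrier in \<open>auto simp: m_assoc[symmetric] subgroup.m_closed subgroup.m_inv_closed\<close>)
  then have "(\<Sum>k\<in>N. psi_at j k / psi_at i k) = (\<Sum>k\<in>N. psi_at j (h \<otimes> k) / psi_at i (h \<otimes> k))"
    by (rule sum.reindex_bij_betw[symmetric])
  also have "\<dots> = (psi_at j h / psi_at i h) * (\<Sum>k\<in>N. psi_at j k / psi_at i k)"
    unfolding sum_distrib_left by (rule sum.cong[OF refl]) (use h psi_at_mult assms in simp)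
  finally have "(\<Sum>k\<in>N. psi_at j k / psi_at i k) = (psi_at j h / psi_at i h) * (\<Sum>k\<in>N. psi_at j k / psi_at i k)" .
  moreover have "psi_at j h / psi_at i h \<noteq> 1" using h psi_at_nonzero[OF assms(1) h(1)] by simp
  ultimately have "(\<Sum>k\<in>N. psi_at j k / psi_at i k) = 0" by (metis mult_cancel_right1)
  then show ?thesis using False by simp
qed

lemma m_pos: "m > 0" using t_ex[OF one_closed] by auto

section \<open>The induced representation in block form\<close>

definition s0 :: "nat \<Rightarrow> ('a \<Rightarrow> complex mat) \<Rightarrow> 'a \<Rightarrow> complex mat" where
  "s0 d \<sigma> y = (if y \<in> T then \<sigma> y else 0\<^sub>m d d)"

abbreviation ind :: "('a \<Rightarrow> complex mat) \<Rightarrow> 'a \<Rightarrow> complex mat" where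
  "ind \<sigma> \<equiv> induced_rep G T \<sigma>"

lemma ind_bm:
  assumes "rep_degree G \<sigma> = d"
  shows "ind \<sigma> x = bm m m d d (\<lambda>a b. s0 d \<sigma> (inv (t a) \<otimes> x \<otimes> t b))"
proof -
  have "d > 0" if "i < m * d" for i using that by (auto intro: Nat.gr0I)
  then show ?thesis unfolding induced_rep_def assms bm_def Let_def by (auto intro!: cong_mat simp: s0_def)
qed

definition ins :: "nat \<Rightarrow> nat \<Rightarrow> complex mat \<Rightarrow> complex mat" where
  "ins d i x = bm m 1 d 1 (\<lambda>a _. if a = i then x else 0\<^sub>m d 1)"

context
  fixes \<sigma> d
  assumes sigma: "mrep (G\<lparr>carrier := T\<rparr>) d \<sigma>"
    and sigma_psi: "\<And>h. h \<in> N \<Longrightarrow> \<sigma> h = \<psi> h \<cdot>\<^sub>m 1\<^sub>m d"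
begin

lemma sigma_degree: "rep_degree G \<sigma> = d" using mrep_degree[OF sigma] by (simp add: rep_degree_def)

lemma sigma_carrier: "s \<in> T \<Longrightarrow> \<sigma> s \<in> carrier_mat d d" using mrepD(1)[OF sigma] by simp
lemma s0_carrier: "s0 d \<sigma> y \<in> carrier_mat d d" by (simp add: s0_def sigma_carrier)

text \<open>For given \<open>y\<close> and \<open>c\<close> exactly one \<open>b\<close> has
  \<open>inv (t b) \<otimes> y \<otimes> t c\<close> in \<open>T\<close>, so at most one term of the
  block product is nonzero.\<close>

lemma s0_transversal:
  assumes "a < m" "c < m" "x \<in> carrier G" "y \<in> carrier G"
  shows "msum d d (\<lambda>b. s0 d \<sigma> (inv (t a) \<otimes> x \<otimes> t b) * s0 d \<sigma> (inv (t b) \<otimes> y \<otimes> t c)) {..<m} =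
    s0 d \<sigma> (inv (t a) \<otimes> (x \<otimes> y) \<otimes> t c)"
proof -
  note tc = t_carrier[OF assms(1)] t_carrier[OF assms(2)]
  obtain b where b: "b < m" "inv (t b) \<otimes> (y \<otimes> t c) \<in> T" using t_ex[of "y \<otimes> t c"] assms tc by auto
  have bc: "t b \<in> carrier G" using t_carrier b by auto
  have b2: "inv (t b) \<otimes> y \<otimes> t c \<in> T" using b bc tc assms by (simp add: m_assoc)
  have prod: "(inv (t a) \<otimes> x \<otimes> t b) \<otimes> (inv (t b) \<otimes> y \<otimes> t c) = inv (t a) \<otimes> (x \<otimes> y) \<otimes> t c"
    using tc bc assms by (simp add: m_assoc cancel_inv)
  have "msum d d (\<lambda>b. s0 d \<sigma> (inv (t a) \<otimes> x \<otimes> t b) * s0 d \<sigma> (inv (t b) \<otimes> y \<otimes> t c)) {..<m} =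
      s0 d \<sigma> (inv (t a) \<otimes> x \<otimes> t b) * s0 d \<sigma> (inv (t b) \<otimes> y \<otimes> t c)"
  proof (rule msum_delta)
    fix b' assume b': "b' \<in> {..<m}" "b' \<noteq> b"
    have c': "t b' \<in> carrier G" using t_carrier b' by auto
    have "inv (t b') \<otimes> y \<otimes> t c \<notin> T"
    proof
      assume h: "inv (t b') \<otimes> y \<otimes> t c \<in> T"
      have "(inv (t b') \<otimes> y \<otimes> t c) \<otimes> inv (inv (t b) \<otimes> y \<otimes> t c) \<in> T"
        using h b2 T by (simp add: subgroup.m_closed subgroup.m_inv_closed)
      moreover have "(inv (t b') \<otimes> y \<otimes> t c) \<otimes> inv (inv (t b) \<otimes> y \<otimes> t c) = inv (t b') \<otimes> t b"
        using c' bc tc assms by (simp add: inv_mult_group m_assoc cancel_inv)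
      ultimately show False using t_inj[of b' b] b b' by auto
    qed
    then have "s0 d \<sigma> (inv (t b') \<otimes> y \<otimes> t c) = 0\<^sub>m d d" by (simp add: s0_def)
    then show "s0 d \<sigma> (inv (t a) \<otimes> x \<otimes> t b') * s0 d \<sigma> (inv (t b') \<otimes> y \<otimes> t c) = 0\<^sub>m d d"
      using right_mult_zero_mat[OF s0_carrier] by simp
  qed (use b in \<open>auto intro!: mult_carrier_mat s0_carrier\<close>)
  also have "\<dots> = s0 d \<sigma> (inv (t a) \<otimes> (x \<otimes> y) \<otimes> t c)"
  proof (cases "inv (t a) \<otimes> x \<otimes> t b \<in> T")
    case True
    then have "inv (t a) \<otimes> (x \<otimes> y) \<otimes> t c \<in> T" using b2 T prod by (metis subgroup.m_closed)
    moreover have "\<sigma> (inv (t a) \<otimes> (x \<otimes> y) \<otimes> t c) = \<sigma> (inv (t a) \<otimes> x \<otimes> t b) * \<sigma> (inv (t b) \<otimes> y \<otimes> t c)"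
      using True b2 mrepD(2)[OF sigma] unfolding prod[symmetric] by simp
    ultimately show ?thesis using True b2 by (simp add: s0_def)
  next
    case False
    have "inv (t a) \<otimes> (x \<otimes> y) \<otimes> t c \<notin> T"
    proof
      assume h: "inv (t a) \<otimes> (x \<otimes> y) \<otimes> t c \<in> T"
      have "(inv (t a) \<otimes> (x \<otimes> y) \<otimes> t c) \<otimes> inv (inv (t b) \<otimes> y \<otimes> t c) \<in> T"
        using h b2 T by (simp add: subgroup.m_closed subgroup.m_inv_closed)
      moreover have "(inv (t a) \<otimes> (x \<otimes> y) \<otimes> t c) \<otimes> inv (inv (t b) \<otimes> y \<otimes> t c) = inv (t a) \<otimes> x \<otimes> t b"
        unfolding prod[symmetric] using bc tc assms by (simp add: m_assoc)
      ultimately show False using False by simp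
    qed
    then show ?thesis using False left_mult_zero_mat[OF s0_carrier] by (simp add: s0_def)
  qed
  finally show ?thesis .
qed

lemma ind_mrep: "mrep G (m * d) (ind \<sigma>)"
  unfolding mrep_def
proof (intro conjI ballI)
  show "ind \<sigma> g \<in> carrier_mat (m * d) (m * d)" for g by (simp add: ind_bm[OF sigma_degree])
  show "ind \<sigma> (g \<otimes> h) = ind \<sigma> g * ind \<sigma> h" if "g \<in> carrier G" "h \<in> carrier G" for g h
    unfolding ind_bm[OF sigma_degree] bm_mult[OF s0_carrier s0_carrier]
    by (rule bm_cong) (rule s0_transversal[symmetric, OF _ _ that])
  have "s0 d \<sigma> (inv (t a) \<otimes> \<one> \<otimes> t b) = (if a = b then 1\<^sub>m d else 0\<^sub>m d d)" if "a < m" "b < m" for a b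
  proof (cases "a = b")
    case True
    then show ?thesis using t_carrier[OF that(1)] mrepD(3)[OF sigma] subgroup.one_closed[OF T] by (simp add: s0_def)
  next
    case False
    then have "inv (t a) \<otimes> t b \<notin> T" using t_inj that by blast
    then show ?thesis using False t_carrier[OF that(1)] by (simp add: s0_def)
  qed
  then show "ind \<sigma> \<one> = 1\<^sub>m (m * d)" unfolding ind_bm[OF sigma_degree] bm_one[symmetric] by (rule bm_cong)
qed

lemma s0_N:
  assumes "h \<in> N" "a < m" "b < m"
  shows "s0 d \<sigma> (inv (t a) \<otimes> h \<otimes> t b) = (if a = b then psi_at a h \<cdot>\<^sub>m 1\<^sub>m d else 0\<^sub>m d d)"
proof (cases "a = b")
  case True
  have "inv (t a) \<otimes> h \<otimes> t a \<in> N" using N_conj t_carrier assms by simp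
  then show ?thesis using True NT sigma_psi by (auto simp: s0_def psi_at_def)
next
  case False
  have c: "t a \<in> carrier G" "t b \<in> carrier G" "h \<in> carrier G" using t_carrier N_carrier assms by auto
  have "inv (t a) \<otimes> h \<otimes> t b \<notin> T"
  proof
    assume x: "inv (t a) \<otimes> h \<otimes> t b \<in> T"
    have "inv (t a) \<otimes> h \<otimes> t a \<in> T" using N_conj t_carrier assms NT by blast
    then have "inv (inv (t a) \<otimes> h \<otimes> t a) \<otimes> (inv (t a) \<otimes> h \<otimes> t b) \<in> T"
      using x T by (simp add: subgroup.m_closed subgroup.m_inv_closed)
    moreover have "inv (inv (t a) \<otimes> h \<otimes> t a) \<otimes> (inv (t a) \<otimes> h \<otimes> t b) = inv (t a) \<otimes> t b"
      using c by (simp add: inv_mult_group m_assoc cancel_inv)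
    ultimately show False using t_inj False assms by simp
  qed
  then show ?thesis using False by (simp add: s0_def)
qed

lemma s0_move:
  assumes "s \<in> T" "a < m" "b < m" "k < m"
  shows "s0 d \<sigma> (inv (t a) \<otimes> (t k \<otimes> s \<otimes> inv (t b)) \<otimes> t b) = (if a = k then \<sigma> s else 0\<^sub>m d d)"
proof -
  have c: "t a \<in> carrier G" "t b \<in> carrier G" "t k \<in> carrier G" "s \<in> carrier G" using t_carrier T_carrier assms by auto
  have e: "inv (t a) \<otimes> (t k \<otimes> s \<otimes> inv (t b)) \<otimes> t b = inv (t a) \<otimes> t k \<otimes> s" using c by (simp add: m_assoc)
  show ?thesis
  proof (cases "a = k")
    case True
    then show ?thesis unfolding e using c assms by (simp add: s0_def)
  next
    case False
    have "inv (t a) \<otimes> t k \<otimes> s \<notin> T"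
    proof
      assume "inv (t a) \<otimes> t k \<otimes> s \<in> T"
      then have "inv (t a) \<otimes> t k \<otimes> s \<otimes> inv s \<in> T" using assms(1) T by (simp add: subgroup.m_closed subgroup.m_inv_closed)
      moreover have "inv (t a) \<otimes> t k \<otimes> s \<otimes> inv s = inv (t a) \<otimes> t k" using c by (simp add: m_assoc)
      ultimately show False using t_inj False assms by simp
    qed
    then show ?thesis unfolding e using False by (simp add: s0_def)
  qed
qed

lemma ins_carrier: "ins d i x \<in> carrier_mat (m * d) 1"
  unfolding ins_def using bm_carrier[of m 1 d 1] by simp

lemma ind_ins:
  assumes "x \<in> carrier_mat d 1" "i < m" "g \<in> carrier G"
  shows "ind \<sigma> g * ins d i x = bm m 1 d 1 (\<lambda>a _. s0 d \<sigma> (inv (t a) \<otimes> g \<otimes> t i) * x)"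
proof -
  have c: "(if a = i then x else 0\<^sub>m d 1) \<in> carrier_mat d 1" for a using assms by simp
  show ?thesis unfolding ins_def ind_bm[OF sigma_degree] bm_mult[OF s0_carrier c]
  proof (rule bm_cong)
    fix a b :: nat assume "a < m"
    have "msum d 1 (\<lambda>b. s0 d \<sigma> (inv (t a) \<otimes> g \<otimes> t b) * (if b = i then x else 0\<^sub>m d 1)) {..<m} =
       s0 d \<sigma> (inv (t a) \<otimes> g \<otimes> t i) * (if i = i then x else 0\<^sub>m d 1)"
      by (rule msum_delta) (use assms right_mult_zero_mat[OF s0_carrier] in \<open>auto intro!: mult_carrier_mat s0_carrier\<close>)
    then show "msum d 1 (\<lambda>b. s0 d \<sigma> (inv (t a) \<otimes> g \<otimes> t b) * (if b = i then x else 0\<^sub>m d 1)) {..<m} =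
       s0 d \<sigma> (inv (t a) \<otimes> g \<otimes> t i) * x" by simp
  qed
qed

lemma ind_move_ins:
  assumes "x \<in> carrier_mat d 1" "i < m" "k < m" "s \<in> T"
  shows "ind \<sigma> (t k \<otimes> s \<otimes> inv (t i)) * ins d i x = ins d k (\<sigma> s * x)"
proof -
  have c: "t k \<otimes> s \<otimes> inv (t i) \<in> carrier G" using t_carrier T_carrier assms by simp
  show ?thesis unfolding ind_ins[OF assms(1,2) c] unfolding ins_def
    by (intro bm_cong) (use s0_move assms in \<open>auto simp: left_mult_zero_mat[OF assms(1)]\<close>)
qed

text \<open>The blocks carry different characters of \<open>N\<close>, so the projection to one of
  them maps a stable subspace \<open>M\<close> to itself and puts a nonzero vector of a single block
  into it. The vectors of that block in \<open>M\<close> form a subspace stable under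
  \<open>\<sigma>\<close>, hence all, and \<open>t k \<otimes> inv (t i)\<close> carries them to the
  other blocks.\<close>

theorem ind_irreducible:
  assumes irr: "irreducible_rep (G\<lparr>carrier := T\<rparr>) \<sigma>"
  shows "irreducible_rep G (ind \<sigma>)"
proof -
  have dT: "rep_degree (G\<lparr>carrier := T\<rparr>) \<sigma> = d" by (rule mrep_degree[OF sigma])
  note irrD = irreducible_repD[OF irr T_group, unfolded dT]
  have "M = {0\<^sub>m (m * d) 1} \<or> M = carrier_mat (m * d) 1"
    if M: "mlin (m * d) 1 M" "\<forall>g\<in>carrier G. \<forall>A\<in>M. ind \<sigma> g * A \<in> M" for M
  proof (cases "M = {0\<^sub>m (m * d) 1}")
    case False
    have "0\<^sub>m (m * d) 1 \<in> M" using M by (simp add: mlin_def)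
    then obtain w where w: "w \<in> M" "w \<noteq> 0\<^sub>m (m * d) 1" using False by blast
    have wc: "w \<in> carrier_mat (m * d) (1 * 1)" using w M by (auto simp: mlin_def)
    define u where "u a = blk d 1 w a 0" for a
    have uc: "u a \<in> carrier_mat d 1" for a by (simp add: u_def)
    have wu: "w = bm m 1 d 1 (\<lambda>a _. u a)"
      by (subst bm_blk[OF wc]) (rule bm_cong, simp add: u_def)
    obtain i where i: "i < m" "u i \<noteq> 0\<^sub>m d 1" using w(2) unfolding wu using bm_zero_iff[of m 1 "\<lambda>a _. u a" d 1] uc by auto
    have "ins d i (u i) \<in> M"
    proof -
      have "ind \<sigma> h * w = bm m 1 d 1 (\<lambda>a _. psi_at a h \<cdot>\<^sub>m u a)" if h: "h \<in> N" for h
        unfolding wu ind_bm[OF sigma_degree] bm_mult[OF s0_carrier uc]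
      proof (rule bm_cong)
        fix a b :: nat assume a: "a < m"
        have "msum d 1 (\<lambda>b. s0 d \<sigma> (inv (t a) \<otimes> h \<otimes> t b) * u b) {..<m} = s0 d \<sigma> (inv (t a) \<otimes> h \<otimes> t a) * u a"
          by (rule msum_delta) (use a s0_N[OF h] left_mult_zero_mat[OF uc] in \<open>auto intro!: mult_carrier_mat s0_carrier uc\<close>)
        then show "msum d 1 (\<lambda>b. s0 d \<sigma> (inv (t a) \<otimes> h \<otimes> t b) * u b) {..<m} = psi_at a h \<cdot>\<^sub>m u a"
          using s0_N[OF h a a] by (simp add: mat_smult_left carrier_matD[OF uc] left_mult_one_mat[OF uc])
      qed
      \<comment> \<open>The sum of \<open>ind \<sigma> h / psi_at i h\<close> over \<open>N\<close>
        is \<open>card N\<close> times the projection to block \<open>i\<close>.\<close>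
      then have "msum (m * d) (1 * 1) (\<lambda>h. (1 / psi_at i h) \<cdot>\<^sub>m (ind \<sigma> h * w)) N =
          msum (m * d) (1 * 1) (\<lambda>h. bm m 1 d 1 (\<lambda>a _. (psi_at a h / psi_at i h) \<cdot>\<^sub>m u a)) N"
        by (intro msum_cong refl) (simp add: bm_smult uc smult_smult_mat)
      also have "\<dots> = bm m 1 d 1 (\<lambda>a _. msum d 1 (\<lambda>h. (psi_at a h / psi_at i h) \<cdot>\<^sub>m u a) N)"
        by (rule bm_msum) (simp add: uc)
      also have "\<dots> = bm m 1 d 1 (\<lambda>a _. of_nat (card N) \<cdot>\<^sub>m (if a = i then u i else 0\<^sub>m d 1))"
        by (rule bm_cong) (use i psi_orth in \<open>auto simp: msum_smult_const[OF uc] zero_smult_mat[OF uc]\<close>)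
      also have "\<dots> = of_nat (card N) \<cdot>\<^sub>m ins d i (u i)" unfolding ins_def
        by (rule bm_smult[symmetric]) (simp add: uc)
      finally have "of_nat (card N) \<cdot>\<^sub>m ins d i (u i) = msum (m * d) (1 * 1) (\<lambda>h. (1 / psi_at i h) \<cdot>\<^sub>m (ind \<sigma> h * w)) N" ..
      also have "\<dots> \<in> M"
        using mlin_msum[OF M(1) N_fin, of "\<lambda>h. (1 / psi_at i h) \<cdot>\<^sub>m (ind \<sigma> h * w)"] M w N_carrier
        by (simp add: mlin_def)
      finally have "(1 / of_nat (card N)) \<cdot>\<^sub>m (of_nat (card N) \<cdot>\<^sub>m ins d i (u i)) \<in> M" using M(1) by (simp add: mlin_def)
      moreover have "card N \<noteq> 0" using N_fin subgroup.one_closed[OF N] by auto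
      ultimately show ?thesis by (simp add: smult_smult_mat one_smult_mat)
    qed
    define Mi where "Mi = {x \<in> carrier_mat d 1. ins d i x \<in> M}"
    have Mi: "Mi = carrier_mat d 1"
    proof (rule irrD(3))
      have add: "ins d i x + ins d i y = ins d i (x + y)" if "x \<in> carrier_mat d 1" "y \<in> carrier_mat d 1" for x y
        unfolding ins_def by (subst bm_add) (use that in \<open>auto intro!: bm_cong\<close>)
      have sm: "c \<cdot>\<^sub>m ins d i x = ins d i (c \<cdot>\<^sub>m x)" if "x \<in> carrier_mat d 1" for x c
        unfolding ins_def by (subst bm_smult) (use that in \<open>auto intro!: bm_cong eq_matI\<close>)
      have z: "ins d i (0\<^sub>m d 1) = 0\<^sub>m (m * d) 1"
        using bm_zero[of m 1 d 1] unfolding ins_def by simp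
      show "mlin d 1 Mi" using M(1) add sm z unfolding mlin_def Mi_def by simp (metis)
      show "\<sigma> g * A \<in> Mi" if gA: "g \<in> carrier (G\<lparr>carrier := T\<rparr>)" "A \<in> Mi" for g A
      proof -
        have g: "g \<in> T" and A: "A \<in> carrier_mat d 1" "ins d i A \<in> M" using gA by (auto simp: Mi_def)
        have "t i \<otimes> g \<otimes> inv (t i) \<in> carrier G" using t_carrier[OF i(1)] T_carrier[OF g] by simp
        then have "ins d i (\<sigma> g * A) \<in> M" using M(2) A(2) ind_move_ins[OF A(1) i(1) i(1) g] by metis
        then show ?thesis using sigma_carrier[OF g] A(1) by (simp add: Mi_def)
      qed
      show "u i \<in> Mi" using \<open>ins d i (u i) \<in> M\<close> uc by (simp add: Mi_def)
      show "u i \<noteq> 0\<^sub>m d 1" by (rule i)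
    qed
    then have all: "ins d k x \<in> M" if "k < m" "x \<in> carrier_mat d 1" for k x
    proof -
      have "x \<in> Mi" using that Mi by simp
      then have "ind \<sigma> (t k \<otimes> \<one> \<otimes> inv (t i)) * ins d i x \<in> M"
        using M(2) t_carrier i that by (simp add: Mi_def)
      then show ?thesis using ind_move_ins[OF that(2) i(1) that(1) subgroup.one_closed[OF T]] mrepD(3)[OF sigma] that
        by (simp add: left_mult_one_mat[of _ d 1])
    qed
    have "A \<in> M" if A: "A \<in> carrier_mat (m * d) (1 * 1)" for A
    proof -
      let ?v = "\<lambda>a. blk d 1 A a 0"
      have "A = bm m 1 d 1 (\<lambda>a _. ?v a)" by (subst bm_blk[OF A]) (rule bm_cong, simp)
      also have "\<dots> = bm m 1 d 1 (\<lambda>a _. msum d 1 (\<lambda>k. if a = k then ?v k else 0\<^sub>m d 1) {..<m})"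
      proof (rule bm_cong)
        fix a b :: nat assume a: "a < m"
        show "?v a = msum d 1 (\<lambda>k. if a = k then ?v k else 0\<^sub>m d 1) {..<m}"
          using msum_delta[of "{..<m}" a "\<lambda>k. if a = k then ?v k else 0\<^sub>m d 1" d 1] a by simp
      qed
      also have "\<dots> = msum (m * d) (1 * 1) (\<lambda>k. ins d k (?v k)) {..<m}" unfolding ins_def
        by (rule bm_msum[symmetric]) simp
      also have "\<dots> \<in> M" using mlin_msum[OF M(1), of "{..<m}" "\<lambda>k. ins d k (?v k)"] all by simp
      finally show ?thesis .
    qed
    then have "M = carrier_mat (m * d) 1" using M(1) by (auto simp: mlin_def)
    then show ?thesis ..
  qed simp
  moreover have "m * d > 0" using m_pos irrD(2) by simp
  ultimately show ?thesis unfolding irreducible_rep_iff[OF is_group] using ind_mrep by blast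
qed

lemma ind_contains:
  assumes "d > 0"
  shows "rep_contains G (ind \<sigma>) N \<psi>"
proof -
  \<comment> \<open>The index of the coset \<open>T\<close> itself. Its representative
    \<open>t i\<close> is in \<open>T\<close> but need not be \<open>\<one>\<close>; it fixes
    \<open>\<psi>\<close>, so the vectors of this block transform by \<open>\<psi>\<close>.\<close>
  obtain i where i: "i < m" "inv (t i) \<otimes> \<one> \<in> T" using t_ex[OF one_closed] by blast
  then have ti: "t i \<in> T" using t_carrier T subgroup.m_inv_closed[OF T, of "inv (t i)"] by simp
  let ?x = "mat d 1 (\<lambda>_. 1) :: complex mat"
  have x: "?x \<in> carrier_mat d 1" by simp
  have "?x \<noteq> 0\<^sub>m d 1"
  proof
    assume "?x = 0\<^sub>m d 1"
    then have "?x $$ (0, 0) = 0\<^sub>m d 1 $$ (0, 0)" by simp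
    then show False using assms by simp
  qed
  then have "ins d i ?x \<noteq> 0\<^sub>m (m * d) 1"
    using bm_zero_iff[of m 1 "\<lambda>a _. if a = i then ?x else 0\<^sub>m d 1" d 1] i unfolding ins_def by auto
  moreover have "ind \<sigma> h * ins d i ?x = \<psi> h \<cdot>\<^sub>m ins d i ?x" if h: "h \<in> N" for h
  proof -
    have "psi_at i h = \<psi> h" unfolding psi_at_def using stab[OF ti h] .
    then show ?thesis unfolding ind_ins[OF x i(1) N_carrier[OF h]] unfolding ins_def
      by (subst bm_smult, simp) (rule bm_cong, use s0_N[OF h _ i(1)] in
        \<open>auto simp: mat_smult_left carrier_matD[OF x] left_mult_one_mat[OF x] left_mult_zero_mat[OF x]\<close>)
  qed
  ultimately show ?thesis using rep_contains_iff[OF ind_mrep subgroup.subset[OF N]] ins_carrier by blast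
qed

text \<open>Frobenius reciprocity: \<open>F\<close> maps the vectors of block \<open>b\<close> by
  \<open>R (t b) * f\<close>.\<close>

lemma frobenius_hom:
  assumes R: "mrep G D R" and f: "f \<in> carrier_mat D d" "f \<noteq> 0\<^sub>m D d" "\<And>s. s \<in> T \<Longrightarrow> R s * f = f * \<sigma> s"
  obtains F where "F \<in> carrier_mat D (m * d)" "F \<noteq> 0\<^sub>m D (m * d)" "\<And>g. g \<in> carrier G \<Longrightarrow> F * ind \<sigma> g = R g * F"
proof -
  define F where "F = bm 1 m D d (\<lambda>_ b. R (t b) * f)"
  have c: "R g * f \<in> carrier_mat D d" if "g \<in> carrier G" for g using mrepD(1)[OF R that] f(1) by auto
  have Fc: "F \<in> carrier_mat D (m * d)" unfolding F_def using bm_carrier[of 1 m D d] by simp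
  have "F \<noteq> 0\<^sub>m D (m * d)"
  proof
    assume "F = 0\<^sub>m D (m * d)"
    then have "R (t 0) * f = 0\<^sub>m D d"
      using bm_zero_iff[of 1 m "\<lambda>_ b. R (t b) * f" D d] c t_carrier m_pos unfolding F_def by simp
    then have "R (inv (t 0)) * (R (t 0) * f) = 0\<^sub>m D d"
      using right_mult_zero_mat[OF mrepD(1)[OF R]] t_carrier m_pos by simp
    moreover have "R (inv (t 0)) * (R (t 0) * f) = R (inv (t 0)) * R (t 0) * f"
      using mrepD(1)[OF R] t_carrier m_pos f(1) by (simp add: assoc_mult_mat[of _ D D _ D _ d])
    ultimately show False using mrep_inv[OF R t_carrier[OF m_pos]] f(1,2) by simp
  qed
  moreover have "F * ind \<sigma> g = R g * F" if g: "g \<in> carrier G" for g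
  proof -
    have "F * ind \<sigma> g = bm 1 m D d (\<lambda>a c. msum D d (\<lambda>b. R (t b) * f * s0 d \<sigma> (inv (t b) \<otimes> g \<otimes> t c)) {..<m})"
      unfolding F_def ind_bm[OF sigma_degree] by (rule bm_mult) (use c t_carrier s0_carrier in auto)
    also have "\<dots> = bm 1 m D d (\<lambda>_ c. R g * (R (t c) * f))"
    proof (rule bm_cong)
      fix a :: nat and j assume j: "j < m"
      have tj: "t j \<in> carrier G" using t_carrier j by simp
      obtain b where b: "b < m" "inv (t b) \<otimes> (g \<otimes> t j) \<in> T" using t_ex[of "g \<otimes> t j"] g tj by auto
      have tb: "t b \<in> carrier G" using t_carrier b by simp
      let ?s = "inv (t b) \<otimes> g \<otimes> t j"
      have s: "?s \<in> T" using b tb tj g by (simp add: m_assoc)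
      have "msum D d (\<lambda>b. R (t b) * f * s0 d \<sigma> (inv (t b) \<otimes> g \<otimes> t j)) {..<m} = R (t b) * f * s0 d \<sigma> ?s"
      proof (rule msum_delta)
        fix b' assume b': "b' \<in> {..<m}" "b' \<noteq> b"
        have tb': "t b' \<in> carrier G" using t_carrier b' by simp
        have "inv (t b') \<otimes> g \<otimes> t j \<notin> T"
        proof
          assume h: "inv (t b') \<otimes> g \<otimes> t j \<in> T"
          have "(inv (t b') \<otimes> g \<otimes> t j) \<otimes> inv ?s \<in> T" using h s T by (simp add: subgroup.m_closed subgroup.m_inv_closed)
          moreover have "(inv (t b') \<otimes> g \<otimes> t j) \<otimes> inv ?s = inv (t b') \<otimes> t b"
            using tb' tb tj g by (simp add: inv_mult_group m_assoc cancel_inv)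
          ultimately show False using t_inj[of b' b] b b' by auto
        qed
        then show "R (t b') * f * s0 d \<sigma> (inv (t b') \<otimes> g \<otimes> t j) = 0\<^sub>m D d"
          using right_mult_zero_mat[OF c[OF tb']] by (simp add: s0_def)
      qed (use b c[OF tb] s0_carrier in \<open>auto intro!: mult_carrier_mat[of _ D d]\<close>)
      also have "\<dots> = R (t b) * (f * \<sigma> ?s)"
        using s sigma_carrier[OF s] mrepD(1)[OF R tb] f(1) by (simp add: s0_def)
      also have "\<dots> = R (t b) * R ?s * f" unfolding f(3)[OF s, symmetric]
        using mrepD(1)[OF R tb] mrepD(1)[OF R T_carrier[OF s]] f(1) by simp
      also have "R (t b) * R ?s = R (t b \<otimes> ?s)" using mrepD(2)[OF R tb T_carrier[OF s]] by simp
      also have "t b \<otimes> ?s = g \<otimes> t j" using tb tj g by (simp add: m_assoc[symmetric])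
      also have "R (g \<otimes> t j) * f = R g * (R (t j) * f)"
        using mrepD(1,2)[OF R] g tj f(1) by (simp add: assoc_mult_mat[of _ D D _ D _ d])
      finally show "msum D d (\<lambda>b. R (t b) * f * s0 d \<sigma> (inv (t b) \<otimes> g \<otimes> t j)) {..<m} = R g * (R (t j) * f)" .
    qed
    also have "\<dots> = R g * F"
    proof -
      have "R g = bm 1 1 D D (\<lambda>_ _. R g)"
        using mrepD(1)[OF R g] bm_index[of 0 1 0 1 _ D _ D "\<lambda>_ _. R g"] bm_carrier[of 1 1 D D]
        by (intro bm_eqI[of _ 1 D 1 D]) auto
      then have "R g * F = bm 1 1 D D (\<lambda>_ _. R g) * F" by simp
      also have "\<dots> = bm 1 m D d (\<lambda>a c. msum D d (\<lambda>b. R g * (R (t c) * f)) {..<1::nat})"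
        unfolding F_def by (rule bm_mult) (use c t_carrier mrepD(1)[OF R g] in auto)
      also have "\<dots> = bm 1 m D d (\<lambda>_ c. R g * (R (t c) * f))"
      proof (rule bm_cong)
        fix a j assume "j < m"
        then have "R g * (R (t j) * f) \<in> carrier_mat D d" using c t_carrier mrepD(1)[OF R g] by auto
        then show "msum D d (\<lambda>b. R g * (R (t j) * f)) {..<1::nat} = R g * (R (t j) * f)"
          using msum_delta[of "{..<1::nat}" "0::nat" "\<lambda>_. R g * (R (t j) * f)" D d] by simp
      qed
      finally show ?thesis ..
    qed
    finally show ?thesis .
  qed
  ultimately show ?thesis using that Fc by blast
qed

end

text \<open>An intertwiner commutes with \<open>N\<close>, which acts on different blocks by
  different characters, so it is block diagonal. A nonzero diagonal block, at index \<open>i\<close>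
  say, intertwines \<open>\<sigma>\<close> and \<open>\<sigma>'\<close>, as one sees on the elements
  \<open>t i \<otimes> x \<otimes> inv (t i)\<close>.\<close>

lemma ind_intertwiner:
  assumes s: "mrep (G\<lparr>carrier := T\<rparr>) d \<sigma>" "\<And>h. h \<in> N \<Longrightarrow> \<sigma> h = \<psi> h \<cdot>\<^sub>m 1\<^sub>m d"
    and s': "mrep (G\<lparr>carrier := T\<rparr>) e \<sigma>'" "\<And>h. h \<in> N \<Longrightarrow> \<sigma>' h = \<psi> h \<cdot>\<^sub>m 1\<^sub>m e"
    and A: "A \<in> carrier_mat (m * e) (m * d)" "A \<noteq> 0\<^sub>m (m * e) (m * d)"
      "\<And>g. g \<in> carrier G \<Longrightarrow> A * ind \<sigma> g = ind \<sigma>' g * A"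
  obtains A0 where "A0 \<in> carrier_mat e d" "A0 \<noteq> 0\<^sub>m e d" "\<And>s. s \<in> T \<Longrightarrow> A0 * \<sigma> s = \<sigma>' s * A0"
proof -
  note deg = sigma_degree[OF s] and deg' = sigma_degree[OF s']
  let ?B = "blk e d A"
  have Ab: "A = bm m m e d ?B" by (rule bm_blk[OF A(1)])
  have Bc: "?B a b \<in> carrier_mat e d" for a b by simp
  note sc = s0_carrier[OF s] and sc' = s0_carrier[OF s']
  have key: "msum e d (\<lambda>b. ?B a b * s0 d \<sigma> (inv (t b) \<otimes> g \<otimes> t c)) {..<m} =
      msum e d (\<lambda>b. s0 e \<sigma>' (inv (t a) \<otimes> g \<otimes> t b) * ?B b c) {..<m}" if "g \<in> carrier G" "a < m" "c < m" for g a c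
  proof -
    have "A * ind \<sigma> g = bm m m e d (\<lambda>a c. msum e d (\<lambda>b. ?B a b * s0 d \<sigma> (inv (t b) \<otimes> g \<otimes> t c)) {..<m})"
      by (subst Ab) (simp add: ind_bm[OF deg] bm_mult[OF Bc sc])
    moreover have "ind \<sigma>' g * A = bm m m e d (\<lambda>a c. msum e d (\<lambda>b. s0 e \<sigma>' (inv (t a) \<otimes> g \<otimes> t b) * ?B b c) {..<m})"
      by (subst Ab) (simp add: ind_bm[OF deg'] bm_mult[OF sc' Bc])
    ultimately have "blk e d (bm m m e d (\<lambda>a c. msum e d (\<lambda>b. ?B a b * s0 d \<sigma> (inv (t b) \<otimes> g \<otimes> t c)) {..<m})) a c =
       blk e d (bm m m e d (\<lambda>a c. msum e d (\<lambda>b. s0 e \<sigma>' (inv (t a) \<otimes> g \<otimes> t b) * ?B b c) {..<m})) a c"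
      using A(3)[OF that(1)] by simp
    then show ?thesis using that by (simp add: blk_bm)
  qed
  have offdiag: "?B i j = 0\<^sub>m e d" if ij: "i < m" "j < m" "i \<noteq> j" for i j
  proof -
    obtain h where h: "h \<in> N" "psi_at j h \<noteq> psi_at i h" using psi_at_distinct ij by blast
    have "msum e d (\<lambda>b. ?B i b * s0 d \<sigma> (inv (t b) \<otimes> h \<otimes> t j)) {..<m} = ?B i j * s0 d \<sigma> (inv (t j) \<otimes> h \<otimes> t j)"
      by (rule msum_delta) (use ij s0_N[OF s h(1)] right_mult_zero_mat[OF Bc] in \<open>auto intro!: mult_carrier_mat[OF Bc] sc\<close>)
    also have "\<dots> = psi_at j h \<cdot>\<^sub>m ?B i j"
      using s0_N[OF s h(1)] ij by (simp add: mat_smult_right carrier_matD[OF Bc] right_mult_one_mat[OF Bc])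
    finally have l: "msum e d (\<lambda>b. ?B i b * s0 d \<sigma> (inv (t b) \<otimes> h \<otimes> t j)) {..<m} = psi_at j h \<cdot>\<^sub>m ?B i j" .
    have "msum e d (\<lambda>b. s0 e \<sigma>' (inv (t i) \<otimes> h \<otimes> t b) * ?B b j) {..<m} = s0 e \<sigma>' (inv (t i) \<otimes> h \<otimes> t i) * ?B i j"
      by (rule msum_delta) (use ij s0_N[OF s' h(1)] left_mult_zero_mat[OF Bc] in \<open>auto intro!: mult_carrier_mat[OF _ Bc] sc'\<close>)
    also have "\<dots> = psi_at i h \<cdot>\<^sub>m ?B i j"
      using s0_N[OF s' h(1)] ij by (simp add: mat_smult_left carrier_matD[OF Bc] left_mult_one_mat[OF Bc])
    finally have "psi_at j h \<cdot>\<^sub>m ?B i j = psi_at i h \<cdot>\<^sub>m ?B i j" using key[OF N_carrier[OF h(1)] ij(1,2)] l by simp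
    then show ?thesis using smult_mat_cancel[OF Bc] h(2) by blast
  qed
  have "\<exists>i<m. ?B i i \<noteq> 0\<^sub>m e d"
  proof (rule ccontr)
    assume "\<not> ?thesis"
    then have "\<forall>a<m. \<forall>b<m. ?B a b = 0\<^sub>m e d" using offdiag by metis
    then have "bm m m e d ?B = 0\<^sub>m (m * e) (m * d)" by (subst bm_zero_iff) auto
    then show False using A(2) Ab by simp
  qed
  then obtain i where i: "i < m" "?B i i \<noteq> 0\<^sub>m e d" by blast
  have "?B i i * \<sigma> x = \<sigma>' x * ?B i i" if x: "x \<in> T" for x
  proof -
    let ?g = "t i \<otimes> x \<otimes> inv (t i)"
    have g: "?g \<in> carrier G" using t_carrier[OF i(1)] T_carrier[OF x] by simp
    have "msum e d (\<lambda>b. ?B i b * s0 d \<sigma> (inv (t b) \<otimes> ?g \<otimes> t i)) {..<m} = ?B i i * s0 d \<sigma> (inv (t i) \<otimes> ?g \<otimes> t i)"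
      by (rule msum_delta) (use i offdiag left_mult_zero_mat[OF sc] in \<open>auto intro!: mult_carrier_mat[OF Bc] sc\<close>)
    moreover have "msum e d (\<lambda>b. s0 e \<sigma>' (inv (t i) \<otimes> ?g \<otimes> t b) * ?B b i) {..<m} = s0 e \<sigma>' (inv (t i) \<otimes> ?g \<otimes> t i) * ?B i i"
      by (rule msum_delta) (use i offdiag right_mult_zero_mat[OF sc'] in \<open>auto intro!: mult_carrier_mat[OF _ Bc] sc'\<close>)
    ultimately show ?thesis using key[OF g i(1) i(1)] s0_move[OF s x i(1) i(1) i(1)] s0_move[OF s' x i(1) i(1) i(1)] by simp
  qed
  then show ?thesis using that Bc i(2) by blast
qed

lemma equiv_rep_iso: "equiv {\<rho>. is_rep G \<rho>} (rep_iso G)"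
proof (rule equivI)
  interpret L: group "GLC d" for d by (rule GLC_group)
  have c: "T \<in> carrier_mat d d" if "T \<in> carrier (GLC d)" for T d using that by (simp add: GLC_carrier)
  have rc: "\<rho> g \<in> carrier_mat (rep_degree G \<rho>) (rep_degree G \<rho>)" if "is_rep G \<rho>" "g \<in> carrier G" for \<rho> g
    by (rule mrepD(1)[OF that(1)[unfolded is_rep_iff_mrep] that(2)])
  show "rep_iso G \<subseteq> {\<rho>. is_rep G \<rho>} \<times> {\<rho>. is_rep G \<rho>}" by (auto simp: rep_iso_def)
  show "refl_on {\<rho>. is_rep G \<rho>} (rep_iso G)"
  proof (rule refl_onI)
    fix \<rho> assume "\<rho> \<in> {\<rho>. is_rep G \<rho>}"
    then have r: "is_rep G \<rho>" by simp
    have "1\<^sub>m (rep_degree G \<rho>) \<in> carrier (GLC (rep_degree G \<rho>))" using L.one_closed by (metis GLC_simps(2))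
    moreover have "1\<^sub>m (rep_degree G \<rho>) * \<rho> g = \<rho> g * 1\<^sub>m (rep_degree G \<rho>)" if "g \<in> carrier G" for g
      using rc[OF r that] by simp
    ultimately show "(\<rho>, \<rho>) \<in> rep_iso G" using r by (auto simp: rep_iso_def)
  qed
  show "sym (rep_iso G)"
  proof (rule symI)
    fix \<rho> \<rho>' assume "(\<rho>, \<rho>') \<in> rep_iso G"
    then obtain T where T: "is_rep G \<rho>" "is_rep G \<rho>'" "rep_degree G \<rho>' = rep_degree G \<rho>"
      "T \<in> carrier (GLC (rep_degree G \<rho>))" "\<forall>g\<in>carrier G. T * \<rho> g = \<rho>' g * T" by (auto simp: rep_iso_def)
    let ?d = "rep_degree G \<rho>"
    obtain S where S: "S \<in> carrier_mat ?d ?d" "T * S = 1\<^sub>m ?d" "S * T = 1\<^sub>m ?d" using T(4) by (auto simp: GLC_carrier)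
    have "S \<in> carrier (GLC ?d)" using S c[OF T(4)] by (auto simp: GLC_carrier)
    moreover have "S * \<rho>' g = \<rho> g * S" if g: "g \<in> carrier G" for g
    proof -
      note rg = rc[OF T(1) g] and rg' = rc[OF T(2) g, unfolded T(3)]
      note dims = carrier_matD[OF rg] carrier_matD[OF rg'] carrier_matD[OF S(1)] carrier_matD[OF c[OF T(4)]]
      have "S * \<rho>' g = S * (\<rho>' g * (T * S))" using S rg' by (simp add: right_mult_one_mat[of _ ?d ?d])
      also have "\<dots> = S * (\<rho>' g * T * S)" by (simp add: mat_assoc dims)
      also have "\<dots> = S * T * (\<rho> g * S)" unfolding T(5)[rule_format, OF g, symmetric] by (simp add: mat_assoc dims)
      also have "\<dots> = \<rho> g * S" unfolding S(3) using rg S(1) by simp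
      finally show ?thesis .
    qed
    ultimately show "(\<rho>', \<rho>) \<in> rep_iso G" using T by (auto simp: rep_iso_def)
  qed
  show "trans (rep_iso G)"
  proof (rule transI)
    fix \<rho> \<rho>' \<rho>'' assume "(\<rho>, \<rho>') \<in> rep_iso G" "(\<rho>', \<rho>'') \<in> rep_iso G"
    then obtain T S where T: "is_rep G \<rho>" "is_rep G \<rho>'" "is_rep G \<rho>''" "rep_degree G \<rho>' = rep_degree G \<rho>" "rep_degree G \<rho>'' = rep_degree G \<rho>"
      "T \<in> carrier (GLC (rep_degree G \<rho>))" "\<forall>g\<in>carrier G. T * \<rho> g = \<rho>' g * T"
      "S \<in> carrier (GLC (rep_degree G \<rho>))" "\<forall>g\<in>carrier G. S * \<rho>' g = \<rho>'' g * S" by (auto simp: rep_iso_def)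
    let ?d = "rep_degree G \<rho>"
    have "S * T \<in> carrier (GLC ?d)" using L.m_closed[OF T(8) T(6)] by simp
    moreover have "S * T * \<rho> g = \<rho>'' g * (S * T)" if g: "g \<in> carrier G" for g
      by (rule intertwiner_comp[OF rc[OF T(1) g] rc[OF T(2) g, unfolded T(4)] rc[OF T(3) g, unfolded T(5)] c[OF T(6)] c[OF T(8)]]) (use T g in auto)
    ultimately show "(\<rho>, \<rho>'') \<in> rep_iso G" using T by (auto simp: rep_iso_def)
  qed
qed

text \<open>The hypotheses are what has to be checked for a family of representations of
  \<open>T\<close>. In \<open>exh\<close> the given representation of \<open>G\<close> is arbitrary
  and only a \<open>\<psi>\<close>-eigenvector is known; the intertwiner found there is extended to
  the induced representation and is an isomorphism when the given representation is
  irreducible.\<close>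

theorem clifford_bij:
  assumes irr: "\<And>\<theta>. \<theta> \<in> \<Theta> \<Longrightarrow> irreducible_rep (G\<lparr>carrier := T\<rparr>) (\<sigma> \<theta>)"
    and over: "\<And>\<theta> h. \<theta> \<in> \<Theta> \<Longrightarrow> h \<in> N \<Longrightarrow> \<sigma> \<theta> h = \<psi> h \<cdot>\<^sub>m 1\<^sub>m (rep_degree G (\<sigma> \<theta>))"
    and inj: "\<And>\<theta> \<theta>' A. \<theta> \<in> \<Theta> \<Longrightarrow> \<theta>' \<in> \<Theta> \<Longrightarrow> A \<in> carrier_mat (rep_degree G (\<sigma> \<theta>')) (rep_degree G (\<sigma> \<theta>)) \<Longrightarrow>
      A \<noteq> 0\<^sub>m (rep_degree G (\<sigma> \<theta>')) (rep_degree G (\<sigma> \<theta>)) \<Longrightarrow> (\<And>s. s \<in> T \<Longrightarrow> A * \<sigma> \<theta> s = \<sigma> \<theta>' s * A) \<Longrightarrow> \<theta> = \<theta>'"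
    and exh: "\<And>D R A. mrep G D R \<Longrightarrow> A \<in> carrier_mat D 1 \<Longrightarrow> A \<noteq> 0\<^sub>m D 1 \<Longrightarrow> (\<And>h. h \<in> N \<Longrightarrow> R h * A = \<psi> h \<cdot>\<^sub>m A) \<Longrightarrow>
      \<exists>\<theta>\<in>\<Theta>. \<exists>f\<in>carrier_mat D (rep_degree G (\<sigma> \<theta>)). f \<noteq> 0\<^sub>m D (rep_degree G (\<sigma> \<theta>)) \<and> (\<forall>s\<in>T. R s * f = f * \<sigma> \<theta> s)"
  shows "bij_betw (\<lambda>\<theta>. rep_iso G `` {ind (\<sigma> \<theta>)}) \<Theta> (Irr_over G N \<psi>)"
proof -
  let ?d = "\<lambda>\<theta>. rep_degree G (\<sigma> \<theta>)"
  have s: "mrep (G\<lparr>carrier := T\<rparr>) (?d \<theta>) (\<sigma> \<theta>)" "?d \<theta> > 0" if "\<theta> \<in> \<Theta>" for \<theta>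
    using irreducible_repD(1,2)[OF irr[OF that] T_group] by (simp_all add: rep_degree_def)
  note over' = over
  have irrG: "irreducible_rep G (ind (\<sigma> \<theta>))" and cont: "rep_contains G (ind (\<sigma> \<theta>)) N \<psi>"
    and ir: "is_rep G (ind (\<sigma> \<theta>))" and deg: "rep_degree G (ind (\<sigma> \<theta>)) = m * ?d \<theta>" if th: "\<theta> \<in> \<Theta>" for \<theta>
  proof -
    show "irreducible_rep G (ind (\<sigma> \<theta>))" by (rule ind_irreducible[OF s(1)[OF th] over[OF th] irr[OF th]])
    then show "is_rep G (ind (\<sigma> \<theta>))" by (simp add: irreducible_rep_def)
    show "rep_contains G (ind (\<sigma> \<theta>)) N \<psi>" by (rule ind_contains[OF s(1)[OF th] over[OF th] s(2)[OF th]])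
    show "rep_degree G (ind (\<sigma> \<theta>)) = m * ?d \<theta>" by (rule mrep_degree[OF ind_mrep[OF s(1)[OF th] over[OF th]]])
  qed
  show ?thesis
  proof (rule bij_betw_imageI[OF inj_onI subset_antisym[OF subsetI subsetI]])
    fix \<theta> \<theta>' assume th: "\<theta> \<in> \<Theta>" "\<theta>' \<in> \<Theta>" and eq: "rep_iso G `` {ind (\<sigma> \<theta>)} = rep_iso G `` {ind (\<sigma> \<theta>')}"
    have "(ind (\<sigma> \<theta>), ind (\<sigma> \<theta>')) \<in> rep_iso G"
      using eq_equiv_class[OF eq equiv_rep_iso] ir th by simp
    then obtain A where A: "m * ?d \<theta>' = m * ?d \<theta>" "A \<in> carrier (GLC (m * ?d \<theta>))"
      "\<And>g. g \<in> carrier G \<Longrightarrow> A * ind (\<sigma> \<theta>) g = ind (\<sigma> \<theta>') g * A"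
      unfolding rep_iso_def using deg th by auto
    have Ac: "A \<in> carrier_mat (m * ?d \<theta>') (m * ?d \<theta>)" using A(2) unfolding A(1) by (auto simp: GLC_carrier)
    have "A \<noteq> 0\<^sub>m (m * ?d \<theta>') (m * ?d \<theta>)"
    proof
      assume z: "A = 0\<^sub>m (m * ?d \<theta>') (m * ?d \<theta>)"
      obtain B where "B \<in> carrier_mat (m * ?d \<theta>) (m * ?d \<theta>)" "A * B = 1\<^sub>m (m * ?d \<theta>)" using A(2) by (auto simp: GLC_carrier)
      then have "0\<^sub>m (m * ?d \<theta>) (m * ?d \<theta>) = (1\<^sub>m (m * ?d \<theta>) :: complex mat)" using z A(1) by simp
      then have "0\<^sub>m (m * ?d \<theta>) (m * ?d \<theta>) $$ (0, 0) = (1\<^sub>m (m * ?d \<theta>) :: complex mat) $$ (0, 0)" by simp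
      then show False using m_pos s(2)[OF th(1)] by simp
    qed
    from ind_intertwiner[OF s(1)[OF th(1)] over[OF th(1)] s(1)[OF th(2)] over[OF th(2)] Ac this A(3)]
    obtain A0 where "A0 \<in> carrier_mat (?d \<theta>') (?d \<theta>)" "A0 \<noteq> 0\<^sub>m (?d \<theta>') (?d \<theta>)"
      "\<And>s. s \<in> T \<Longrightarrow> A0 * \<sigma> \<theta> s = \<sigma> \<theta>' s * A0" by blast
    then show "\<theta> = \<theta>'" using inj[OF th] by blast
  next
    fix C assume "C \<in> (\<lambda>\<theta>. rep_iso G `` {ind (\<sigma> \<theta>)}) ` \<Theta>"
    then show "C \<in> Irr_over G N \<psi>" using irrG cont by (auto simp: Irr_over_def intro: quotientI)
  next
    fix C assume "C \<in> Irr_over G N \<psi>"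
    then obtain \<rho> where \<rho>: "irreducible_rep G \<rho>" "rep_contains G \<rho> N \<psi>" "C = rep_iso G `` {\<rho>}"
      by (auto simp: Irr_over_def elim: quotientE)
    let ?D = "rep_degree G \<rho>"
    have m: "mrep G ?D \<rho>" by (rule irreducible_repD(1)[OF \<rho>(1) is_group])
    obtain A where "A \<in> carrier_mat ?D 1" "A \<noteq> 0\<^sub>m ?D 1" "\<And>h. h \<in> N \<Longrightarrow> \<rho> h * A = \<psi> h \<cdot>\<^sub>m A"
      using \<rho>(2) rep_contains_iff[OF m subgroup.subset[OF N]] by blast
    from exh[OF m this] obtain \<theta> f where f: "\<theta> \<in> \<Theta>" "f \<in> carrier_mat ?D (?d \<theta>)" "f \<noteq> 0\<^sub>m ?D (?d \<theta>)"
      "\<And>s. s \<in> T \<Longrightarrow> \<rho> s * f = f * \<sigma> \<theta> s" by blast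
    from frobenius_hom[OF s(1)[OF f(1)] over[OF f(1)] m f(2-4)]
    obtain F where F: "F \<in> carrier_mat ?D (m * ?d \<theta>)" "F \<noteq> 0\<^sub>m ?D (m * ?d \<theta>)"
      "\<And>g. g \<in> carrier G \<Longrightarrow> F * ind (\<sigma> \<theta>) g = \<rho> g * F" by blast
    have "(ind (\<sigma> \<theta>), \<rho>) \<in> rep_iso G"
      by (rule irreducible_rep_iso[OF is_group fin irrG[OF f(1)] \<rho>(1)]) (use F deg[OF f(1)] in auto)
    then have "rep_iso G `` {ind (\<sigma> \<theta>)} = C" unfolding \<rho>(3) by (rule equiv_class_eq[OF equiv_rep_iso])
    then show "C \<in> (\<lambda>\<theta>. rep_iso G `` {ind (\<sigma> \<theta>)}) ` \<Theta>" using f(1) by blast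
  qed
qed

end

text \<open>The matrix \<open>A * U g\<close> is not zero, so it can be cancelled, which makes the
  eigenvalues multiplicative.\<close>

lemma (in comm_group) common_eigenvector_char:
  assumes fin: "finite (carrier G)" and R: "mrep G D R" and U: "mrep G d U"
    and M: "mlin D d M" "\<And>g A. g \<in> carrier G \<Longrightarrow> A \<in> M \<Longrightarrow> R g * A * U (inv g) \<in> M"
    and A0: "A0 \<in> M" "A0 \<noteq> 0\<^sub>m D d"
  obtains A ev where "A \<in> M" "A \<noteq> 0\<^sub>m D d" "\<And>g. g \<in> carrier G \<Longrightarrow> R g * A = ev g \<cdot>\<^sub>m (A * U g)"
    "\<And>g h. g \<in> carrier G \<Longrightarrow> h \<in> carrier G \<Longrightarrow> ev (g \<otimes> h) = ev g * ev h"
    "\<And>g. g \<in> carrier G \<Longrightarrow> ev g \<noteq> 0"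
proof -
  obtain A ev where A: "A \<in> M" "A \<noteq> 0\<^sub>m D d" "\<And>g. g \<in> carrier G \<Longrightarrow> R g * A = ev g \<cdot>\<^sub>m (A * U g)"
    using common_eigenvector[OF assms] by blast
  have Ac: "A \<in> carrier_mat D d" using A(1) M(1) by (auto simp: mlin_def)
  note dims = carrier_matD[OF Ac] carrier_matD[OF mrepD(1)[OF R]] carrier_matD[OF mrepD(1)[OF U]]
  have AU: "A * U g \<noteq> 0\<^sub>m D d" "A * U g \<in> carrier_mat D d" if g: "g \<in> carrier G" for g
  proof
    assume z: "A * U g = 0\<^sub>m D d"
    have "A = A * U g * U (inv g)" using mrep_inv[OF U g] g Ac by (simp add: mat_assoc dims right_mult_one_mat)
    also have "\<dots> = 0\<^sub>m D d" unfolding z using left_mult_zero_mat[OF mrepD(1)[OF U inv_closed[OF g]]] .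
    finally show False using A(2) by simp
  qed (use Ac mrepD(1)[OF U g] in auto)
  have mult: "ev (g \<otimes> h) = ev g * ev h" if g: "g \<in> carrier G" and h: "h \<in> carrier G" for g h
  proof -
    have "ev (g \<otimes> h) \<cdot>\<^sub>m (A * U (g \<otimes> h)) = R g * (R h * A)"
      using A(3)[of "g \<otimes> h"] g h by (simp add: mrepD(2)[OF R] mat_assoc dims)
    also have "\<dots> = ev h \<cdot>\<^sub>m (R g * A * U h)"
      unfolding A(3)[OF h] using g h by (simp add: mat_smult_right mat_assoc dims)
    also have "\<dots> = (ev g * ev h) \<cdot>\<^sub>m (A * U (g \<otimes> h))"
      unfolding A(3)[OF g] using g h by (simp add: mrepD(2)[OF U] mat_smult_left mat_assoc dims smult_smult_mat mult.commute)
    finally show ?thesis by (rule smult_mat_cancel[OF AU(2)[OF m_closed[OF g h]] AU(1)[OF m_closed[OF g h]]])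
  qed
  have "ev g \<noteq> 0" if g: "g \<in> carrier G" for g
  proof
    assume "ev g = 0"
    then have "R g * A = 0\<^sub>m D d" using A(3)[OF g] zero_smult_mat[OF AU(2)[OF g]] by simp
    then have "R (inv g) * (R g * A) = 0\<^sub>m D d" using right_mult_zero_mat[OF mrepD(1)[OF R inv_closed[OF g]]] by simp
    moreover have "R (inv g) * (R g * A) = A"
      using mrep_inv[OF R g] g Ac by (simp add: mat_assoc[symmetric] dims)
    ultimately show False using A(2) by simp
  qed
  then show ?thesis using that A mult by blast
qed

lemma (in group) subgroup_comm_group:
  assumes "subgroup H G" "\<And>x y. x \<in> H \<Longrightarrow> y \<in> H \<Longrightarrow> x \<otimes> y = y \<otimes> x"
  shows "comm_group (G\<lparr>carrier := H\<rparr>)"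
  by (rule group.group_comm_groupI[OF subgroup.subgroup_is_group[OF assms(1) is_group]]) (use assms(2) in auto)

text \<open>The index set \<open>\<Theta>\<close> is abstract; \<open>tq\<close> identifies it with
  the characters of \<open>Gb\<close> that agree with \<open>\<psi>\<close> on
  \<open>Gb \<inter> N\<close>.\<close>

locale inertia_abelian = inertia +
  fixes Gb :: "'a set" and \<Theta> :: "'th set" and tq :: "'th \<Rightarrow> 'a \<Rightarrow> complex"
  assumes Gb: "subgroup Gb G" and GbT: "Gb \<subseteq> T"
    and Gb_comm: "\<And>x y. x \<in> Gb \<Longrightarrow> y \<in> Gb \<Longrightarrow> x \<otimes> y = y \<otimes> x"
    and tq_mult: "\<And>\<theta> g h. \<theta> \<in> \<Theta> \<Longrightarrow> g \<in> Gb \<Longrightarrow> h \<in> Gb \<Longrightarrow> tq \<theta> (g \<otimes> h) = tq \<theta> g * tq \<theta> h"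
    and tq_nonzero: "\<And>\<theta> g. \<theta> \<in> \<Theta> \<Longrightarrow> g \<in> Gb \<Longrightarrow> tq \<theta> g \<noteq> 0"
    and tq_psi: "\<And>\<theta> g. \<theta> \<in> \<Theta> \<Longrightarrow> g \<in> Gb \<Longrightarrow> g \<in> N \<Longrightarrow> tq \<theta> g = \<psi> g"
    and tq_inj: "\<And>\<theta> \<theta>'. \<theta> \<in> \<Theta> \<Longrightarrow> \<theta>' \<in> \<Theta> \<Longrightarrow> (\<And>g. g \<in> Gb \<Longrightarrow> tq \<theta> g = tq \<theta>' g) \<Longrightarrow> \<theta> = \<theta>'"
    and tq_surj: "\<And>\<eta>. (\<And>g h. g \<in> Gb \<Longrightarrow> h \<in> Gb \<Longrightarrow> \<eta> (g \<otimes> h) = \<eta> g * \<eta> h) \<Longrightarrow> (\<And>g. g \<in> Gb \<Longrightarrow> \<eta> g \<noteq> 0) \<Longrightarrow>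
        (\<And>g. g \<in> Gb \<Longrightarrow> g \<in> N \<Longrightarrow> \<eta> g = \<psi> g) \<Longrightarrow> \<exists>\<theta>\<in>\<Theta>. \<forall>g\<in>Gb. tq \<theta> g = \<eta> g"
begin

lemma Gb_carrier: "g \<in> Gb \<Longrightarrow> g \<in> carrier G" by (rule subgroup.mem_carrier[OF Gb])

lemma char_one: "(\<And>g h. g \<in> S \<Longrightarrow> h \<in> S \<Longrightarrow> \<eta> (g \<otimes> h) = \<eta> g * \<eta> h) \<Longrightarrow> (\<And>g. g \<in> S \<Longrightarrow> \<eta> g \<noteq> (0::complex)) \<Longrightarrow>
  subgroup S G \<Longrightarrow> \<eta> \<one> = 1"
proof -
  assume h: "\<And>g h. g \<in> S \<Longrightarrow> h \<in> S \<Longrightarrow> \<eta> (g \<otimes> h) = \<eta> g * \<eta> h" "\<And>g. g \<in> S \<Longrightarrow> \<eta> g \<noteq> (0::complex)" "subgroup S G"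
  have "\<one> \<in> S" by (rule subgroup.one_closed[OF h(3)])
  then have "\<eta> \<one> * \<eta> \<one> = \<eta> \<one> * 1" "\<eta> \<one> \<noteq> 0" using h(1)[of \<one> \<one>] h(2) by auto
  then show ?thesis by (metis mult_left_cancel)
qed

lemma psi_one: "\<psi> \<one> = 1" by (rule char_one[OF psi_mult psi_nonzero N])
lemma tq_one: "\<theta> \<in> \<Theta> \<Longrightarrow> tq \<theta> \<one> = 1" by (rule char_one[OF tq_mult tq_nonzero Gb])

definition psi_space :: "nat \<Rightarrow> ('a \<Rightarrow> complex mat) \<Rightarrow> complex mat set" where
  "psi_space D R = {A \<in> carrier_mat D 1. \<forall>h\<in>N. R h * A = \<psi> h \<cdot>\<^sub>m A}"

lemma psi_space_mlin:
  assumes "mrep G D R"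
  shows "mlin D 1 (psi_space D R)"
  unfolding mlin_def psi_space_def using mrepD(1)[OF assms N_carrier]
  by (auto simp: mult_add_distrib_mat[of _ D D] mat_smult_right add_smult_distrib_left_mat[of _ D 1] smult_smult_mat mult.commute
      carrier_matD[OF mrepD(1)[OF assms N_carrier]] intro!: eq_matI)

lemma psi_space_stable:
  assumes R: "mrep G D R" and g: "g \<in> T" and A: "A \<in> psi_space D R"
  shows "R g * A \<in> psi_space D R"
proof -
  have gc: "g \<in> carrier G" using g by (rule T_carrier)
  have Ac: "A \<in> carrier_mat D 1" using A by (simp add: psi_space_def)
  note dims = carrier_matD[OF Ac] carrier_matD[OF mrepD(1)[OF R]]
  have "R h * (R g * A) = \<psi> h \<cdot>\<^sub>m (R g * A)" if h: "h \<in> N" for h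
  proof -
    have hc: "h \<in> carrier G" by (rule N_carrier[OF h])
    have k: "inv g \<otimes> h \<otimes> g \<in> N" by (rule N_conj[OF gc h])
    have "h \<otimes> g = g \<otimes> (inv g \<otimes> h \<otimes> g)" using gc hc by (simp add: m_assoc cancel_inv)
    then have "R h * R g = R g * R (inv g \<otimes> h \<otimes> g)"
      using mrepD(2)[OF R gc N_carrier[OF k]] mrepD(2)[OF R hc gc] by simp
    then have "R h * (R g * A) = R g * (R (inv g \<otimes> h \<otimes> g) * A)"
      using gc hc N_carrier[OF k] by (simp add: mat_assoc[symmetric] dims)
    also have "\<dots> = R g * (\<psi> h \<cdot>\<^sub>m A)" using A k stab[OF g h] by (simp add: psi_space_def)
    finally show ?thesis using gc by (simp add: mat_smult_right dims)
  qed
  then show ?thesis using Ac mrepD(1)[OF R gc] by (simp add: psi_space_def)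
qed

lemma psi_space_eigenvector:
  assumes R: "mrep G D R" and A0: "A0 \<in> psi_space D R" "A0 \<noteq> 0\<^sub>m D 1" and S: "subgroup S G" "S \<subseteq> Gb"
  obtains A ev where "A \<in> psi_space D R" "A \<noteq> 0\<^sub>m D 1" "\<And>g. g \<in> S \<Longrightarrow> R g * A = ev g \<cdot>\<^sub>m A"
    "\<And>g h. g \<in> S \<Longrightarrow> h \<in> S \<Longrightarrow> ev (g \<otimes> h) = ev g * ev h" "\<And>g. g \<in> S \<Longrightarrow> ev g \<noteq> 0"
    "\<And>g. g \<in> S \<Longrightarrow> g \<in> N \<Longrightarrow> ev g = \<psi> g"
proof -
  let ?S = "G\<lparr>carrier := S\<rparr>"
  interpret C: comm_group ?S by (rule subgroup_comm_group[OF S(1)]) (use S Gb_comm in auto)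
  have Ac: "A \<in> carrier_mat D 1" if "A \<in> psi_space D R" for A using that by (simp add: psi_space_def)
  \<comment> \<open>The trivial twist, which makes the result an ordinary eigenvector.\<close>
  have U: "mrep ?S 1 (\<lambda>_. 1\<^sub>m 1)" by (simp add: mrep_def)
  have fS: "finite (carrier ?S)" using fin S(1) subgroup.subset finite_subset by fastforce
  have st: "R g * A * 1\<^sub>m 1 \<in> psi_space D R" if "g \<in> carrier ?S" "A \<in> psi_space D R" for g A
  proof -
    have "g \<in> T" using that S GbT by auto
    then have "R g * A \<in> psi_space D R" by (rule psi_space_stable[OF R _ that(2)])
    then show ?thesis by (simp add: right_mult_one_mat[OF Ac])
  qed
  obtain A ev where A: "A \<in> psi_space D R" "A \<noteq> 0\<^sub>m D 1" "\<And>g. g \<in> S \<Longrightarrow> R g * A = ev g \<cdot>\<^sub>m (A * 1\<^sub>m 1)"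
    "\<And>g h. g \<in> S \<Longrightarrow> h \<in> S \<Longrightarrow> ev (g \<otimes> h) = ev g * ev h" "\<And>g. g \<in> S \<Longrightarrow> ev g \<noteq> 0"
    using C.common_eigenvector_char[OF fS mrep_restrict[OF R S(1)] U psi_space_mlin[OF R] st A0] by auto
  have A3: "R g * A = ev g \<cdot>\<^sub>m A" if "g \<in> S" for g using A(3)[OF that] Ac[OF A(1)] by simp
  have "ev g = \<psi> g" if "g \<in> S" "g \<in> N" for g
    using A3[OF that(1)] A(1) that(2) smult_mat_cancel[OF Ac[OF A(1)] A(2)] by (auto simp: psi_space_def)
  then show ?thesis using that[OF A(1,2) A3 A(4,5)] by blast
qed

end

lemma (in group) irreducible_rep_degree_one:
  assumes m: "mrep G 1 \<rho>"
  shows "irreducible_rep G \<rho>"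
proof -
  have "M = {0\<^sub>m 1 1} \<or> M = carrier_mat 1 1" if M: "mlin 1 1 M" for M
  proof (cases "M = {0\<^sub>m 1 1}")
    case False
    then obtain A where A: "A \<in> M" "A \<noteq> 0\<^sub>m 1 1" using M by (auto simp: mlin_def)
    have Ac: "A \<in> carrier_mat 1 1" using A M by (auto simp: mlin_def)
    have a: "A $$ (0, 0) \<noteq> 0"
    proof
      assume "A $$ (0, 0) = 0"
      then have "A = 0\<^sub>m 1 1" using Ac by (intro eq_matI) (auto simp: One_nat_def)
      then show False using A by simp
    qed
    have "B \<in> M" if B: "B \<in> carrier_mat 1 1" for B
    proof -
      have "B = (B $$ (0, 0) / A $$ (0, 0)) \<cdot>\<^sub>m A" using Ac B a by (intro eq_matI) (auto simp: One_nat_def)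
      then show ?thesis using M A(1) by (metis mlin_def)
    qed
    then show ?thesis using M by (auto simp: mlin_def)
  qed simp
  then show ?thesis unfolding irreducible_rep_iff[OF is_group] using m by (intro exI[of _ 1]) auto
qed

section \<open>Extension of Heisenberg representations to the inertia group\<close>

locale inertia_heisenberg = inertia_abelian +
  fixes H Z :: "'a set" and P :: "'r set" and psr :: "'r \<Rightarrow> 'a \<Rightarrow> complex"
    and ro :: "'c \<Rightarrow> 'r" and \<pi> U :: "'r \<Rightarrow> 'a \<Rightarrow> complex mat"
  assumes H: "subgroup H G" and H_conj: "\<And>g h. g \<in> carrier G \<Longrightarrow> h \<in> H \<Longrightarrow> inv g \<otimes> h \<otimes> g \<in> H"
    and NH: "N \<subseteq> H" and HT: "H \<subseteq> T"
    and T_prod: "\<And>x. x \<in> T \<Longrightarrow> \<exists>g\<in>Gb. \<exists>h\<in>H. x = g \<otimes> h"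
    and Z: "Z \<subseteq> H" "N \<subseteq> Z" and Z_prod: "\<And>z. z \<in> Z \<Longrightarrow> \<exists>g\<in>Gb \<inter> H. \<exists>h\<in>N. z = g \<otimes> h"
    and prodZ: "\<And>g h. g \<in> Gb \<inter> H \<Longrightarrow> h \<in> N \<Longrightarrow> g \<otimes> h \<in> Z"
    and psr_mult: "\<And>\<rho> x y. \<rho> \<in> P \<Longrightarrow> x \<in> Z \<Longrightarrow> y \<in> Z \<Longrightarrow> psr \<rho> (x \<otimes> y) = psr \<rho> x * psr \<rho> y"
    and psr_psi: "\<And>\<rho> h. \<rho> \<in> P \<Longrightarrow> h \<in> N \<Longrightarrow> psr \<rho> h = \<psi> h"
    and comm: "\<And>x h. x \<in> H \<Longrightarrow> h \<in> H \<Longrightarrow> inv x \<otimes> inv h \<otimes> x \<otimes> h \<in> N"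
    and cent: "\<And>x h. x \<in> Z \<Longrightarrow> h \<in> H \<Longrightarrow> \<psi> (inv x \<otimes> inv h \<otimes> x \<otimes> h) = 1"
    and nondeg: "\<And>x. x \<in> H \<Longrightarrow> x \<notin> Z \<Longrightarrow> \<exists>h\<in>H. \<psi> (inv x \<otimes> inv h \<otimes> x \<otimes> h) \<noteq> 1"
    and psr_inj: "\<And>\<rho> \<rho>'. \<rho> \<in> P \<Longrightarrow> \<rho>' \<in> P \<Longrightarrow> (\<And>g. g \<in> Gb \<inter> H \<Longrightarrow> psr \<rho> g = psr \<rho>' g) \<Longrightarrow> \<rho> = \<rho>'"
    and psr_surj: "\<And>\<eta>. (\<And>g h. g \<in> Gb \<inter> H \<Longrightarrow> h \<in> Gb \<inter> H \<Longrightarrow> \<eta> (g \<otimes> h) = \<eta> g * \<eta> h) \<Longrightarrow> (\<And>g. g \<in> Gb \<inter> H \<Longrightarrow> \<eta> g \<noteq> 0) \<Longrightarrow>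
        (\<And>g. g \<in> Gb \<inter> H \<Longrightarrow> g \<in> N \<Longrightarrow> \<eta> g = \<psi> g) \<Longrightarrow> \<exists>\<rho>\<in>P. \<forall>g\<in>Gb \<inter> H. psr \<rho> g = \<eta> g"
    and ro: "\<And>\<theta>. \<theta> \<in> \<Theta> \<Longrightarrow> ro \<theta> \<in> P" "\<And>\<theta> g. \<theta> \<in> \<Theta> \<Longrightarrow> g \<in> Gb \<inter> H \<Longrightarrow> psr (ro \<theta>) g = tq \<theta> g"
    and pi_irr: "\<And>\<rho>. \<rho> \<in> P \<Longrightarrow> irreducible_rep (G\<lparr>carrier := H\<rparr>) (\<pi> \<rho>)"
    and pi_contains: "\<And>\<rho>. \<rho> \<in> P \<Longrightarrow> rep_contains (G\<lparr>carrier := H\<rparr>) (\<pi> \<rho>) Z (psr \<rho>)"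
    and U_hom: "\<And>\<rho>. \<rho> \<in> P \<Longrightarrow> U \<rho> \<in> hom (G\<lparr>carrier := Gb\<rparr>) (GLC (rep_degree (G\<lparr>carrier := H\<rparr>) (\<pi> \<rho>)))"
    and U_conj: "\<And>\<rho> g x. \<rho> \<in> P \<Longrightarrow> g \<in> Gb \<Longrightarrow> x \<in> H \<Longrightarrow> U \<rho> g * \<pi> \<rho> (inv g \<otimes> x \<otimes> g) = \<pi> \<rho> x * U \<rho> g"
    and U_one: "\<And>\<rho> g. \<rho> \<in> P \<Longrightarrow> g \<in> Gb \<inter> H \<Longrightarrow> U \<rho> g = 1\<^sub>m (rep_degree (G\<lparr>carrier := H\<rparr>) (\<pi> \<rho>))"
begin

lemma H_carrier: "h \<in> H \<Longrightarrow> h \<in> carrier G" by (rule subgroup.mem_carrier[OF H])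
lemma H_group: "group (G\<lparr>carrier := H\<rparr>)" by (rule subgroup.subgroup_is_group[OF H is_group])
lemma Z_carrier: "z \<in> Z \<Longrightarrow> z \<in> carrier G" using Z H_carrier by blast
lemma GbH: "subgroup (Gb \<inter> H) G" by (rule subgroups_Inter_pair[OF Gb H])

abbreviation "pdeg \<rho> \<equiv> rep_degree (G\<lparr>carrier := H\<rparr>) (\<pi> \<rho>)"

lemma GbZ: "Gb \<inter> H \<subseteq> Z"
proof
  fix g assume g: "g \<in> Gb \<inter> H"
  then show "g \<in> Z" using prodZ[OF g subgroup.one_closed[OF N]] H_carrier by simp
qed

lemmas pi_mrep = irreducible_repD(1)[OF pi_irr H_group]

lemma U_mrep:
  assumes "\<rho> \<in> P" shows "mrep (G\<lparr>carrier := Gb\<rparr>) (pdeg \<rho>) (U \<rho>)"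
proof -
  interpret B: group "G\<lparr>carrier := Gb\<rparr>" by (rule subgroup.subgroup_is_group[OF Gb is_group])
  have "U \<rho> \<one>\<^bsub>G\<lparr>carrier := Gb\<rparr>\<^esub> = \<one>\<^bsub>GLC (pdeg \<rho>)\<^esub>" by (rule hom_one[OF U_hom[OF assms] B.is_group GLC_group])
  then show ?thesis using U_hom[OF assms] by (auto simp: mrep_def hom_def GLC_carrier Pi_iff)
qed

text \<open>The vectors on which \<open>Z\<close> acts by \<open>psr \<rho>\<close> form a stable
  subspace: \<open>z \<otimes> x\<close> equals \<open>x \<otimes> z\<close> times a commutator in
  \<open>N\<close> on which \<open>\<psi>\<close> is \<open>1\<close>. It is not zero by assumption,
  so it is everything.\<close>

lemma pi_scalar:
  assumes \<rho>: "\<rho> \<in> P" and z: "z \<in> Z"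
  shows "\<pi> \<rho> z = psr \<rho> z \<cdot>\<^sub>m 1\<^sub>m (pdeg \<rho>)"
proof -
  let ?d = "pdeg \<rho>" and ?H = "G\<lparr>carrier := H\<rparr>"
  note p = pi_mrep[OF \<rho>]
  define M where "M = {A \<in> carrier_mat ?d 1. \<forall>z\<in>Z. \<pi> \<rho> z * A = psr \<rho> z \<cdot>\<^sub>m A}"
  have pc: "\<pi> \<rho> x \<in> carrier_mat ?d ?d" if "x \<in> H" for x using mrepD(1)[OF p] that by simp
  have pm: "\<pi> \<rho> (x \<otimes> y) = \<pi> \<rho> x * \<pi> \<rho> y" if "x \<in> H" "y \<in> H" for x y using mrepD(2)[OF p] that by simp
  obtain A where A: "A \<in> M" "A \<noteq> 0\<^sub>m ?d 1"
    using pi_contains[OF \<rho>] rep_contains_iff[OF p, of Z "psr \<rho>"] Z unfolding M_def by auto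
  have "M = carrier_mat ?d 1"
  proof (rule irreducible_repD(3)[OF pi_irr[OF \<rho>] H_group _ _ A])
    show "mlin ?d 1 M" unfolding mlin_def M_def using pc Z
      by (auto simp: mult_add_distrib_mat[of _ ?d ?d] mat_smult_right add_smult_distrib_left_mat[of _ ?d 1] smult_smult_mat mult.commute
        carrier_matD[OF pc] subset_iff intro!: eq_matI)
    show "\<pi> \<rho> x * B \<in> M" if xB: "x \<in> carrier ?H" "B \<in> M" for x B
    proof -
      have x: "x \<in> H" and B: "B \<in> carrier_mat ?d 1" "\<And>z. z \<in> Z \<Longrightarrow> \<pi> \<rho> z * B = psr \<rho> z \<cdot>\<^sub>m B"
        using xB by (auto simp: M_def)
      have "\<pi> \<rho> z * (\<pi> \<rho> x * B) = psr \<rho> z \<cdot>\<^sub>m (\<pi> \<rho> x * B)" if z: "z \<in> Z" for z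
      proof -
        let ?k = "inv z \<otimes> inv x \<otimes> z \<otimes> x"
        have zH: "z \<in> H" using z Z by auto
        note c = H_carrier[OF x] H_carrier[OF zH]
        have k: "?k \<in> N" "?k \<in> Z" "?k \<in> H" using comm[OF zH x] Z NH by auto
        have zk: "z \<otimes> ?k \<in> Z"
        proof -
          obtain g h where g: "g \<in> Gb \<inter> H" "h \<in> N" "z = g \<otimes> h" using Z_prod[OF z] by blast
          have "z \<otimes> ?k = g \<otimes> (h \<otimes> ?k)" using g(3) H_carrier[OF k(3)] N_carrier[OF g(2)] GbH subgroup.mem_carrier[OF GbH g(1)]
            by (simp add: m_assoc)
          moreover have "h \<otimes> ?k \<in> N" by (rule subgroup.m_closed[OF N g(2) k(1)])
          ultimately show ?thesis using prodZ[OF g(1)] by simp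
        qed
        have "z \<otimes> x = x \<otimes> (z \<otimes> ?k)" using c by (simp add: m_assoc cancel_inv)
        then have "\<pi> \<rho> z * \<pi> \<rho> x = \<pi> \<rho> x * \<pi> \<rho> (z \<otimes> ?k)"
          using pm[OF zH x] pm[OF x, of "z \<otimes> ?k"] zk Z by auto
        then have "\<pi> \<rho> z * (\<pi> \<rho> x * B) = \<pi> \<rho> x * (\<pi> \<rho> (z \<otimes> ?k) * B)"
          using x zH zk Z B(1) by (simp add: mat_assoc[symmetric] carrier_matD[OF pc] carrier_matD[OF B(1)] subset_iff)
        also have "\<pi> \<rho> (z \<otimes> ?k) * B = psr \<rho> z \<cdot>\<^sub>m B"
          using B(2)[OF zk] psr_mult[OF \<rho> z k(2)] psr_psi[OF \<rho> k(1)] cent[OF z x] by simp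
        finally show ?thesis using x by (simp add: mat_smult_right carrier_matD[OF pc] carrier_matD[OF B(1)])
      qed
      then show ?thesis using pc[OF x] B(1) by (simp add: M_def)
    qed
  qed
  then show ?thesis using z Z by (intro mat_eq_smult_oneI pc) (auto simp: M_def)
qed

definition sig :: "'c \<Rightarrow> 'a \<Rightarrow> complex mat" where
  "sig \<theta> x = (THE M. \<exists>g\<in>Gb. \<exists>h\<in>H. x = g \<otimes> h \<and> M = tq \<theta> g \<cdot>\<^sub>m (U (ro \<theta>) g * \<pi> (ro \<theta>) h))"

text \<open>Two factorizations differ by an element \<open>z\<close> of
  \<open>Gb \<inter> H\<close>, on which \<open>U\<close> is the identity and \<open>\<pi>\<close>
  is the scalar \<open>psr (ro \<theta>) z = tq \<theta> z\<close>; so the value does not depend on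
  the factorization.\<close>

lemma sig_eq:
  assumes th: "\<theta> \<in> \<Theta>" and g: "g \<in> Gb" and h: "h \<in> H"
  shows "sig \<theta> (g \<otimes> h) = tq \<theta> g \<cdot>\<^sub>m (U (ro \<theta>) g * \<pi> (ro \<theta>) h)"
  unfolding sig_def
proof (rule the_equality)
  let ?\<rho> = "ro \<theta>"
  let ?d = "pdeg ?\<rho>"
  note p = pi_mrep[OF ro(1)[OF th]] and u = U_mrep[OF ro(1)[OF th]]
  show "\<exists>g'\<in>Gb. \<exists>h'\<in>H. g \<otimes> h = g' \<otimes> h' \<and> tq \<theta> g \<cdot>\<^sub>m (U ?\<rho> g * \<pi> ?\<rho> h) = tq \<theta> g' \<cdot>\<^sub>m (U ?\<rho> g' * \<pi> ?\<rho> h')"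
    using assms by blast
  fix M assume "\<exists>g'\<in>Gb. \<exists>h'\<in>H. g \<otimes> h = g' \<otimes> h' \<and> M = tq \<theta> g' \<cdot>\<^sub>m (U ?\<rho> g' * \<pi> ?\<rho> h')"
  then obtain g' h' where g': "g' \<in> Gb" "h' \<in> H" "g \<otimes> h = g' \<otimes> h'" "M = tq \<theta> g' \<cdot>\<^sub>m (U ?\<rho> g' * \<pi> ?\<rho> h')" by blast
  define z where "z = inv g' \<otimes> g"
  note c = Gb_carrier[OF g] Gb_carrier[OF g'(1)] H_carrier[OF h] H_carrier[OF g'(2)]
  have zG: "z \<in> Gb" unfolding z_def using g g' Gb by (simp add: subgroup.m_closed subgroup.m_inv_closed)
  have zh: "z \<otimes> h = h'" unfolding z_def using g'(3) c by (simp add: m_assoc cancel_inv)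
  then have "z = h' \<otimes> inv h" using c zG Gb_carrier by (metis inv_solve_right)
  then have zH: "z \<in> H" using h g' H by (simp add: subgroup.m_closed subgroup.m_inv_closed)
  have zZ: "z \<in> Z" using zG zH GbZ by blast
  have gz: "g = g' \<otimes> z" unfolding z_def using c by (simp add: cancel_inv)
  have "tq \<theta> g = tq \<theta> g' * tq \<theta> z" using tq_mult[OF th g'(1) zG] gz by simp
  moreover have "U ?\<rho> g = U ?\<rho> g'"
    using mrepD(2)[OF u, of g' z] mrepD(1)[OF u, of g'] U_one[OF ro(1)[OF th], of z] g' zG zH gz by simp
  moreover have "\<pi> ?\<rho> h' = tq \<theta> z \<cdot>\<^sub>m \<pi> ?\<rho> h"
  proof -
    have "\<pi> ?\<rho> h' = \<pi> ?\<rho> z * \<pi> ?\<rho> h" using mrepD(2)[OF p, of z h] zH h zh by simp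
    also have "\<dots> = tq \<theta> z \<cdot>\<^sub>m \<pi> ?\<rho> h"
      unfolding pi_scalar[OF ro(1)[OF th] zZ] using ro(2)[OF th, of z] zG zH mrepD(1)[OF p, of h] h
      by (simp add: mat_smult_left)
    finally show ?thesis .
  qed
  ultimately show "M = tq \<theta> g \<cdot>\<^sub>m (U ?\<rho> g * \<pi> ?\<rho> h)"
    using g' h mrepD(1)[OF u, of g'] mrepD(1)[OF p, of h] by (simp add: mat_smult_right smult_smult_mat)
qed

lemma sig_Gb: "\<theta> \<in> \<Theta> \<Longrightarrow> g \<in> Gb \<Longrightarrow> sig \<theta> g = tq \<theta> g \<cdot>\<^sub>m U (ro \<theta>) g"
  using sig_eq[of \<theta> g \<one>] subgroup.one_closed[OF H] mrepD(3)[OF pi_mrep[OF ro(1)]]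
    mrepD(1)[OF U_mrep[OF ro(1)], of \<theta> g] Gb_carrier by simp

lemma sig_H: "\<theta> \<in> \<Theta> \<Longrightarrow> h \<in> H \<Longrightarrow> sig \<theta> h = \<pi> (ro \<theta>) h"
  using sig_eq[of \<theta> \<one> h] subgroup.one_closed[OF Gb] mrepD(3)[OF U_mrep[OF ro(1)]]
    mrepD(1)[OF pi_mrep[OF ro(1)], of \<theta> h] H_carrier tq_one by (simp add: one_smult_mat)

lemma sig_GbH:
  assumes "\<theta> \<in> \<Theta>" "g \<in> Gb \<inter> H" shows "sig \<theta> g = tq \<theta> g \<cdot>\<^sub>m 1\<^sub>m (pdeg (ro \<theta>))"
  using sig_Gb[OF assms(1), of g] U_one[OF ro(1)[OF assms(1)] assms(2)] assms(2) by simp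

lemma sig_mrep:
  assumes th: "\<theta> \<in> \<Theta>"
  shows "mrep (G\<lparr>carrier := T\<rparr>) (pdeg (ro \<theta>)) (sig \<theta>)"
  unfolding mrep_def
proof (intro conjI ballI)
  let ?\<rho> = "ro \<theta>"
  let ?d = "pdeg ?\<rho>"
  note r = ro(1)[OF th]
  note p = pi_mrep[OF r] and u = U_mrep[OF r]
  fix x assume "x \<in> carrier (G\<lparr>carrier := T\<rparr>)"
  then obtain g h where x: "g \<in> Gb" "h \<in> H" "x = g \<otimes> h" using T_prod by fastforce
  have pc: "\<pi> ?\<rho> y \<in> carrier_mat ?d ?d" if "y \<in> H" for y using mrepD(1)[OF p] that by simp
  have uc: "U ?\<rho> y \<in> carrier_mat ?d ?d" if "y \<in> Gb" for y using mrepD(1)[OF u] that by simp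
  note dims = carrier_matD[OF pc] carrier_matD[OF uc]
  show "sig \<theta> x \<in> carrier_mat ?d ?d" unfolding x(3) sig_eq[OF th x(1,2)] using pc[OF x(2)] uc[OF x(1)] by simp
  fix y assume "y \<in> carrier (G\<lparr>carrier := T\<rparr>)"
  then obtain g' h' where y: "g' \<in> Gb" "h' \<in> H" "y = g' \<otimes> h'" using T_prod by fastforce
  note c = Gb_carrier[OF x(1)] Gb_carrier[OF y(1)] H_carrier[OF x(2)] H_carrier[OF y(2)]
  let ?k = "inv g' \<otimes> h \<otimes> g'"
  have k: "?k \<in> H" by (rule H_conj[OF c(2) x(2)])
  have "x \<otimes> y = (g \<otimes> g') \<otimes> (?k \<otimes> h')" unfolding x(3) y(3) using c by (simp add: m_assoc cancel_inv)
  then have "sig \<theta> (x \<otimes> y) = tq \<theta> (g \<otimes> g') \<cdot>\<^sub>m (U ?\<rho> (g \<otimes> g') * \<pi> ?\<rho> (?k \<otimes> h'))"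
    using sig_eq[OF th subgroup.m_closed[OF Gb x(1) y(1)] subgroup.m_closed[OF H k y(2)]] by simp
  also have "\<dots> = (tq \<theta> g * tq \<theta> g') \<cdot>\<^sub>m (U ?\<rho> g * (U ?\<rho> g' * \<pi> ?\<rho> ?k) * \<pi> ?\<rho> h')"
    using tq_mult[OF th x(1) y(1)] mrepD(2)[OF u, of g g'] mrepD(2)[OF p, of ?k h'] x y k by (simp add: mat_assoc dims)
  also have "\<dots> = (tq \<theta> g * tq \<theta> g') \<cdot>\<^sub>m ((U ?\<rho> g * \<pi> ?\<rho> h) * (U ?\<rho> g' * \<pi> ?\<rho> h'))"
    unfolding U_conj[OF r y(1) x(2)] using x y by (simp add: mat_assoc dims)
  also have "\<dots> = sig \<theta> x * sig \<theta> y"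
    unfolding x(3) y(3) sig_eq[OF th x(1,2)] sig_eq[OF th y(1,2)] using x y
    by (simp add: mat_smult_left mat_smult_right dims smult_smult_mat mult.commute)
  finally show "sig \<theta> (x \<otimes>\<^bsub>G\<lparr>carrier := T\<rparr>\<^esub> y) = sig \<theta> x * sig \<theta> y" by simp
next
  show "sig \<theta> \<one>\<^bsub>G\<lparr>carrier := T\<rparr>\<^esub> = 1\<^sub>m (pdeg (ro \<theta>))"
    using sig_H[OF th subgroup.one_closed[OF H]] mrepD(3)[OF pi_mrep[OF ro(1)[OF th]]] by simp
qed

text \<open>Irreducibility holds already on \<open>H\<close>. For a nonzero intertwiner between
  \<open>sig \<theta>\<close> and \<open>sig \<theta>'\<close>, the scalars on
  \<open>Gb \<inter> H\<close> give \<open>ro \<theta> = ro \<theta>'\<close>; it is then a scalar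
  by Schur on \<open>H\<close>, and comparing on \<open>Gb\<close> gives
  \<open>tq \<theta> = tq \<theta>'\<close> there.\<close>

theorem heisenberg_bij: "bij_betw (\<lambda>\<theta>. rep_iso G `` {ind (sig \<theta>)}) \<Theta> (Irr_over G N \<psi>)"
proof (rule clifford_bij)
  fix \<theta> assume th: "\<theta> \<in> \<Theta>"
  note m = sig_mrep[OF th] and r = ro(1)[OF th]
  let ?d = "pdeg (ro \<theta>)"
  have deg: "rep_degree G (sig \<theta>) = ?d" using mrep_degree[OF m] by (simp add: rep_degree_def)
  note irrD = irreducible_repD[OF pi_irr[OF r] H_group]
  have "M = {0\<^sub>m ?d 1} \<or> M = carrier_mat ?d 1"
    if M: "mlin ?d 1 M" "\<forall>g\<in>T. \<forall>A\<in>M. sig \<theta> g * A \<in> M" for M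
  proof (cases "M = {0\<^sub>m ?d 1}")
    case False
    then obtain A where A: "A \<in> M" "A \<noteq> 0\<^sub>m ?d 1" using M by (auto simp: mlin_def)
    have "\<pi> (ro \<theta>) g * B \<in> M" if "g \<in> carrier (G\<lparr>carrier := H\<rparr>)" "B \<in> M" for g B
      using M(2) HT that sig_H[OF th, of g] by (metis partial_object.select_convs(1) partial_object.surjective partial_object.update_convs(1) subsetD)
    then show ?thesis using irrD(3)[OF M(1) _ A] by blast
  qed simp
  then show "irreducible_rep (G\<lparr>carrier := T\<rparr>) (sig \<theta>)"
    unfolding irreducible_rep_iff[OF T_group] using m irrD(2) by (intro exI[of _ ?d]) auto
  fix h assume h: "h \<in> N"
  show "sig \<theta> h = \<psi> h \<cdot>\<^sub>m 1\<^sub>m (rep_degree G (sig \<theta>))"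
    using sig_H[OF th subsetD[OF NH h]] pi_scalar[OF r subsetD[OF Z(2) h]] psr_psi[OF r h] unfolding deg by simp
next
  fix \<theta> \<theta>' A assume th: "\<theta> \<in> \<Theta>" "\<theta>' \<in> \<Theta>" and
    A: "A \<in> carrier_mat (rep_degree G (sig \<theta>')) (rep_degree G (sig \<theta>))"
      "A \<noteq> 0\<^sub>m (rep_degree G (sig \<theta>')) (rep_degree G (sig \<theta>))"
      "\<And>s. s \<in> T \<Longrightarrow> A * sig \<theta> s = sig \<theta>' s * A"
  have deg: "rep_degree G (sig \<theta>) = pdeg (ro \<theta>)" "rep_degree G (sig \<theta>') = pdeg (ro \<theta>')"
    using mrep_degree[OF sig_mrep[OF th(1)]] mrep_degree[OF sig_mrep[OF th(2)]] by (simp_all add: rep_degree_def)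
  note A = A[unfolded deg]
  have eqH: "tq \<theta> g = tq \<theta>' g" if g: "g \<in> Gb \<inter> H" for g
  proof -
    have "tq \<theta> g \<cdot>\<^sub>m A = tq \<theta>' g \<cdot>\<^sub>m A"
      using A(3)[of g] g HT A(1) unfolding sig_GbH[OF th(1) g] sig_GbH[OF th(2) g]
      by (auto simp: mat_smult_left mat_smult_right)
    then show ?thesis using smult_mat_cancel[OF A(1,2)] by blast
  qed
  have rr: "ro \<theta>' = ro \<theta>" by (rule psr_inj) (use th ro eqH in auto)
  note r = ro(1)[OF th(1)]
  have "A * \<pi> (ro \<theta>) h = \<pi> (ro \<theta>) h * A" if "h \<in> H" for h
    using A(3)[of h] that HT sig_H[OF th(1) that] sig_H[OF th(2) that] rr by auto
  then obtain c where c: "A = c \<cdot>\<^sub>m 1\<^sub>m (pdeg (ro \<theta>))"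
    using schur_scalar[OF H_group pi_irr[OF r], of A] A(1) rr by auto
  have c0: "c \<noteq> 0" using A(2) zero_smult_mat[OF one_carrier_mat] c rr by metis
  show "\<theta> = \<theta>'"
  proof (rule tq_inj[OF th])
    fix g assume g: "g \<in> Gb"
    have uc: "U (ro \<theta>) g \<in> carrier_mat (pdeg (ro \<theta>)) (pdeg (ro \<theta>))" using mrepD(1)[OF U_mrep[OF r]] g by simp
    have u0: "U (ro \<theta>) g \<noteq> 0\<^sub>m (pdeg (ro \<theta>)) (pdeg (ro \<theta>))"
    proof
      assume z: "U (ro \<theta>) g = 0\<^sub>m (pdeg (ro \<theta>)) (pdeg (ro \<theta>))"
      interpret B: group "G\<lparr>carrier := Gb\<rparr>" by (rule subgroup.subgroup_is_group[OF Gb is_group])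
      have "0\<^sub>m (pdeg (ro \<theta>)) (pdeg (ro \<theta>)) = (1\<^sub>m (pdeg (ro \<theta>)) :: complex mat)"
        using B.mrep_inv(1)[OF U_mrep[OF r], of g] mrepD(1)[OF U_mrep[OF r] B.inv_closed, of g] g
        unfolding z by simp
      then have "0\<^sub>m (pdeg (ro \<theta>)) (pdeg (ro \<theta>)) $$ (0, 0) = (1\<^sub>m (pdeg (ro \<theta>)) :: complex mat) $$ (0, 0)" by simp
      then show False using irreducible_repD(2)[OF pi_irr[OF r] H_group] by simp
    qed
    have "(c * tq \<theta> g) \<cdot>\<^sub>m U (ro \<theta>) g = (c * tq \<theta>' g) \<cdot>\<^sub>m U (ro \<theta>) g"
      using A(3)[OF subsetD[OF GbT g]] uc unfolding sig_Gb[OF th(1) g] sig_Gb[OF th(2) g] rr c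
      by (simp add: mat_smult_left mat_smult_right smult_smult_mat mult.commute)
    then have "c * tq \<theta> g = c * tq \<theta>' g" by (rule smult_mat_cancel[OF uc u0])
    then show "tq \<theta> g = tq \<theta>' g" using c0 by simp
  qed
next
  fix D R A assume R: "mrep G D R" and A: "A \<in> carrier_mat D 1" "A \<noteq> 0\<^sub>m D 1" "\<And>h. h \<in> N \<Longrightarrow> R h * A = \<psi> h \<cdot>\<^sub>m A"
  have "A \<in> psi_space D R" using A by (simp add: psi_space_def)
  from psi_space_eigenvector[OF R this A(2) GbH] obtain A1 ev where
    A1: "A1 \<in> psi_space D R" "A1 \<noteq> 0\<^sub>m D 1" "\<And>g. g \<in> Gb \<inter> H \<Longrightarrow> R g * A1 = ev g \<cdot>\<^sub>m A1"
    "\<And>g h. g \<in> Gb \<inter> H \<Longrightarrow> h \<in> Gb \<inter> H \<Longrightarrow> ev (g \<otimes> h) = ev g * ev h" "\<And>g. g \<in> Gb \<inter> H \<Longrightarrow> ev g \<noteq> 0"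
    "\<And>g. g \<in> Gb \<inter> H \<Longrightarrow> g \<in> N \<Longrightarrow> ev g = \<psi> g" by blast
  obtain \<rho> where \<rho>: "\<rho> \<in> P" "\<And>g. g \<in> Gb \<inter> H \<Longrightarrow> psr \<rho> g = ev g" using psr_surj[OF A1(4-6)] by blast
  have A1c: "A1 \<in> carrier_mat D 1" using A1(1) by (simp add: psi_space_def)
  note Rd = carrier_matD[OF mrepD(1)[OF R]]
  let ?d = "pdeg \<rho>" and ?H = "G\<lparr>carrier := H\<rparr>" and ?B = "G\<lparr>carrier := Gb\<rparr>"
  have d0: "?d > 0" by (rule irreducible_repD(2)[OF pi_irr[OF \<rho>(1)] H_group])
  interpret HG: group ?H by (rule H_group)
  have A1Z: "R z * A1 = psr \<rho> z \<cdot>\<^sub>m A1" if z: "z \<in> Z" for z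
  proof -
    obtain g h where g: "g \<in> Gb \<inter> H" "h \<in> N" "z = g \<otimes> h" using Z_prod[OF z] by blast
    note c = subgroup.mem_carrier[OF GbH g(1)] N_carrier[OF g(2)]
    have "R z * A1 = R g * (R h * A1)" unfolding g(3) using c by (simp add: mrepD(2)[OF R] mat_assoc Rd carrier_matD[OF A1c])
    also have "R h * A1 = \<psi> h \<cdot>\<^sub>m A1" using A1(1) g(2) by (simp add: psi_space_def)
    also have "R g * (\<psi> h \<cdot>\<^sub>m A1) = (psr \<rho> g * psr \<rho> h) \<cdot>\<^sub>m A1"
      using c A1(3)[OF g(1)] \<rho>(2)[OF g(1)] psr_psi[OF \<rho>(1) g(2)]
      by (simp add: mat_smult_right Rd carrier_matD[OF A1c] smult_smult_mat mult.commute)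
    also have "psr \<rho> g * psr \<rho> h = psr \<rho> z" unfolding g(3) by (rule psr_mult[symmetric, OF \<rho>(1)]) (use g GbZ Z in auto)
    finally show ?thesis .
  qed
  \<comment> \<open>The eigenvector \<open>A1\<close> as the first column of a matrix with
    \<open>?d\<close> columns, the shape of a linear map from the space of
    \<open>\<pi> \<rho>\<close> that can be averaged.\<close>
  define A2 where "A2 = A1 * mat 1 ?d (\<lambda>(i, j). if j = 0 then 1 else 0)"
  have A2c: "A2 \<in> carrier_mat D ?d" unfolding A2_def using A1c by simp
  have A20: "A2 \<noteq> 0\<^sub>m D ?d"
  proof
    assume z: "A2 = 0\<^sub>m D ?d"
    have "A1 $$ (i, 0) = A2 $$ (i, 0)" if "i < D" for i
      unfolding A2_def using mult_index_sum[of A1 D 1 "mat 1 ?d (\<lambda>(i, j). if j = 0 then 1 else 0)" ?d i 0] A1c that d0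
      by (simp add: One_nat_def)
    then have "A1 = 0\<^sub>m D 1" unfolding z using A1c d0 by (intro eq_matI) (auto simp: One_nat_def)
    then show False using A1(2) by simp
  qed
  have A2Z: "R z * A2 = psr \<rho> z \<cdot>\<^sub>m A2" if z: "z \<in> Z" for z
    unfolding A2_def using A1Z[OF z] Z_carrier[OF z]
    by (simp add: mat_assoc[symmetric] Rd carrier_matD[OF A1c] mat_smult_left)
  have inv_H: "inv\<^bsub>?H\<^esub> x = inv x" if "x \<in> H" for x by (rule m_inv_consistent[OF H that])
  define \<kappa> where "\<kappa> x h = \<psi> (inv x \<otimes> inv h \<otimes> x \<otimes> h)" for x h
  have mul: "\<kappa> x (h \<otimes> k) = \<kappa> x h * \<kappa> x k" if x: "x \<in> H" and h: "h \<in> H" and k: "k \<in> H" for x h k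
  proof -
    note c = H_carrier[OF x] H_carrier[OF h] H_carrier[OF k]
    \<comment> \<open>The commutator of \<open>x\<close> with \<open>h \<otimes> k\<close> is its
      commutator with \<open>k\<close> times the conjugate by \<open>k\<close> of its commutator
      with \<open>h\<close>; \<open>\<psi>\<close> is invariant under that conjugation.\<close>
    have "inv x \<otimes> inv (h \<otimes> k) \<otimes> x \<otimes> (h \<otimes> k) = (inv x \<otimes> inv k \<otimes> x \<otimes> k) \<otimes> (inv k \<otimes> (inv x \<otimes> inv h \<otimes> x \<otimes> h) \<otimes> k)"
      using c by (simp add: inv_mult_group m_assoc cancel_inv)
    then show ?thesis unfolding \<kappa>_def
      using psi_mult[OF comm[OF x k] N_conj[OF c(3) comm[OF x h]]] stab[OF subsetD[OF HT k] comm[OF x h]] by simp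
  qed
  have "\<exists>B\<in>carrier_mat D ?d. B \<noteq> 0\<^sub>m D ?d \<and> (\<forall>x\<in>H. R x * B = B * \<pi> \<rho> x)"
  proof (rule HG.heisenberg_hom[OF _ mrep_restrict[OF R H] pi_mrep[OF \<rho>(1)] _ _ A2c A20 A2Z pi_scalar[OF \<rho>(1)], of _ \<kappa>])
    show "finite (carrier ?H)" using fin H subgroup.subset finite_subset by fastforce
    show "\<exists>h\<in>carrier ?H. \<kappa> x h \<noteq> 1" if "x \<in> carrier ?H" "x \<notin> Z" for x using nondeg that by (simp add: \<kappa>_def)
  qed (use Z subgroup.one_closed[OF N] comm cent mul psr_psi[OF \<rho>(1) comm] in \<open>auto simp: inv_H \<kappa>_def\<close>)
  then obtain B where B: "B \<in> carrier_mat D ?d" "B \<noteq> 0\<^sub>m D ?d" "\<And>x. x \<in> H \<Longrightarrow> R x * B = B * \<pi> \<rho> x" by blast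
  \<comment> \<open>The \<open>H\<close>-homomorphisms from \<open>\<pi> \<rho>\<close> to the given
    representation.\<close>
  define M where "M = {B \<in> carrier_mat D ?d. \<forall>x\<in>H. R x * B = B * \<pi> \<rho> x}"
  have pc: "\<pi> \<rho> y \<in> carrier_mat ?d ?d" if "y \<in> H" for y using mrepD(1)[OF pi_mrep[OF \<rho>(1)]] that by simp
  have uc: "U \<rho> y \<in> carrier_mat ?d ?d" if "y \<in> Gb" for y using mrepD(1)[OF U_mrep[OF \<rho>(1)]] that by simp
  have Rc: "R y \<in> carrier_mat D D" if "y \<in> H" for y using mrepD(1)[OF R H_carrier[OF that]] .
  have Mlin: "mlin D ?d M" unfolding mlin_def M_def
    using pc Rc by (auto simp: mult_add_distrib_mat[of _ D D] add_mult_distrib_mat[of _ D ?d _ _ ?d] mat_smult_right mat_smult_left carrier_matD[OF pc] carrier_matD[OF Rc]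
        right_mult_zero_mat[of _ D D] left_mult_zero_mat[of _ ?d ?d])
  interpret C: comm_group ?B by (rule subgroup_comm_group[OF Gb Gb_comm])
  have inv_Gb: "inv\<^bsub>?B\<^esub> x = inv x" if "x \<in> Gb" for x by (rule m_inv_consistent[OF Gb that])
  have st: "R g * A * U \<rho> (inv\<^bsub>?B\<^esub> g) \<in> M" if gA: "g \<in> carrier ?B" "A \<in> M" for g A
  proof -
    have g: "g \<in> Gb" using gA by simp
    have gi: "inv g \<in> Gb" by (rule subgroup.m_inv_closed[OF Gb g])
    have Ac: "A \<in> carrier_mat D ?d" and Ai: "\<And>x. x \<in> H \<Longrightarrow> R x * A = A * \<pi> \<rho> x" using gA by (auto simp: M_def)
    note gc = Gb_carrier[OF g]
    note dims = carrier_matD[OF pc] carrier_matD[OF uc] Rd carrier_matD[OF Ac]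
    have "R x * (R g * A * U \<rho> (inv g)) = R g * A * U \<rho> (inv g) * \<pi> \<rho> x" if x: "x \<in> H" for x
    proof -
      let ?k = "inv g \<otimes> x \<otimes> g"
      have k: "?k \<in> H" by (rule H_conj[OF gc x])
      note c = H_carrier[OF x] H_carrier[OF k]
      have "x \<otimes> g = g \<otimes> ?k" using c gc by (simp add: m_assoc cancel_inv)
      then have "R x * R g = R g * R ?k" using mrepD(2)[OF R c(1) gc] mrepD(2)[OF R gc c(2)] by simp
      then have "R x * (R g * A * U \<rho> (inv g)) = R g * R ?k * A * U \<rho> (inv g)"
        using c gc gi by (simp add: mat_assoc[symmetric] dims)
      also have "\<dots> = R g * (R ?k * A) * U \<rho> (inv g)" using c gc gi by (simp add: mat_assoc dims)
      also have "\<dots> = R g * A * (\<pi> \<rho> ?k * U \<rho> (inv g))" unfolding Ai[OF k] using c gc gi k by (simp add: mat_assoc dims)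
      also have "\<pi> \<rho> ?k * U \<rho> (inv g) = U \<rho> (inv g) * \<pi> \<rho> x"
      proof -
        have "inv (inv g) \<otimes> ?k \<otimes> inv g = x" using c gc by (simp add: m_assoc cancel_inv)
        then show ?thesis using U_conj[OF \<rho>(1) gi k] by simp
      qed
      also have "R g * A * (U \<rho> (inv g) * \<pi> \<rho> x) = R g * A * U \<rho> (inv g) * \<pi> \<rho> x"
        using x gc gi by (simp add: mat_assoc dims)
      finally show ?thesis .
    qed
    moreover have "R g * A * U \<rho> (inv g) \<in> carrier_mat D ?d" by (rule carrier_matI) (use gc gi in \<open>simp_all add: dims\<close>)
    ultimately show ?thesis using g by (simp add: M_def inv_Gb)
  qed
  have fB: "finite (carrier ?B)" using fin Gb subgroup.subset finite_subset by fastforce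
  have BM: "B \<in> M" using B by (simp add: M_def)
  obtain f ev2 where f: "f \<in> M" "f \<noteq> 0\<^sub>m D ?d" "\<And>g. g \<in> Gb \<Longrightarrow> R g * f = ev2 g \<cdot>\<^sub>m (f * U \<rho> g)"
    "\<And>g h. g \<in> Gb \<Longrightarrow> h \<in> Gb \<Longrightarrow> ev2 (g \<otimes> h) = ev2 g * ev2 h" "\<And>g. g \<in> Gb \<Longrightarrow> ev2 g \<noteq> 0"
    using C.common_eigenvector_char[OF fB mrep_restrict[OF R Gb] U_mrep[OF \<rho>(1)] Mlin st BM B(2)] by auto
  have fc: "f \<in> carrier_mat D ?d" and fH: "\<And>x. x \<in> H \<Longrightarrow> R x * f = f * \<pi> \<rho> x" using f(1) by (auto simp: M_def)
  \<comment> \<open>On \<open>Gb \<inter> H\<close> the map \<open>U \<rho>\<close> is trivial, so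
    the eigenvalue is forced; this ensures that the \<open>\<theta>\<close> belonging to
    \<open>ev2\<close> has \<open>ro \<theta> = \<rho>\<close>.\<close>
  have ev2: "ev2 g = psr \<rho> g" if g: "g \<in> Gb \<inter> H" for g
  proof -
    have "ev2 g \<cdot>\<^sub>m f = R g * f" using f(3)[of g] U_one[OF \<rho>(1) g] g fc by simp
    also have "\<dots> = psr \<rho> g \<cdot>\<^sub>m f" using fH[of g] pi_scalar[OF \<rho>(1), of g] g GbZ fc by (auto simp: mat_smult_right)
    finally show ?thesis by (rule smult_mat_cancel[OF fc f(2)])
  qed
  have "ev2 g = \<psi> g" if "g \<in> Gb" "g \<in> N" for g using ev2[of g] psr_psi[OF \<rho>(1) that(2)] that NH by auto
  from tq_surj[OF f(4,5) this] obtain \<theta> where th: "\<theta> \<in> \<Theta>" "\<And>g. g \<in> Gb \<Longrightarrow> tq \<theta> g = ev2 g" by blast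
  have rt: "ro \<theta> = \<rho>"
    by (rule psr_inj[OF ro(1)[OF th(1)] \<rho>(1)]) (use ro(2)[OF th(1)] th(2) ev2 in auto)
  have deg: "rep_degree G (sig \<theta>) = ?d" using mrep_degree[OF sig_mrep[OF th(1)]] rt by (simp add: rep_degree_def)
  have "R s * f = f * sig \<theta> s" if "s \<in> T" for s
  proof -
    obtain g h where s: "g \<in> Gb" "h \<in> H" "s = g \<otimes> h" using T_prod \<open>s \<in> T\<close> by blast
    note c = Gb_carrier[OF s(1)] H_carrier[OF s(2)]
    note dims = carrier_matD[OF pc] carrier_matD[OF uc] Rd carrier_matD[OF fc]
    have "R s * f = R g * (R h * f)" unfolding s(3) using c by (simp add: mrepD(2)[OF R] mat_assoc dims)
    also have "\<dots> = R g * f * \<pi> \<rho> h" unfolding fH[OF s(2)] using c s by (simp add: mat_assoc dims)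
    also have "\<dots> = f * (ev2 g \<cdot>\<^sub>m (U \<rho> g * \<pi> \<rho> h))"
      unfolding f(3)[OF s(1)] using s by (simp add: mat_assoc mat_smult_left mat_smult_right dims)
    also have "\<dots> = f * sig \<theta> s" unfolding s(3) sig_eq[OF th(1) s(1,2)] th(2)[OF s(1)] rt ..
    finally show ?thesis .
  qed
  then show "\<exists>\<theta>\<in>\<Theta>. \<exists>f\<in>carrier_mat D (rep_degree G (sig \<theta>)). f \<noteq> 0\<^sub>m D (rep_degree G (sig \<theta>)) \<and> (\<forall>s\<in>T. R s * f = f * sig \<theta> s)"
    using th(1) fc f(2) deg by (intro bexI[of _ \<theta>] bexI[of _ f]) auto
qed

end

section \<open>The bijection\<close>

context unramified_level
begin

lemma inertia_abelian: "inertia_abelian (UG r) KN (cent l' r) \<psi> Gb \<Theta> tq"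
proof (intro inertia_abelian.intro inertia.intro inertia_axioms.intro inertia_abelian_axioms.intro UG_group UG_finite)
  show "subgroup KN (UG r)" using cong_subgroup_normal[of l r] by (simp add: normal_def)
  show "KN \<subseteq> cent l' r" by (rule cong_cent[OF l'_le]) simp
  show "subgroup (cent l' r) (UG r)" by (rule cent_subgroup) simp
  show "subgroup Gb (UG r)" unfolding centralizer_cent by (rule cent_subgroup) simp
  show "Gb \<subseteq> cent l' r" by (auto simp: centralizer_eq cent_def isom_N1 intro!: exI cmt_mult_by isom_N1)
  show "tq \<theta> (g \<odot> h) = tq \<theta> g * tq \<theta> h" if "\<theta> \<in> \<Theta>" "g \<in> Gb" "h \<in> Gb" for \<theta> g h
    using that by (auto simp: centralizer_eq UG_mult_by theta_Q_eval N1 theta_setD)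
  show "tq \<theta> g \<noteq> 0" if "\<theta> \<in> \<Theta>" "g \<in> Gb" for \<theta> g
    using that by (auto simp: centralizer_eq theta_Q_eval theta_setD)
qed (use cong_subgroup_conj[of l r] psi_mult psi_nonzero psi_stab psi_not_stab centralizer_comm tq_psi tq_inj tq_surj in auto)

text \<open>Here all commutators lie in the kernel of \<open>\<psi>\<close>, and \<open>\<pi>\<close> is the one-dimensional representation \<open>\<psi>\<close>.\<close>

lemma bij_even:
  assumes e: "l' = l"
  shows "bij_betw (\<lambda>\<theta>. rep_iso (UG r) `` {induced_rep (UG r) (stab D r l' \<beta>) (sigma_rep D l l' \<beta> \<pi> U \<theta>)})
    \<Theta> (Irr_over (UG r) KN \<psi>)"
proof -
  interpret A: inertia_abelian "UG r" KN "cent l' r" \<psi> Gb \<Theta> tq by (rule inertia_abelian)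
  let ?N = "UG r\<lparr>carrier := KN\<rparr>" and ?p = "\<lambda>h. Matrix.mat 1 1 (\<lambda>_. \<psi> h)"
  interpret N: group ?N by (rule subgroup.subgroup_is_group[OF A.N A.is_group])
  have m: "mrep ?N 1 ?p" unfolding mrep_def
    using psi_mult A.psi_one by (auto simp: scalar_prod_def One_nat_def intro!: eq_matI)
  have deg: "rep_degree ?N ?p = 1" by (rule mrep_degree[OF m])
  have comm: "iv x \<odot> iv h \<odot> x \<in> KN" "cm x h \<in> KN"
    if "x \<in> KN" "h \<in> KN" for x h using that A.N by (simp_all add: subgroup.m_closed subgroup.m_inv_closed)
  interpret inertia_heisenberg "UG r" KN "cent l' r" \<psi> Gb \<Theta> tq KN KN "{()}" "\<lambda>_. \<psi>" "\<lambda>_. ()" "\<lambda>_. ?p" "\<lambda>_ _. 1\<^sub>m 1"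
  proof (intro inertia_heisenberg.intro inertia_abelian inertia_heisenberg_axioms.intro; (unfold deg)?)
    show "\<exists>g\<in>Gb. \<exists>h\<in>KN. x = g \<odot> h" if "x \<in> cent l' r" for x using cent_prod[OF _ that] e by simp
    show "\<exists>g\<in>Gb \<inter> KN. \<exists>h\<in>KN. z = g \<odot> h" if z: "z \<in> KN" for z
      using subgroup.one_closed[OF A.N] subgroup.one_closed[OF A.Gb] z A.N_carrier[OF z] by (intro bexI[of _ "\<one>\<^bsub>UG r\<^esub>"] bexI[of _ z]) auto
    show "\<psi> (cm x h) = 1" if x: "x \<in> KN" and h: "h \<in> KN" for x h
    proof -
      have i: "iv h \<in> KN" by (rule subgroup.m_inv_closed[OF A.N h])
      have "\<psi> (cm x h) = \<psi> (iv h) * \<psi> h"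
        using psi_mult[OF comm(1)[OF x h] h] A.stab[OF subsetD[OF A.NT x] i] by simp
      also have "\<dots> = 1" using psi_mult[OF i h] A.psi_one A.N_carrier[OF h] by simp
      finally show ?thesis .
    qed
    have "1\<^sub>m 1 $$ (0, 0) \<noteq> (0\<^sub>m 1 1 $$ (0, 0) :: complex)" by simp
    then have "1\<^sub>m 1 \<noteq> (0\<^sub>m 1 1 :: complex mat)" by metis
    moreover have "KN \<subseteq> carrier ?N" by simp
    moreover have "?p h * 1\<^sub>m 1 = \<psi> h \<cdot>\<^sub>m 1\<^sub>m 1" for h by (auto intro!: eq_matI simp: One_nat_def)
    ultimately show "rep_contains ?N ?p KN \<psi>"
      unfolding rep_contains_iff[OF m \<open>KN \<subseteq> carrier ?N\<close>] by (intro bexI[of _ "1\<^sub>m 1"]) auto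
    show "(\<lambda>_. 1\<^sub>m 1) \<in> hom (UG r\<lparr>carrier := Gb\<rparr>) (GLC 1)" by (auto simp: hom_def GLC_carrier)
  qed (use A.N A.N_conj A.NT comm(2) psi_mult tq_psi A.stab[OF subsetD[OF A.GbT]] N.irreducible_rep_degree_one[OF m] in \<open>auto intro: subgroup.m_closed\<close>)
  \<comment> \<open>With \<open>U\<close> the identity of size one, the scalar formula of the even
    case takes the shape of \<open>sig\<close>.\<close>
  have "Matrix.mat 1 1 (\<lambda>_. a * c) = a \<cdot>\<^sub>m (1\<^sub>m 1 * Matrix.mat 1 1 (\<lambda>_. c))" for a c :: complex by (auto intro!: eq_matI)
  then have "sigma_rep D l l' \<beta> \<pi> U \<theta> x = sig \<theta> x" for \<theta> x unfolding sigma_rep_def sig_def by (simp add: e)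
  then have "sigma_rep D l l' \<beta> \<pi> U = sig" by (intro ext)
  then show ?thesis using heisenberg_bij stab_cent[of l' r] by simp
qed

end

context unramified_odd
begin

text \<open>The definite description is justified by \<open>psr_surj\<close> for existence and
  \<open>psr_inj\<close> for uniqueness.\<close>

lemma rho_of:
  assumes th: "\<theta> \<in> \<Theta>"
  shows "rho_of D l l' \<beta> \<theta> \<in> chars Lc" "g \<in> Gb \<inter> KH \<Longrightarrow> psr (rho_of D l l' \<beta> \<theta>) g = tq \<theta> g"
proof -
  interpret inertia_abelian "UG r" KN "cent l' r" \<psi> Gb \<Theta> tq by (rule inertia_abelian)
  obtain \<rho> where \<rho>: "\<rho> \<in> chars Lc" "\<forall>g\<in>Gb \<inter> KH. psr \<rho> g = tq \<theta> g"
    using psr_surj[of "tq \<theta>"] tq_mult[OF th] tq_nonzero[OF th] tq_psi[OF th] by blast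
  have "rho_of D l l' \<beta> \<theta> = \<rho>" unfolding rho_of_def
  proof (rule the_equality)
    fix \<rho>' assume "\<rho>' \<in> chars Lc \<and> (\<forall>g\<in>Gb \<inter> KH. tq \<theta> g = psr \<rho>' g)"
    then show "\<rho>' = \<rho>" using \<rho> by (intro psr_inj) auto
  qed (use \<rho> in auto)
  then show "rho_of D l l' \<beta> \<theta> \<in> chars Lc" "g \<in> Gb \<inter> KH \<Longrightarrow> psr (rho_of D l l' \<beta> \<theta>) g = tq \<theta> g" using \<rho> by auto
qed

lemma bij_odd:
  assumes data: "\<And>\<rho>. \<rho> \<in> chars Lc \<Longrightarrow> intertwining_data D l l' \<beta> \<rho> (\<pi> \<rho>) (U \<rho>)"
  shows "bij_betw (\<lambda>\<theta>. rep_iso (UG r) `` {induced_rep (UG r) (stab D r l' \<beta>) (sigma_rep D l l' \<beta> \<pi> U \<theta>)})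
    \<Theta> (Irr_over (UG r) KN \<psi>)"
proof -
  let ?H = "UG r\<lparr>carrier := KH\<rparr>"
  have N: "normal KH (UG r)" by (rule cong_subgroup_normal) simp
  have d: "irreducible_rep ?H (\<pi> \<rho>)" "rep_contains ?H (\<pi> \<rho>) ZG (psr \<rho>)"
    "U \<rho> \<in> hom (UG r\<lparr>carrier := Gb\<rparr>) (GLC (rep_degree ?H (\<pi> \<rho>)))"
    "\<And>g x. g \<in> Gb \<Longrightarrow> x \<in> KH \<Longrightarrow> \<pi> \<rho> (iv g \<odot> x \<odot> g) =
       inv\<^bsub>GLC (rep_degree ?H (\<pi> \<rho>))\<^esub> (U \<rho> g) \<otimes>\<^bsub>GLC (rep_degree ?H (\<pi> \<rho>))\<^esub> \<pi> \<rho> x \<otimes>\<^bsub>GLC (rep_degree ?H (\<pi> \<rho>))\<^esub> U \<rho> g"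
    "\<And>g. g \<in> Gb \<inter> KH \<Longrightarrow> U \<rho> g = \<one>\<^bsub>GLC (rep_degree ?H (\<pi> \<rho>))\<^esub>" if "\<rho> \<in> chars Lc" for \<rho>
    using data[OF that] unfolding intertwining_data_def Let_def by blast+
  have conj: "U \<rho> g * \<pi> \<rho> (iv g \<odot> x \<odot> g) = \<pi> \<rho> x * U \<rho> g"
    if h: "\<rho> \<in> chars Lc" "g \<in> Gb" "x \<in> KH" for \<rho> g x
  proof -
    let ?GL = "GLC (rep_degree ?H (\<pi> \<rho>))"
    interpret GL: group ?GL by (rule GLC_group)
    have u: "U \<rho> g \<in> carrier ?GL" using d(3)[OF h(1)] h(2) by (auto simp: hom_def)
    have p: "\<pi> \<rho> x \<in> carrier ?GL" using d(1)[OF h(1)] h(3) by (auto simp: irreducible_rep_def is_rep_def hom_def)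
    have "U \<rho> g \<otimes>\<^bsub>?GL\<^esub> (inv\<^bsub>?GL\<^esub> (U \<rho> g) \<otimes>\<^bsub>?GL\<^esub> \<pi> \<rho> x \<otimes>\<^bsub>?GL\<^esub> U \<rho> g) = \<pi> \<rho> x \<otimes>\<^bsub>?GL\<^esub> U \<rho> g"
      using u p by (simp only: GL.m_assoc[symmetric] GL.m_closed GL.inv_closed GL.r_inv GL.l_one)
    then show ?thesis unfolding d(4)[OF h] by (simp only: GLC_simps)
  qed
  have prod: "\<exists>g\<in>Gb. \<exists>h\<in>KH. x = g \<odot> h" if "x \<in> cent l' r" for x using cent_prod[OF _ that] by simp
  interpret inertia_heisenberg "UG r" KN "cent l' r" \<psi> Gb \<Theta> tq KH ZG "chars Lc" psr "rho_of D l l' \<beta>" \<pi> U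
  proof (intro inertia_heisenberg.intro inertia_abelian inertia_heisenberg_axioms.intro)
    show "subgroup KH (UG r)" using N by (simp add: normal_def)
    show "KN \<subseteq> KH" by (rule cong_antimono[OF l'_le]) simp
    show "KH \<subseteq> cent l' r" by (rule cong_cent) simp_all
    show "U \<rho> g = 1\<^sub>m (rep_degree ?H (\<pi> \<rho>))" if "\<rho> \<in> chars Lc" "g \<in> Gb \<inter> KH" for \<rho> g using d(5)[OF that] by (simp only: GLC_simps)
  qed (fact normal.inv_op_closed1[OF N] prod ZG_KH KN_ZG Z_prod prodZ psr_mult psr_psi comm cent_Z nondeg psr_inj psr_surj rho_of d(1-3) conj)+
  have "l' \<noteq> l" using l_eq by simp
  then have "sigma_rep D l l' \<beta> \<pi> U = sig" by (intro ext) (simp add: sigma_rep_def sig_def)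
  then show ?thesis using heisenberg_bij stab_cent[of l' r] by simp
qed

end

theorem proposition5p4p4:
  fixes D :: "'a::Fields.field unitary_datum"
    and n r l l' :: nat
    and \<beta> :: 'a
    and \<pi> U :: "(('a set \<Rightarrow> 'a set) \<Rightarrow> complex) \<Rightarrow> ('a set \<Rightarrow> 'a set) \<Rightarrow> complex mat"
  assumes "n \<ge> 3" and "odd n"
    and "unramified_unitary_datum D n"
    and "r \<ge> 2" and "r = 2 * l \<and> l' = l \<or> r = 2 * l - 1 \<and> l' = l - 1"
    and "\<beta> \<in> OL D" and "invol D \<beta> + \<beta> = 0"
    and "OL D = ring.simple_extension ringL (OF D) \<beta>"
    and "r = 2 * l - 1 \<Longrightarrow> \<forall>\<rho>\<in>chars (lie_centralizer D 1 \<beta>).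
           intertwining_data D l l' \<beta> \<rho> (\<pi> \<rho>) (U \<rho>)"
  shows "bij_betw
    (\<lambda>\<theta>. rep_iso (unitary_group D r) ``
       {induced_rep (unitary_group D r) (stab D r l' \<beta>) (sigma_rep D l l' \<beta> \<pi> U \<theta>)})
    (theta_set D l l' \<beta>)
    (Irr_over (unitary_group D r) (cong_subgroup D l r) (psi D l l' \<beta>))"
proof -
  \<comment> \<open>The bound \<open>r \<ge> 2\<close> gives \<open>l' \<ge> 1\<close> in both
    cases, and it keeps the subtractions in \<open>2 * l - 1\<close> and \<open>l - 1\<close> from
    being truncated.\<close>
  have r: "r = l + l'" and l: "l' \<ge> 1" "l' \<le> l" "l \<le> l' + 1" using assms(4,5) by auto
  interpret unramified_unitary_datum D n by (rule assms(3))
  interpret unramified_level D n \<beta> l l' by unfold_locales (use assms l in auto)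
  show ?thesis
  proof (cases "l' = l")
    case True
    then show ?thesis using bij_even unfolding r by blast
  next
    case False
    then have e: "l = l' + 1" "r = 2 * l - 1" using assms(4,5) by auto
    interpret unramified_odd D n \<beta> l l' by unfold_locales (rule e(1))
    show ?thesis using bij_odd assms(9)[OF e(2)] unfolding r by blast
  qed
qed

end
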